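(* Let $\mathcal P$ be a finite injective labeled oriented tree. Then $\mathcal P$ is aspherical, i.e. $\pi_2(K(\mathcal P))=0$. Furthermore, if $\mathcal H$ is a sub-LOT of $\mathcal P$, then the homomorphism $\pi_1(K(\mathcal H))\to\pi_1(K(\mathcal P))$ induced by the inclusion $K(\mathcal H)\subseteq K(\mathcal P)$ is injective.
   Context: A labeled oriented graph (LOG) $\mathcal G$ is a finite oriented graph with vertex set $\mathbf x$ and edge set $\mathbf e$ in which every edge is labeled by a vertex; an edge from $x$ to $y$ with label $z$ is written $e=[x,z,y]$. Its LOG-presentation is $P(\mathcal G)=\langle \mathbf x\mid \{r_e\}_{e\in\mathbf e}\rangle$ with $r_e=xz(zy)^{-1}=xzy^{-1}z^{-1}$ for $e=[x,z,y]$, and $K(\mathcal G)$ is the standard 2-complex of this presentation (one 0-cell, one oriented 1-cell per generator, one 2-cell per relator attached along the relator word). $\mathcal G$ is called aspherical if $K(\mathcal G)$ is aspherical. A labeled oriented tree (LOT) is a LOG whose underlying graph is a tree. A LOG is injective if each vertex occurs at most once as an edge label. A sub-LOT of $\mathcal G$ is a connected subgraph $\mathcal H$ containing at least one edge such that every edge label of an edge of $\mathcal H$ is a vertex of $\mathcal H$ (with the inherited orientations and labels); $K(\mathcal H)$ is then a subcomplex of $K(\mathcal G)$. *)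

theory Defs
  imports "HOL-Analysis.Analysis"
begin

section \<open>Labeled oriented graphs\<close>

text \<open>A LOG is given by a vertex set V and an edge set E of triples (x,z,y),
  meaning an edge from x to y labelled by z.\<close>

definition is_LOG :: "'v set \<Rightarrow> ('v \<times> 'v \<times> 'v) set \<Rightarrow> bool" where
  "is_LOG V E \<longleftrightarrow> finite V \<and> finite E \<and> (\<forall>(x,z,y)\<in>E. x \<in> V \<and> z \<in> V \<and> y \<in> V)"

definition lab :: "'v \<times> 'v \<times> 'v \<Rightarrow> 'v" where "lab e = fst (snd e)"
definition src :: "'v \<times> 'v \<times> 'v \<Rightarrow> 'v" where "src e = fst e"
definition tgt :: "'v \<times> 'v \<times> 'v \<Rightarrow> 'v" where "tgt e = snd (snd e)"

text \<open>Edge e joins a and b in the underlying (unoriented) graph.\<close>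
definition joins :: "'v \<times> 'v \<times> 'v \<Rightarrow> 'v \<Rightarrow> 'v \<Rightarrow> bool" where
  "joins e a b \<longleftrightarrow> (src e = a \<and> tgt e = b) \<or> (src e = b \<and> tgt e = a)"

definition graph_connected :: "'v set \<Rightarrow> ('v \<times> 'v \<times> 'v) set \<Rightarrow> bool" where
  "graph_connected V E \<longleftrightarrow>
     (\<forall>a\<in>V. \<forall>b\<in>V. (a, b) \<in> ({(u, w). \<exists>e\<in>E. joins e u w})\<^sup>*)"

text \<open>A cycle (closed trail) in the underlying multigraph: a nonempty list of pairwise
  distinct edges es and vertices vs such that es!i joins vs!i and vs!((i+1) mod n).
  Loops (n = 1) and pairs of parallel edges (n = 2) count as cycles.\<close>
definition has_cycle :: "('v \<times> 'v \<times> 'v) set \<Rightarrow> bool" where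
  "has_cycle E \<longleftrightarrow> (\<exists>es vs. es \<noteq> [] \<and> distinct es \<and> set es \<subseteq> E \<and> length vs = length es \<and>
      (\<forall>i < length es. joins (es ! i) (vs ! i) (vs ! ((i + 1) mod length es))))"

definition is_LOT :: "'v set \<Rightarrow> ('v \<times> 'v \<times> 'v) set \<Rightarrow> bool" where
  "is_LOT V E \<longleftrightarrow> is_LOG V E \<and> V \<noteq> {} \<and> graph_connected V E \<and> \<not> has_cycle E"

definition injective_LOG :: "('v \<times> 'v \<times> 'v) set \<Rightarrow> bool" where
  "injective_LOG E \<longleftrightarrow> (\<forall>e1\<in>E. \<forall>e2\<in>E. lab e1 = lab e2 \<longrightarrow> e1 = e2)"

text \<open>Sub-LOT: connected subgraph with at least one edge, closed under edge labels.\<close>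
definition sub_LOT :: "'v set \<Rightarrow> ('v \<times> 'v \<times> 'v) set \<Rightarrow> 'v set \<Rightarrow> ('v \<times> 'v \<times> 'v) set \<Rightarrow> bool" where
  "sub_LOT V E VH EH \<longleftrightarrow> VH \<subseteq> V \<and> EH \<subseteq> E \<and> EH \<noteq> {} \<and>
     (\<forall>e\<in>EH. src e \<in> VH \<and> tgt e \<in> VH \<and> lab e \<in> VH) \<and> graph_connected VH EH"

section \<open>The standard 2-complex K(G)\<close>

text \<open>Points of the CW complex: the 0-cell, interior points of the 1-cell of generator x,
  and interior points of the 2-cell of edge e (open unit disk in the complex plane).\<close>
datatype 'v cellpt = Base | Edge 'v real | Face "'v \<times> 'v \<times> 'v" complex

definition K_points :: "'v set \<Rightarrow> ('v \<times> 'v \<times> 'v) set \<Rightarrow> 'v cellpt set" where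
  "K_points V E = {Base} \<union> {Edge x t | x t. x \<in> V \<and> 0 < t \<and> t < 1}
                   \<union> {Face e p | e p. e \<in> E \<and> norm p < 1}"

text \<open>Characteristic map of the 1-cell of generator x, defined on [0,1].\<close>
definition char1 :: "'v \<Rightarrow> real \<Rightarrow> 'v cellpt" where
  "char1 x t = (if 0 < t \<and> t < 1 then Edge x t else Base)"

text \<open>The relator word r_e = x z y^-1 z^-1 for e = (x,z,y), as (generator, positive?) list.\<close>
definition rel_word :: "'v \<times> 'v \<times> 'v \<Rightarrow> ('v \<times> bool) list" where
  "rel_word e = (case e of (x, z, y) \<Rightarrow> [(x, True), (z, True), (y, False), (z, False)])"

text \<open>Attaching map of the 2-cell of e on the unit circle: the circle is divided into
  four arcs (by argument), the k-th arc traversing the 1-cell of the k-th letter,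
  in reverse for inverse letters.\<close>
definition attach :: "'v \<times> 'v \<times> 'v \<Rightarrow> complex \<Rightarrow> 'v cellpt" where
  "attach e w = (let s = 2 * Arg2pi w / pi; k = nat \<lfloor>s\<rfloor>; u = s - of_int \<lfloor>s\<rfloor>;
                     (g, pos) = rel_word e ! k
                 in char1 g (if pos then u else 1 - u))"

text \<open>Characteristic map of the 2-cell of e, defined on the closed unit disk.\<close>
definition char2 :: "'v \<times> 'v \<times> 'v \<Rightarrow> complex \<Rightarrow> 'v cellpt" where
  "char2 e p = (if norm p < 1 then Face e p else attach e p)"

text \<open>The (weak = quotient) CW topology: a set is open iff its preimages under all
  characteristic maps are open.\<close>
definition K_open :: "'v set \<Rightarrow> ('v \<times> 'v \<times> 'v) set \<Rightarrow> 'v cellpt set \<Rightarrow> bool" where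
  "K_open V E U \<longleftrightarrow> U \<subseteq> K_points V E \<and>
     (\<forall>x\<in>V. openin (top_of_set {0..1::real}) {t \<in> {0..1}. char1 x t \<in> U}) \<and>
     (\<forall>e\<in>E. openin (top_of_set (cball (0::complex) 1)) {p \<in> cball 0 1. char2 e p \<in> U})"

lemma istopology_K_open: "istopology (K_open V E)"
  unfolding istopology_def K_open_def
proof (intro conjI allI impI)
  fix S T assume S: "S \<subseteq> K_points V E \<and>
     (\<forall>x\<in>V. openin (top_of_set {0..1::real}) {t \<in> {0..1}. char1 x t \<in> S}) \<and>
     (\<forall>e\<in>E. openin (top_of_set (cball (0::complex) 1)) {p \<in> cball 0 1. char2 e p \<in> S})"
    and T: "T \<subseteq> K_points V E \<and>
     (\<forall>x\<in>V. openin (top_of_set {0..1::real}) {t \<in> {0..1}. char1 x t \<in> T}) \<and>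
     (\<forall>e\<in>E. openin (top_of_set (cball (0::complex) 1)) {p \<in> cball 0 1. char2 e p \<in> T})"
  show "S \<inter> T \<subseteq> K_points V E" using S by blast
  show "\<forall>x\<in>V. openin (top_of_set {0..1::real}) {t \<in> {0..1}. char1 x t \<in> S \<inter> T}"
  proof
    fix x assume "x \<in> V"
    then have "openin (top_of_set {0..1::real}) ({t \<in> {0..1}. char1 x t \<in> S} \<inter> {t \<in> {0..1}. char1 x t \<in> T})"
      using S T by (intro openin_Int) auto
    moreover have "{t \<in> {0..1}. char1 x t \<in> S} \<inter> {t \<in> {0..1}. char1 x t \<in> T} = {t \<in> {0..1}. char1 x t \<in> S \<inter> T}" by blast
    ultimately show "openin (top_of_set {0..1::real}) {t \<in> {0..1}. char1 x t \<in> S \<inter> T}" by simp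
  qed
  show "\<forall>e\<in>E. openin (top_of_set (cball (0::complex) 1)) {p \<in> cball 0 1. char2 e p \<in> S \<inter> T}"
  proof
    fix e assume "e \<in> E"
    then have "openin (top_of_set (cball (0::complex) 1)) ({p \<in> cball 0 1. char2 e p \<in> S} \<inter> {p \<in> cball 0 1. char2 e p \<in> T})"
      using S T by (intro openin_Int) auto
    moreover have "{p \<in> cball 0 1. char2 e p \<in> S} \<inter> {p \<in> cball 0 1. char2 e p \<in> T} = {p \<in> cball (0::complex) 1. char2 e p \<in> S \<inter> T}" by blast
    ultimately show "openin (top_of_set (cball (0::complex) 1)) {p \<in> cball 0 1. char2 e p \<in> S \<inter> T}" by simp
  qed
next
  fix \<K> :: "'a cellpt set set"
  assume H: "\<forall>K\<in>\<K>. K \<subseteq> K_points V E \<and>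
     (\<forall>x\<in>V. openin (top_of_set {0..1::real}) {t \<in> {0..1}. char1 x t \<in> K}) \<and>
     (\<forall>e\<in>E. openin (top_of_set (cball (0::complex) 1)) {p \<in> cball 0 1. char2 e p \<in> K})"
  show "\<Union>\<K> \<subseteq> K_points V E" using H by blast
  show "\<forall>x\<in>V. openin (top_of_set {0..1::real}) {t \<in> {0..1}. char1 x t \<in> \<Union>\<K>}"
  proof
    fix x assume "x \<in> V"
    have "openin (top_of_set {0..1::real}) (\<Union>K\<in>\<K>. {t \<in> {0..1}. char1 x t \<in> K})"
      using H \<open>x \<in> V\<close> by (intro openin_Union) auto
    moreover have "(\<Union>K\<in>\<K>. {t \<in> {0..1}. char1 x t \<in> K}) = {t \<in> {0..1::real}. char1 x t \<in> \<Union>\<K>}" by blast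
    ultimately show "openin (top_of_set {0..1::real}) {t \<in> {0..1}. char1 x t \<in> \<Union>\<K>}" by simp
  qed
  show "\<forall>e\<in>E. openin (top_of_set (cball (0::complex) 1)) {p \<in> cball 0 1. char2 e p \<in> \<Union>\<K>}"
  proof
    fix e assume "e \<in> E"
    have "openin (top_of_set (cball (0::complex) 1)) (\<Union>K\<in>\<K>. {p \<in> cball 0 1. char2 e p \<in> K})"
      using H \<open>e \<in> E\<close> by (intro openin_Union) auto
    moreover have "(\<Union>K\<in>\<K>. {p \<in> cball 0 1. char2 e p \<in> K}) = {p \<in> cball (0::complex) 1. char2 e p \<in> \<Union>\<K>}" by blast
    ultimately show "openin (top_of_set (cball (0::complex) 1)) {p \<in> cball 0 1. char2 e p \<in> \<Union>\<K>}" by simp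
  qed
qed

definition K_LOG :: "'v set \<Rightarrow> ('v \<times> 'v \<times> 'v) set \<Rightarrow> 'v cellpt topology" where
  "K_LOG V E = topology (K_open V E)"

section \<open>Homotopy groups (triviality statements)\<close>

definition S2 :: "(real \<times> real \<times> real) topology" where
  "S2 = top_of_set (sphere 0 1)"

definition s2_base :: "real \<times> real \<times> real" where "s2_base = (1, 0, 0)"

text \<open>pi_2(X, b) = 0: every based map (S^2, s0) -> (X, b) is based-homotopic to the constant.\<close>
definition pi2_trivial :: "'a topology \<Rightarrow> 'a \<Rightarrow> bool" where
  "pi2_trivial X b \<longleftrightarrow> (\<forall>f. continuous_map S2 X f \<and> f s2_base = b \<longrightarrow>
      homotopic_with (\<lambda>h. h s2_base = b) S2 X f (\<lambda>_. b))"

text \<open>The homomorphism pi_1(X,b) -> pi_1(Y,b) induced by the inclusion (identity on points)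
  is injective: its kernel is trivial, i.e. every loop in X at b that is null-homotopic rel
  endpoints in Y is already null-homotopic rel endpoints in X.\<close>
definition pi1_incl_injective :: "'a topology \<Rightarrow> 'a topology \<Rightarrow> 'a \<Rightarrow> bool" where
  "pi1_incl_injective X Y b \<longleftrightarrow> (\<forall>g. continuous_map (top_of_set {0..1::real}) X g \<and> g 0 = b \<and> g 1 = b \<and>
      homotopic_with (\<lambda>h. h 0 = b \<and> h 1 = b) (top_of_set {0..1}) Y (id \<circ> g) (\<lambda>_. b) \<longrightarrow>
      homotopic_with (\<lambda>h. h 0 = b \<and> h 1 = b) (top_of_set {0..1}) X g (\<lambda>_. b))"

end

theory Submission
  imports Defs
begin

text \<open>Maps from a simply connected space T into K(P) are studied through finite 2-complexes L immersed in K(P).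
  Gluing local lifts of such a map f to stars of vertices along the smallest equivalence closed under folding
  gives a connected L through which f factors, and every integer cocycle on L is a coboundary because it
  defines a circle-valued function on T, which has a logarithm; counting unknowns and equations, the Euler
  characteristic of L is then at least 1.

  It therefore suffices that every finite connected immersed L with Euler characteristic at least 1 is
  contractible in K(P), has Euler characteristic exactly 1, and restricts to pieces of the same kind over sub-LOTs.
  This is proved by induction on the number of generators. Partition the vertices of P into proper sub-LOTs,
  as few as possible. By Edmonds' branching theorem the two ends of the remaining edges can be
  distributed over two arborescences on the classes. This assigns to every mixed face of L a top and a bottom corner,
  and counting these corners against the extremal vertices of the pieces of L shows
  that L can be simplified: either a piece attached at one vertex is pruned, or a vertex is split along the unique mixed
  face corner of some piece there, removing that face.\<close>

section \<open>Square complexes and their realization\<close>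

text \<open>Second homotopy is never computed: a map is contracted as soon as it factors through a
  complex L that contracts in K(P), and what decides about L is its Euler characteristic. The
  obstacle is that the pieces of L over the classes may each contribute +1. In twice the
  characteristic such a piece contributes 2, and the count repays this at two vertices, an upper and
  a lower extremum of its height. At a vertex the top corners, read as links between the classes
  that meet there, must form a forest, so that there are fewer corners than classes, and likewise
  the bottom corners; a piece that is extremal there takes no part. One arborescence on the classes
  gives this acyclicity at all vertices, and two directions call for two arborescences. A partition
  with fewest classes is used because several classes left by at most one arc would unite to a
  larger sub-LOT. The inequality can fail only where all pieces at a vertex are extremal in the same
  direction; there the vertex splits. Heights come from the induction hypothesis, which therefore
  includes them.\<close>

type_synonym ('u,'v) edge = "'u \<times> 'v \<times> 'u"
text \<open>Cells carry their corners and labels as data, so parallel edges with the same label, or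
  faces with the same corners and relator, are equal.\<close>

type_synonym ('u,'v) face = "('u \<times> 'u \<times> 'u \<times> 'u) \<times> ('v \<times> 'v \<times> 'v)"

datatype ('u,'v) lpt = LV 'u | LE "('u,'v) edge" real | LF "('u,'v) face" complex

definition esrc :: "('u,'v) edge => 'u" where "esrc a = fst a"
definition etgt :: "('u,'v) edge => 'u" where "etgt a = snd (snd a)"

definition charE :: "('u,'v) edge => real => ('u,'v) lpt" where
  "charE a t = (if t <= 0 then LV (esrc a) else if 1 <= t then LV (etgt a) else LE a t)"

text \<open>Each edge keeps its own orientation; the sign tells how the relator word
  \<open>x z y^-1 z^-1\<close> runs through it. Hence corner 0 is a source and corner 2 a sink of
  the square.\<close>

definition bd :: "('u,'v) face => (('u,'v) edge \<times> bool) list" where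
  "bd ph = (case ph of ((u0,u1,u2,u3),(x,z,y)) =>
     [((u0,x,u1),True), ((u1,z,u2),True), ((u3,y,u2),False), ((u0,z,u3),False)])"

text \<open>The reduction of \<open>k\<close> modulo 4 closes the circle: parameter 4 is read as
  0.\<close>

definition bdpt :: "('u,'v) face => real => ('u,'v) lpt" where
  "bdpt ph s = (let k = nat \<lfloor>s\<rfloor>; u = s - of_int \<lfloor>s\<rfloor>; (a, pos) = bd ph ! (k mod 4)
                in charE a (if pos then u else 1 - u))"

definition charF :: "('u,'v) face => complex => ('u,'v) lpt" where
  "charF ph p = (if norm p < 1 then LF ph p else bdpt ph (2 * Arg2pi p / pi))"

definition lpts where
  "lpts U R Ph = LV ` U \<union> {LE a t | a t. a \<in> R \<and> 0 < t \<and> t < 1} \<union> {LF ph p | ph p. ph \<in> Ph \<and> norm p < 1}"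

definition lopen where
  "lopen U R Ph W \<longleftrightarrow> W \<subseteq> lpts U R Ph \<and>
     (\<forall>a\<in>R. openin (top_of_set {0..1::real}) {t \<in> {0..1}. charE a t \<in> W}) \<and>
     (\<forall>ph\<in>Ph. openin (top_of_set (cball (0::complex) 1)) {p \<in> cball 0 1. charF ph p \<in> W})"

definition LT where "LT U R Ph = topology (lopen U R Ph)"

definition wf_cx where
  "wf_cx U R Ph \<longleftrightarrow> (\<forall>a\<in>R. esrc a \<in> U \<and> etgt a \<in> U) \<and> (\<forall>ph\<in>Ph. fst ` set (bd ph) \<subseteq> R)"

lemma istopology_lopen: "istopology (lopen U R Ph)"
proof -
  have 1: "{t \<in> A. f t \<in> S \<inter> T} = {t \<in> A. f t \<in> S} \<inter> {t \<in> A. f t \<in> T}" for A f S T by auto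
  have 2: "{t \<in> A. f t \<in> \<Union>\<K>} = \<Union>((\<lambda>K. {t \<in> A. f t \<in> K}) ` \<K>)" for A f \<K> by auto
  have "lopen U R Ph (S \<inter> T)" if "lopen U R Ph S" "lopen U R Ph T" for S T
    using that unfolding lopen_def 1 by (auto intro!: openin_Int)
  moreover have "lopen U R Ph (\<Union>\<K>)" if "\<forall>K\<in>\<K>. lopen U R Ph K" for \<K>
  proof -
    have "\<Union>\<K> \<subseteq> lpts U R Ph" using that unfolding lopen_def by blast
    moreover have "openin (top_of_set {0..1}) (\<Union>((\<lambda>K. {t \<in> {0..1}. charE a t \<in> K}) ` \<K>))" if "a \<in> R" for a
      by (rule openin_Union) (use \<open>\<forall>K\<in>\<K>. _\<close> that in \<open>auto simp: lopen_def\<close>)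
    moreover have "openin (top_of_set (cball 0 1)) (\<Union>((\<lambda>K. {t \<in> cball 0 1. charF a t \<in> K}) ` \<K>))" if "a \<in> Ph" for a
      by (rule openin_Union) (use \<open>\<forall>K\<in>\<K>. _\<close> that in \<open>auto simp: lopen_def\<close>)
    ultimately show ?thesis unfolding lopen_def 2 by simp
  qed
  ultimately show ?thesis unfolding istopology_def by simp
qed

lemma openin_LT: "openin (LT U R Ph) W \<longleftrightarrow> lopen U R Ph W"
  by (simp add: LT_def istopology_lopen)

lemma mem_lpts [simp]:
  "LV u \<in> lpts U R Ph \<longleftrightarrow> u \<in> U"
  "LE a t \<in> lpts U R Ph \<longleftrightarrow> a \<in> R \<and> 0 < t \<and> t < 1"
  "LF ph p \<in> lpts U R Ph \<longleftrightarrow> ph \<in> Ph \<and> norm p < 1"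
  unfolding lpts_def by blast+

lemma charE_in: "wf_cx U R Ph ==> a \<in> R ==> charE a t \<in> lpts U R Ph'"
  by (cases "t <= 0"; cases "1 <= t") (simp_all add: charE_def wf_cx_def)

lemma length_bd [simp]: "length (bd ph) = 4"
  by (simp add: bd_def split: prod.splits)

lemma bdpt_in:
  assumes "wf_cx U R Ph" "ph \<in> Ph" shows "bdpt ph s \<in> lpts U R Ph'"
proof -
  define k where "k = nat \<lfloor>s\<rfloor> mod 4"
  have "bd ph ! k \<in> set (bd ph)" by (rule nth_mem) (simp add: k_def)
  then have "fst (bd ph ! k) \<in> R" using assms by (auto simp: wf_cx_def)
  from charE_in[OF assms(1) this] show ?thesis
    by (simp add: bdpt_def Let_def k_def case_prod_unfold)
qed

lemma charF_in: "wf_cx U R Ph ==> ph \<in> Ph ==> charF ph p \<in> lpts U R Ph"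
  using bdpt_in[of U R Ph ph _ Ph] by (cases "norm p < 1") (simp_all add: charF_def)

lemma topspace_LT: assumes "wf_cx U R Ph" shows "topspace (LT U R Ph) = lpts U R Ph"
proof -
  have "{t \<in> {0..1}. charE a t \<in> lpts U R Ph} = {0..1}" if "a \<in> R" for a
    using charE_in[OF assms that] by auto
  moreover have "{t \<in> cball 0 1. charF a t \<in> lpts U R Ph} = cball 0 1" if "a \<in> Ph" for a
    using charF_in[OF assms that] by auto
  ultimately have "lopen U R Ph (lpts U R Ph)"
    unfolding lopen_def by (simp del: mem_cball atLeastAtMost_iff)
  then show ?thesis
    by (metis openin_LT lopen_def openin_subset openin_topspace subset_antisym)
qed

lemma continuous_charE:
  assumes "wf_cx U R Ph" "a \<in> R" shows "continuous_map (top_of_set {0..1}) (LT U R Ph) (charE a)"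
  unfolding continuous_map_def using assms charE_in[OF assms]
  by (auto simp: openin_LT lopen_def topspace_LT[OF assms(1)])

lemma continuous_charF:
  assumes "wf_cx U R Ph" "ph \<in> Ph" shows "continuous_map (top_of_set (cball 0 1)) (LT U R Ph) (charF ph)"
  unfolding continuous_map_def using assms charF_in[OF assms]
  by (auto simp: openin_LT lopen_def topspace_LT[OF assms(1)])

text \<open>All cells are modelled inside the complex plane, so that the realization is the quotient
  of a single disjoint sum.\<close>
definition cell_model :: "'u + ('u,'v) edge + ('u,'v) face => complex set" where
  "cell_model c = (case c of Inl u => {0} | Inr (Inl a) => of_real ` {0..1} | Inr (Inr ph) => cball 0 1)"

definition cell_char :: "'u + ('u,'v) edge + ('u,'v) face => complex => ('u,'v) lpt" where
  "cell_char c p = (case c of Inl u => LV u | Inr (Inl a) => charE a (Re p) | Inr (Inr ph) => charF ph p)"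

lemma openin_segment_iff:
  "openin (top_of_set (complex_of_real ` {0..1})) (complex_of_real ` S) \<longleftrightarrow> openin (top_of_set {0..1}) S"
  if "S \<subseteq> {0..1}"
proof -
  have h: "homeomorphism {0..1} (complex_of_real ` {0..1}) of_real Re"
    by (rule homeomorphismI) (auto intro!: continuous_intros)
  have r: "Re ` complex_of_real ` S = S" by (simp add: image_image)
  show ?thesis
    using homeomorphism_imp_open_map[OF h, of S]
      homeomorphism_imp_open_map[OF h[THEN homeomorphism_sym[THEN iffD1]], of "complex_of_real ` S"] unfolding r by blast
qed

text \<open>A quotient map remains one after a product with a locally compact Hausdorff space.
  Presenting the weak topology as a quotient of one sum is what makes homotopies, which are maps out
  of a product with the realization, testable cell by cell.\<close>

lemma quotient_cells:
  assumes "wf_cx U R Ph"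
  shows "quotient_map (sum_topology (top_of_set \<circ> cell_model) (U <+> (R <+> Ph))) (LT U R Ph)
           (\<lambda>(c,p). cell_char c p)" (is "quotient_map ?S _ ?q")
  unfolding quotient_map_def
proof (intro conjI allI impI)
  show "?q ` topspace ?S = topspace (LT U R Ph)"
  proof
    show "?q ` topspace ?S \<subseteq> topspace (LT U R Ph)"
    proof -
      have *: "cell_char c p \<in> lpts U R Ph" if "c \<in> U <+> (R <+> Ph)" for c p
        using that by (elim PlusE) (simp_all add: cell_char_def charE_in[OF assms] charF_in[OF assms])
      show ?thesis unfolding topspace_LT[OF assms] topspace_sum_topology split_beta
      proof (rule image_subsetI)
        fix x :: "('a + ('a,'b) edge + ('a,'b) face) \<times> complex"
        assume "x \<in> Sigma (U <+> (R <+> Ph)) (topspace \<circ> (top_of_set \<circ> cell_model))"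
        then have "fst x \<in> U <+> (R <+> Ph)" by (rule SigmaE) simp
        then show "cell_char (fst x) (snd x) \<in> lpts U R Ph" by (rule *)
      qed
    qed
    show "topspace (LT U R Ph) \<subseteq> ?q ` topspace ?S"
    proof
      fix q assume "q \<in> topspace (LT U R Ph)"
      then have "q \<in> lpts U R Ph" by (simp add: topspace_LT[OF assms])
      then consider u where "q = LV u" "u \<in> U" | a t where "q = LE a t" "a \<in> R" "0 < t" "t < 1"
        | ph p where "q = LF ph p" "ph \<in> Ph" "norm p < 1" unfolding lpts_def by blast
      then show "q \<in> ?q ` topspace ?S"
      proof cases
        case 1 then show ?thesis by (intro image_eqI[of _ _ "(Inl u, 0)"]) (auto simp: cell_char_def cell_model_def)
      next
        case 2 then show ?thesis by (intro image_eqI[of _ _ "(Inr (Inl a), of_real t)"])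
            (auto simp: cell_char_def cell_model_def charE_def)
      next
        case 3 then show ?thesis by (intro image_eqI[of _ _ "(Inr (Inr ph), p)"])
            (auto simp: cell_char_def cell_model_def charF_def)
      qed
    qed
  qed
next
  fix W assume W: "W \<subseteq> topspace (LT U R Ph)"
  have V: "{p. (Inl u, p) \<in> {x \<in> topspace ?S. ?q x \<in> W}} = (if LV u \<in> W then {0} else {})" if "u \<in> U" for u
    using that by (auto simp: cell_char_def cell_model_def)
  have E: "{p. (Inr (Inl a), p) \<in> {x \<in> topspace ?S. ?q x \<in> W}} = of_real ` {t \<in> {0..1}. charE a t \<in> W}" if "a \<in> R" for a
    using that by (auto simp: cell_char_def cell_model_def)
  have F: "{p. (Inr (Inr ph), p) \<in> {x \<in> topspace ?S. ?q x \<in> W}} = {p \<in> cball 0 1. charF ph p \<in> W}" if "ph \<in> Ph" for ph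
    using that by (auto simp: cell_char_def cell_model_def)
  show "openin ?S {x \<in> topspace ?S. ?q x \<in> W} = openin (LT U R Ph) W"
  proof -
    have *: "(\<forall>c \<in> U <+> (R <+> Ph). P c) \<longleftrightarrow> (\<forall>u\<in>U. P (Inl u)) \<and> (\<forall>a\<in>R. P (Inr (Inl a))) \<and> (\<forall>ph\<in>Ph. P (Inr (Inr ph)))" for P
      by auto
    have sub: "{x \<in> topspace ?S. ?q x \<in> W} \<subseteq> Sigma (U <+> (R <+> Ph)) (topspace \<circ> (top_of_set \<circ> cell_model))" by auto
    have Vo: "openin (top_of_set {0::complex}) (if Q then {0} else {})" for Q
      by (metis openin_subtopology_self openin_empty)
    have "(\<forall>u\<in>U. openin ((top_of_set \<circ> cell_model) (Inl u)) {p. (Inl u, p) \<in> {x \<in> topspace ?S. ?q x \<in> W}})"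
      using V Vo by (simp add: cell_model_def)
    moreover have "(\<forall>a\<in>R. openin ((top_of_set \<circ> cell_model) (Inr (Inl a))) {p. (Inr (Inl a), p) \<in> {x \<in> topspace ?S. ?q x \<in> W}})
       \<longleftrightarrow> (\<forall>a\<in>R. openin (top_of_set {0..1::real}) {t \<in> {0..1}. charE a t \<in> W})"
      by (rule ball_cong[OF refl], subst E, assumption) (simp only: o_apply cell_model_def sum.case openin_segment_iff[OF Collect_restrict])
    moreover have "(\<forall>a\<in>Ph. openin ((top_of_set \<circ> cell_model) (Inr (Inr a))) {p. (Inr (Inr a), p) \<in> {x \<in> topspace ?S. ?q x \<in> W}})
       \<longleftrightarrow> (\<forall>a\<in>Ph. openin (top_of_set (cball 0 1)) {t \<in> cball 0 1. charF a t \<in> W})"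
      by (rule ball_cong[OF refl], subst F, assumption) (simp add: cell_model_def)
    ultimately show ?thesis
      unfolding openin_sum_topology openin_LT lopen_def * using sub W topspace_LT[OF assms] by blast
  qed
qed

text \<open>The summands give open sets of the product, so pasting applies.\<close>

lemma continuous_map_from_prod_sum:
  assumes "!!i. i \<in> I ==> continuous_map (prod_topology Y (X i)) Z (\<lambda>(y,x). h (y,(i,x)))"
  shows "continuous_map (prod_topology Y (sum_topology X I)) Z h"
proof (rule pasting_lemma[where I=I and T="\<lambda>i. topspace Y \<times> ({i} \<times> topspace (X i))" and f="\<lambda>_. h"])
  fix i assume i: "i \<in> I"
  have "{i} \<times> topspace (X i) = Sigma I (\<lambda>j. if j = i then topspace (X i) else {})" using i by (auto split: if_splits)
  moreover have "openin (sum_topology X I) (Sigma I (\<lambda>j. if j = i then topspace (X i) else {}))"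
    unfolding openin_disjoint_union by auto
  ultimately show "openin (prod_topology Y (sum_topology X I)) (topspace Y \<times> ({i} \<times> topspace (X i)))"
    by (simp add: openin_prod_Times_iff)
  have snd: "continuous_map (subtopology (sum_topology X I) ({i} \<times> topspace (X i))) (X i) snd"
    unfolding continuous_map_def
  proof (intro conjI allI impI)
    show "snd \<in> topspace (subtopology (sum_topology X I) ({i} \<times> topspace (X i))) \<rightarrow> topspace (X i)" by auto
    fix W assume W: "openin (X i) W"
    have "openin (sum_topology X I) (Sigma I (\<lambda>j. if j = i then W else {}))"
      unfolding openin_disjoint_union using W by auto
    moreover have "Sigma I (\<lambda>j. if j = i then W else {}) = {i} \<times> W" using i by (auto split: if_splits)
    moreover have "{x \<in> topspace (subtopology (sum_topology X I) ({i} \<times> topspace (X i))). snd x \<in> W} = ({i} \<times> W) \<inter> ({i} \<times> topspace (X i))"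
      using openin_subset[OF W] i by auto
    ultimately show "openin (subtopology (sum_topology X I) ({i} \<times> topspace (X i)))
        {x \<in> topspace (subtopology (sum_topology X I) ({i} \<times> topspace (X i))). snd x \<in> W}"
      by (auto simp: openin_subtopology)
  qed
  have "continuous_map (prod_topology Y (subtopology (sum_topology X I) ({i} \<times> topspace (X i)))) (prod_topology Y (X i)) (\<lambda>(y,x). (y, snd x))"
    by (rule continuous_map_prod_top[THEN iffD2]) (auto simp: snd)
  from continuous_map_compose[OF this assms[OF i]]
  have "continuous_map (prod_topology Y (subtopology (sum_topology X I) ({i} \<times> topspace (X i)))) Z h"
    by (rule continuous_map_eq) (auto simp: case_prod_unfold)
  then show "continuous_map (subtopology (prod_topology Y (sum_topology X I)) (topspace Y \<times> ({i} \<times> topspace (X i)))) Z h"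
    by (simp add: subtopology_Times subtopology_topspace)
qed auto

lemma continuous_map_prod_LT:
  assumes wf: "wf_cx U R Ph" and Y: "locally_compact_space Y" "Hausdorff_space Y"
    and V: "!!u. u \<in> U ==> continuous_map Y Z (\<lambda>y. h (y, LV u))"
    and E: "!!a. a \<in> R ==> continuous_map (prod_topology Y (top_of_set {0..1})) Z (\<lambda>(y,t). h (y, charE a t))"
    and F: "!!ph. ph \<in> Ph ==> continuous_map (prod_topology Y (top_of_set (cball 0 1))) Z (\<lambda>(y,p). h (y, charF ph p))"
  shows "continuous_map (prod_topology Y (LT U R Ph)) Z h"
proof -
  let ?S = "sum_topology (top_of_set \<circ> cell_model) (U <+> (R <+> Ph))"
  have q: "quotient_map (prod_topology Y ?S) (prod_topology Y (LT U R Ph)) (\<lambda>(y,x). (y, case x of (c,p) => cell_char c p))"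
    by (rule quotient_map_prod_right) (use Y quotient_cells[OF wf] in auto)
  have "continuous_map (prod_topology Y ?S) Z (h \<circ> (\<lambda>(y,x). (y, case x of (c,p) => cell_char c p)))"
  proof (rule continuous_map_from_prod_sum)
    fix c assume "c \<in> U <+> (R <+> Ph)"
    then consider u where "c = Inl u" "u \<in> U" | a where "c = Inr (Inl a)" "a \<in> R" | ph where "c = Inr (Inr ph)" "ph \<in> Ph" by auto
    then show "continuous_map (prod_topology Y ((top_of_set \<circ> cell_model) c)) Z
      (\<lambda>(y, x). (h \<circ> (\<lambda>(y, x). (y, case x of (c, p) => cell_char c p))) (y, c, x))"
    proof cases
      case 1
      then show ?thesis
        using continuous_map_compose[OF continuous_map_fst V[OF 1(2)], of "top_of_set {0}"]
        by (simp add: cell_model_def cell_char_def o_def case_prod_unfold)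
    next
      case 2
      have "continuous_map (prod_topology Y (top_of_set (complex_of_real ` {0..1}))) (prod_topology Y (top_of_set {0..1})) (\<lambda>(y,p). (y, Re p))"
        by (rule continuous_map_prod_top[THEN iffD2]) (auto simp: continuous_map_iff_continuous continuous_map_in_subtopology intro!: continuous_intros)
      from continuous_map_compose[OF this E[OF 2(2)]] 2 show ?thesis
        by (simp add: cell_model_def cell_char_def o_def case_prod_unfold)
    next
      case 3
      with F[OF 3(2)] show ?thesis
        by (simp add: cell_model_def cell_char_def o_def case_prod_unfold)
    qed
  qed
  then show ?thesis using q continuous_compose_quotient_map_eq by blast
qed

lemma continuous_map_top_of_set_compose:
  assumes "continuous_map (top_of_set T) Z g" "continuous_on S f" "f ` S \<subseteq> T"
  shows "continuous_map (top_of_set S) Z (\<lambda>x. g (f x))"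
  using continuous_map_compose[of "top_of_set S" "top_of_set T" f Z g] assms
  by (simp add: continuous_map_iff_continuous continuous_map_in_subtopology o_def image_subset_iff_funcset)

lemma continuous_map_top_of_set_cases:
  fixes p q :: "'a::topological_space => real"
  assumes "continuous_on S p" "continuous_on S q"
    and "continuous_map (top_of_set {x\<in>S. p x <= q x}) Y f"
    and "continuous_map (top_of_set {x\<in>S. q x <= p x}) Y g"
    and "!!x. x \<in> S ==> p x = q x ==> f x = g x"
  shows "continuous_map (top_of_set S) Y (\<lambda>x. if p x <= q x then f x else g x)"
proof -
  have "S \<inter> {x \<in> S. p x <= q x} = {x \<in> S. p x <= q x}" "S \<inter> {x \<in> S. q x <= p x} = {x \<in> S. q x <= p x}" by auto
  then show ?thesis
    using assms by (intro continuous_map_cases_le)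
      (auto simp: continuous_map_iff_continuous subtopology_subtopology)
qed

text \<open>The pair consisting of a cell times the interval and its boundary has the homotopy extension
  property: project radially from a point above the centre of the top face.\<close>
lemma cell_homotopy_extension:
  fixes hc :: "real \<times> 'n::real_normed_vector => 'z" and b :: "(real \<times> real) \<times> 'n => 'z"
  assumes hc: "continuous_map (top_of_set ({0..1} \<times> cball 0 1)) Z hc"
    and b: "continuous_map (top_of_set (({0..1} \<times> {0..1}) \<times> sphere 0 1)) Z b"
    and b0: "!!s p. s \<in> {0..1} ==> norm p = 1 ==> b ((s,0),p) = hc (s,p)"
    and be: "!!u p s. u \<in> {0..1} ==> norm p = 1 ==> s \<in> {0,1} ==> b ((s,u),p) = hc (s,p)"
  obtains G where "continuous_map (top_of_set (({0..1} \<times> {0..1}) \<times> cball 0 1)) Z G"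
    "!!s p. s \<in> {0..1} ==> norm p <= 1 ==> G ((s,0),p) = hc (s,p)"
    "!!s u p. u \<in> {0..1} ==> norm p <= 1 ==> s \<in> {0,1} ==> G ((s,u),p) = hc (s,p)"
    "!!s u p. s \<in> {0..1} ==> u \<in> {0..1} ==> norm p = 1 ==> G ((s,u),p) = b ((s,u),p)"
proof -
  \<comment> \<open>\<open>\<nu>\<close> is the gauge of the prism \<open>[0,1] x ball\<close> about
    its centre \<open>(1/2, 0)\<close>, and \<open>sc c\<close> is the dilation by
    \<open>1/c\<close> from that centre.\<close>
  define \<nu> :: "(real \<times> real) \<times> 'n => real" where "\<nu> x = max (norm (snd x)) \<bar>2 * fst (fst x) - 1\<bar>" for x
  define sc :: "real => (real \<times> real) \<times> 'n => real \<times> 'n" where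
    "sc c x = (1/2 + (fst (fst x) - 1/2) / c, snd x /\<^sub>R c)" for c x
  define D where "D = ({0..1::real} \<times> {0..1::real}) \<times> cball (0::'n) 1"
  \<comment> \<open>The ray from the point at height 2 above the centre through a point at height
    \<open>u\<close> meets the bottom after stretching by \<open>1 / (1 - u/2)\<close> and the wall
    after stretching by \<open>1 / \<nu>\<close>, at height \<open>2 - (2 - u) / \<nu>\<close>. The
    smaller stretch decides between \<open>A\<close> and \<open>B\<close>.\<close>
  define A where "A x = hc (sc (1 - snd (fst x) / 2) x)" for x
  \<comment> \<open>The wall has two kinds of parts: over the boundary sphere \<open>b\<close> is
    used, on the ends \<open>s = 0\<close> and \<open>s = 1\<close> the extension is independent of
    \<open>u\<close>, so \<open>hc\<close> serves.\<close>
  define B where "B x = (if \<bar>2 * fst (fst x) - 1\<bar> <= norm (snd x)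
      then b ((fst (sc (\<nu> x) x), 2 - (2 - snd (fst x)) / \<nu> x), snd (sc (\<nu> x) x)) else hc (sc (\<nu> x) x))" for x
  define G where "G x = (if \<nu> x <= 1 - snd (fst x) / 2 then A x else B x)" for x
  have cont\<nu>: "continuous_on S \<nu>" for S unfolding \<nu>_def by (intro continuous_intros)
  have \<nu>1: "\<nu> x <= 1" if "x \<in> D" for x using that by (auto simp: D_def \<nu>_def)
  have half: "\<bar>s - 1/2\<bar> * 2 = \<bar>2 * s - 1\<bar>" for s :: real by (simp add: abs_if)
  have scin: "sc c x \<in> {0..1} \<times> cball 0 1" if "\<nu> x <= c" "0 < c" for c x
  proof -
    have "\<bar>2 * fst (fst x) - 1\<bar> <= c" "norm (snd x) <= c" using that by (auto simp: \<nu>_def)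
    then have "\<bar>(fst (fst x) - 1/2) / c\<bar> <= 1/2" "norm (snd x /\<^sub>R c) <= 1"
      using that(2) half[of "fst (fst x)"] by (auto simp: field_simps)
    then show ?thesis unfolding sc_def mem_Times_iff fst_conv snd_conv mem_cball_0 atLeastAtMost_iff
      by linarith
  qed
  have normone: "norm (snd (sc (\<nu> x) x)) = 1" if "\<nu> x = norm (snd x)" "1/2 <= \<nu> x" for x
  proof -
    have "\<nu> x ~= 0" using that by linarith
    then show ?thesis using that(1) by (simp add: sc_def)
  qed
  have uin: "2 - (2 - u) / n \<in> {0..1}" if "u \<in> {0..1}" "1 - u / 2 <= n" "n <= 1" for u n :: real
  proof -
    have "0 < n" using that by auto
    then show ?thesis using that by (auto simp: field_simps)
  qed
  have Bpos: "\<nu> x \<ge> 1/2" if "x \<in> D" "1 - snd (fst x) / 2 <= \<nu> x" for x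
    using that by (auto simp: D_def)
  have contA: "continuous_map (top_of_set {x\<in>D. \<nu> x <= 1 - snd (fst x) / 2}) Z A"
    unfolding A_def
  proof (rule continuous_map_top_of_set_compose[OF hc])
    show "continuous_on {x \<in> D. \<nu> x <= 1 - snd (fst x) / 2} (\<lambda>x. sc (1 - snd (fst x) / 2) x)"
      unfolding sc_def by (intro continuous_intros) (auto simp: D_def)
    show "(\<lambda>x. sc (1 - snd (fst x) / 2) x) ` {x \<in> D. \<nu> x <= 1 - snd (fst x) / 2} \<subseteq> {0..1} \<times> cball 0 1"
      by (intro image_subsetI scin) (auto simp: D_def)
  qed
  have contB: "continuous_map (top_of_set {x\<in>D. 1 - snd (fst x) / 2 <= \<nu> x}) Z B"
    unfolding B_def
  proof (rule continuous_map_top_of_set_cases)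
    let ?S = "{x\<in>D. 1 - snd (fst x) / 2 <= \<nu> x}"
    have nz: "\<nu> x ~= 0" if "x \<in> ?S" for x using Bpos[of x] that by auto
    have csc: "continuous_on T (\<lambda>x. fst (sc (\<nu> x) x))" "continuous_on T (\<lambda>x. snd (sc (\<nu> x) x))"
       "continuous_on T (\<lambda>x. 2 - (2 - snd (fst x)) / \<nu> x)" if "T \<subseteq> ?S" for T
      unfolding sc_def using nz that by (auto intro!: continuous_intros cont\<nu>)
    show "continuous_map (top_of_set {x \<in> ?S. \<bar>2 * fst (fst x) - 1\<bar> <= norm (snd x)}) Z
       (\<lambda>x. b ((fst (sc (\<nu> x) x), 2 - (2 - snd (fst x)) / \<nu> x), snd (sc (\<nu> x) x)))"
    proof (rule continuous_map_top_of_set_compose[OF b])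
      show "(\<lambda>x. ((fst (sc (\<nu> x) x), 2 - (2 - snd (fst x)) / \<nu> x), snd (sc (\<nu> x) x))) `
        {x \<in> ?S. \<bar>2 * fst (fst x) - 1\<bar> <= norm (snd x)} \<subseteq> ({0..1} \<times> {0..1}) \<times> sphere 0 1"
      proof (rule image_subsetI)
        fix x assume x: "x \<in> {x \<in> ?S. \<bar>2 * fst (fst x) - 1\<bar> <= norm (snd x)}"
        then have n: "\<nu> x = norm (snd x)" "\<nu> x \<ge> 1/2" "\<nu> x <= 1" "1 - snd (fst x) / 2 <= \<nu> x" "snd (fst x) \<in> {0..1}"
          using Bpos[of x] \<nu>1[of x] by (auto simp: \<nu>_def D_def)
        have "norm (snd (sc (\<nu> x) x)) = 1" by (rule normone) (use n in auto)
        moreover have "fst (sc (\<nu> x) x) \<in> {0..1}" using scin[of x "\<nu> x"] n(2) by (auto simp: mem_Times_iff)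
        moreover have "2 - (2 - snd (fst x)) / \<nu> x \<in> {0..1}" by (rule uin) (use n in auto)
        ultimately show "((fst (sc (\<nu> x) x), 2 - (2 - snd (fst x)) / \<nu> x), snd (sc (\<nu> x) x)) \<in> ({0..1} \<times> {0..1}) \<times> sphere 0 1"
          by simp
      qed
    qed (intro continuous_intros csc; auto)
    show "continuous_map (top_of_set {x \<in> ?S. norm (snd x) <= \<bar>2 * fst (fst x) - 1\<bar>}) Z (\<lambda>x. hc (sc (\<nu> x) x))"
    proof (rule continuous_map_top_of_set_compose[OF hc])
      show "continuous_on {x \<in> ?S. norm (snd x) <= \<bar>2 * fst (fst x) - 1\<bar>} (\<lambda>x. sc (\<nu> x) x)"
        using continuous_on_Pair[OF csc(1,2), of "{x \<in> ?S. norm (snd x) <= \<bar>2 * fst (fst x) - 1\<bar>}"]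
        by (simp add: subset_iff)
      show "(\<lambda>x. sc (\<nu> x) x) ` {x \<in> ?S. norm (snd x) <= \<bar>2 * fst (fst x) - 1\<bar>} \<subseteq> {0..1} \<times> cball 0 1"
        using Bpos by (intro image_subsetI scin) force+
    qed
    fix x assume x: "x \<in> ?S" and eq: "\<bar>2 * fst (fst x) - 1\<bar> = norm (snd x)"
    have n: "\<nu> x = norm (snd x)" "\<nu> x = \<bar>2 * fst (fst x) - 1\<bar>" "\<nu> x \<ge> 1/2" "\<nu> x <= 1" "1 - snd (fst x) / 2 <= \<nu> x" "snd (fst x) \<in> {0..1}"
      using Bpos[of x] \<nu>1[of x] x eq by (auto simp: \<nu>_def D_def)
    have "norm (snd (sc (\<nu> x) x)) = 1" by (rule normone) (use n in auto)
    moreover have "2 - (2 - snd (fst x)) / \<nu> x \<in> {0..1}" by (rule uin) (use n in auto)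
    moreover have "fst (sc (\<nu> x) x) \<in> {0,1}" using n(2,3) by (auto simp: sc_def field_simps abs_if split: if_splits)
    ultimately show "b ((fst (sc (\<nu> x) x), 2 - (2 - snd (fst x)) / \<nu> x), snd (sc (\<nu> x) x)) = hc (sc (\<nu> x) x)"
      by (subst be) auto
  qed (auto intro!: continuous_intros)
  have "continuous_map (top_of_set D) Z G"
    unfolding G_def
  proof (rule continuous_map_top_of_set_cases[OF _ _ contA contB])
    fix x assume x: "x \<in> D" and eq: "\<nu> x = 1 - snd (fst x) / 2"
    have n: "\<nu> x \<ge> 1/2" "\<nu> x <= 1" using Bpos[of x] \<nu>1[of x] x eq by auto
    then have u: "2 - (2 - snd (fst x)) / \<nu> x = 0" using eq by (simp add: field_simps)
    have "fst (sc (\<nu> x) x) \<in> {0..1}" using scin[of x "\<nu> x"] n by auto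
    moreover have "norm (snd (sc (\<nu> x) x)) = 1" if "\<bar>2 * fst (fst x) - 1\<bar> <= norm (snd x)"
    proof -
      have "\<nu> x = norm (snd x)" using that by (simp add: \<nu>_def)
      then show ?thesis by (intro normone) (use n in auto)
    qed
    ultimately show "A x = B x" unfolding A_def B_def u eq[symmetric] by (auto simp: b0)
  qed (auto intro!: continuous_intros cont\<nu>)
  moreover have "G ((s,0),p) = hc (s,p)" if "s \<in> {0..1}" "norm p <= 1" for s p
    using that by (auto simp: G_def A_def sc_def \<nu>_def)
  moreover have "G ((s,u),p) = hc (s,p)" if "u \<in> {0..1}" "norm p <= 1" "s \<in> {0,1}" for s u p
  proof -
    have n: "\<nu> ((s,u),p) = 1" using that by (auto simp: \<nu>_def max_def)
    then have "sc (\<nu> ((s,u),p)) ((s,u),p) = (s,p)" by (simp add: sc_def)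
    then show ?thesis using that n be[of u p s] by (auto simp: G_def A_def B_def sc_def)
  qed
  moreover have "G ((s,u),p) = b ((s,u),p)" if "s \<in> {0..1}" "u \<in> {0..1}" "norm p = 1" for s u p
  proof -
    have a: "\<bar>2 * s - 1\<bar> <= 1" using that by (auto simp: abs_le_iff)
    then have n: "\<nu> ((s,u),p) = 1" using that by (simp add: \<nu>_def max_def)
    show ?thesis using that n a b0[of s p] by (auto simp: G_def A_def B_def sc_def)
  qed
  ultimately show thesis using that unfolding D_def by blast
qed

section \<open>Boundary arcs of a face and polar coordinates\<close>

definition barc :: "('u,'v) face => nat => real => ('u,'v) lpt" where
  "barc ph k t = charE (fst (bd ph ! k)) (if snd (bd ph ! k) then t else 1 - t)"

definition corner :: "('u,'v) face => nat => 'u" where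
  "corner ph k = (case ph of ((u0,u1,u2,u3),_) => [u0,u1,u2,u3] ! k)"

lemma less_4_cases: "k < (4::nat) ==> k = 0 \<or> k = 1 \<or> k = 2 \<or> k = 3" by auto

lemma barc_ends:
  assumes "k < 4" shows "barc ph k 0 = LV (corner ph k)" "barc ph k 1 = LV (corner ph (Suc k mod 4))"
proof -
  obtain u0 u1 u2 u3 x z y where "ph = ((u0,u1,u2,u3),(x,z,y))" by (metis prod.exhaust)
  then show "barc ph k 0 = LV (corner ph k)" "barc ph k 1 = LV (corner ph (Suc k mod 4))"
    using less_4_cases[OF assms]
    by (elim disjE; simp add: barc_def corner_def bd_def charE_def esrc_def etgt_def)+
qed

text \<open>True on the closed arc, because the next arc starts in the corner in which this one
  ends.\<close>

lemma bdpt_barc: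
  assumes "k < 4" "real k <= s" "s <= real k + 1" shows "bdpt ph s = barc ph k (s - real k)"
proof (cases "s = real k + 1")
  case True
  then have "\<lfloor>s\<rfloor> = int k + 1" by (simp add: floor_eq_iff)
  then have "bdpt ph s = barc ph (Suc k mod 4) 0"
    using True by (simp add: bdpt_def barc_def Let_def case_prod_unfold nat_add_distrib)
  moreover have "s - real k = 1" using True by simp
  ultimately show ?thesis using assms(1) barc_ends(2)[of k ph] barc_ends(1)[of "Suc k mod 4" ph] by simp
next
  case False
  then have "\<lfloor>s\<rfloor> = int k" using assms by (simp add: floor_eq_iff)
  then show ?thesis using assms(1) by (simp add: bdpt_def barc_def Let_def case_prod_unfold)
qed

lemma charF_cis:
  assumes "s \<in> {0..4}" shows "charF ph (cis (pi * s / 2)) = bdpt ph s"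
proof (cases "s = 4")
  case True
  then have "pi * s / 2 = 2 * pi" by simp
  then have c: "cis (pi * s / 2) = 1" by (simp only: cis_2pi)
  have "Arg2pi 1 = 0" by (rule Arg2pi_unique[of 1]) auto
  with c show ?thesis using True bdpt_barc[of 3 4 ph] bdpt_barc[of 0 0 ph] barc_ends[of 3 ph] barc_ends[of 0 ph]
    by (simp add: charF_def)
next
  case False
  then have "pi * s / 2 < 2 * pi" "0 <= pi * s / 2" using assms by auto
  then have "Arg2pi (cis (pi * s / 2)) = pi * s / 2"
    by (intro Arg2pi_unique[of 1]) (auto simp: cis_conv_exp mult.commute)
  then have "2 * Arg2pi (cis (pi * s / 2)) / pi = s" by (simp add: field_simps)
  then show ?thesis unfolding charF_def by simp
qed

text \<open>The faces \<open>Ph'\<close> of the target are free: a boundary path uses edges only.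
  With \<open>Ph' = {}\<close> it is continuous into the 1-skeleton, as extension over skeleta
  requires.\<close>

lemma continuous_bdpt:
  assumes "wf_cx U R Ph" "ph \<in> Ph" and that: "wf_cx U R Ph'"
  shows "continuous_map (top_of_set {0..4}) (LT U R Ph') (bdpt ph)"
proof (rule pasting_lemma_closed[where I="{..<4::nat}" and T="\<lambda>k. {real k..real k + 1}" and f="\<lambda>k s. barc ph k (s - real k)"])
  fix k :: nat assume k: "k \<in> {..<4}"
  then have sub: "{real k..real k + 1} \<subseteq> {0..4}" by auto
  then show "closedin (top_of_set {0..4}) {real k..real k + 1}"
    by (metis closed_real_atLeastAtMost closed_subset)
  have "bd ph ! k \<in> set (bd ph)" using k by (intro nth_mem) auto
  then have a: "fst (bd ph ! k) \<in> R" using assms unfolding wf_cx_def by blast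
  have "{0..4} \<inter> {real k..real k + 1} = {real k..real k + 1}" using sub by auto
  then show "continuous_map (subtopology (top_of_set {0..4}) {real k..real k + 1}) (LT U R Ph') (\<lambda>s. barc ph k (s - real k))"
    unfolding barc_def subtopology_subtopology
    by (simp only:) (rule continuous_map_top_of_set_compose[OF continuous_charE[OF that a]]; cases "snd (bd ph ! k)"; auto intro!: continuous_intros)
next
  fix i j s assume "i \<in> {..<4::nat}" "j \<in> {..<4::nat}" "s \<in> topspace (top_of_set {0..4}) \<inter> {real i..real i + 1} \<inter> {real j..real j + 1}"
  then show "barc ph i (s - real i) = barc ph j (s - real j)"
    using bdpt_barc[of i s ph] bdpt_barc[of j s ph] by auto
next
  fix s assume "s \<in> topspace (top_of_set {0..4::real})"
  then have s: "0 <= s" "s <= 4" by auto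
  define k where "k = (if s = 4 then 3 else nat \<lfloor>s\<rfloor>)"
  have "k < 4" "real k <= s" "s <= real k + 1" using s by (auto simp: k_def nat_less_iff floor_less_iff)
  then show "\<exists>j. j \<in> {..<4} \<and> s \<in> {real j..real j + 1} \<and> bdpt ph s = barc ph j (s - real j)"
    by (intro exI[of _ k]) (simp add: bdpt_barc)
qed auto

text \<open>A continuous surjection from a compact onto a Hausdorff space is a quotient map.
  Functions given by radius and angle can so be tested in polar coordinates, and the jump of
  \<open>Arg2pi\<close> never matters.\<close>

lemma quotient_circle: "quotient_map (top_of_set {0..4}) (top_of_set (sphere 0 1)) (\<lambda>s. cis (pi * s / 2))"
proof (rule continuous_imp_quotient_map)
  show "(\<lambda>s. cis (pi * s / 2)) ` topspace (top_of_set {0..4}) = topspace (top_of_set (sphere 0 1))"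
  proof -
    have "\<exists>s\<in>{0..4}. p = cis (pi * s / 2)" if "norm p = 1" for p
      using that Arg2pi[of p] by (intro bexI[of _ "2 * Arg2pi p / pi"]) (auto simp: cis_conv_exp is_Arg_def field_simps)
    then show ?thesis by (force simp: image_iff)
  qed
qed (auto simp: continuous_map_iff_continuous continuous_map_in_subtopology compact_space_subtopology Hausdorff_space_subtopology
      intro!: continuous_intros)

lemma quotient_disc: "quotient_map (top_of_set ({0..1} \<times> {0..4})) (top_of_set (cball 0 1)) (\<lambda>(r,s). of_real r * cis (pi * s / 2))"
proof (rule continuous_imp_quotient_map)
  show "(\<lambda>(r,s). of_real r * cis (pi * s / 2)) ` topspace (top_of_set ({0..1} \<times> {0..4})) = topspace (top_of_set (cball 0 1))"
  proof -
    have "\<exists>x\<in>{0..1}\<times>{0..4}. p = of_real (fst x) * cis (pi * snd x / 2)" if "norm p <= 1" for p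
      using that Arg2pi[of p] by (intro bexI[of _ "(norm p, 2 * Arg2pi p / pi)"]) (auto simp: cis_conv_exp is_Arg_def field_simps)
    then show ?thesis by (force simp: norm_mult image_iff case_prod_unfold)
  qed
qed (auto simp: continuous_map_iff_continuous continuous_map_in_subtopology compact_space_subtopology Hausdorff_space_subtopology
      compact_Times norm_mult case_prod_unfold intro!: continuous_intros)

lemma continuous_map_prod_circle:
  assumes "locally_compact_space Y" "Hausdorff_space Y"
    and "continuous_map (prod_topology Y (top_of_set {0..4})) Z (\<lambda>(y,s). g (y, cis (pi * s / 2)))"
  shows "continuous_map (prod_topology Y (top_of_set (sphere 0 1))) Z g"
proof -
  have "quotient_map (prod_topology Y (top_of_set {0..4})) (prod_topology Y (top_of_set (sphere 0 1))) (\<lambda>(y,s). (y, cis (pi * s / 2)))"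
    by (rule quotient_map_prod_right) (use assms quotient_circle in auto)
  from continuous_compose_quotient_map_eq[OF this, of Z g] assms(3) show ?thesis by (simp add: o_def case_prod_unfold)
qed

lemma continuous_map_prod_disc:
  assumes "locally_compact_space Y" "Hausdorff_space Y"
    and "continuous_map (prod_topology Y (top_of_set ({0..1} \<times> {0..4}))) Z (\<lambda>(y,(r,s)). g (y, of_real r * cis (pi * s / 2)))"
  shows "continuous_map (prod_topology Y (top_of_set (cball 0 1))) Z g"
proof -
  have "quotient_map (prod_topology Y (top_of_set ({0..1} \<times> {0..4}))) (prod_topology Y (top_of_set (cball 0 1)))
      (\<lambda>(y,x). (y, case x of (r,s) => of_real r * cis (pi * s / 2)))"
    by (rule quotient_map_prod_right) (use assms quotient_disc in auto)
  from continuous_compose_quotient_map_eq[OF this, of Z g] assms(3) show ?thesis by (simp add: o_def case_prod_unfold)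
qed

section \<open>Homotopy extension over a complex\<close>

lemma lc_H_interval:
  "locally_compact_space (top_of_set {0..1::real})" "Hausdorff_space (top_of_set {0..1::real})"
  "locally_compact_space (top_of_set ({0..1::real} \<times> {0..1::real}))" "Hausdorff_space (top_of_set ({0..1::real} \<times> {0..1::real}))"
  by (auto intro!: compact_imp_locally_compact_space Hausdorff_space_subtopology simp: compact_space_subtopology compact_Times)

lemma continuous_charF_sphere:
  assumes "wf_cx U R Ph" "ph \<in> Ph" "wf_cx U R Ph'"
  shows "continuous_map (top_of_set (sphere 0 1)) (LT U R Ph') (charF ph)"
proof -
  have "continuous_map (top_of_set {0..4}) (LT U R Ph') (charF ph \<circ> (\<lambda>s. cis (pi * s / 2)))"
    by (rule continuous_map_eq[OF continuous_bdpt[OF assms]]) (simp add: charF_cis)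
  then show ?thesis using continuous_compose_quotient_map_eq[OF quotient_circle] by blast
qed

text \<open>Two parameters occur because the homotopy \<open>h\<close> in \<open>s\<close> is itself
  deformed in \<open>u\<close>: \<open>k v\<close> prescribes how the track of the vertex
  \<open>v\<close> moves, while the ends \<open>s = 0\<close> and \<open>s = 1\<close> stay put. The
  deformation is extended over edges and then over faces.\<close>

lemma complex_homotopy_extension:
  fixes h :: "real \<times> ('u,'v) lpt => 'z" and k :: "'u => real \<times> real => 'z"
  assumes wf: "wf_cx U R Ph"
    and h: "continuous_map (prod_topology (top_of_set {0..1}) (LT U R Ph)) Z h"
    and k: "!!v. v \<in> U ==> continuous_map (top_of_set ({0..1} \<times> {0..1})) Z (k v)"
    and k0: "!!v s. v \<in> U ==> s \<in> {0..1} ==> k v (s,0) = h (s, LV v)"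
    and ke: "!!v s u. v \<in> U ==> u \<in> {0..1} ==> s \<in> {0,1} ==> k v (s,u) = h (s, LV v)"
  obtains G where "continuous_map (prod_topology (top_of_set ({0..1} \<times> {0..1})) (LT U R Ph)) Z G"
    "!!s q. s \<in> {0..1} ==> q \<in> lpts U R Ph ==> G ((s,0),q) = h (s,q)"
    "!!s u q. s \<in> {0,1} ==> u \<in> {0..1} ==> q \<in> lpts U R Ph ==> G ((s,u),q) = h (s,q)"
    "!!s u v. G ((s,u),LV v) = k v (s,u)"
proof -
  have wf0: "wf_cx U R {}" using wf by (simp add: wf_cx_def)
  \<comment> \<open>Edges are treated by the same cell lemma with the ball \<open>[-1,1]\<close>,
    hence the change of parameter \<open>t = (1 + p) / 2\<close>.\<close>
  let ?PE = "\<lambda>a G. continuous_map (top_of_set (({0..1} \<times> {0..1}) \<times> cball 0 1)) Z G \<and>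
    (\<forall>s\<in>{0..1}. \<forall>p\<in>cball (0::real) 1. G ((s,0),p) = h (s, charE a ((1 + p) / 2))) \<and>
    (\<forall>s\<in>{0,1}. \<forall>u\<in>{0..1}. \<forall>p\<in>cball 0 1. G ((s,u),p) = h (s, charE a ((1 + p) / 2))) \<and>
    (\<forall>s\<in>{0..1}. \<forall>u\<in>{0..1}. G ((s,u),-1) = k (esrc a) (s,u) \<and> G ((s,u),1) = k (etgt a) (s,u))"
  have "\<exists>G. ?PE a G"
    if a: "a \<in> R" for a
  proof -
    have ends: "esrc a \<in> U" "etgt a \<in> U" using wf a by (auto simp: wf_cx_def)
    define hc where "hc = (\<lambda>(s, p). h (s, charE a ((1 + p) / 2)))"
    define b where "b = (\<lambda>(y, p::real). if p <= 0 then k (esrc a) y else k (etgt a) y)"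
    have "continuous_map (prod_topology (top_of_set {0..1}) (top_of_set (cball (0::real) 1))) (prod_topology (top_of_set {0..1}) (LT U R Ph)) (\<lambda>(s,p). (s, charE a ((1 + p) / 2)))"
      unfolding continuous_map_prod_top
      by (intro disjI2 conjI continuous_map_top_of_set_compose[OF continuous_charE[OF wf a]])
        (auto intro!: continuous_intros simp: dist_real_def abs_le_iff)
    from continuous_map_compose[OF this h]
    have hc: "continuous_map (top_of_set ({0..1} \<times> cball 0 1)) Z hc"
      by (simp add: hc_def o_def case_prod_unfold)
    have b: "continuous_map (top_of_set (({0..1} \<times> {0..1}) \<times> sphere 0 1)) Z b"
      unfolding b_def case_prod_unfold
    proof (rule continuous_map_top_of_set_cases)
      show "continuous_map (top_of_set {x \<in> ({0..1} \<times> {0..1}) \<times> sphere 0 1. snd x <= 0}) Z (\<lambda>p. k (esrc a) (fst p))"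
        by (rule continuous_map_top_of_set_compose[OF k[OF ends(1)]]) (auto intro!: continuous_intros)
      show "continuous_map (top_of_set {x \<in> ({0..1} \<times> {0..1}) \<times> sphere 0 1. 0 <= snd x}) Z (\<lambda>p. k (etgt a) (fst p))"
        by (rule continuous_map_top_of_set_compose[OF k[OF ends(2)]]) (auto intro!: continuous_intros)
    qed (auto intro!: continuous_intros)
    have pm: "p = 1 \<or> p = -1" if "norm (p::real) = 1" for p using that by auto
    obtain G where G: "continuous_map (top_of_set (({0..1} \<times> {0..1}) \<times> cball 0 1)) Z G"
      "!!s p. s \<in> {0..1} ==> norm p <= 1 ==> G ((s,0),p) = hc (s,p)"
      "!!s u p. u \<in> {0..1} ==> norm p <= 1 ==> s \<in> {0,1} ==> G ((s,u),p) = hc (s,p)"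
      "!!s u p. s \<in> {0..1} ==> u \<in> {0..1} ==> norm p = 1 ==> G ((s,u),p) = b ((s,u),p)"
    proof (rule cell_homotopy_extension[OF hc b])
      show "b ((s, 0), p) = hc (s, p)" if "s \<in> {0..1}" "norm p = 1" for s p
        using that pm[of p] k0 ends by (auto simp: b_def hc_def charE_def)
      show "b ((s, u), p) = hc (s, p)" if "u \<in> {0..1}" "norm p = 1" "s \<in> {0,1}" for u p s
        using that pm[of p] ke ends by (auto simp: b_def hc_def charE_def)
    qed blast
    show ?thesis
      by (intro exI[of _ G] conjI ballI) (simp_all add: G(1) G(2) G(3) G(4) hc_def b_def del: insert_iff)
  qed
  then have "\<exists>Ge. \<forall>a\<in>R. ?PE a (Ge a)" by (intro bchoice ballI)
  then obtain Ge where Ge0: "\<forall>a\<in>R. ?PE a (Ge a)" by (elim exE)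
  have Ge: "!!a. a \<in> R ==> continuous_map (top_of_set (({0..1} \<times> {0..1}) \<times> cball 0 1)) Z (Ge a)"
    "!!a s p. a \<in> R ==> s\<in>{0..1} ==> p\<in>cball (0::real) 1 ==> Ge a ((s,0),p) = h (s, charE a ((1 + p) / 2))"
    "!!a s u p. a \<in> R ==> s\<in>{0,1} ==> u\<in>{0..1} ==> p\<in>cball 0 1 ==> Ge a ((s,u),p) = h (s, charE a ((1 + p) / 2))"
    "!!a s u. a \<in> R ==> s\<in>{0..1} ==> u\<in>{0..1} ==> Ge a ((s,u),-1) = k (esrc a) (s,u) \<and> Ge a ((s,u),1) = k (etgt a) (s,u)"
    subgoal using Ge0 by (elim ballE) auto
    subgoal using Ge0 by (elim ballE) auto
    subgoal using Ge0 by (elim ballE conjE) blast+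
    subgoal using Ge0 by (elim ballE) auto
    done
  define G1 where "G1 = (\<lambda>(y,q). case q of LV v => k v y | LE a t => Ge a (y, 2 * t - 1) | LF _ _ => undefined)"
  have G1e: "G1 (y, charE a t) = Ge a (y, 2 * t - 1)" if "a \<in> R" "t \<in> {0..1}" "y \<in> {0..1} \<times> {0..1}" for a t y
    using that Ge(4)[of a "fst y" "snd y"] by (auto simp: G1_def charE_def)
  have contE: "continuous_map (prod_topology (top_of_set ({0..1} \<times> {0..1})) (top_of_set {0..1})) Z (\<lambda>(y, t). Ge a (y, 2 * t - 1))" if "a \<in> R" for a
    unfolding prod_topology_subtopology_eu case_prod_unfold
    by (rule continuous_map_top_of_set_compose[OF Ge(1)[OF that]])
      (auto intro!: continuous_intros simp: dist_real_def abs_le_iff)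
  \<comment> \<open>Continuity on the 1-skeleton is needed first: it is composed with the boundary
    circles of the faces to give the boundary data \<open>b\<close> there.\<close>
  have contG1: "continuous_map (prod_topology (top_of_set ({0..1} \<times> {0..1})) (LT U R {})) Z G1"
  proof (rule continuous_map_prod_LT[OF wf0 lc_H_interval(3,4)])
    show "continuous_map (prod_topology (top_of_set ({0..1} \<times> {0..1})) (top_of_set {0..1})) Z (\<lambda>(y, t). G1 (y, charE a t))" if "a \<in> R" for a
      by (rule continuous_map_eq[OF contE[OF that]]) (auto simp: G1e that)
  qed (use k in \<open>auto simp: G1_def\<close>)
  let ?PF = "\<lambda>ph G. continuous_map (top_of_set (({0..1} \<times> {0..1}) \<times> cball 0 1)) Z G \<and>
    (\<forall>s\<in>{0..1}. \<forall>p\<in>cball (0::complex) 1. G ((s,0),p) = h (s, charF ph p)) \<and>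
    (\<forall>s\<in>{0,1}. \<forall>u\<in>{0..1}. \<forall>p\<in>cball 0 1. G ((s,u),p) = h (s, charF ph p)) \<and>
    (\<forall>s\<in>{0..1}. \<forall>u\<in>{0..1}. \<forall>p\<in>sphere 0 1. G ((s,u),p) = G1 ((s,u), charF ph p))"
  have "\<exists>G. ?PF ph G"
    if f: "ph \<in> Ph" for ph
  proof -
    define hc where "hc = (\<lambda>(s, p). h (s, charF ph p))"
    define b where "b = (\<lambda>(y, p). G1 (y, charF ph p))"
    have "continuous_map (prod_topology (top_of_set {0..1}) (top_of_set (cball 0 1))) (prod_topology (top_of_set {0..1}) (LT U R Ph)) (\<lambda>(s,p). (s, charF ph p))"
      unfolding continuous_map_prod_top using continuous_charF[OF wf f] by auto
    from continuous_map_compose[OF this h]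
    have hc: "continuous_map (top_of_set ({0..1} \<times> cball 0 1)) Z hc"
      by (simp add: hc_def o_def case_prod_unfold)
    have "continuous_map (prod_topology (top_of_set ({0..1} \<times> {0..1})) (top_of_set (sphere 0 1))) (prod_topology (top_of_set ({0..1} \<times> {0..1})) (LT U R {})) (\<lambda>(s,p). (s, charF ph p))"
      unfolding continuous_map_prod_top using continuous_charF_sphere[OF wf f wf0] by auto
    from continuous_map_compose[OF this contG1]
    have b: "continuous_map (top_of_set (({0..1} \<times> {0..1}) \<times> sphere 0 1)) Z b"
      by (simp add: b_def o_def case_prod_unfold)
    have bd: "\<exists>a\<in>R. \<exists>t\<in>{0..1}. charF ph p = charE a t" if "norm p = 1" for p
    proof -
      define s where "s = 2 * Arg2pi p / pi"
      define j where "j = nat \<lfloor>s\<rfloor> mod 4"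
      have "bd ph ! j \<in> set (bd ph)" by (rule nth_mem) (simp add: j_def)
      then have "fst (bd ph ! j) \<in> R" using wf f unfolding wf_cx_def by blast
      moreover have "charF ph p = charE (fst (bd ph ! j)) (if snd (bd ph ! j) then s - of_int \<lfloor>s\<rfloor> else 1 - (s - of_int \<lfloor>s\<rfloor>))"
        using that by (simp add: charF_def bdpt_def Let_def case_prod_unfold s_def j_def)
      moreover have "s - of_int \<lfloor>s\<rfloor> \<in> {0..1}" by (simp add: floor_le_iff) linarith
      ultimately show ?thesis by (intro bexI) auto
    qed
    have G1h: "G1 ((s,u), charF ph p) = h (s, charF ph p)" if p: "norm p = 1" and su: "s \<in> {0..1}" "u \<in> {0..1}" "u = 0 \<or> s \<in> {0,1}" for s u p
    proof -
      obtain a t where at: "a \<in> R" "t \<in> {0..1}" "charF ph p = charE a t" using bd[OF p] by blast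
      then have "G1 ((s,u), charF ph p) = Ge a ((s,u), 2 * t - 1)" using G1e su by auto
      also have "\<dots> = h (s, charE a t)"
      proof -
        have t: "2 * t - 1 \<in> cball 0 1" using at(2) by (simp add: dist_real_def abs_le_iff)
        show ?thesis using su(3) Ge(2)[OF at(1) su(1) t] Ge(3)[OF at(1) _ su(2) t] by auto
      qed
      finally show ?thesis by (simp only: at(3))
    qed
    obtain G where G: "continuous_map (top_of_set (({0..1} \<times> {0..1}) \<times> cball 0 1)) Z G"
      "!!s p. s \<in> {0..1} ==> norm p <= 1 ==> G ((s,0),p) = hc (s,p)"
      "!!s u p. u \<in> {0..1} ==> norm p <= 1 ==> s \<in> {0,1} ==> G ((s,u),p) = hc (s,p)"
      "!!s u p. s \<in> {0..1} ==> u \<in> {0..1} ==> norm p = 1 ==> G ((s,u),p) = b ((s,u),p)"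
    proof (rule cell_homotopy_extension[OF hc b])
      show "b ((s, 0), p) = hc (s, p)" if "s \<in> {0..1}" "norm p = 1" for s p
        using that G1h[of p s 0] by (simp add: b_def hc_def)
      show "b ((s, u), p) = hc (s, p)" if "u \<in> {0..1}" "norm p = 1" "s \<in> {0,1}" for u p s
        using that G1h[of p s u] by (auto simp: b_def hc_def)
    qed blast
    show ?thesis
      by (intro exI[of _ G] conjI ballI) (simp_all add: G(1) G(2) G(3) G(4) hc_def b_def del: insert_iff)
  qed
  then have "\<exists>Gf. \<forall>ph\<in>Ph. ?PF ph (Gf ph)" by (intro bchoice ballI)
  then obtain Gf where Gf0: "\<forall>ph\<in>Ph. ?PF ph (Gf ph)" by (elim exE)
  have Gf: "!!ph. ph \<in> Ph ==> continuous_map (top_of_set (({0..1} \<times> {0..1}) \<times> cball 0 1)) Z (Gf ph)"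
    "!!ph s p. ph \<in> Ph ==> s\<in>{0..1} ==> p\<in>cball 0 1 ==> Gf ph ((s,0),p) = h (s, charF ph p)"
    "!!ph s u p. ph \<in> Ph ==> s\<in>{0,1} ==> u\<in>{0..1} ==> p\<in>cball 0 1 ==> Gf ph ((s,u),p) = h (s, charF ph p)"
    "!!ph s u p. ph \<in> Ph ==> s\<in>{0..1} ==> u\<in>{0..1} ==> p\<in>sphere 0 1 ==> Gf ph ((s,u),p) = G1 ((s,u), charF ph p)"
    subgoal using Gf0 by (elim ballE) auto
    subgoal using Gf0 by (elim ballE) auto
    subgoal using Gf0 by (elim ballE conjE) blast+
    subgoal using Gf0 by (elim ballE) auto
    done
  define G where "G = (\<lambda>(y,q). case q of LF ph p => Gf ph (y, p) | _ => G1 (y,q))"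
  have Ge': "G (y, charE a t) = G1 (y, charE a t)" for y a t by (auto simp: G_def charE_def)
  have Gf': "G (y, charF ph p) = Gf ph (y, p)" if "ph \<in> Ph" "p \<in> cball 0 1" "y \<in> {0..1} \<times> {0..1}" for y ph p
  proof (cases "norm p < 1")
    case True then show ?thesis by (simp add: G_def charF_def)
  next
    case False
    then have "norm p = 1" using that by simp
    then have "Gf ph (y,p) = G1 (y, charF ph p)" using Gf(4)[of ph "fst y" "snd y" p] that by auto
    moreover have "G (y, charF ph p) = G1 (y, charF ph p)"
      using False by (simp add: charF_def bdpt_def Let_def case_prod_unfold Ge')
    ultimately show ?thesis by simp
  qed
  have "continuous_map (prod_topology (top_of_set ({0..1} \<times> {0..1})) (LT U R Ph)) Z G"
  proof (rule continuous_map_prod_LT[OF wf lc_H_interval(3,4)])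
    show "continuous_map (prod_topology (top_of_set ({0..1} \<times> {0..1})) (top_of_set {0..1})) Z (\<lambda>(y, t). G (y, charE a t))" if "a \<in> R" for a
      by (rule continuous_map_eq[OF contE[OF that]]) (auto simp: Ge' G1e that)
    show "continuous_map (prod_topology (top_of_set ({0..1} \<times> {0..1})) (top_of_set (cball 0 1))) Z (\<lambda>(y, p). G (y, charF ph p))" if "ph \<in> Ph" for ph
      unfolding prod_topology_subtopology_eu
      by (rule continuous_map_eq[OF Gf(1)[OF that]]) (auto simp: Gf' that)
  qed (use k in \<open>auto simp: G_def G1_def\<close>)
  moreover have "G ((s,u),q) = h (s,q)" if q: "q \<in> lpts U R Ph" and su: "s \<in> {0..1}" "u \<in> {0..1}" "u = 0 \<or> s \<in> {0,1}" for s u q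
  proof (cases q)
    case (LV v) then show ?thesis using q su k0 ke by (auto simp: G_def G1_def)
  next
    case (LE a t)
    then have at: "a \<in> R" "t \<in> {0..1}" "q = charE a t" using q by (auto simp: charE_def)
    have t: "2 * t - 1 \<in> cball 0 1" using at(2) by (simp add: dist_real_def abs_le_iff)
    have "G ((s,u),q) = Ge a ((s,u), 2 * t - 1)" using at su by (simp add: Ge' G1e)
    then show ?thesis using su Ge(2)[OF at(1) su(1) t] Ge(3)[OF at(1) _ su(2) t] at(3) by auto
  next
    case (LF ph p)
    then have f: "ph \<in> Ph" "p \<in> cball 0 1" "q = charF ph p" using q by (auto simp: charF_def)
    have "G ((s,u),q) = Gf ph ((s,u),p)" using Gf'[OF f(1,2), of "(s,u)"] su f(3) by simp
    then show ?thesis using su(3) Gf(2)[OF f(1) su(1) f(2)] Gf(3)[OF f(1) _ su(2) f(2)] f(3) by auto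
  qed
  moreover have "G ((s,u),LV v) = k v (s,u)" for s u v by (simp add: G_def G1_def)
  ultimately show thesis by (intro that[of G]) auto
qed

section \<open>Null homotopies\<close>

abbreviation I01 :: "real topology" where "I01 \<equiv> top_of_set {0..1}"

text \<open>The homotopy is free: vertices over the base point may run through loops.\<close>

definition nullhtpy where
  "nullhtpy Z r b U R Ph h \<longleftrightarrow> continuous_map (prod_topology I01 (LT U R Ph)) Z h \<and>
     (\<forall>q\<in>lpts U R Ph. h (0,q) = r q \<and> h (1,q) = b)"

lemma continuous_map_pair_LT:
  assumes "continuous_map (prod_topology (top_of_set A) X) Z h"
    and "continuous_on S g1" "g1 ` S \<subseteq> A" "continuous_map (top_of_set S) X g2"
  shows "continuous_map (top_of_set S) Z (\<lambda>x. h (g1 x, g2 x))"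
proof -
  have "continuous_map (top_of_set S) (top_of_set A) g1"
    using assms by (auto simp: continuous_map_in_subtopology)
  from continuous_map_compose[OF continuous_map_pairedI[OF this assms(4)] assms(1)]
  show ?thesis by (simp add: o_def)
qed

lemma nullhtpy_based:
  assumes wf: "wf_cx U R Ph" and r: "!!u. u \<in> U ==> r (LV u) = b" and v: "v \<in> U"
    and h: "nullhtpy Z r b U R Ph h"
  obtains h' where "nullhtpy Z r b U R Ph h'" "!!s. s \<in> {0..1} ==> h' (s, LV v) = b"
proof -
  note hc = h[unfolded nullhtpy_def, THEN conjunct1]
  have h0: "h (0,q) = r q" "h (1,q) = b" if "q \<in> lpts U R Ph" for q using h that by (auto simp: nullhtpy_def)
  have vc: "continuous_map (top_of_set S) (LT U R Ph) (\<lambda>_. LV u)" if "u \<in> U" for S :: "'x::topological_space set" and u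
    using that topspace_LT[OF wf] by simp
  define h2 where "h2 = (\<lambda>(s,q). if s <= 1/2 then h (2 * s, q) else h (2 - 2 * s, LV v))"
  have h2c: "continuous_map (prod_topology I01 (LT U R Ph)) Z h2"
    unfolding h2_def case_prod_unfold
  proof (rule continuous_map_cases_le)
    let ?X = "prod_topology I01 (LT U R Ph)"
    have sf: "continuous_map ?X euclideanreal fst"
      by (rule continuous_map_into_fulltopology[OF continuous_map_fst])
    then show "continuous_map ?X euclideanreal fst" .
    have s: "continuous_map (subtopology ?X S) euclideanreal fst" for S
      by (rule continuous_map_from_subtopology[OF sf])
    have "continuous_map (subtopology ?X {x \<in> topspace ?X. fst x <= 1/2}) ?X (\<lambda>x. (2 * fst x, snd x))"
    proof (intro continuous_map_pairedI)
      show "continuous_map (subtopology ?X {x \<in> topspace ?X. fst x <= 1/2}) I01 (\<lambda>x. 2 * fst x)"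
        unfolding continuous_map_in_subtopology using s by (auto intro!: continuous_intros)
    qed (auto intro: continuous_map_from_subtopology continuous_map_snd)
    from continuous_map_compose[OF this hc]
    show "continuous_map (subtopology ?X {x \<in> topspace ?X. fst x <= 1/2}) Z (\<lambda>x. h (2 * fst x, snd x))" by (simp add: o_def)
    have "continuous_map (subtopology ?X {x \<in> topspace ?X. 1/2 <= fst x}) ?X (\<lambda>x. (2 - 2 * fst x, LV v))"
    proof (intro continuous_map_pairedI)
      show "continuous_map (subtopology ?X {x \<in> topspace ?X. 1/2 <= fst x}) I01 (\<lambda>x. 2 - 2 * fst x)"
        unfolding continuous_map_in_subtopology using s by (auto intro!: continuous_intros)
    qed (use v topspace_LT[OF wf] in auto)
    from continuous_map_compose[OF this hc]
    show "continuous_map (subtopology ?X {x \<in> topspace ?X. 1/2 <= fst x}) Z (\<lambda>x. h (2 - 2 * fst x, LV v))" by (simp add: o_def)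
    show "h (2 * fst x, snd x) = h (2 - 2 * fst x, LV v)" if "x \<in> topspace ?X" "fst x = 1/2" for x
    proof -
      have "2 * fst x = 1" "2 - 2 * fst x = 1" using that(2) by auto
      then show ?thesis using that(1) v h0(2) topspace_LT[OF wf] by auto
    qed
  qed auto
  \<comment> \<open>\<open>min (2 * s) (2 - 2 * s)\<close> runs out and back along the track, the
    factor \<open>1 - t\<close> shortens the excursion; all other vertices keep their
    tracks.\<close>
  define k where "k u = (\<lambda>(s,t). if u = v then h ((1-t) * min (2 * s) (2 - 2 * s), LV v) else h2 (s, LV u))" for u
  have kc: "continuous_map (top_of_set ({0..1} \<times> {0..1})) Z (k u)" if "u \<in> U" for u
  proof (cases "u = v")
    case True
    have "(1-t) * min (2 * s) (2 - 2 * s) \<in> {0..1}" if "s \<in> {0..1}" "t \<in> {0..1}" for s t :: real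
    proof -
      have "0 <= min (2 * s) (2 - 2 * s)" "min (2 * s) (2 - 2 * s) <= 1" "0 <= 1 - t" "1 - t <= 1" using that by auto
      then show ?thesis using mult_le_one[of "1-t" "min (2 * s) (2 - 2 * s)"] by (auto intro!: mult_nonneg_nonneg)
    qed
    then show ?thesis unfolding k_def case_prod_unfold using True
      by (simp only: simp_thms if_True) (rule continuous_map_pair_LT[OF hc _ _ vc[OF v]], auto intro!: continuous_intros)
  next
    case False
    then show ?thesis unfolding k_def case_prod_unfold
      by (simp only: simp_thms if_False) (rule continuous_map_pair_LT[OF h2c _ _ vc[OF that]], auto intro!: continuous_intros)
  qed
  obtain G where G: "continuous_map (prod_topology (top_of_set ({0..1} \<times> {0..1})) (LT U R Ph)) Z G"
    "!!s q. s \<in> {0..1} ==> q \<in> lpts U R Ph ==> G ((s,0),q) = h2 (s,q)"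
    "!!s u q. s \<in> {0,1} ==> u \<in> {0..1} ==> q \<in> lpts U R Ph ==> G ((s,u),q) = h2 (s,q)"
    "!!s u v. G ((s,u),LV v) = k v (s,u)"
  proof (rule complex_homotopy_extension[OF wf h2c kc])
    show "k u (s, 0) = h2 (s, LV u)" if "u \<in> U" "s \<in> {0..1}" for u s
      using that by (auto simp: k_def h2_def min_def)
    show "k u (s, t) = h2 (s, LV u)" if "u \<in> U" "t \<in> {0..1}" "s \<in> {0,1}" for u s t
      using that by (auto simp: k_def h2_def)
  qed auto
  have "continuous_map (prod_topology I01 (LT U R Ph)) (prod_topology (top_of_set ({0..1} \<times> {0..1})) (LT U R Ph)) (\<lambda>(s,q). ((s,1::real),q))"
    unfolding continuous_map_prod_top by (auto simp: continuous_map_in_subtopology intro!: continuous_intros)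
  from continuous_map_compose[OF this G(1)]
  have "continuous_map (prod_topology I01 (LT U R Ph)) Z (\<lambda>x. G ((fst x,1), snd x))" by (simp add: o_def case_prod_unfold)
  moreover have "h2 (0,q) = r q" "h2 (1,q) = b" if "q \<in> lpts U R Ph" for q
    using h0[OF that] h0[of "LV v"] v r by (auto simp: h2_def)
  ultimately have "nullhtpy Z r b U R Ph (\<lambda>x. G ((fst x,1), snd x))"
    unfolding nullhtpy_def using G(3)[of 0 1] G(3)[of 1 1] by auto
  moreover have "G ((s,1), LV v) = b" for s using G(4) h0(1)[of "LV v"] v r by (auto simp: k_def)
  ultimately show thesis using that[of "\<lambda>x. G ((fst x,1), snd x)"] by auto
qed

text \<open>Both null homotopies are first made stationary at the common vertex, after which they
  agree on the intersection.\<close>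

lemma nullhtpy_wedge:
  assumes wf: "wf_cx U1 R1 Ph1" "wf_cx U2 R2 Ph2" and int: "U1 \<inter> U2 = {v}" "R1 \<inter> R2 = {}" "Ph1 \<inter> Ph2 = {}"
    and r: "!!u. u \<in> U1 \<union> U2 ==> r (LV u) = b"
    and h1: "nullhtpy Z r b U1 R1 Ph1 h1" and h2: "nullhtpy Z r b U2 R2 Ph2 h2"
  shows "\<exists>h. nullhtpy Z r b (U1 \<union> U2) (R1 \<union> R2) (Ph1 \<union> Ph2) h"
proof -
  have v: "v \<in> U1" "v \<in> U2" using int by auto
  obtain g1 where g1: "nullhtpy Z r b U1 R1 Ph1 g1" "!!s. s \<in> {0..1} ==> g1 (s, LV v) = b"
    using nullhtpy_based[OF wf(1) _ v(1) h1] r by auto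
  obtain g2 where g2: "nullhtpy Z r b U2 R2 Ph2 g2" "!!s. s \<in> {0..1} ==> g2 (s, LV v) = b"
    using nullhtpy_based[OF wf(2) _ v(2) h2] r by auto
  define P1 where "P1 = lpts U1 R1 Ph1"
  define P2 where "P2 = lpts U2 R2 Ph2"
  have P: "q = LV v" if "q \<in> P1" "q \<in> P2" for q
    using that int unfolding P1_def P2_def by (cases q) auto
  define h where "h = (\<lambda>(s,q). if q \<in> P1 then g1 (s,q) else g2 (s,q))"
  have h2: "h (s,q) = g2 (s,q)" if "q \<in> P2" "s \<in> {0..1}" for s q
    using P[OF _ that(1)] g1(2)[OF that(2)] g2(2)[OF that(2)] by (auto simp: h_def)
  have h1: "h (s,q) = g1 (s,q)" if "q \<in> P1" for s q using that by (simp add: h_def)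
  have wf12: "wf_cx (U1 \<union> U2) (R1 \<union> R2) (Ph1 \<union> Ph2)" using wf unfolding wf_cx_def by blast
  note c1 = g1(1)[unfolded nullhtpy_def, THEN conjunct1] and c2 = g2(1)[unfolded nullhtpy_def, THEN conjunct1]
  have "continuous_map (prod_topology I01 (LT (U1 \<union> U2) (R1 \<union> R2) (Ph1 \<union> Ph2))) Z h"
  proof (rule continuous_map_prod_LT[OF wf12 lc_H_interval(1,2)])
    have cc: "continuous_map I01 Z (\<lambda>s. g (s, q))" if "continuous_map (prod_topology I01 X) Z g" "q \<in> topspace X" for X g q
      using that by (intro continuous_map_pair_LT[OF that(1)]) auto
    have cp: "continuous_map (prod_topology I01 (top_of_set S)) Z (\<lambda>(s,t). g (s, c t))"
      if "continuous_map (prod_topology I01 X) Z g" "continuous_map (top_of_set S) X c" for X g c and S :: "'x::topological_space set"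
    proof -
      have "continuous_map (prod_topology I01 (top_of_set S)) (prod_topology I01 X) (\<lambda>(s,t). (s, c t))"
        unfolding continuous_map_prod_top using that by auto
      from continuous_map_compose[OF this that(1)] show ?thesis by (simp add: o_def case_prod_unfold)
    qed
    show "continuous_map I01 Z (\<lambda>s. h (s, LV u))" if "u \<in> U1 \<union> U2" for u
    proof (cases "u \<in> U1")
      case True
      then have "LV u \<in> P1" by (simp add: P1_def)
      then show ?thesis using cc[OF c1, of "LV u"] True by (simp add: h1 topspace_LT[OF wf(1)])
    next
      case False
      then have "LV u \<in> P2" using that by (simp add: P2_def)
      then show ?thesis using cc[OF c2, of "LV u"] False that
        by (intro continuous_map_eq[OF cc[OF c2, of "LV u"]]) (simp_all add: h2 topspace_LT[OF wf(2)])
    qed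
    show "continuous_map (prod_topology I01 (top_of_set {0..1})) Z (\<lambda>(s, t). h (s, charE a t))" if "a \<in> R1 \<union> R2" for a
    proof (cases "a \<in> R1")
      case True
      show ?thesis using cp[OF c1 continuous_charE[OF wf(1) True]] charE_in[OF wf(1) True]
        by (simp add: h1 P1_def)
    next
      case False
      then have a: "a \<in> R2" using that by blast
      show ?thesis
        by (rule continuous_map_eq[OF cp[OF c2 continuous_charE[OF wf(2) a]]])
          (use charE_in[OF wf(2) a] in \<open>auto simp: h2 P2_def\<close>)
    qed
    show "continuous_map (prod_topology I01 (top_of_set (cball 0 1))) Z (\<lambda>(s, t). h (s, charF a t))" if "a \<in> Ph1 \<union> Ph2" for a
    proof (cases "a \<in> Ph1")
      case True
      show ?thesis using cp[OF c1 continuous_charF[OF wf(1) True]] charF_in[OF wf(1) True]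
        by (simp add: h1 P1_def)
    next
      case False
      then have a: "a \<in> Ph2" using that by blast
      show ?thesis
        by (rule continuous_map_eq[OF cp[OF c2 continuous_charF[OF wf(2) a]]])
          (use charF_in[OF wf(2) a] in \<open>auto simp: h2 P2_def\<close>)
    qed
  qed
  moreover have "q \<in> P1 \<or> q \<in> P2" if "q \<in> lpts (U1 \<union> U2) (R1 \<union> R2) (Ph1 \<union> Ph2)" for q
    using that unfolding P1_def P2_def by (cases q) auto
  ultimately show ?thesis
    using g1(1) g2(1) h1 h2 unfolding nullhtpy_def P1_def[symmetric] P2_def[symmetric]
    by (intro exI[of _ h]) fastforce
qed

section \<open>Reparametrizations of the disc\<close>

definition ang :: "complex => real" where "ang p = 2 * Arg2pi p / pi"
definition e4 :: "real => complex" where "e4 t = cis (pi * t / 2)"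

lemma ang_e4: assumes "0 < r" "0 <= t" "t < 4" shows "ang (of_real r * e4 t) = t"
proof -
  have "pi * t / 2 < 2 * pi" "0 <= pi * t / 2" using assms by auto
  then have "Arg2pi (of_real r * e4 t) = pi * t / 2"
    using assms by (intro Arg2pi_unique[of r]) (auto simp: cis_conv_exp e4_def mult.commute)
  then show ?thesis by (simp add: ang_def field_simps)
qed

lemma e4_4 [simp]: "e4 4 = 1" "e4 0 = 1" "norm (e4 t) = 1"
proof -
  have "e4 4 = cis (2 * pi)" unfolding e4_def by (rule arg_cong[of _ _ cis]) simp
  then show "e4 4 = 1" by (simp only: cis_2pi)
qed (simp_all add: e4_def)

text \<open>A formula in radius and angle defines a function of the point once it ignores the angle
  at radius 0 and agrees at the angles 0 and 4.\<close>

lemma polar_eq: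
  assumes "!!t. t \<in> {0..4} ==> F 0 t = F 0 0" "!!r. F r 0 = F r 4" "r \<in> {0..1}" "t \<in> {0..4}"
  shows "F (norm (of_real r * e4 t)) (ang (of_real r * e4 t)) = F r t"
proof -
  have a0: "ang 0 = 0" by (simp add: ang_def Arg2pi_def)
  have a1: "ang (of_real r) = 0" if "r > 0" using ang_e4[of r 0] that by simp
  consider "r = 0" | "r > 0" "t = 4" | "r > 0" "t < 4" using assms(3,4) by fastforce
  then show ?thesis
  proof cases
    case 1 then show ?thesis using assms(1)[OF assms(4)] a0 by simp
  next
    case 2 then show ?thesis using assms(2) a1 by simp
  next
    case 3 then show ?thesis using assms ang_e4[of r t] by (simp add: norm_mult)
  qed
qed

text \<open>On the circle, \<open>Qm u\<close> makes a full turn while the angle runs up to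
  \<open>2 * (1 + u)\<close> and then rests at 1; \<open>Qm 1\<close> is the identity.\<close>

definition Qm :: "real => complex => complex" where
  "Qm u p = of_real (norm p) * e4 (min (2 * ang p / (1 + u)) 4)"
text \<open>On the circle \<open>Mm\<close> runs from 0 to 4 and back to 0. The factor
  \<open>norm p\<close> extends it over the disc, so a path composed with \<open>Mm\<close> fills
  the loop that follows the path and returns.\<close>

definition Mm :: "complex => real" where
  "Mm p = norm p * min (2 * ang p) (8 - 2 * ang p)"

lemma Qm_polar: "u \<in> {0..1} ==> r \<in> {0..1} ==> t \<in> {0..4} ==> Qm u (of_real r * e4 t) = of_real r * e4 (min (2 * t / (1 + u)) 4)"
  unfolding Qm_def by (rule polar_eq[of "\<lambda>r t. of_real r * e4 (min (2 * t / (1 + u)) 4)"]) (auto simp: min_def field_simps)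

lemma Mm_polar: "r \<in> {0..1} ==> t \<in> {0..4} ==> Mm (of_real r * e4 t) = r * min (2 * t) (8 - 2 * t)"
  unfolding Mm_def by (rule polar_eq[of "\<lambda>r t. r * min (2 * t) (8 - 2 * t)"]) auto

lemma continuous_on_prod_disc:
  assumes "continuous_on (Y \<times> ({0..1} \<times> {0..4})) (\<lambda>x. g (fst x, of_real (fst (snd x)) * e4 (snd (snd x))))" "compact Y"
  shows "continuous_on (Y \<times> cball 0 1) (g :: 'a::metric_space \<times> complex => 'b::topological_space)"
proof -
  have "continuous_map (prod_topology (top_of_set Y) (top_of_set (cball 0 1))) euclidean g"
  proof (rule continuous_map_prod_disc)
    show "locally_compact_space (top_of_set Y)" "Hausdorff_space (top_of_set Y)"
      using assms(2) by (auto intro!: compact_imp_locally_compact_space Hausdorff_space_subtopology simp: compact_space_subtopology)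
  qed (use assms(1) in \<open>simp add: case_prod_unfold e4_def\<close>)
  then show ?thesis by simp
qed

lemma continuous_e4: "continuous_on S f ==> continuous_on S (\<lambda>x. e4 (f x))"
  unfolding e4_def by (auto intro!: continuous_intros)

lemma continuous_Qm: "continuous_on ({0..1} \<times> cball 0 1) (\<lambda>x. Qm (fst x) (snd x))"
proof (rule continuous_on_prod_disc)
  have "continuous_on ({0..1} \<times> {0..1} \<times> {0..4}) (\<lambda>x. of_real (fst (snd x)) * e4 (min (2 * snd (snd x) / (1 + fst x)) 4))"
    by (intro continuous_intros continuous_e4) (auto simp: field_simps)
  then show "continuous_on ({0..1} \<times> {0..1} \<times> {0..4}) (\<lambda>x. Qm (fst (fst x, of_real (fst (snd x)) * e4 (snd (snd x)))) (snd (fst x, of_real (fst (snd x)) * e4 (snd (snd x)))))"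
    by (rule continuous_on_eq) (auto simp: Qm_polar)
qed auto

lemma continuous_Mm: "continuous_on (cball 0 1) Mm"
proof -
  have "continuous_on ({0::real} \<times> cball 0 1) (\<lambda>x. Mm (snd x))"
  proof (rule continuous_on_prod_disc)
    have "continuous_on ({0::real} \<times> {0..1} \<times> {0..4::real}) (\<lambda>x. fst (snd x) * min (2 * snd (snd x)) (8 - 2 * snd (snd x)))"
      by (intro continuous_intros)
    then show "continuous_on ({0::real} \<times> {0..1} \<times> {0..4}) (\<lambda>x. Mm (snd (fst x, of_real (fst (snd x)) * e4 (snd (snd x)))))"
      by (rule continuous_on_eq) (auto simp: Mm_polar)
  qed auto
  then have "continuous_on (cball 0 1) ((\<lambda>x. Mm (snd x)) \<circ> (\<lambda>p. (0::real,p)))"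
    by (intro continuous_on_compose) (auto intro!: continuous_intros elim: continuous_on_subset)
  then show ?thesis by (simp add: o_def)
qed

lemma Qm_props:
  "norm p <= 1 ==> norm (Qm u p) <= 1" "norm p <= 1 ==> Qm 1 p = p"
  "t \<in> {0..4} ==> u \<in> {0..1} ==> Qm u (e4 t) = e4 (min (2 * t / (1 + u)) 4)"
  using Qm_polar[of u 1 t]
proof -
  show "norm (Qm u p) <= 1" if "norm p <= 1" using that by (simp add: Qm_def norm_mult)
  show "Qm 1 p = p"
  proof -
    have "p = of_real (norm p) * e4 (ang p)"
      using Arg2pi[of p] by (simp add: e4_def ang_def is_Arg_def cis_conv_exp mult.commute)
    moreover have "min (2 * ang p / (1 + 1)) 4 = ang p"
      using Arg2pi[of p] by (simp add: ang_def field_simps)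
    ultimately show ?thesis by (simp add: Qm_def)
  qed
qed (use Qm_polar[of u 1 t] in simp)

lemma Mm_props: "t \<in> {0..4} ==> Mm (e4 t) = min (2 * t) (8 - 2 * t)" "norm p <= 1 ==> Mm p \<in> {0..4}"
proof -
  show "t \<in> {0..4} ==> Mm (e4 t) = min (2 * t) (8 - 2 * t)" using Mm_polar[of 1 t] by simp
  show "Mm p \<in> {0..4}" if "norm p <= 1"
  proof -
    define x where "x = min (2 * ang p) (8 - 2 * ang p)"
    have "0 <= x" "x <= 4" using Arg2pi[of p] by (auto simp: x_def ang_def min_def field_simps)
    moreover have "norm p * x <= 1 * x" using that calculation by (intro mult_right_mono) auto
    ultimately show ?thesis by (auto simp: Mm_def x_def[symmetric])
  qed
qed

text \<open>Here \<beta> is the boundary of the removed face, opened at the split vertex into a path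
  from \<open>p0\<close> to \<open>p1\<close>, and \<open>f\<close> is the map on that face. With
  \<open>p0\<close> kept still, the track of \<open>p1\<close> is a loop, and it contracts because
  the homotopy sweeps it to the image of \<beta>, which \<open>f\<close> fills. So the null homotopy
  can be made stationary at both ends; it then remains to extend it over the disc.\<close>

lemma detach_core:
  fixes \<beta> :: "real => ('u,'v) lpt"
  assumes wf: "wf_cx U R Ph" and p: "p0 \<in> U" "p1 \<in> U" "p0 ~= p1" and r: "!!u. u \<in> U ==> r (LV u) = b"
    and h: "nullhtpy Z r b U R Ph h" and f: "continuous_map (top_of_set (cball 0 1)) Z f"
    and \<beta>: "continuous_map (top_of_set {0..4}) (LT U R Ph) \<beta>" "\<beta> 0 = LV p0" "\<beta> 4 = LV p1"
    and f\<beta>: "!!t. t \<in> {0..4} ==> f (e4 t) = r (\<beta> t)"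
  obtains h' hf where "nullhtpy Z r b U R Ph h'" "!!s. s \<in> {0..1} ==> h' (s, LV p0) = b" "!!s. s \<in> {0..1} ==> h' (s, LV p1) = b"
    "continuous_map (top_of_set ({0..1} \<times> cball 0 1)) Z hf" "!!p. norm p <= 1 ==> hf (0,p) = f p" "!!p. norm p <= 1 ==> hf (1,p) = b"
    "!!s t. s \<in> {0..1} ==> t \<in> {0..4} ==> hf (s, e4 t) = h' (s, \<beta> t)"
proof -
  obtain ho where ho: "nullhtpy Z r b U R Ph ho" "!!s. s \<in> {0..1} ==> ho (s, LV p0) = b"
    using nullhtpy_based[OF wf r p(1) h] by blast
  note hoc = ho(1)[unfolded nullhtpy_def, THEN conjunct1]
  have ho01: "ho (0,q) = r q" "ho (1,q) = b" if "q \<in> lpts U R Ph" for q using ho that by (auto simp: nullhtpy_def)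
  have \<beta>in: "\<beta> t \<in> lpts U R Ph" if "t \<in> {0..4}" for t
    using \<beta>(1) that topspace_LT[OF wf] by (auto simp: continuous_map_def)
  have f1: "f 1 = b" using f\<beta>[of 0] \<beta>(2) r p by simp
  have convex: "of_real (1 - x) * y + of_real x * z \<in> cball 0 1" if "x \<in> {0..1}" "norm y <= 1" "norm z <= 1" for x and y z :: complex
    using that convexD_alt[OF convex_cball[of "0::complex" 1], of y z x] by (simp add: scaleR_conv_of_real)
  \<comment> \<open>\<open>H\<close> rests during the first half of the time, which leaves room for
    the part of \<open>K\<close> that moves inside the disc.\<close>
  define H where "H = (\<lambda>(s,q). ho (max 0 (2 * s - 1), q))"
  have delay: "continuous_map (prod_topology I01 (LT U R Ph)) Z (\<lambda>(s,q). g (max 0 (2 * s - 1), q))"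
    if "continuous_map (prod_topology I01 (LT U R Ph)) Z g" for g
  proof -
    have "continuous_map (prod_topology I01 (LT U R Ph)) (prod_topology I01 (LT U R Ph)) (\<lambda>(s,q). (max 0 (2 * s - 1), q))"
      unfolding continuous_map_prod_top by (auto simp: continuous_map_in_subtopology intro!: continuous_intros)
    from continuous_map_compose[OF this that] show ?thesis by (simp add: o_def case_prod_unfold)
  qed
  have Hc: "continuous_map (prod_topology I01 (LT U R Ph)) Z H" unfolding H_def using delay[OF hoc] .
  have H01: "H (s,q) = (if s <= 1/2 then r q else ho (2 * s - 1, q))" if "q \<in> lpts U R Ph" for s q
  proof (cases "s = 1/2")
    case True then show ?thesis using ho01[OF that] by (simp add: H_def)
  qed (use ho01[OF that] in \<open>auto simp: H_def max_def\<close>)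
  \<comment> \<open>\<open>K\<close> contracts the delayed track of \<open>p1\<close>: at stage
    \<open>u\<close> it goes inside the disc straight from 1 to the boundary point with
    \<beta>-parameter \<open>4 * (1 - u)\<close> and then follows that point under
    \<open>ho\<close>. For \<open>u = 1\<close> this is the resting point \<open>p0\<close>.\<close>
  define K where "K = (\<lambda>(s,u). if s <= 1/2 then f (of_real (1 - 2 * s) * 1 + of_real (2 * s) * e4 (4 * (1 - u))) else ho (2 * s - 1, \<beta> (4 * (1 - u))))"
  have Kc: "continuous_map (top_of_set ({0..1} \<times> {0..1})) Z K"
    unfolding K_def case_prod_unfold
  proof (rule continuous_map_top_of_set_cases)
    show "continuous_map (top_of_set {x \<in> {0..1} \<times> {0..1}. fst x <= 1/2}) Z
        (\<lambda>p. f (of_real (1 - 2 * fst p) * 1 + of_real (2 * fst p) * e4 (4 * (1 - snd p))))"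
    proof (rule continuous_map_top_of_set_compose[OF f])
      show "(\<lambda>p. of_real (1 - 2 * fst p) * 1 + of_real (2 * fst p) * e4 (4 * (1 - snd p))) ` {x \<in> {0..1} \<times> {0..1}. fst x <= 1/2} \<subseteq> cball 0 1"
        by (intro image_subsetI convex) auto
    qed (intro continuous_intros continuous_e4)
    show "continuous_map (top_of_set {x \<in> {0..1} \<times> {0..1}. 1/2 <= fst x}) Z (\<lambda>p. ho (2 * fst p - 1, \<beta> (4 * (1 - snd p))))"
      by (rule continuous_map_pair_LT[OF hoc]) (auto intro!: continuous_intros continuous_map_top_of_set_compose[OF \<beta>(1)])
    show "f (of_real (1 - 2 * fst x) * 1 + of_real (2 * fst x) * e4 (4 * (1 - snd x))) = ho (2 * fst x - 1, \<beta> (4 * (1 - snd x)))"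
      if "x \<in> {0..1} \<times> {0..1}" "fst x = 1/2" for x
    proof -
      have "x = (1/2, snd x)" using that(2) by (metis prod.collapse)
      then obtain y where "x = (1/2, y)" by blast
      then show ?thesis using that(1) by (auto simp: f\<beta> ho01 \<beta>in)
    qed
  qed (auto intro!: continuous_intros)
  define k where "k v = (\<lambda>(s,u). if v = p1 then K (s,u) else H (s, LV v))" for v
  have kc: "continuous_map (top_of_set ({0..1} \<times> {0..1})) Z (k v)" if "v \<in> U" for v
  proof (cases "v = p1")
    case True then show ?thesis using Kc by (simp add: k_def)
  next
    case False
    have "continuous_map (top_of_set ({0..1} \<times> {0..1::real})) Z (\<lambda>x. H (fst x, LV v))"
      using that topspace_LT[OF wf] by (intro continuous_map_pair_LT[OF Hc]) (auto intro!: continuous_intros)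
    then show ?thesis using False by (simp add: k_def case_prod_unfold)
  qed
  have K1: "K (s,0) = H (s, LV p1)" "u \<in> {0..1} ==> K (0,u) = b" "u \<in> {0..1} ==> K (1,u) = b" "s \<in> {0..1} ==> K (s,1) = b" for s u
    using H01[of "LV p1" s] p r f1 \<beta> ho01 \<beta>in ho(2)[of "2 * s - 1"] by (auto simp: K_def)
  obtain G where G: "continuous_map (prod_topology (top_of_set ({0..1} \<times> {0..1})) (LT U R Ph)) Z G"
    "!!s q. s \<in> {0..1} ==> q \<in> lpts U R Ph ==> G ((s,0),q) = H (s,q)"
    "!!s u q. s \<in> {0,1} ==> u \<in> {0..1} ==> q \<in> lpts U R Ph ==> G ((s,u),q) = H (s,q)"
    "!!s u v. G ((s,u),LV v) = k v (s,u)"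
  proof (rule complex_homotopy_extension[OF wf Hc kc])
    show "k v (s, 0) = H (s, LV v)" if "v \<in> U" "s \<in> {0..1}" for v s using K1(1) by (auto simp: k_def)
    show "k v (s, u) = H (s, LV v)" if "v \<in> U" "u \<in> {0..1}" "s \<in> {0,1}" for v s u
      using that K1 H01[of "LV v"] r p ho01[of "LV v"] by (auto simp: k_def)
  qed auto
  have Gp0: "G ((s,u), LV p0) = b" if "s \<in> {0..1}" for s u
    using that p r H01[of "LV p0" s] ho(2)[of "2 * s - 1"] G(4) by (auto simp: k_def)
  have Gp1: "G ((s,u), LV p1) = K (s,u)" for s u using G(4) by (simp add: k_def)
  \<comment> \<open>At stage \<open>u = 0\<close> the boundary loop is \<beta> followed by its
    reverse. It is filled by pulling \<beta> back along \<open>Mm\<close>; the first half of \<Xi>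
    moves \<open>Qm 0\<close> to that filling along segments of the disc.\<close>
  define \<Xi> where "\<Xi> = (\<lambda>(s,p). if s <= 1/2 then f (of_real (1 - 2 * s) * Qm 0 p + of_real (2 * s) * e4 (Mm p)) else ho (2 * s - 1, \<beta> (Mm p)))"
  define hc where "hc = (\<lambda>(s,p). if s <= 1/2 then f (Qm (1 - 2 * s) p) else \<Xi> (2 * s - 1, p))"
  \<comment> \<open>At stage \<open>u\<close> the loop is \<beta> deformed up to \<open>u\<close>,
    closed by the remaining part of the contraction \<open>K\<close> from \<open>u\<close> to 1. For
    \<open>u = 1\<close> only the deformed \<beta> is left, which is the boundary wanted in the
    end.\<close>
  define side where "side u t s = (if t <= 2 * (1 + u) then G ((s,u), \<beta> (2 * t / (1 + u))) else K (s, t / 2 - 1))" for u t s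
  define B where "B = (\<lambda>((s,u),p). if s <= 1/2 then f (Qm (max u (1 - 2 * s)) p) else side u (ang p) (2 * s - 1))"
  define B' where "B' = (\<lambda>((s,u),t). if s <= 1/2 then f (Qm (max u (1 - 2 * s)) (e4 t)) else side u t (2 * s - 1))"
  have cMm: "continuous_on S (\<lambda>x. Mm (g x))" if "continuous_on S g" "g ` S \<subseteq> cball 0 1" for S g
    by (rule continuous_on_compose2[OF continuous_Mm that])
  have cQm: "continuous_on S (\<lambda>x. Qm (g' x) (g x))" if "continuous_on S g" "g ` S \<subseteq> cball 0 1" "continuous_on S g'" "g' ` S \<subseteq> {0..1}" for S g g'
  proof -
    have "(\<lambda>x. (g' x, g x)) ` S \<subseteq> {0..1} \<times> cball 0 1" using that(2,4) by (auto simp: image_subset_iff)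
    from continuous_on_compose2[OF continuous_Qm continuous_on_Pair[OF that(3,1)] this] show ?thesis by simp
  qed
  have \<Xi>c: "continuous_map (top_of_set ({0..1} \<times> cball 0 1)) Z \<Xi>"
    unfolding \<Xi>_def case_prod_unfold
  proof (rule continuous_map_top_of_set_cases)
    show "continuous_map (top_of_set {x \<in> {0..1} \<times> cball 0 1. fst x <= 1/2}) Z
        (\<lambda>p. f (of_real (1 - 2 * fst p) * Qm 0 (snd p) + of_real (2 * fst p) * e4 (Mm (snd p))))"
    proof (rule continuous_map_top_of_set_compose[OF f])
      show "(\<lambda>p. of_real (1 - 2 * fst p) * Qm 0 (snd p) + of_real (2 * fst p) * e4 (Mm (snd p))) ` {x \<in> {0..1} \<times> cball 0 1. fst x <= 1/2} \<subseteq> cball 0 1"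
        by (intro image_subsetI convex) (auto intro!: Qm_props)
    qed (intro continuous_intros continuous_e4 cMm cQm; auto)
    show "continuous_map (top_of_set {x \<in> {0..1} \<times> cball 0 1. 1/2 <= fst x}) Z (\<lambda>p. ho (2 * fst p - 1, \<beta> (Mm (snd p))))"
      by (rule continuous_map_pair_LT[OF hoc])
        (use Mm_props(2) in \<open>auto intro!: continuous_intros continuous_map_top_of_set_compose[OF \<beta>(1)] cMm\<close>)
    show "f (of_real (1 - 2 * fst x) * Qm 0 (snd x) + of_real (2 * fst x) * e4 (Mm (snd x))) = ho (2 * fst x - 1, \<beta> (Mm (snd x)))"
      if "x \<in> {0..1} \<times> cball 0 1" "fst x = 1/2" for x
    proof -
      have "x = (1/2, snd x)" using that(2) by (metis prod.collapse)
      then obtain y where "x = (1/2, y)" by blast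
      then show ?thesis using that(1) Mm_props(2)[of y] by (auto simp: f\<beta> ho01 \<beta>in)
    qed
  qed (auto intro!: continuous_intros)
  have \<Xi>1: "\<Xi> (1,p) = b" "\<Xi> (0,p) = f (Qm 0 p)" if "norm p <= 1" for p
    using Mm_props(2)[OF that] by (auto simp: \<Xi>_def ho01 \<beta>in)
  have hcc: "continuous_map (top_of_set ({0..1} \<times> cball 0 1)) Z hc"
    unfolding hc_def case_prod_unfold
  proof (rule continuous_map_top_of_set_cases)
    show "continuous_map (top_of_set {x \<in> {0..1} \<times> cball 0 1. fst x <= 1/2}) Z (\<lambda>p. f (Qm (1 - 2 * fst p) (snd p)))"
      by (rule continuous_map_top_of_set_compose[OF f]) (auto intro!: continuous_intros cQm Qm_props)
    show "continuous_map (top_of_set {x \<in> {0..1} \<times> cball 0 1. 1/2 <= fst x}) Z (\<lambda>p. \<Xi> (2 * fst p - 1, snd p))"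
      by (rule continuous_map_top_of_set_compose[OF \<Xi>c]) (auto intro!: continuous_intros)
    show "f (Qm (1 - 2 * fst x) (snd x)) = \<Xi> (2 * fst x - 1, snd x)" if "x \<in> {0..1} \<times> cball 0 1" "fst x = 1/2" for x
    proof -
      have "x = (1/2, snd x)" using that(2) by (metis prod.collapse)
      then obtain y where "x = (1/2, y)" by blast
      then show ?thesis using that(1) by (auto simp: \<Xi>1)
    qed
  qed (auto intro!: continuous_intros)
  have B'c: "continuous_map (top_of_set (({0..1} \<times> {0..1}) \<times> {0..4})) Z B'"
    unfolding B'_def case_prod_unfold
  proof (rule continuous_map_top_of_set_cases)
    let ?S = "({0..1} \<times> {0..1}) \<times> {0..4} :: ((real \<times> real) \<times> real) set"
    show "continuous_map (top_of_set {x \<in> ?S. fst (fst x) <= 1/2}) Z (\<lambda>p. f (Qm (max (snd (fst p)) (1 - 2 * fst (fst p))) (e4 (snd p))))"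
      by (rule continuous_map_top_of_set_compose[OF f]) (auto intro!: continuous_intros cQm Qm_props continuous_e4)
    show "continuous_map (top_of_set {x \<in> ?S. 1/2 <= fst (fst x)}) Z (\<lambda>p. side (snd (fst p)) (snd p) (2 * fst (fst p) - 1))"
      unfolding side_def
    proof (rule continuous_map_top_of_set_cases)
      show "continuous_map (top_of_set {x \<in> {x \<in> ?S. 1/2 <= fst (fst x)}. snd x <= 2 * (1 + snd (fst x))}) Z
         (\<lambda>x. G ((2 * fst (fst x) - 1, snd (fst x)), \<beta> (2 * snd x / (1 + snd (fst x)))))"
        by (rule continuous_map_pair_LT[OF G(1)])
          (auto intro!: continuous_intros continuous_map_top_of_set_compose[OF \<beta>(1)] simp: field_simps)
      show "continuous_map (top_of_set {x \<in> {x \<in> ?S. 1/2 <= fst (fst x)}. 2 * (1 + snd (fst x)) <= snd x}) Z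
         (\<lambda>x. K (2 * fst (fst x) - 1, snd x / 2 - 1))"
        by (rule continuous_map_top_of_set_compose[OF Kc]) (auto intro!: continuous_intros)
      show "G ((2 * fst (fst x) - 1, snd (fst x)), \<beta> (2 * snd x / (1 + snd (fst x)))) = K (2 * fst (fst x) - 1, snd x / 2 - 1)"
        if "x \<in> {x \<in> ?S. 1/2 <= fst (fst x)}" "snd x = 2 * (1 + snd (fst x))" for x
      proof -
        have "2 * snd x / (1 + snd (fst x)) = 4" "snd x / 2 - 1 = snd (fst x)" using that by (auto simp: field_simps)
        then show ?thesis using Gp1 \<beta>(3) by simp
      qed
    qed (auto intro!: continuous_intros)
    show "f (Qm (max (snd (fst x)) (1 - 2 * fst (fst x))) (e4 (snd x))) = side (snd (fst x)) (snd x) (2 * fst (fst x) - 1)"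
      if x: "x \<in> ?S" "fst (fst x) = 1/2" for x
    proof -
      obtain u t where [simp]: "x = ((1/2,u),t)" using x(2) by (metis prod.collapse)
      have u: "u \<in> {0..1}" "t \<in> {0..4}" using x by auto
      then have q: "Qm (max u (1 - 2 * (1/2))) (e4 t) = e4 (min (2 * t / (1 + u)) 4)" by (auto simp: Qm_props(3))
      show ?thesis
      proof (cases "t <= 2 * (1 + u)")
        case True
        then have t: "2 * t / (1 + u) \<in> {0..4}" using u by (auto simp: field_simps)
        then have "G ((0,u), \<beta> (2 * t / (1 + u))) = r (\<beta> (2 * t / (1 + u)))"
          using G(3)[of 0 u] u \<beta>in[OF t] H01[OF \<beta>in[OF t]] by simp
        then show ?thesis using True q t u f\<beta>[OF t] by (auto simp: side_def min_def)
      next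
        case False
        then have "min (2 * t / (1 + u)) 4 = 4" using u by (auto simp: field_simps)
        then show ?thesis using False q u f1 K1(2)[of "t / 2 - 1"] by (auto simp: side_def)
      qed
    qed
  qed (auto intro!: continuous_intros)
  have BB': "B (y, e4 t) = B' (y, t)" if "y \<in> {0..1} \<times> {0..1}" "t \<in> {0..4}" for y t
  proof (cases "t = 4")
    case False
    then show ?thesis using ang_e4[of 1 t] that by (auto simp: B_def B'_def)
  next
    case True
    from that(1) have "y = (fst y, snd y) \<and> fst y \<in> {0..1} \<and> snd y \<in> {0..1}" by auto
    then obtain s u where y: "y = (s,u)" "s \<in> {0..1}" "u \<in> {0..1}" by blast
    have a: "ang 1 = 0" using ang_e4[of 1 0] by simp
    have "side u 0 (2 * s - 1) = b" "side u 4 (2 * s - 1) = b" if "\<not> s <= 1/2"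
      using that y Gp0[of "2 * s - 1" u] Gp1[of "2 * s - 1" u] \<beta>(2,3) K1(4)[of "2 * s - 1"] by (auto simp: side_def)
    then show ?thesis using True y a by (auto simp: B_def B'_def)
  qed
  have Bc: "continuous_map (top_of_set (({0..1} \<times> {0..1}) \<times> sphere 0 1)) Z B"
  proof -
    have "continuous_map (prod_topology (top_of_set ({0..1} \<times> {0..1})) (top_of_set (sphere 0 1))) Z B"
    proof (rule continuous_map_prod_circle[OF lc_H_interval(3,4)])
      show "continuous_map (prod_topology (top_of_set ({0..1} \<times> {0..1})) (top_of_set {0..4})) Z (\<lambda>(y, s). B (y, cis (pi * s / 2)))"
        unfolding prod_topology_subtopology_eu
        by (rule continuous_map_eq[OF B'c]) (auto simp: BB' simp flip: e4_def)
    qed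
    then show ?thesis by simp
  qed
  have e4ex: "\<exists>t\<in>{0..4}. p = e4 t" if "norm p = 1" for p
  proof -
    have "p = e4 (ang p)" using Arg2pi[of p] that by (simp add: e4_def ang_def is_Arg_def cis_conv_exp mult.commute)
    moreover have "ang p \<in> {0..4}" using Arg2pi[of p] by (simp add: ang_def field_simps)
    ultimately show ?thesis by blast
  qed
  have B0: "B ((s,0),p) = hc (s,p)" if "s \<in> {0..1}" "norm p = 1" for s p
  proof -
    note st = that
    from e4ex[OF that(2)] obtain t where t: "t \<in> {0..4}" "p = e4 t" by blast
    have "side 0 t (2 * s - 1) = \<Xi> (2 * s - 1, e4 t)" if s': "\<not> s <= 1/2"
    proof (cases "t <= 2")
      case True
      then have M: "Mm (e4 t) = 2 * t" "Qm 0 (e4 t) = e4 (2 * t)" using t by (auto simp: Mm_props Qm_props(3) min_def)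
      have "G ((2 * s - 1, 0), \<beta> (2 * t)) = H (2 * s - 1, \<beta> (2 * t))" using s' st(1) True t by (intro G(2) \<beta>in) auto
      moreover have comb: "of_real (1 - 2 * x) * e4 y + of_real (2 * x) * e4 y = e4 y" for x y by (simp add: algebra_simps)
      ultimately show ?thesis using True t H01[OF \<beta>in[of "2 * t"]] f\<beta>[of "2 * t"] unfolding side_def \<Xi>_def prod.case M comb by auto
    next
      case False
      then have M: "Mm (e4 t) = 8 - 2 * t" "Qm 0 (e4 t) = 1" using t by (auto simp: Mm_props Qm_props(3) min_def)
      show ?thesis using False unfolding side_def \<Xi>_def K_def by (auto simp: M algebra_simps)
    qed
    then show ?thesis using BB'[of "(s,0)" t] t that by (auto simp: B'_def hc_def)
  qed
  have Be: "B ((s,u),p) = hc (s,p)" if "u \<in> {0..1}" "norm p = 1" "s \<in> {0,1}" for u p s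
  proof -
    from e4ex[OF that(2)] obtain t where t: "t \<in> {0..4}" "p = e4 t" by blast
    have "side u t 1 = b"
    proof (cases "t <= 2 * (1 + u)")
      case True
      then have tt: "2 * t / (1 + u) \<in> {0..4}" using t that by (auto simp: field_simps)
      show ?thesis using True G(3)[of 1 u, OF _ that(1) \<beta>in[OF tt]] H01[OF \<beta>in[OF tt]] ho01[OF \<beta>in[OF tt]] by (simp add: side_def)
    next
      case False then show ?thesis using K1(3)[of "t / 2 - 1"] t that by (auto simp: side_def)
    qed
    then show ?thesis using BB'[of "(s,u)" t] t that \<Xi>1 by (auto simp: B'_def hc_def max_def)
  qed
  obtain C where C: "continuous_map (top_of_set (({0..1} \<times> {0..1}) \<times> cball 0 1)) Z C"
    "!!s p. s \<in> {0..1} ==> norm p <= 1 ==> C ((s,0),p) = hc (s,p)"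
    "!!s u p. u \<in> {0..1} ==> norm p <= 1 ==> s \<in> {0,1} ==> C ((s,u),p) = hc (s,p)"
    "!!s u p. s \<in> {0..1} ==> u \<in> {0..1} ==> norm p = 1 ==> C ((s,u),p) = B ((s,u),p)"
    by (rule cell_homotopy_extension[OF hcc Bc B0 Be]) blast+
  \<comment> \<open>The second delay matches the first half of \<open>B\<close>, in which only the
    disc is reparametrized.\<close>
  define h' where "h' = (\<lambda>(s,q). G ((max 0 (2 * s - 1), 1), q))"
  have "continuous_map (prod_topology I01 (LT U R Ph)) (prod_topology (top_of_set ({0..1} \<times> {0..1})) (LT U R Ph)) (\<lambda>(s,q). ((s,1::real),q))"
    unfolding continuous_map_prod_top by (auto simp: continuous_map_in_subtopology intro!: continuous_intros)
  from continuous_map_compose[OF this G(1)]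
  have "continuous_map (prod_topology I01 (LT U R Ph)) Z (\<lambda>x. G ((fst x,1), snd x))" by (simp add: o_def case_prod_unfold)
  from delay[OF this] have "continuous_map (prod_topology I01 (LT U R Ph)) Z h'" by (simp add: h'_def case_prod_unfold)
  then have "nullhtpy Z r b U R Ph h'"
    unfolding nullhtpy_def using G(3)[of 0 1] G(3)[of 1 1] H01 ho01 by (auto simp: h'_def)
  moreover have "h' (s, LV p0) = b" "h' (s, LV p1) = b" if "s \<in> {0..1}" for s
    using that Gp0[of "max 0 (2 * s - 1)" 1] Gp1[of "max 0 (2 * s - 1)" 1] K1(4)[of "max 0 (2 * s - 1)"] by (auto simp: h'_def)
  moreover have "continuous_map (top_of_set ({0..1} \<times> cball 0 1)) Z (\<lambda>x. C ((fst x, 1), snd x))"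
    by (rule continuous_map_top_of_set_compose[OF C(1)]) (auto intro!: continuous_intros)
  moreover have "C ((0,1),p) = f p" "C ((1,1),p) = b" if "norm p <= 1" for p
    using that C(3)[of 1 p 0] C(3)[of 1 p 1] \<Xi>1 by (auto simp: hc_def Qm_props)
  moreover have "C ((s,1), e4 t) = h' (s, \<beta> t)" if "s \<in> {0..1}" "t \<in> {0..4}" for s t
  proof -
    have CB: "C ((s,1), e4 t) = B' ((s,1),t)" using C(4)[of s 1 "e4 t"] BB'[of "(s,1)" t] that by simp
    have G01: "G ((0, 1), \<beta> t) = r (\<beta> t)" using \<beta>in[OF that(2)] G(3)[of 0 1 "\<beta> t"] H01[of "\<beta> t"] by auto
    show ?thesis
    proof (cases "s = 1/2")
      case True
      show ?thesis using CB G01 that f\<beta>[OF that(2)] unfolding True by (simp add: B'_def h'_def Qm_props)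
    qed (use CB G01 that f\<beta>[OF that(2)] in \<open>auto simp: B'_def h'_def side_def Qm_props max_def\<close>)
  qed
  ultimately show thesis by (intro that[of h' "\<lambda>x. C ((fst x, 1), snd x)"]) auto
qed

section \<open>Renaming of vertices and gluing back a split vertex\<close>

definition renE :: "('u => 'w) => ('u,'v) edge => ('w,'v) edge" where
  "renE \<rho> a = (\<rho> (fst a), fst (snd a), \<rho> (snd (snd a)))"
definition renF :: "('u => 'w) => ('u,'v) face => ('w,'v) face" where
  "renF \<rho> ph = (case ph of ((u0,u1,u2,u3),e) => ((\<rho> u0, \<rho> u1, \<rho> u2, \<rho> u3), e))"
primrec renP :: "('u => 'w) => ('u,'v) lpt => ('w,'v) lpt" where
  "renP \<rho> (LV u) = LV (\<rho> u)" | "renP \<rho> (LE a t) = LE (renE \<rho> a) t" | "renP \<rho> (LF ph p) = LF (renF \<rho> ph) p"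

lemma renP_charE: "renP \<rho> (charE a t) = charE (renE \<rho> a) t"
  by (auto simp: charE_def renE_def esrc_def etgt_def)

lemma bd_renF: "bd (renF \<rho> ph) = map (\<lambda>(a,s). (renE \<rho> a, s)) (bd ph)"
  by (auto simp: bd_def renF_def renE_def split: prod.splits)

lemma renP_charF: "renP \<rho> (charF ph p) = charF (renF \<rho> ph) p"
  by (auto simp: charF_def bdpt_def Let_def bd_renF renP_charE case_prod_unfold)

lemma renP_in:
  assumes "\<rho> ` U' \<subseteq> U" "renE \<rho> ` R' \<subseteq> R" "renF \<rho> ` Ph' \<subseteq> Ph" "q \<in> lpts U' R' Ph'"
  shows "renP \<rho> q \<in> lpts U R Ph"
  using assms by (cases q) (simp_all add: image_subset_iff)

lemma e4_add: "e4 (s + t) = e4 s * e4 t"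
proof -
  have "pi * (s + t) / 2 = pi * s / 2 + pi * t / 2" by (simp add: algebra_simps add_divide_distrib)
  then show ?thesis unfolding e4_def cis_mult by (simp only:)
qed

text \<open>The null homotopy of the split complex descends to the quotient because \<rho>
  identifies no vertices except \<open>p0\<close> with \<open>p1\<close>, and both are stationary;
  over the extra face the disc homotopy takes over. Rotation by \<open>e4 k0\<close> makes the
  boundary of the face start at the corner that was opened.\<close>

lemma nullhtpy_detach:
  assumes wf': "wf_cx U' R' Ph'" and wf: "wf_cx U R Ph"
    and U: "U = \<rho> ` U'" and R: "R = renE \<rho> ` R'" and Ph: "Ph = insert ph (renF \<rho> ` Ph')" "ph \<notin> renF \<rho> ` Ph'"
    and inj: "inj_on (renE \<rho>) R'" "inj_on (renF \<rho>) Ph'"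
    and p: "p0 \<in> U'" "p1 \<in> U'" "p0 ~= p1" and glue: "!!u u'. u \<in> U' ==> u' \<in> U' ==> \<rho> u = \<rho> u' ==> u = u' \<or> {u,u'} = {p0,p1}"
    and r: "!!u. u \<in> U ==> r (LV u) = b" and rc: "continuous_map (top_of_set (cball 0 1)) Z (\<lambda>p. r (charF ph p))"
    and \<beta>: "continuous_map (top_of_set {0..4}) (LT U' R' Ph') \<beta>" "\<beta> 0 = LV p0" "\<beta> 4 = LV p1"
    and \<beta>r: "!!t. t \<in> {0..4} ==> renP \<rho> (\<beta> t) = charF ph (e4 (t + k0))"
    and h: "nullhtpy Z (\<lambda>q. r (renP \<rho> q)) b U' R' Ph' h"
  shows "\<exists>h. nullhtpy Z r b U R Ph h"
proof -
  define f where "f p = r (charF ph (e4 k0 * p))" for p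
  have fc: "continuous_map (top_of_set (cball 0 1)) Z f"
    unfolding f_def by (rule continuous_map_top_of_set_compose[OF rc]) (auto intro!: continuous_intros simp: norm_mult)
  have f\<beta>: "f (e4 t) = r (renP \<rho> (\<beta> t))" if "t \<in> {0..4}" for t
    using \<beta>r[OF that] by (simp add: f_def e4_add mult.commute)
  have r': "r (renP \<rho> (LV u)) = b" if "u \<in> U'" for u using r U that by simp
  obtain h' hf where h': "nullhtpy Z (\<lambda>q. r (renP \<rho> q)) b U' R' Ph' h'"
    "!!s. s \<in> {0..1} ==> h' (s, LV p0) = b" "!!s. s \<in> {0..1} ==> h' (s, LV p1) = b"
    and hf: "continuous_map (top_of_set ({0..1} \<times> cball 0 1)) Z hf" "!!p. norm p <= 1 ==> hf (0,p) = f p" "!!p. norm p <= 1 ==> hf (1,p) = b"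
    "!!s t. s \<in> {0..1} ==> t \<in> {0..4} ==> hf (s, e4 t) = h' (s, \<beta> t)"
    by (rule detach_core[OF wf' p r' h fc \<beta> f\<beta>]) blast+
  note h'c = h'(1)[unfolded nullhtpy_def, THEN conjunct1]
  have same: "h' (s,q1) = h' (s,q2)" if "q1 \<in> lpts U' R' Ph'" "q2 \<in> lpts U' R' Ph'" "renP \<rho> q1 = renP \<rho> q2" "s \<in> {0..1}" for s q1 q2
  proof -
    note eq = that(3)
    have "q1 = q2 \<or> (\<exists>u u'. q1 = LV u \<and> q2 = LV u' \<and> {u,u'} = {p0,p1})"
    proof (cases q1)
      case (LV u) then obtain u' where "q2 = LV u'" using eq by (cases q2) auto
      then show ?thesis using LV that glue by auto
    next
      case (LE a t) then obtain a' where "q2 = LE a' t" using eq by (cases q2) auto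
      then show ?thesis using LE that inj by (auto dest: inj_onD)
    next
      case (LF a t) then obtain a' where "q2 = LF a' t" using eq by (cases q2) auto
      then show ?thesis using LF that inj by (auto dest: inj_onD)
    qed
    then show ?thesis using h'(2,3)[OF that(4)] by (auto simp: doubleton_eq_iff)
  qed
  \<comment> \<open>A point off the extra face can have two preimages under \<rho>; by
    \<open>same\<close> the choice does not matter.\<close>
  define h where "h = (\<lambda>(s,q). if \<exists>p. q = LF ph p then hf (s, (THE p. q = LF ph p) / e4 k0)
     else h' (s, SOME q'. q' \<in> lpts U' R' Ph' \<and> renP \<rho> q' = q))"
  have hF: "h (s, LF ph p) = hf (s, p / e4 k0)" for s p by (simp add: h_def)
  have hR: "h (s, renP \<rho> q) = h' (s, q)" if q: "q \<in> lpts U' R' Ph'" "s \<in> {0..1}" for s q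
  proof -
    have "\<not> (\<exists>p. renP \<rho> q = LF ph p)" using q(1) Ph(2) by (cases q) auto
    moreover have "h' (s, SOME q'. q' \<in> lpts U' R' Ph' \<and> renP \<rho> q' = renP \<rho> q) = h' (s,q)"
    proof (rule someI2[where a=q])
      fix q' assume "q' \<in> lpts U' R' Ph' \<and> renP \<rho> q' = renP \<rho> q"
      then show "h' (s,q') = h' (s,q)" using same[of q' q s] q by blast
    qed (use q in simp)
    ultimately show ?thesis by (simp add: h_def)
  qed
  have \<beta>in: "\<beta> t \<in> lpts U' R' Ph'" if "t \<in> {0..4}" for t
    using \<beta>(1) that topspace_LT[OF wf'] by (auto simp: continuous_map_def)
  have e4nz: "e4 k0 ~= 0" using e4_4(3)[of k0] by (metis norm_zero zero_neq_one)
  have hcF: "h (s, charF ph p) = hf (s, p / e4 k0)" if "s \<in> {0..1}" "norm p <= 1" for s p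
  proof (cases "norm p < 1")
    case True then show ?thesis by (simp add: charF_def hF)
  next
    case False
    define t where "t = ang (p / e4 k0)"
    have n: "norm (p / e4 k0) = 1" using False that by (simp add: norm_divide)
    have t: "t \<in> {0..4}" "p / e4 k0 = e4 t"
      using Arg2pi[of "p / e4 k0"] n by (auto simp: t_def ang_def e4_def is_Arg_def cis_conv_exp mult.commute field_simps)
    then have "p = e4 (t + k0)" using e4nz by (simp add: e4_add field_simps)
    then have "h (s, charF ph p) = h (s, renP \<rho> (\<beta> t))" using \<beta>r[OF t(1)] by simp
    then show ?thesis using hR[OF \<beta>in[OF t(1)] that(1)] hf(4)[OF that(1) t(1)] t(2) by simp
  qed
  have cp: "continuous_map (prod_topology I01 (top_of_set S)) Z (\<lambda>(s,t). h' (s, c t))"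
    if "continuous_map (top_of_set S) (LT U' R' Ph') c" for c and S :: "'x::topological_space set"
  proof -
    have "continuous_map (prod_topology I01 (top_of_set S)) (prod_topology I01 (LT U' R' Ph')) (\<lambda>(s,t). (s, c t))"
      unfolding continuous_map_prod_top using that by auto
    from continuous_map_compose[OF this h'c] show ?thesis by (simp add: o_def case_prod_unfold)
  qed
  have "continuous_map (prod_topology I01 (LT U R Ph)) Z h"
  proof (rule continuous_map_prod_LT[OF wf lc_H_interval(1,2)])
    fix u assume "u \<in> U"
    then obtain u' where u': "u' \<in> U'" "u = \<rho> u'" using U by auto
    have "continuous_map I01 Z (\<lambda>s. h' (s, LV u'))"
      using u' topspace_LT[OF wf'] by (intro continuous_map_pair_LT[OF h'c]) auto
    then show "continuous_map I01 Z (\<lambda>s. h (s, LV u))"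
      by (rule continuous_map_eq) (use u' hR[of "LV u'"] in auto)
  next
    fix a assume "a \<in> R"
    then obtain a' where a': "a' \<in> R'" "a = renE \<rho> a'" using R by auto
    show "continuous_map (prod_topology I01 (top_of_set {0..1})) Z (\<lambda>(s, t). h (s, charE a t))"
      by (rule continuous_map_eq[OF cp[OF continuous_charE[OF wf' a'(1)]]])
        (use a'(2) charE_in[OF wf' a'(1)] in \<open>auto simp: hR simp flip: renP_charE\<close>)
  next
    fix \<psi> assume "\<psi> \<in> Ph"
    then consider "\<psi> = ph" | \<psi>' where "\<psi>' \<in> Ph'" "\<psi> = renF \<rho> \<psi>'" using Ph(1) by auto
    then show "continuous_map (prod_topology I01 (top_of_set (cball 0 1))) Z (\<lambda>(s, t). h (s, charF \<psi> t))"
    proof cases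
      case 1
      have "continuous_map (top_of_set ({0..1} \<times> cball 0 1)) Z (\<lambda>x. hf (fst x, snd x / e4 k0))"
        by (rule continuous_map_top_of_set_compose[OF hf(1)]) (use e4nz in \<open>auto intro!: continuous_intros simp: norm_divide\<close>)
      then show ?thesis unfolding prod_topology_subtopology_eu 1
        by (rule continuous_map_eq) (auto simp: hcF)
    next
      case 2
      show ?thesis by (rule continuous_map_eq[OF cp[OF continuous_charF[OF wf' 2(1)]]])
        (use 2(2) charF_in[OF wf' 2(1)] in \<open>auto simp: hR simp flip: renP_charF\<close>)
    qed
  qed
  moreover have "h (0,q) = r q \<and> h (1,q) = b" if q: "q \<in> lpts U R Ph" for q
  proof (cases "\<exists>q'\<in>lpts U' R' Ph'. q = renP \<rho> q'")
    case True then show ?thesis using h'(1) hR unfolding nullhtpy_def by auto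
  next
    case False
    have "\<exists>p. q = LF ph p \<and> norm p < 1"
    proof (cases q)
      case (LV u) then show ?thesis using False q U by (metis imageE mem_lpts(1) renP.simps(1))
    next
      case (LE a t) then show ?thesis using False q R by (metis imageE mem_lpts(2) renP.simps(2))
    next
      case (LF \<psi> t) then show ?thesis using False q Ph by (metis imageE insertE mem_lpts(3) renP.simps(3))
    qed
    then obtain p where pp: "q = LF ph p" "norm p < 1" by blast
    then have "norm (p / e4 k0) <= 1" by (simp add: norm_divide)
    then show ?thesis using pp hf(2,3)[of "p / e4 k0"] e4nz by (auto simp: hF f_def charF_def)
  qed
  ultimately show ?thesis unfolding nullhtpy_def by blast
qed

section \<open>Immersed complexes and splitting of vertices\<close>

definition elab :: "('u,'v) edge => 'v" where "elab a = fst (snd a)"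

primrec proj :: "('u,'v) lpt => 'v cellpt" where
  "proj (LV u) = Base" | "proj (LE a t) = Edge (elab a) t" | "proj (LF ph p) = Face (snd ph) p"

lemma proj_charE: "proj (charE a t) = char1 (elab a) t"
  by (auto simp: charE_def char1_def)

lemma bd_rel_word: "k < 4 ==> rel_word (snd ph) ! k = (elab (fst (bd ph ! k)), snd (bd ph ! k))"
  using less_4_cases[of k] by (auto simp: rel_word_def bd_def elab_def split: prod.splits)

lemma proj_charF: "proj (charF ph p) = char2 (snd ph) p"
proof (cases "norm p < 1")
  case False
  define s where "s = 2 * Arg2pi p / pi"
  have "0 <= s" "s < 4" using Arg2pi[of p] by (auto simp: s_def field_simps)
  then have k: "nat \<lfloor>s\<rfloor> < 4" by (simp add: nat_less_iff floor_less_iff)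
  show ?thesis using False k
    by (simp add: charF_def char2_def bdpt_def attach_def Let_def proj_charE case_prod_unfold bd_rel_word flip: s_def)
qed (simp add: charF_def char2_def)

lemma proj_renP: "proj (renP \<rho> q) = proj q"
  by (cases q) (auto simp: elab_def renE_def renF_def split: prod.splits)

text \<open>The last clause is local injectivity of the projection along edges. Local injectivity on
  faces then follows, see \<open>cx_face_eq\<close>.\<close>

definition cx :: "'v set => ('v \<times> 'v \<times> 'v) set => 'u set => ('u,'v) edge set => ('u,'v) face set => bool" where
  "cx V E U R Ph \<longleftrightarrow> finite U \<and> finite R \<and> finite Ph \<and> wf_cx U R Ph \<and> elab ` R \<subseteq> V \<and> snd ` Ph \<subseteq> E \<and>
     (\<forall>a\<in>R. \<forall>a'\<in>R. elab a = elab a' --> (esrc a = esrc a' \<longleftrightarrow> etgt a = etgt a'))"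

definition adj :: "('u,'v) edge set => ('u \<times> 'u) set" where
  "adj R = {(u,w). \<exists>a\<in>R. esrc a = u \<and> etgt a = w \<or> esrc a = w \<and> etgt a = u}"

definition conn where "conn U R \<longleftrightarrow> (\<forall>u\<in>U. \<forall>w\<in>U. (u,w) \<in> (adj R)\<^sup>*)"

definition chi :: "'u set => ('u,'v) edge set => ('u,'v) face set => int" where
  "chi U R Ph = int (card U) - int (card R) + int (card Ph)"

text \<open>A potential of the integer cocycle with value 1 on every edge.\<close>

definition Ht :: "('u,'v) edge set => bool" where
  "Ht R \<longleftrightarrow> (\<exists>h::'u => int. \<forall>a\<in>R. h (etgt a) = h (esrc a) + 1)"

definition clab :: "('u,'v) face => nat => 'v" where "clab ph k = elab (fst (bd ph ! k))"

definition labs :: "('u,'v) face => 'v set" where "labs ph = {fst (snd ph), fst (snd (snd ph)), snd (snd (snd ph))}"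

text \<open>Corner \<open>k\<close> lies between the letters \<open>k - 1\<close> and
  \<open>k\<close>, whence the index \<open>k + 3\<close>; these are the corners at which a face
  passes between \<open>c\<close> and the other classes.\<close>

definition chgc :: "'v set => ('u,'v) face => nat => bool" where
  "chgc c ph k \<longleftrightarrow> (clab ph k \<in> c) ~= (clab ph ((k + 3) mod 4) \<in> c)"

definition Rl :: "('u,'v) edge set => 'v set => ('u,'v) edge set" where "Rl R c = {a\<in>R. elab a \<in> c}"
definition comp :: "('u,'v) edge set => 'v set => 'u => 'u set" where "comp R c u = {w. (u,w) \<in> (adj (Rl R c))\<^sup>*}"
definition Rp where "Rp R c C = {a\<in>R. elab a \<in> c \<and> esrc a \<in> C}"
definition Fp where "Fp Ph c C = {ph\<in>Ph. labs ph \<subseteq> c \<and> corner ph 0 \<in> C}"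
definition chip where "chip R Ph c C = chi C (Rp R c C) (Fp Ph c C)"

section \<open>Splitting a vertex along a class\<close>

definition bstart :: "('u,'v) edge \<times> bool => 'u" where "bstart b = (if snd b then esrc (fst b) else etgt (fst b))"
definition bend :: "('u,'v) edge \<times> bool => 'u" where "bend b = (if snd b then etgt (fst b) else esrc (fst b))"

lemma bd_ends:
  assumes "k < 4" shows "bstart (bd ph ! k) = corner ph k" "bend (bd ph ! k) = corner ph (Suc k mod 4)"
proof -
  obtain u0 u1 u2 u3 x z y where "ph = ((u0,u1,u2,u3),(x,z,y))" by (metis prod.exhaust)
  then show "bstart (bd ph ! k) = corner ph k" "bend (bd ph ! k) = corner ph (Suc k mod 4)"
    using less_4_cases[OF assms] by (elim disjE; simp add: bstart_def bend_def corner_def bd_def esrc_def etgt_def)+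
qed

definition spE :: "'u => 'v set => 'u => ('u,'v) edge => ('u,'v) edge" where
  "spE v c n a = (if esrc a = v \<and> elab a \<in> c then n else esrc a, elab a, if etgt a = v \<and> elab a \<in> c then n else etgt a)"

text \<open>A corner follows the letter that leaves it in the relator word. If both letters at the
  corner agree about \<open>c\<close>, this is the same as following the boundary edges.\<close>

definition spF :: "'u => 'v set => 'u => ('u,'v) face => ('u,'v) face" where
  "spF v c n ph = (let s = (\<lambda>k. if corner ph k = v \<and> clab ph k \<in> c then n else corner ph k) in ((s 0, s 1, s 2, s 3), snd ph))"

lemma bd_spF:
  assumes "!!k. k < 4 ==> corner ph k = v ==> \<not> chgc c ph k"
  shows "bd (spF v c n ph) = map (\<lambda>(a,s). (spE v c n a, s)) (bd ph)"
proof -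
  obtain u0 u1 u2 u3 x z y where f: "ph = ((u0,u1,u2,u3),(x,z,y))" by (metis prod.exhaust)
  have "u0 = v ==> (x \<in> c) = (z \<in> c)" using assms[of 0] unfolding f by (simp add: corner_def clab_def chgc_def bd_def elab_def)
  moreover have "u1 = v ==> (x \<in> c) = (z \<in> c)" using assms[of 1] unfolding f by (simp add: corner_def clab_def chgc_def bd_def elab_def)
  moreover have "u2 = v ==> (y \<in> c) = (z \<in> c)" using assms[of 2] unfolding f by (simp add: corner_def clab_def chgc_def bd_def elab_def)
  moreover have "u3 = v ==> (y \<in> c) = (z \<in> c)" using assms[of 3] unfolding f by (simp add: corner_def clab_def chgc_def bd_def elab_def)
  ultimately show ?thesis unfolding f
    by (simp add: bd_def spF_def spE_def corner_def clab_def esrc_def etgt_def elab_def Let_def) blast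
qed

definition lpath :: "(('u,'v) edge \<times> bool) list => real => ('u,'v) lpt" where
  "lpath bl t = (let j = min 3 (nat \<lfloor>t\<rfloor>) in charE (fst (bl ! j)) (if snd (bl ! j) then t - real j else 1 - (t - real j)))"

lemma charE_ends: "charE (fst b) (if snd b then 0 else 1) = LV (bstart b)" "charE (fst b) (if snd b then 1 else 0) = LV (bend b)"
  by (auto simp: charE_def bstart_def bend_def)

lemma lpath_piece:
  assumes ends: "!!j. j < 3 ==> bend (bl ! j) = bstart (bl ! Suc j)" and j: "j < 4" "real j <= t" "t <= real j + 1"
  shows "lpath bl t = charE (fst (bl ! j)) (if snd (bl ! j) then t - real j else 1 - (t - real j))"
proof (cases "t = real j + 1 \<and> j < 3")
  case True
  then have "\<lfloor>t\<rfloor> = int j + 1" by (simp add: floor_eq_iff)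
  then have "min 3 (nat \<lfloor>t\<rfloor>) = Suc j" using True by (simp add: nat_add_distrib)
  then have "lpath bl t = charE (fst (bl ! Suc j)) (if snd (bl ! Suc j) then 0 else 1)"
    using True by (simp add: lpath_def)
  then show ?thesis using True charE_ends(1)[of "bl ! Suc j"] charE_ends(2)[of "bl ! j"] ends[of j] by (auto split: if_splits)
next
  case False
  have "min 3 (nat \<lfloor>t\<rfloor>) = j"
  proof (cases "t = real j + 1")
    case True
    then have "\<lfloor>t\<rfloor> = int j + 1" by (simp add: floor_eq_iff)
    then show ?thesis using True False j by (auto simp: nat_add_distrib)
  next
    case False
    then have "\<lfloor>t\<rfloor> = int j" using j by (simp add: floor_eq_iff)
    then show ?thesis using j by simp
  qed
  then show ?thesis by (simp add: lpath_def Let_def)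
qed

lemma continuous_lpath:
  assumes wf: "wf_cx U R Ph" and R: "!!j. j < 4 ==> fst (bl ! j) \<in> R"
    and ends: "!!j. j < 3 ==> bend (bl ! j) = bstart (bl ! Suc j)"
  shows "continuous_map (top_of_set {0..4}) (LT U R Ph) (lpath bl)"
proof (rule pasting_lemma_closed[where I="{..<4::nat}" and T="\<lambda>k. {real k..real k + 1}"
      and f="\<lambda>j t. charE (fst (bl ! j)) (if snd (bl ! j) then t - real j else 1 - (t - real j))"])
  fix k :: nat assume k: "k \<in> {..<4}"
  then have sub: "{real k..real k + 1} \<subseteq> {0..4}" by auto
  then show "closedin (top_of_set {0..4}) {real k..real k + 1}"
    by (metis closed_real_atLeastAtMost closed_subset)
  have "{0..4} \<inter> {real k..real k + 1} = {real k..real k + 1}" using sub by auto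
  then show "continuous_map (subtopology (top_of_set {0..4}) {real k..real k + 1}) (LT U R Ph)
       (\<lambda>t. charE (fst (bl ! k)) (if snd (bl ! k) then t - real k else 1 - (t - real k)))"
    unfolding subtopology_subtopology using k
    by (simp only:) (rule continuous_map_top_of_set_compose[OF continuous_charE[OF wf R]]; cases "snd (bl ! k)"; auto intro!: continuous_intros)
next
  fix i j s assume "i \<in> {..<4::nat}" "j \<in> {..<4::nat}" "s \<in> topspace (top_of_set {0..4}) \<inter> {real i..real i + 1} \<inter> {real j..real j + 1}"
  then show "charE (fst (bl ! i)) (if snd (bl ! i) then s - real i else 1 - (s - real i)) = charE (fst (bl ! j)) (if snd (bl ! j) then s - real j else 1 - (s - real j))"
    using lpath_piece[of bl i s, OF ends] lpath_piece[of bl j s, OF ends] by auto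
next
  fix s assume "s \<in> topspace (top_of_set {0..4::real})"
  then have s: "0 <= s" "s <= 4" by auto
  define k where "k = (if s = 4 then 3 else nat \<lfloor>s\<rfloor>)"
  have "k < 4" "real k <= s" "s <= real k + 1" using s by (auto simp: k_def nat_less_iff floor_less_iff)
  then show "\<exists>j. j \<in> {..<4} \<and> s \<in> {real j..real j + 1} \<and> lpath bl s = charE (fst (bl ! j)) (if snd (bl ! j) then s - real j else 1 - (s - real j))"
    using lpath_piece[of bl k s, OF ends] by (intro exI[of _ k]) simp
qed auto

lemma lpath_ends:
  assumes "!!j. j < 3 ==> bend (bl ! j) = bstart (bl ! Suc j)"
  shows "lpath bl 0 = LV (bstart (bl ! 0))" "lpath bl 4 = LV (bend (bl ! 3))"
  using lpath_piece[of bl 0 0, OF assms] lpath_piece[of bl 3 4, OF assms] charE_ends(1)[of "bl ! 0"] charE_ends(2)[of "bl ! 3"]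
  by (auto split: if_splits)

lemma face_eqI: "(!!k. k < 4 ==> corner ph k = corner \<psi> k) ==> snd ph = snd \<psi> ==> ph = \<psi>" for ph \<psi> :: "('x,'v) face"
proof -
  assume a: "!!k. k < 4 ==> corner ph k = corner \<psi> k" "snd ph = snd \<psi>"
  obtain u0 u1 u2 u3 where f: "ph = ((u0,u1,u2,u3),snd ph)" by (metis prod.exhaust snd_conv)
  obtain w0 w1 w2 w3 where g: "\<psi> = ((w0,w1,w2,w3),snd \<psi>)" by (metis prod.exhaust snd_conv)
  have "corner ph 0 = u0" "corner ph 1 = u1" "corner ph 2 = u2" "corner ph 3 = u3" by (subst f, simp add: corner_def)+
  moreover have "corner \<psi> 0 = w0" "corner \<psi> 1 = w1" "corner \<psi> 2 = w2" "corner \<psi> 3 = w3" by (subst g, simp add: corner_def)+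
  ultimately show ?thesis using a(1)[of 0] a(1)[of 1] a(1)[of 2] a(1)[of 3] a(2) f g by simp
qed

lemma corner_renF: "k < 4 ==> corner (renF g ph) k = g (corner ph k)" for g :: "'x => 'y" and ph :: "('x,'v) face"
proof -
  assume k: "k < 4"
  obtain u0 u1 u2 u3 e where f: "ph = ((u0,u1,u2,u3),e)" by (metis prod.exhaust)
  then show ?thesis using less_4_cases[OF k] by (elim disjE; simp add: renF_def corner_def)
qed

lemma snd_renF [simp]: "snd (renF g ph) = snd ph" by (simp add: renF_def split: prod.splits)
lemma clab_eq: "snd ph = snd \<psi> ==> k < 4 ==> clab ph k = clab \<psi> k" for ph :: "('x,'v) face" and \<psi> :: "('y,'v) face"
  using bd_rel_word[of k ph] bd_rel_word[of k \<psi>] by (simp add: clab_def)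

lemma adj_sym: "(u,w) \<in> (adj S)\<^sup>* ==> (w,u) \<in> (adj S)\<^sup>*" for S :: "('x,'v) edge set"
proof -
  have "sym (adj S)" by (auto simp: sym_def adj_def)
  then show "(u,w) \<in> (adj S)\<^sup>* ==> (w,u) \<in> (adj S)\<^sup>*" by (meson sym_rtrancl symD)
qed

text \<open>The \<open>c\<close>-edges at \<open>v\<close> are moved to a new vertex
  \<open>n\<close>. A face survives unless one of its corners at \<open>v\<close> changes between
  \<open>c\<close> and the rest; by \<open>uniq\<close> this happens at a single corner, whose face
  is dropped and whose boundary opens into a path between \<open>n\<close> and
  \<open>v\<close>.\<close>

locale detach =
  fixes V :: "'v set" and E U R Ph and c :: "'v set" and v n :: 'u and ph0 :: "('u,'v) face" and k0 :: nat
  assumes cx: "cx V E U R Ph" and n: "n \<notin> U" and v: "v \<in> U" and ph0: "ph0 \<in> Ph" "k0 < 4" "corner ph0 k0 = v" "chgc c ph0 k0"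
    and uniq: "!!ph k. ph \<in> Ph ==> k < 4 ==> corner ph k = v ==> chgc c ph k ==> ph = ph0 \<and> k = k0"
begin

abbreviation "sE \<equiv> spE v c n"
abbreviation "sF \<equiv> spF v c n"
definition "U' = insert n U"
definition "R' = sE ` R"
definition "Ph' = sF ` (Ph - {ph0})"
definition "\<rho> u = (if u = n then v else u)"

lemma wf: "wf_cx U R Ph" and fin: "finite U" "finite R" "finite Ph" using cx by (auto simp: cx_def)

lemma ends: "a \<in> R ==> esrc a \<in> U" "a \<in> R ==> etgt a \<in> U" using wf by (auto simp: wf_cx_def)

lemma ren_sE: "a \<in> R ==> renE \<rho> (sE a) = a"
  using ends[of a] n by (cases a) (auto simp: renE_def spE_def \<rho>_def esrc_def etgt_def elab_def split: if_splits)

lemma bd_R: "ph \<in> Ph ==> k < 4 ==> fst (bd ph ! k) \<in> R"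
proof -
  assume a: "ph \<in> Ph" "k < 4"
  then have "bd ph ! k \<in> set (bd ph)" by (intro nth_mem) simp
  then show ?thesis using a wf unfolding wf_cx_def by blast
qed

lemma corner_U: "ph \<in> Ph ==> k < 4 ==> corner ph k \<in> U"
  using bd_ends(1)[of k ph] ends[OF bd_R[of ph k]] by (auto simp: bstart_def split: if_splits)

lemma bd_sF: "ph \<in> Ph - {ph0} ==> bd (sF ph) = map (\<lambda>(a,s). (sE a, s)) (bd ph)"
  by (intro bd_spF notI) (metis DiffE singletonI uniq)

lemma corner_sF: "k < 4 ==> corner (sF ph) k = (if corner ph k = v \<and> clab ph k \<in> c then n else corner ph k)"
proof -
  assume k: "k < 4"
  obtain u0 u1 u2 u3 e where f: "ph = ((u0,u1,u2,u3),e)" by (metis prod.exhaust)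
  show ?thesis using less_4_cases[OF k] unfolding f by (elim disjE; auto simp: spF_def corner_def Let_def)
qed

lemma snd_sF [simp]: "snd (sF ph) = snd ph" by (simp add: spF_def Let_def)

lemma ren_sF: "ph \<in> Ph ==> renF \<rho> (sF ph) = ph"
  using corner_U[of ph] n by (intro face_eqI) (auto simp: corner_renF corner_sF \<rho>_def)

lemma wf': "wf_cx U' R' Ph'"
  unfolding wf_cx_def
proof (intro conjI ballI)
  fix a assume "a \<in> R'"
  then obtain b where "b \<in> R" "a = sE b" unfolding R'_def by blast
  then show "esrc a \<in> U'" "etgt a \<in> U'" using ends[of b] by (simp_all add: U'_def spE_def esrc_def etgt_def)
next
  fix \<psi> assume "\<psi> \<in> Ph'"
  then obtain ph where f: "ph \<in> Ph - {ph0}" "\<psi> = sF ph" unfolding Ph'_def by blast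
  then have "fst ` set (bd ph) \<subseteq> R" using wf by (auto simp: wf_cx_def)
  then show "fst ` set (bd \<psi>) \<subseteq> R'" using f bd_sF[OF f(1)] by (force simp: R'_def)
qed

lemma elab_sE [simp]: "elab (sE a) = elab a" by (simp add: spE_def elab_def)

lemma ends_sE: "esrc (sE x) = (if esrc x = v \<and> elab x \<in> c then n else esrc x)"
    "etgt (sE x) = (if etgt x = v \<and> elab x \<in> c then n else etgt x)" by (simp_all add: spE_def esrc_def etgt_def)

lemma cx': "cx V E U' R' Ph'"
  unfolding cx_def
proof (intro conjI ballI impI wf')
  show "finite U'" "finite R'" "finite Ph'" using fin by (auto simp: U'_def R'_def Ph'_def)
  show "elab ` R' \<subseteq> V" "snd ` Ph' \<subseteq> E" using cx by (auto simp: R'_def Ph'_def cx_def)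
  fix a a' assume aa: "a \<in> R'" "a' \<in> R'" "elab a = elab a'"
  then obtain b b' where b: "b \<in> R" "b' \<in> R" "a = sE b" "a' = sE b'" unfolding R'_def by blast
  have ifeq: "((if p = v \<and> Q then n else p) = (if p' = v \<and> Q then n else p')) = (p = p')" if "p ~= n" "p' ~= n" for p p' Q
    using that by auto
  from b have l: "elab b = elab b'" using aa(3) by simp
  then have "esrc b = esrc b' \<longleftrightarrow> etgt b = etgt b'" using b cx unfolding cx_def by blast
  moreover have "esrc b ~= n" "etgt b ~= n" "esrc b' ~= n" "etgt b' ~= n" using b ends n by metis+
  ultimately show "(esrc a = esrc a') = (etgt a = etgt a')" unfolding b(3,4) ends_sE l
    by (simp add: ifeq)
qed

text \<open>A vertex is gained and a face lost; edges and remaining faces correspond bijectively,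
  since renaming by \<rho> undoes the splitting.\<close>

lemma chi': "chi U' R' Ph' = chi U R Ph" "card Ph' = card Ph - 1" "card Ph' < card Ph" "card U' = card U + 1"
proof -
  have "inj_on sE R" by (metis inj_onI ren_sE)
  moreover have "inj_on sF (Ph - {ph0})" by (metis DiffD1 inj_onI ren_sF)
  moreover have "card Ph > 0" using fin ph0 by (auto simp: card_gt_0_iff)
  ultimately show "chi U' R' Ph' = chi U R Ph" "card Ph' = card Ph - 1" "card Ph' < card Ph" "card U' = card U + 1"
    using fin n ph0 by (auto simp: chi_def U'_def R'_def Ph'_def card_image)
qed

text \<open>The boundary of the lost face in the split complex, read from the corner
  \<open>k0\<close>: a path between the two copies of \<open>v\<close>.\<close>

definition "bl = map (\<lambda>j. (sE (fst (bd ph0 ! ((k0 + j) mod 4))), snd (bd ph0 ! ((k0 + j) mod 4)))) [0,1,2,3]"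

lemma bl_nth: "j < 4 ==> bl ! j = (sE (fst (bd ph0 ! ((k0 + j) mod 4))), snd (bd ph0 ! ((k0 + j) mod 4)))"
  using less_4_cases[of j] by (auto simp: bl_def)

lemma bstart_sE: "bstart (sE a, s) = (if bstart (a,s) = v \<and> elab a \<in> c then n else bstart (a,s))"
  and bend_sE: "bend (sE a, s) = (if bend (a,s) = v \<and> elab a \<in> c then n else bend (a,s))"
  by (auto simp: bstart_def bend_def spE_def esrc_def etgt_def)

lemma bl_start: "j < 4 ==> bstart (bl ! j) = (if corner ph0 ((k0 + j) mod 4) = v \<and> clab ph0 ((k0 + j) mod 4) \<in> c then n else corner ph0 ((k0 + j) mod 4))"
  using bd_ends(1)[of "(k0 + j) mod 4" ph0] by (simp add: bl_nth bstart_sE clab_def)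

lemma bl_end: "j < 4 ==> bend (bl ! j) = (if corner ph0 ((k0 + j + 1) mod 4) = v \<and> clab ph0 ((k0 + j) mod 4) \<in> c then n else corner ph0 ((k0 + j + 1) mod 4))"
  using bd_ends(2)[of "(k0 + j) mod 4" ph0] by (simp add: bl_nth bend_sE clab_def mod_Suc_eq)

lemma bl_match: assumes "j < 3" shows "bend (bl ! j) = bstart (bl ! Suc j)"
proof -
  let ?k = "(k0 + j + 1) mod 4"
  have "?k ~= k0" using assms ph0(2) by presburger
  then have "corner ph0 ?k = v ==> \<not> chgc c ph0 ?k" using uniq[OF ph0(1), of ?k] by auto
  moreover have "(?k + 3) mod 4 = (k0 + j) mod 4" by presburger
  ultimately show ?thesis using assms bl_end[of j] bl_start[of "Suc j"] by (auto simp: chgc_def)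
qed

lemma bl_R: "j < 4 ==> fst (bl ! j) \<in> R'"
  using bd_R[OF ph0(1)] by (simp add: bl_nth R'_def)

definition "q0 = bstart (bl ! 0)"
definition "q1 = bend (bl ! 3)"

lemma q01: "{q0,q1} = {n,v}" "q0 \<in> U'" "q1 \<in> U'" "q0 ~= q1"
proof -
  have "v ~= n" using n v by auto
  moreover have "q0 = (if clab ph0 k0 \<in> c then n else v)" using bl_start[of 0] ph0 by (simp add: q0_def)
  moreover have "q1 = (if clab ph0 ((k0 + 3) mod 4) \<in> c then n else v)"
  proof -
    have "(k0 + 3 + 1) mod 4 = k0" using ph0(2) by presburger
    then show ?thesis using bl_end[of 3] ph0 by (simp add: q1_def)
  qed
  ultimately show "{q0,q1} = {n,v}" "q0 \<in> U'" "q1 \<in> U'" "q0 ~= q1"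
    using ph0(4) v by (auto simp: chgc_def U'_def)
qed

lemma bl_adj: "j < 4 ==> (bstart (bl ! j), bend (bl ! j)) \<in> adj R'"
  using bl_R[of j] by (auto simp: adj_def bstart_def bend_def)

text \<open>The opened boundary of the lost face joins the two copies, so splitting never
  disconnects.\<close>

lemma nv: "(n,v) \<in> (adj R')\<^sup>*"
proof -
  have "(q0,q1) \<in> (adj R')\<^sup>*"
    using bl_adj[of 0] bl_adj[of 1] bl_adj[of 2] bl_adj[of 3] bl_match[of 0] bl_match[of 1] bl_match[of 2]
    unfolding q0_def q1_def
    by (simp add: numeral_2_eq_2 numeral_3_eq_3)
  then show ?thesis using q01(1) adj_sym by (auto simp: doubleton_eq_iff)
qed

lemma conn': assumes "conn U R" shows "conn U' R'"
proof -
  have step: "(u,w) \<in> (adj R')\<^sup>*" if uw: "(u,w) \<in> adj R" for u w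
  proof -
    obtain a where a: "a \<in> R" "esrc a = u \<and> etgt a = w \<or> esrc a = w \<and> etgt a = u" using uw unfolding adj_def by blast
    have "(esrc (sE a), etgt (sE a)) \<in> adj R'" using a(1) unfolding adj_def R'_def by blast
    then have "(esrc (sE a), etgt (sE a)) \<in> (adj R')\<^sup>*" by (rule r_into_rtrancl)
    moreover have "(esrc a, esrc (sE a)) \<in> (adj R')\<^sup>*" "(etgt (sE a), etgt a) \<in> (adj R')\<^sup>*"
      using nv adj_sym[OF nv] by (simp_all add: ends_sE)
    ultimately have "(esrc a, etgt a) \<in> (adj R')\<^sup>*" using rtrancl_trans by metis
    then show ?thesis using a(2) adj_sym by metis
  qed
  then have "(adj R)\<^sup>* \<subseteq> (adj R')\<^sup>*" by (intro rtrancl_subset_rtrancl subrelI)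
  then have "(u,w) \<in> (adj R')\<^sup>*" if "u \<in> U" "w \<in> U" for u w using assms that unfolding conn_def by blast
  then show ?thesis using nv adj_sym[OF nv] v unfolding conn_def U'_def
    by (metis insertE rtrancl.rtrancl_refl rtrancl_trans)
qed

text \<open>The relator has exponent sum 0, so the opened boundary ends at the height at which it
  starts. Thus \<open>n\<close> and \<open>v\<close> are equally high and the height
  descends.\<close>

lemma Ht': assumes "Ht R'" shows "Ht R"
proof -
  obtain h :: "'u => int" where h: "!!a. a \<in> R' ==> h (etgt a) = h (esrc a) + 1" using assms by (auto simp: Ht_def)
  have st: "h (bend (bl ! j)) = h (bstart (bl ! j)) + (if snd (bl ! j) then 1 else -1)" if "j < 4" for j
    using h[OF bl_R[OF that]] by (auto simp: bend_def bstart_def)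
  obtain u0 u1 u2 u3 x z y where f: "ph0 = ((u0,u1,u2,u3),(x,z,y))" by (metis prod.exhaust)
  define D where "D k = (if snd (bd ph0 ! k) then 1 else -1 :: int)" for k
  have D: "D 0 = 1" "D 1 = 1" "D 2 = -1" "D 3 = -1" unfolding f D_def by (simp_all add: bd_def)
  have d: "h (bend (bl ! j)) = h (bstart (bl ! j)) + D ((k0 + j) mod 4)" if "j < 4" for j
    using st[OF that] bl_nth[OF that] by (simp add: D_def)
  have "D (k0 mod 4) + D ((k0 + 1) mod 4) + D ((k0 + 2) mod 4) + D ((k0 + 3) mod 4) = 0"
  proof -
    consider "k0 = 0" | "k0 = 1" | "k0 = 2" | "k0 = 3" using less_4_cases[OF ph0(2)] by blast
    then show ?thesis
    proof cases
      case 1 have "k0 mod 4 = 0" "(k0 + 1) mod 4 = 1" "(k0 + 2) mod 4 = 2" "(k0 + 3) mod 4 = 3" using 1 by auto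
      then show ?thesis by (simp only: D)
    next
      case 2 have "k0 mod 4 = 1" "(k0 + 1) mod 4 = 2" "(k0 + 2) mod 4 = 3" "(k0 + 3) mod 4 = 0" using 2 by auto
      then show ?thesis by (simp only: D)
    next
      case 3 have "k0 mod 4 = 2" "(k0 + 1) mod 4 = 3" "(k0 + 2) mod 4 = 0" "(k0 + 3) mod 4 = 1" using 3 by auto
      then show ?thesis by (simp only: D)
    next
      case 4 have "k0 mod 4 = 3" "(k0 + 1) mod 4 = 0" "(k0 + 2) mod 4 = 1" "(k0 + 3) mod 4 = 2" using 4 by auto
      then show ?thesis by (simp only: D)
    qed
  qed
  moreover have "h (bend (bl ! 0)) = h (bstart (bl ! 1))" "h (bend (bl ! 1)) = h (bstart (bl ! 2))" "h (bend (bl ! 2)) = h (bstart (bl ! 3))"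
    using bl_match[of 0] bl_match[of 1] bl_match[of 2] by (simp_all add: numeral_2_eq_2 numeral_3_eq_3)
  moreover have "h (bend (bl ! 0)) = h (bstart (bl ! 0)) + D (k0 mod 4)" "h (bend (bl ! 1)) = h (bstart (bl ! 1)) + D ((k0 + 1) mod 4)"
    "h (bend (bl ! 2)) = h (bstart (bl ! 2)) + D ((k0 + 2) mod 4)" "h (bend (bl ! 3)) = h (bstart (bl ! 3)) + D ((k0 + 3) mod 4)"
    using d[of 0] d[of 1] d[of 2] d[of 3] by simp_all
  ultimately have "h q1 = h q0" unfolding q0_def q1_def by linarith
  then have nv: "h n = h v" using q01(1) by (auto simp: doubleton_eq_iff)
  have "h (etgt a) = h (esrc a) + 1" if "a \<in> R" for a
    using h[of "sE a"] that nv by (simp add: R'_def ends_sE split: if_splits)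
  then show ?thesis unfolding Ht_def by blast
qed

lemma null':
  assumes h: "nullhtpy Z proj Base U' R' Ph' h" and rc: "continuous_map (top_of_set (cball 0 1)) Z (\<lambda>p. proj (charF ph0 p))"
  shows "\<exists>h. nullhtpy Z proj Base U R Ph h"
proof (rule nullhtpy_detach[OF wf' wf, of \<rho> ph0 q0 q1 proj Base Z "lpath bl" "real k0"])
  show "U = \<rho> ` U'" using n v by (auto simp: \<rho>_def U'_def)
  show "R = renE \<rho> ` R'" using ren_sE by (auto simp: R'_def image_image)
  have "renF \<rho> ` Ph' = Ph - {ph0}" using ren_sF by (force simp: Ph'_def image_image)
  then show "Ph = insert ph0 (renF \<rho> ` Ph')" "ph0 \<notin> renF \<rho> ` Ph'" using ph0 by auto
  show "inj_on (renE \<rho>) R'" unfolding R'_def inj_on_def by (metis imageE ren_sE)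
  show "inj_on (renF \<rho>) Ph'" unfolding Ph'_def inj_on_def by (metis DiffD1 imageE ren_sF)
  show "u = u' \<or> {u,u'} = {q0,q1}" if "u \<in> U'" "u' \<in> U'" "\<rho> u = \<rho> u'" for u u'
    using that q01(1) by (auto simp: \<rho>_def split: if_splits)
  show "continuous_map (top_of_set {0..4}) (LT U' R' Ph') (lpath bl)"
    by (rule continuous_lpath[OF wf' bl_R bl_match])
  show "lpath bl 0 = LV q0" "lpath bl 4 = LV q1" using lpath_ends[OF bl_match] by (auto simp: q0_def q1_def)
  show "renP \<rho> (lpath bl t) = charF ph0 (e4 (t + real k0))" if t: "t \<in> {0..4}" for t
  proof -
    define j where "j = (if t = 4 then 3 else nat \<lfloor>t\<rfloor>)"
    have j: "j < 4" "real j <= t" "t <= real j + 1" using t by (auto simp: j_def nat_less_iff floor_less_iff)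
    define i where "i = (k0 + j) mod 4"
    \<comment> \<open>\<open>s\<close> is \<open>t + k0\<close> reduced modulo 4, kept in the closed
      arc \<open>i\<close> so that the arc formula also covers its end point.\<close>
    define s where "s = (if k0 + j < 4 then t + real k0 else t + real k0 - 4)"
    have "i < 4" by (simp add: i_def)
    have i: "i = k0 + j \<and> k0 + j < 4 \<or> i + 4 = k0 + j \<and> \<not> k0 + j < 4" using j(1) ph0(2) unfolding i_def by presburger
    then have si: "s - real i = t - real j" "real i <= s" "s <= real i + 1" using j by (auto simp: s_def)
    have "e4 (t + real k0) = e4 s"
      using e4_add[of "t + real k0 - 4" 4] by (simp add: s_def)
    moreover have "s \<in> {0..4}" using si \<open>i < 4\<close> by auto
    ultimately have "charF ph0 (e4 (t + real k0)) = barc ph0 i (t - real j)"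
      using charF_cis[of s ph0] bdpt_barc[OF \<open>i < 4\<close> si(2,3)] si(1) by (simp add: e4_def)
    moreover have "renP \<rho> (lpath bl t) = barc ph0 i (t - real j)"
      using lpath_piece[of bl j t, OF bl_match j] bl_nth[OF j(1)] ren_sE[OF bd_R[OF ph0(1) \<open>i < 4\<close>]]
      by (simp add: renP_charE barc_def flip: i_def)
    ultimately show ?thesis by simp
  qed
  show "nullhtpy Z (\<lambda>q. proj (renP \<rho> q)) Base U' R' Ph' h" using h by (simp add: proj_renP)
qed (use q01 rc in auto)

end

section \<open>Immersions and their pieces\<close>

lemma cxD:
  assumes "cx V E U R Ph"
  shows "finite U" "finite R" "finite Ph" "wf_cx U R Ph" "a \<in> R ==> esrc a \<in> U" "a \<in> R ==> etgt a \<in> U" "a \<in> R ==> elab a \<in> V"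
    "ph \<in> Ph ==> snd ph \<in> E" "ph \<in> Ph ==> k < 4 ==> fst (bd ph ! k) \<in> R"
    "a \<in> R ==> a' \<in> R ==> elab a = elab a' ==> esrc a = esrc a' \<longleftrightarrow> etgt a = etgt a'"
proof -
  show "finite U" "finite R" "finite Ph" "wf_cx U R Ph" "a \<in> R ==> esrc a \<in> U" "a \<in> R ==> etgt a \<in> U" "a \<in> R ==> elab a \<in> V"
    "ph \<in> Ph ==> snd ph \<in> E" "a \<in> R ==> a' \<in> R ==> elab a = elab a' ==> esrc a = esrc a' \<longleftrightarrow> etgt a = etgt a'"
    using assms unfolding cx_def wf_cx_def by blast+
  show "fst (bd ph ! k) \<in> R" if "ph \<in> Ph" "k < 4"
  proof -
    have "bd ph ! k \<in> set (bd ph)" using that by (intro nth_mem) simp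
    then show ?thesis using that assms unfolding cx_def wf_cx_def by blast
  qed
qed

lemma edge_eqI: "esrc a = esrc b ==> elab a = elab b ==> etgt a = etgt b ==> a = b"
  by (cases a; cases b) (simp add: esrc_def elab_def etgt_def)

lemma cx_edge_eq:
  assumes "cx V E U R Ph" "a \<in> R" "b \<in> R" "elab a = elab b" "esrc a = esrc b \<or> etgt a = etgt b" shows "a = b"
  using cxD(10)[OF assms(1-4)] assms(4,5) edge_eqI by blast

lemma bd_sgn: "snd (bd ph ! 0)" "snd (bd ph ! 1)" "\<not> snd (bd ph ! 2)" "\<not> snd (bd ph ! 3)"
  by (simp_all add: bd_def split: prod.splits)

lemma bd_sgn_eq: "k < 4 ==> snd (bd ph ! k) = snd (bd \<psi> ! k)"
  using less_4_cases[of k] bd_sgn by metis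

text \<open>In an immersed complex a label and a start determine the next edge of the boundary, so
  the boundary develops from one corner.\<close>

lemma cx_face_eq:
  assumes cx: "cx V E U R Ph" and f: "ph \<in> Ph" "\<psi> \<in> Ph" and l: "snd ph = snd \<psi>" and k: "k < 4" "corner ph k = corner \<psi> k"
  shows "ph = \<psi>"
proof -
  have step: "corner ph (Suc j mod 4) = corner \<psi> (Suc j mod 4)" if j: "j < 4" "corner ph j = corner \<psi> j" for j
  proof -
    have "fst (bd ph ! j) = fst (bd \<psi> ! j)"
    proof (rule cx_edge_eq[OF cx cxD(9)[OF cx f(1) j(1)] cxD(9)[OF cx f(2) j(1)]])
      show "elab (fst (bd ph ! j)) = elab (fst (bd \<psi> ! j))" using clab_eq[OF l j(1)] by (simp add: clab_def)
      show "esrc (fst (bd ph ! j)) = esrc (fst (bd \<psi> ! j)) \<or> etgt (fst (bd ph ! j)) = etgt (fst (bd \<psi> ! j))"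
        using bd_ends(1)[OF j(1), of ph] bd_ends(1)[OF j(1), of \<psi>] j(2) bd_sgn_eq[OF j(1), of ph \<psi>]
        by (auto simp: bstart_def split: if_splits)
    qed
    then have "bd ph ! j = bd \<psi> ! j" using bd_sgn_eq[OF j(1), of ph \<psi>] by (rule prod_eqI)
    then show ?thesis using bd_ends(2)[OF j(1), of ph] bd_ends(2)[OF j(1), of \<psi>] by simp
  qed
  have n: "corner ph ((k + m) mod 4) = corner \<psi> ((k + m) mod 4)" for m
  proof (induction m)
    case (Suc m) then show ?case using step[of "(k + m) mod 4"] by (simp add: mod_Suc_eq)
  qed (use k in simp)
  show ?thesis
  proof (rule face_eqI[OF _ l])
    fix j :: nat assume "j < 4"
    then have "(k + (j + 4 - k)) mod 4 = j" using k(1) by simp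
    then show "corner ph j = corner \<psi> j" using n[of "j + 4 - k"] by simp
  qed
qed

lemma comp_refl [simp]: "u \<in> comp R c u" by (simp add: comp_def)

lemma comp_eq: "w \<in> comp R c u ==> comp R c w = comp R c u"
  unfolding comp_def by (auto dest: adj_sym intro: rtrancl_trans)

lemma comp_step: "a \<in> R ==> elab a \<in> c ==> comp R c (esrc a) = comp R c (etgt a)"
proof -
  assume "a \<in> R" "elab a \<in> c"
  then have "(etgt a, esrc a) \<in> adj (Rl R c)" unfolding adj_def Rl_def by blast
  then show ?thesis by (intro comp_eq) (auto simp: comp_def)
qed

lemma comp_sub: assumes "cx V E U R Ph" "u \<in> U" shows "comp R c u \<subseteq> U"
proof
  fix w assume "w \<in> comp R c u"
  then have "(u,w) \<in> (adj (Rl R c))\<^sup>*" by (simp add: comp_def)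
  then show "w \<in> U"
  proof (induction rule: rtrancl_induct)
    case (step y z)
    then obtain a where "a \<in> R" "esrc a = z \<or> etgt a = z" unfolding adj_def Rl_def by blast
    then show ?case using cxD(5,6)[OF assms(1)] by blast
  qed (use assms in simp)
qed

lemma piece_cx:
  assumes cx: "cx V E U R Ph" and u: "u \<in> U" and C: "C = comp R c u"
  shows "cx (V \<inter> c) {e\<in>E. {fst e, fst (snd e), snd (snd e)} \<subseteq> c} C (Rp R c C) (Fp Ph c C)" "conn C (Rp R c C)"
proof -
  have tg: "esrc a \<in> C \<longleftrightarrow> etgt a \<in> C" if "a \<in> R" "elab a \<in> c" for a
    using comp_step[OF that] comp_eq unfolding C by (metis comp_refl)
  have wf: "wf_cx C (Rp R c C) (Fp Ph c C)"
    unfolding wf_cx_def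
  proof (intro conjI ballI)
    fix a assume "a \<in> Rp R c C" then show "esrc a \<in> C" "etgt a \<in> C" using tg[of a] by (auto simp: Rp_def)
  next
    fix ph assume f: "ph \<in> Fp Ph c C"
    then have p: "ph \<in> Ph" "labs ph \<subseteq> c" "corner ph 0 \<in> C" by (auto simp: Fp_def)
    have cl: "clab ph k \<in> c" if "k < 4" for k
    proof -
      obtain u0 u1 u2 u3 x z y where "ph = ((u0,u1,u2,u3),(x,z,y))" by (metis prod.exhaust)
      then show ?thesis using p(2) less_4_cases[OF that] by (elim disjE; simp add: clab_def labs_def bd_def elab_def)
    qed
    have cc: "corner ph k \<in> C \<and> fst (bd ph ! k) \<in> Rp R c C" if "k < 4" for k
      using that
    proof (induction k)
      case 0
      have "fst (bd ph ! 0) \<in> R" "elab (fst (bd ph ! 0)) \<in> c" using cxD(9)[OF cx p(1)] cl[of 0] by (auto simp: clab_def)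
      then show ?case using p(3) bd_ends(1)[of 0 ph] bd_sgn[of ph] by (simp add: Rp_def bstart_def)
    next
      case (Suc k)
      then have IH: "fst (bd ph ! k) \<in> Rp R c C" by simp
      then have e: "esrc (fst (bd ph ! k)) \<in> C" "etgt (fst (bd ph ! k)) \<in> C" using tg[of "fst (bd ph ! k)"] by (simp_all add: Rp_def)
      have a: "fst (bd ph ! Suc k) \<in> R" "elab (fst (bd ph ! Suc k)) \<in> c" using cxD(9)[OF cx p(1) Suc.prems] cl[OF Suc.prems] by (auto simp: clab_def)
      have "corner ph (Suc k) \<in> C" using bd_ends(2)[of k ph] Suc.prems e by (auto simp: bend_def split: if_splits)
      moreover have "esrc (fst (bd ph ! Suc k)) \<in> C"
        using bd_ends(1)[OF Suc.prems, of ph] calculation tg[OF a] by (auto simp: bstart_def split: if_splits)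
      ultimately show ?case using a by (simp add: Rp_def)
    qed
    show "fst ` set (bd ph) \<subseteq> Rp R c C"
    proof
      fix a assume "a \<in> fst ` set (bd ph)"
      then obtain b where "b \<in> set (bd ph)" "a = fst b" by blast
      then obtain k where "k < 4" "a = fst (bd ph ! k)" unfolding in_set_conv_nth by auto
      then show "a \<in> Rp R c C" using cc by blast
    qed
  qed
  have "C \<subseteq> U" using comp_sub[OF cx u] C by simp
  then have "finite C" using cxD(1)[OF cx] finite_subset by blast
  moreover have "finite (Rp R c C)" "finite (Fp Ph c C)" using cxD(2,3)[OF cx] by (simp_all add: Rp_def Fp_def)
  moreover have "elab ` Rp R c C \<subseteq> V \<inter> c" using cxD(7)[OF cx] unfolding Rp_def by blast
  moreover have "snd ` Fp Ph c C \<subseteq> {e\<in>E. {fst e, fst (snd e), snd (snd e)} \<subseteq> c}" using cxD(8)[OF cx] unfolding Fp_def labs_def by blast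
  moreover have "\<forall>a\<in>Rp R c C. \<forall>a'\<in>Rp R c C. elab a = elab a' --> (esrc a = esrc a' \<longleftrightarrow> etgt a = etgt a')"
    using cxD(10)[OF cx] unfolding Rp_def by blast
  ultimately show "cx (V \<inter> c) {e\<in>E. {fst e, fst (snd e), snd (snd e)} \<subseteq> c} C (Rp R c C) (Fp Ph c C)"
    unfolding cx_def using wf by (intro conjI)
  have st: "(u,w) \<in> (adj (Rp R c C))\<^sup>*" if "w \<in> C" for w
  proof -
    have "(u,w) \<in> (adj (Rl R c))\<^sup>*" using that by (simp add: C comp_def)
    then show ?thesis
    proof (induction rule: rtrancl_induct)
      case (step y z)
      then obtain a where a: "a \<in> R" "elab a \<in> c" "esrc a = y \<and> etgt a = z \<or> esrc a = z \<and> etgt a = y" unfolding adj_def Rl_def by blast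
      have "y \<in> C" using step.hyps(1) by (simp add: C comp_def)
      then have "a \<in> Rp R c C" using a tg[OF a(1,2)] by (auto simp: Rp_def)
      then have "(y,z) \<in> adj (Rp R c C)" using a(3) unfolding adj_def by blast
      then show ?case using step.IH by (rule rtrancl_into_rtrancl[rotated])
    qed simp
  qed
  show "conn C (Rp R c C)" unfolding conn_def using st adj_sym rtrancl_trans by metis
qed

text \<open>Distinct pieces are disjoint, and a face labelled inside \<open>c\<close> belongs to the
  piece of its corner 0. \<open>D\<close> omits vertices on no \<open>c\<close>-edge, whose pieces
  would be points.\<close>

lemma sum_components:
  assumes cx: "cx V E U R Ph" and D: "D = {u. \<exists>a\<in>R. elab a \<in> c \<and> (esrc a = u \<or> etgt a = u)}"
  shows "int (card D) - int (card (Rl R c)) + int (card {ph\<in>Ph. labs ph \<subseteq> c}) = (\<Sum>C\<in>comp R c ` D. chip R Ph c C)"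
proof -
  have DU: "D \<subseteq> U" using cxD(5,6)[OF cx] unfolding D by blast
  have finD: "finite D" using DU cxD(1)[OF cx] finite_subset by blast
  have CD: "comp R c u \<subseteq> D" if "u \<in> D" for u
  proof
    fix w assume "w \<in> comp R c u"
    then have "(u,w) \<in> (adj (Rl R c))\<^sup>*" by (simp add: comp_def)
    then show "w \<in> D"
    proof (cases rule: rtranclE)
      case (step y)
      then obtain a where "a \<in> R" "elab a \<in> c" "esrc a = w \<or> etgt a = w" unfolding adj_def Rl_def by blast
      then show ?thesis unfolding D by blast
    qed (use that in simp)
  qed
  let ?K = "comp R c ` D"
  have finK: "finite ?K" using finD by simp
  have disj: "C \<inter> C' = {}" if "C \<in> ?K" "C' \<in> ?K" "C ~= C'" for C C'
  proof (rule ccontr)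
    assume "C \<inter> C' ~= {}"
    then obtain w where "w \<in> C" "w \<in> C'" by blast
    then show False using that comp_eq by (metis (no_types, lifting) imageE)
  qed
  have D1: "D = \<Union>?K" using CD comp_refl by fastforce
  have "card D = (\<Sum>C\<in>?K. card C)"
  proof (subst D1, rule card_Union_disjoint)
    show "finite C" if "C \<in> ?K" for C using that CD finD finite_subset by blast
  qed (use disj in \<open>auto simp: pairwise_def disjnt_def\<close>)
  moreover have "card (Rl R c) = (\<Sum>C\<in>?K. card (Rp R c C))"
  proof -
    have "Rl R c = (\<Union>C\<in>?K. Rp R c C)"
      unfolding Rl_def Rp_def D using comp_refl by fastforce
    moreover have "card (\<Union>C\<in>?K. Rp R c C) = (\<Sum>C\<in>?K. card (Rp R c C))"
    proof (rule card_UN_disjoint[OF finK]; intro ballI impI)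
      show "finite (Rp R c C)" for C using cxD(2)[OF cx] by (simp add: Rp_def)
      show "Rp R c C \<inter> Rp R c C' = {}" if "C \<in> ?K" "C' \<in> ?K" "C ~= C'" for C C' using disj[OF that] unfolding Rp_def by blast
    qed
    ultimately show ?thesis by simp
  qed
  moreover have "card {ph\<in>Ph. labs ph \<subseteq> c} = (\<Sum>C\<in>?K. card (Fp Ph c C))"
  proof -
    have "corner ph 0 \<in> D" if "ph \<in> Ph" "labs ph \<subseteq> c" for ph
    proof -
      obtain u0 u1 u2 u3 x z y where f: "ph = ((u0,u1,u2,u3),(x,z,y))" by (metis prod.exhaust)
      have "(u0,x,u1) \<in> R" using cxD(9)[OF cx that(1), of 0] unfolding f by (simp add: bd_def)
      then show ?thesis using that(2) unfolding D f by (force simp: labs_def corner_def elab_def esrc_def)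
    qed
    then have "{ph\<in>Ph. labs ph \<subseteq> c} = (\<Union>C\<in>?K. Fp Ph c C)"
      unfolding Fp_def using comp_refl D1 by fastforce
    moreover have "card (\<Union>C\<in>?K. Fp Ph c C) = (\<Sum>C\<in>?K. card (Fp Ph c C))"
    proof (rule card_UN_disjoint[OF finK]; intro ballI impI)
      show "finite (Fp Ph c C)" for C using cxD(3)[OF cx] by (simp add: Fp_def)
      show "Fp Ph c C \<inter> Fp Ph c C' = {}" if "C \<in> ?K" "C' \<in> ?K" "C ~= C'" for C C' using disj[OF that] unfolding Fp_def by blast
    qed
    ultimately show ?thesis by simp
  qed
  ultimately show ?thesis by (simp add: chip_def chi_def sum.distrib sum_subtractf)
qed

section \<open>Counting corners\<close>

definition Iv :: "'v set set => ('u,'v) edge set => 'u => 'v set set" where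
  "Iv \<P> R v = {c\<in>\<P>. \<exists>a\<in>R. elab a \<in> c \<and> (esrc a = v \<or> etgt a = v)}"

lemma ex_max: "finite A ==> A ~= {} ==> \<exists>t\<in>A. \<forall>x\<in>A. f x <= f t" for f :: "'a => 'b::linorder"
proof -
  assume "finite A" "A ~= {}"
  then have "Max (f ` A) \<in> f ` A" "!!x. x \<in> A ==> f x <= Max (f ` A)" by auto
  then show ?thesis by (elim imageE) (rule bexI, auto)
qed

lemma ex_min: "finite A ==> A ~= {} ==> \<exists>t\<in>A. \<forall>x\<in>A. f t <= f x" for f :: "'a => 'b::linorder"
proof -
  assume "finite A" "A ~= {}"
  then have "Min (f ` A) \<in> f ` A" "!!x. x \<in> A ==> Min (f ` A) <= f x" by auto
  then show ?thesis by (elim imageE) (rule bexI, auto)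
qed

definition sgd :: "bool => int" where "sgd d = (if d then 1 else -1)"

text \<open>Abstract form of the count. A mixed face is owned by the class \<open>zc ph\<close>. The
  boolean \<open>d\<close> is a direction, up or down: \<open>pos d ph\<close> is the corner from
  which both neighbouring pieces lead on in direction \<open>d\<close>, and \<open>oc d ph\<close>
  is the second class there. \<open>rk d\<close> drops from the owner to the second class, which
  makes the corners at one vertex a forest on the classes. \<open>transit\<close> says that any
  other corner except the opposite one still has a piece leading on in direction
  \<open>d\<close>.\<close>

locale count =
  fixes V :: "'v set" and E and U :: "'u set" and R Ph and \<P> :: "'v set set"
    and zc :: "('u,'v) face => 'v set" and pos :: "bool => ('u,'v) face => nat" and oc :: "bool => ('u,'v) face => 'v set"
    and rk :: "bool => 'v set => nat" and ht :: "'v set => 'u => int" and N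
  assumes cx: "cx V E U R Ph" and finP: "finite \<P>" and disjP: "!!c c'. c \<in> \<P> ==> c' \<in> \<P> ==> c ~= c' ==> c \<inter> c' = {}"
    and coverP: "V \<subseteq> \<Union>\<P>" and N_def: "N = {ph\<in>Ph. \<not> (\<exists>c\<in>\<P>. labs ph \<subseteq> c)}"
    and noniso: "!!v. v \<in> U ==> Iv \<P> R v ~= {}"
    and zc_inj: "!!ph \<psi>. ph \<in> N ==> \<psi> \<in> N ==> zc ph = zc \<psi> ==> snd ph = snd \<psi>"
    and pos4: "!!d ph. ph \<in> N ==> pos d ph < 4" and pos_snd: "!!d ph \<psi>. snd ph = snd \<psi> ==> pos d ph = pos d \<psi>"
    and zcI: "!!d ph. ph \<in> N ==> zc ph \<in> Iv \<P> R (corner ph (pos d ph))" and ocI: "!!d ph. ph \<in> N ==> oc d ph \<in> Iv \<P> R (corner ph (pos d ph))"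
    and rk: "!!d ph. ph \<in> N ==> rk d (oc d ph) < rk d (zc ph)"
    and labpos: "!!d ph x k. ph \<in> N ==> k = pos d ph ==> x \<in> {clab ph k, clab ph ((k + 3) mod 4)} ==> x \<in> zc ph \<or> x \<in> oc d ph"
    and labchg: "!!d ph. ph \<in> N ==> chgc (zc ph) ph (pos d ph)"
    and up: "!!d ph c. ph \<in> N ==> c = zc ph \<or> c = oc d ph ==> 1 <= chip R Ph c (comp R c (corner ph (pos d ph))) ==>
        \<exists>w\<in>comp R c (corner ph (pos d ph)). 2 <= card (Iv \<P> R w) \<and> sgd d * ht c (corner ph (pos d ph)) < sgd d * ht c w"
    and transit: "!!d ph c k. ph \<in> N ==> k < 4 ==> c \<in> \<P> ==> chgc c ph k ==> k ~= pos (\<not> d) ph ==>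
        \<exists>c'\<in>Iv \<P> R (corner ph k). 1 <= chip R Ph c' (comp R c' (corner ph k)) -->
          (\<exists>w\<in>comp R c' (corner ph k). 2 <= card (Iv \<P> R w) \<and> sgd d * ht c' (corner ph k) < sgd d * ht c' w)"
    and chip1: "!!c u. c \<in> \<P> ==> u \<in> U ==> chip R Ph c (comp R c u) <= 1"
    and two: "!!c u. c \<in> Iv \<P> R u ==> 1 <= chip R Ph c (comp R c u) ==>
        \<exists>w w'. w ~= w' \<and> w \<in> comp R c u \<and> w' \<in> comp R c u \<and> 2 <= card (Iv \<P> R w) \<and> 2 <= card (Iv \<P> R w')"
begin

abbreviation "I \<equiv> Iv \<P> R"
abbreviation "good c v \<equiv> 1 <= chip R Ph c (comp R c v)"
abbreviation "cor d ph \<equiv> corner ph (pos d ph)"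

lemma finI: "finite (I v)" using finP by (simp add: Iv_def)
lemma IvU: "c \<in> I v ==> v \<in> U" using cxD(5,6)[OF cx] unfolding Iv_def by blast
lemma IP: "c \<in> I v ==> c \<in> \<P>" by (simp add: Iv_def)
lemma I_comp:
  assumes "c \<in> I u" "w \<in> comp R c u" shows "c \<in> I w"
proof -
  have "(u, w) \<in> (adj (Rl R c))\<^sup>*" using assms(2) by (simp add: comp_def)
  then show ?thesis
  proof (cases rule: rtranclE)
    case (step y)
    then obtain b where "b \<in> R" "elab b \<in> c" "esrc b = w \<or> etgt b = w" unfolding adj_def Rl_def by blast
    then show ?thesis using IP[OF assms(1)] unfolding Iv_def by blast
  qed (use assms in simp)
qed
lemma finN: "finite N" using cxD(3)[OF cx] by (simp add: N_def)
lemma NF: "ph \<in> N ==> ph \<in> Ph" by (simp add: N_def)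

text \<open>Top and bottom must be different vertices. If one attached vertex is both highest and
  lowest, all have the same height and a second one can serve as bottom.\<close>

lemma ext_exists:
  assumes "c \<in> I u" "good c u"
  shows "\<exists>x. x True ~= x False \<and> (\<forall>d. x d \<in> comp R c u \<and> 2 <= card (I (x d)) \<and>
     (\<forall>w\<in>comp R c u. 2 <= card (I w) --> sgd d * ht c w <= sgd d * ht c (x d)))"
proof -
  let ?A = "{w\<in>comp R c u. 2 <= card (I w)}"
  have fin: "finite ?A" using comp_sub[OF cx IvU[OF assms(1)]] cxD(1)[OF cx] finite_subset by fastforce
  obtain w w' where w: "w ~= w'" "w \<in> ?A" "w' \<in> ?A" using two[OF assms] by blast
  then have ne: "?A ~= {}" by blast
  obtain t where t: "t \<in> ?A" "!!x. x \<in> ?A ==> ht c x <= ht c t"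
    using ex_max[OF fin ne, of "ht c"] by blast
  obtain b where b: "b \<in> ?A" "!!x. x \<in> ?A ==> ht c b <= ht c x"
    using ex_min[OF fin ne, of "ht c"] by blast
  have "\<exists>b'. b' \<in> ?A \<and> b' ~= t \<and> (\<forall>x\<in>?A. ht c b' <= ht c x)"
  proof (cases "b = t")
    case True
    obtain z where z: "z \<in> ?A" "z ~= t" using w by metis
    have "ht c z <= ht c x" if "x \<in> ?A" for x using t(2)[OF z(1)] b(2)[OF that] True by simp
    then show ?thesis using z by blast
  next
    case False then show ?thesis using b by blast
  qed
  then obtain b' where b': "b' \<in> ?A" "b' ~= t" "!!x. x \<in> ?A ==> ht c b' <= ht c x" by blast
  show ?thesis
    using t b' by (intro exI[of _ "\<lambda>d. if d then t else b'"]) (auto simp: sgd_def)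
qed

text \<open>Chosen for the piece as a set, so every good piece is charged at exactly one vertex per
  direction.\<close>

definition "xt c C = (SOME x. x True ~= x False \<and> (\<forall>d. x d \<in> C \<and> 2 <= card (I (x d)) \<and>
     (\<forall>w\<in>C. 2 <= card (I w) --> sgd d * ht c w <= sgd d * ht c (x d))))"

lemma xt:
  assumes "c \<in> I u" "good c u"
  shows "xt c (comp R c u) True ~= xt c (comp R c u) False" "xt c (comp R c u) d \<in> comp R c u" "2 <= card (I (xt c (comp R c u) d))"
    "w \<in> comp R c u ==> 2 <= card (I w) ==> sgd d * ht c w <= sgd d * ht c (xt c (comp R c u) d)"
  using someI_ex[OF ext_exists[OF assms]] unfolding xt_def[symmetric] by blast+

definition "Tops d v = {c\<in>I v. good c v \<and> xt c (comp R c v) d = v}"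

lemma top_max: "c \<in> Tops d v ==> w \<in> comp R c v ==> 2 <= card (I w) ==> sgd d * ht c w <= sgd d * ht c v"
  using xt(4)[of c v w d] by (auto simp: Tops_def)

definition "S d v = {ph\<in>N. cor d ph = v}"

text \<open>A class owns at most one relator, and a face of an immersed complex is determined by its
  relator and one corner.\<close>

lemma zc_S: "inj_on zc (S d v)"
proof (rule inj_onI)
  fix ph \<psi> assume a: "ph \<in> S d v" "\<psi> \<in> S d v" "zc ph = zc \<psi>"
  then have l: "snd ph = snd \<psi>" by (intro zc_inj) (auto simp: S_def)
  show "ph = \<psi>"
    by (rule cx_face_eq[OF cx _ _ l, of "pos d ph"]) (use a l pos_snd[OF l] pos4 NF in \<open>auto simp: S_def\<close>)
qed

text \<open>By \<open>up\<close> both pieces at a \<open>d\<close>-corner reach further in direction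
  \<open>d\<close>, so neither can have its extremum there.\<close>

lemma iso: "ph \<in> S d v ==> zc ph \<in> I v - Tops d v" "ph \<in> S d v ==> oc d ph \<in> I v - Tops d v"
proof -
  assume s: "ph \<in> S d v"
  then have n: "ph \<in> N" "cor d ph = v" by (auto simp: S_def)
  have "c \<notin> Tops d v" if "c = zc ph \<or> c = oc d ph" for c
  proof
    assume t: "c \<in> Tops d v"
    then have "good c (cor d ph)" using n by (auto simp: Tops_def)
    from up[OF n(1) that this] obtain w where w: "w \<in> comp R c v" "2 <= card (I w)" "sgd d * ht c v < sgd d * ht c w" using n by auto
    then show False using top_max[OF t w(1,2)] by simp
  qed
  then show "zc ph \<in> I v - Tops d v" "oc d ph \<in> I v - Tops d v" using zcI[OF n(1), of d] ocI[OF n(1), of d] n(2) by auto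
qed

lemma cardS: "card (S d v) = card (zc ` S d v)" using card_image[OF zc_S] by simp

text \<open>The forest inequality: sending a corner to its owner is injective into the classes not
  extremal at \<open>v\<close>, and it misses one of least rank because the second class would have
  still smaller rank.\<close>

lemma S_bound: assumes "Tops d v ~= I v" shows "int (card (S d v)) <= int (card (I v)) - int (card (Tops d v)) - 1"
proof -
  let ?J = "I v - Tops d v"
  have fJ: "finite ?J" "?J ~= {}" using finI assms by (auto simp: Tops_def)
  obtain m where m: "m \<in> ?J" "!!c. c \<in> ?J ==> rk d m <= rk d c"
    using ex_min[OF fJ, of "rk d"] by blast
  have "m \<notin> zc ` S d v"
  proof
    assume "m \<in> zc ` S d v"
    then obtain ph where f: "ph \<in> S d v" "m = zc ph" by blast
    then have "rk d (oc d ph) < rk d m" using rk[of ph d] by (simp add: S_def)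
    then show False using m(2)[OF iso(2)[OF f(1)]] by simp
  qed
  then have "zc ` S d v \<subseteq> ?J - {m}" using iso(1) by blast
  then have "card (S d v) <= card (?J - {m})" unfolding cardS using fJ by (intro card_mono) auto
  also have "card (?J - {m}) = card (I v) - card (Tops d v) - 1"
    using m fJ finI[of v] by (simp add: Tops_def card_Diff_subset)
  finally have "card (S d v) <= card (I v) - card (Tops d v) - 1" .
  moreover have "card (Tops d v) < card (I v)" using assms finI[of v] by (intro psubset_card_mono) (auto simp: Tops_def)
  ultimately show ?thesis by linarith
qed

lemma S_empty: "Tops d v = I v ==> card (S d v) = 0"
  using iso(1)[of _ d v] by (metis Diff_cancel card.empty empty_iff equals0I)

text \<open>If all pieces at \<open>v\<close> are extremal in direction \<open>d\<close>, every
  mixed corner at \<open>v\<close> points the other way. When these corners are as numerous as the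
  edges of a spanning tree on the classes, the class of greatest rank is an owner; it is never the
  second class, so it changes at this one corner only.\<close>

lemma detach_exists:
  assumes T: "Tops d v = I v" and v: "v \<in> U" and s: "int (card (S (\<not> d) v)) \<ge> int (card (I v)) - 1"
  shows "\<exists>c ph0 k0. c \<in> I v \<and> good c v \<and> ph0 \<in> Ph \<and> k0 < 4 \<and> corner ph0 k0 = v \<and> chgc c ph0 k0 \<and>
     (\<forall>ph\<in>Ph. \<forall>k<4. corner ph k = v --> chgc c ph k --> ph = ph0 \<and> k = k0)"
proof -
  have gd: "good c v" if "c \<in> I v" for c using that T by (auto simp: Tops_def)
  obtain c1 where c1: "c1 \<in> I v" using noniso[OF v] by blast
  then have two: "2 <= card (I v)" using xt(3)[OF c1 gd[OF c1], of d] T by (metis (mono_tags, lifting) Tops_def mem_Collect_eq)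
  have T0: "Tops (\<not> d) v = {}"
  proof (rule equals0I)
    fix c assume c: "c \<in> Tops (\<not> d) v"
    then have "c \<in> Tops d v" using T by (auto simp: Tops_def)
    then have "xt c (comp R c v) d = v" "xt c (comp R c v) (\<not> d) = v" "c \<in> I v" "good c v" using c by (auto simp: Tops_def)
    then show False using xt(1)[of c v] by (cases d) auto
  qed
  let ?e = "\<not> d"
  let ?Z = "zc ` S ?e v"
  have ZI: "?Z \<subseteq> I v" using iso(1) by blast
  have cZ: "card ?Z \<ge> card (I v) - 1" using s cardS[of ?e v] by simp
  obtain c where c: "c \<in> I v" "!!c'. c' \<in> I v ==> rk ?e c' <= rk ?e c"
    using ex_max[OF finI, of v "rk ?e"] c1 by blast
  \<comment> \<open>Otherwise all the other classes are owners. The owner of least rank must have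
    \<open>c\<close> as its second class, which contradicts the maximal rank of
    \<open>c\<close>.\<close>
  have "c \<in> ?Z"
  proof (rule ccontr)
    assume nc: "c \<notin> ?Z"
    then have "?Z \<subseteq> I v - {c}" using ZI by blast
    moreover have "card (I v - {c}) = card (I v) - 1" using c(1) finI by simp
    ultimately have Z: "?Z = I v - {c}" using cZ finI by (metis card_seteq finite_Diff)
    have ne: "I v - {c} ~= {}" 
    proof
      assume "I v - {c} = {}"
      then have "I v \<subseteq> {c}" by blast
      then have "card (I v) <= card {c}" by (intro card_mono) auto
      then show False using two by simp
    qed
    obtain m where m: "m \<in> I v - {c}" "!!x. x \<in> I v - {c} ==> rk ?e m <= rk ?e x"
      using ex_min[OF finite_Diff[OF finI] ne, of "rk ?e"] by blast
    obtain ph where f: "ph \<in> S ?e v" "m = zc ph" using m(1) Z by blast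
    then have r: "rk ?e (oc ?e ph) < rk ?e m" using rk[of ph ?e] by (simp add: S_def)
    have "oc ?e ph \<in> I v" using iso(2)[OF f(1)] by blast
    then have "oc ?e ph = c" using m(2)[of "oc ?e ph"] r by fastforce
    then show False using r c(2)[of m] m(1) by simp
  qed
  then obtain ph0 where f0: "ph0 \<in> S ?e v" "c = zc ph0" by blast
  then have n0: "ph0 \<in> N" "cor ?e ph0 = v" by (auto simp: S_def)
  have cP: "c \<in> \<P>" using c(1) by (simp add: Iv_def)
  have oP: "oc ?e ph \<in> \<P>" if "ph \<in> N" for ph using ocI[OF that, of ?e] by (simp add: Iv_def)
  \<comment> \<open>A face with such a corner is mixed; by \<open>transit\<close> the corner is its
    \<open>\<not> d\<close> corner, as no piece at \<open>v\<close> leads on in direction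
    \<open>d\<close>; and its owner is \<open>c\<close>.\<close>
  have key: "ph = ph0 \<and> k = pos ?e ph0" if a: "ph \<in> Ph" "k < 4" "corner ph k = v" "chgc c ph k" for ph k
  proof -
    have lab4: "clab ph j \<in> labs ph" if "j < 4" for j
    proof -
      obtain u0 u1 u2 u3 x z y where "ph = ((u0,u1,u2,u3),(x,z,y))" by (metis prod.exhaust)
      then show ?thesis using less_4_cases[OF that] by (elim disjE; simp add: clab_def labs_def bd_def elab_def)
    qed
    have nN: "ph \<in> N"
    proof (rule ccontr)
      assume "ph \<notin> N"
      then obtain c' where c': "c' \<in> \<P>" "labs ph \<subseteq> c'" using a(1) by (auto simp: N_def)
      then have "clab ph k \<in> c'" "clab ph ((k + 3) mod 4) \<in> c'" using lab4[OF a(2)] lab4[of "(k + 3) mod 4"] by auto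
      then show False using a(4) disjP[OF cP c'(1)] by (cases "c = c'") (auto simp: chgc_def)
    qed
    have kp: "k = pos ?e ph"
    proof (rule ccontr)
      assume "k ~= pos ?e ph"
      from transit[OF nN a(2) cP a(4) this] obtain c' where c': "c' \<in> I v"
        "good c' v --> (\<exists>w\<in>comp R c' v. 2 <= card (I w) \<and> sgd d * ht c' v < sgd d * ht c' w)" using a(3) by auto
      then obtain w where "w \<in> comp R c' v" "2 <= card (I w)" "sgd d * ht c' v < sgd d * ht c' w" using gd by blast
      moreover have "c' \<in> Tops d v" using c' T by simp
      ultimately show False using top_max[of c' d v w] by simp
    qed
    then have s: "ph \<in> S ?e v" using nN a(3) by (simp add: S_def)
    obtain x where x: "x \<in> c" "x \<in> {clab ph k, clab ph ((k + 3) mod 4)}" using a(4) by (auto simp: chgc_def)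
    from labpos[OF nN kp x(2)] have "c = zc ph \<or> c = oc ?e ph"
      using x(1) disjP[OF cP oP[OF nN]] disjP[OF cP, of "zc ph"] iso(1)[OF s] by (auto simp: Iv_def)
    moreover have "c ~= oc ?e ph" using rk[OF nN, of ?e] c(2)[of "zc ph"] iso(1)[OF s] by auto
    ultimately have "zc ph = zc ph0" using f0 by simp
    then have "ph = ph0" using zc_S s f0(1) by (auto dest: inj_onD)
    then show ?thesis using kp by simp
  qed
  have "chgc c ph0 (pos ?e ph0)" using labchg[OF n0(1)] f0(2) by simp
  then show ?thesis using c(1) gd[OF c(1)] n0 NF pos4[OF n0(1), of ?e] key by blast
qed

text \<open>Add the forest inequalities of both directions. Where \<open>Tops d v\<close> exhausts
  \<open>I v\<close> that inequality is missing; there direction \<open>d\<close> has no corner at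
  all, and the strictness in \<open>nd\<close> supplies the missing unit.\<close>

lemma vertex_bound:
  assumes v: "v \<in> U" and nd: "!!d. Tops d v = I v ==> int (card (S (\<not> d) v)) < int (card (I v)) - 1"
  shows "2 - 2 * int (card (I v)) + int (card (S True v)) + int (card (S False v)) <= - int (card (Tops True v)) - int (card (Tops False v))"
proof -
  have ne: "I v ~= {}" using noniso[OF v] .
  have dj: "Tops True v \<inter> Tops False v = {}"
  proof (rule equals0I)
    fix c assume "c \<in> Tops True v \<inter> Tops False v"
    then show False using xt(1)[of c v] by (simp add: Tops_def)
  qed
  have *: "2 - 2 * int (card (I v)) + int (card (S d v)) + int (card (S (\<not> d) v)) <= - int (card (Tops d v)) - int (card (Tops (\<not> d) v))"
    if T: "Tops d v = I v" for d
  proof -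
    have "Tops (\<not> d) v = {}" using dj T by (cases d) (auto simp: Tops_def)
    then show ?thesis using nd[OF T] S_empty[OF T] T by simp
  qed
  show ?thesis
  proof (cases "\<exists>d. Tops d v = I v")
    case True
    then obtain d where d: "Tops d v = I v" by blast
    show ?thesis using *[OF d] by (cases d) auto
  next
    case False
    then show ?thesis using S_bound[of True v] S_bound[of False v] by fastforce
  qed
qed

text \<open>Each good piece has exactly one chosen extremum in direction \<open>d\<close>.\<close>

lemma sum_tops: "(\<Sum>v\<in>U. card (Tops d v)) = (\<Sum>c\<in>\<P>. card {C \<in> comp R c ` {u. c \<in> I u}. 1 <= chip R Ph c C})"
proof -
  have "(\<Sum>v\<in>U. card (Tops d v)) = card (SIGMA v:U. Tops d v)"
    using cxD(1)[OF cx] finI by (subst card_SigmaI) (auto simp: Tops_def)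
  also have "\<dots> = card (SIGMA c:\<P>. {C \<in> comp R c ` {u. c \<in> I u}. 1 <= chip R Ph c C})"
  proof (rule bij_betw_same_card[of "\<lambda>(v,c). (c, comp R c v)"], rule bij_betwI[where g="\<lambda>(c,C). (xt c C d, c)"])
    show "(\<lambda>(v,c). (c, comp R c v)) \<in> (SIGMA v:U. Tops d v) \<rightarrow> (SIGMA c:\<P>. {C \<in> comp R c ` {u. c \<in> I u}. 1 <= chip R Ph c C})"
      by (auto simp: Tops_def intro: IP)
    show "(\<lambda>(c,C). (xt c C d, c)) \<in> (SIGMA c:\<P>. {C \<in> comp R c ` {u. c \<in> I u}. 1 <= chip R Ph c C}) \<rightarrow> (SIGMA v:U. Tops d v)"
    proof (clarsimp)
      fix c u assume a: "c \<in> \<P>" "c \<in> I u" "good c u"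
      let ?x = "xt c (comp R c u) d"
      have x: "?x \<in> comp R c u" using xt(2)[OF a(2,3)] .
      then have ce: "comp R c ?x = comp R c u" by (rule comp_eq)
      have "c \<in> I ?x" using I_comp[OF a(2) x] .
      then show "?x \<in> U \<and> c \<in> Tops d ?x" using IvU[of c ?x] a(3) by (simp add: Tops_def ce)
    qed
    show "(case (case x of (v,c) => (c, comp R c v)) of (c,C) => (xt c C d, c)) = x" if "x \<in> (SIGMA v:U. Tops d v)" for x
      using that by (auto simp: Tops_def)
    show "(case (case y of (c,C) => (xt c C d, c)) of (v,c) => (c, comp R c v)) = y"
      if "y \<in> (SIGMA c:\<P>. {C \<in> comp R c ` {u. c \<in> I u}. 1 <= chip R Ph c C})" for y
      using that comp_eq[OF xt(2)] by auto
  qed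
  also have "\<dots> = (\<Sum>c\<in>\<P>. card {C \<in> comp R c ` {u. c \<in> I u}. 1 <= chip R Ph c C})"
  proof (rule card_SigmaI[OF finP], intro ballI)
    fix c
    have "{u. c \<in> I u} \<subseteq> U" using IvU by blast
    then have "finite {u. c \<in> I u}" using cxD(1)[OF cx] finite_subset by blast
    then show "finite {C \<in> comp R c ` {u. c \<in> I u}. 1 <= chip R Ph c C}" by simp
  qed
  finally show ?thesis .
qed

lemma sum_S: "(\<Sum>v\<in>U. card (S d v)) = card N"
proof -
  have "(\<Sum>v\<in>U. card (S d v)) = card (\<Union>v\<in>U. S d v)"
    using cxD(1)[OF cx] finN by (subst card_UN_disjoint) (auto simp: S_def)
  also have "(\<Union>v\<in>U. S d v) = N" using IvU[OF zcI[of _ d]] by (auto simp: S_def)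
  finally show ?thesis .
qed

lemma card_classes:
  assumes "finite X" "!!x. x \<in> X ==> \<exists>c\<in>\<P>. P x c" "!!x c c'. x \<in> X ==> c \<in> \<P> ==> c' \<in> \<P> ==> P x c ==> P x c' ==> c = c'"
  shows "card X = (\<Sum>c\<in>\<P>. card {x\<in>X. P x c})"
proof -
  have "X = (\<Union>c\<in>\<P>. {x\<in>X. P x c})" using assms(2) by blast
  also have "card \<dots> = (\<Sum>c\<in>\<P>. card {x\<in>X. P x c})"
    using finP assms(1,3) by (intro card_UN_disjoint) auto
  finally show ?thesis .
qed

text \<open>Twice the characteristic is twice the sum over the pieces plus, at each vertex,
  \<open>2 - 2 * card (I v)\<close> and one unit for every top and every bottom corner there, since
  a mixed face has one of each. Good pieces contribute 2, repaid at their two extrema; the others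
  contribute nothing positive.\<close>

theorem chi_nonpos_or_detach:
  "chi U R Ph <= 0 \<or> (\<exists>v\<in>U. \<exists>c ph0 k0. c \<in> I v \<and> good c v \<and> ph0 \<in> Ph \<and> k0 < 4 \<and> corner ph0 k0 = v \<and> chgc c ph0 k0 \<and>
     (\<forall>ph\<in>Ph. \<forall>k<4. corner ph k = v --> chgc c ph k --> ph = ph0 \<and> k = k0))"
proof (cases "\<exists>v\<in>U. \<exists>d. Tops d v = I v \<and> int (card (S (\<not> d) v)) \<ge> int (card (I v)) - 1")
  case True
  then obtain v d where v: "v \<in> U" "Tops d v = I v" "int (card (S (\<not> d) v)) \<ge> int (card (I v)) - 1" by blast
  show ?thesis by (rule disjI2, rule bexI, rule detach_exists[OF v(2,1,3)], rule v(1))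
next
  case False
  define D where "D c = {u. c \<in> I u}" for c
  define G where "G = (\<Sum>c\<in>\<P>. card {C \<in> comp R c ` D c. 1 <= chip R Ph c C})"
  have DU: "D c \<subseteq> U" for c using IvU unfolding D_def by blast
  have cls: "int (card (D c)) - int (card (Rl R c)) + int (card {ph\<in>Ph. labs ph \<subseteq> c}) <= int (card {C \<in> comp R c ` D c. 1 <= chip R Ph c C})" if c: "c \<in> \<P>" for c
  proof -
    have "D c = {u. \<exists>a\<in>R. elab a \<in> c \<and> (esrc a = u \<or> etgt a = u)}" unfolding D_def Iv_def using c by blast
    from sum_components[OF cx this]
    have "int (card (D c)) - int (card (Rl R c)) + int (card {ph\<in>Ph. labs ph \<subseteq> c}) = (\<Sum>C\<in>comp R c ` D c. chip R Ph c C)" .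
    also have "\<dots> <= (\<Sum>C\<in>comp R c ` D c. if 1 <= chip R Ph c C then 1 else 0)"
      using chip1[OF c] DU by (intro sum_mono) (force split: if_splits)
    also have "\<dots> = int (card {C \<in> comp R c ` D c. 1 <= chip R Ph c C})"
      using finite_subset[OF DU cxD(1)[OF cx]] by (simp add: sum.If_cases Int_def)
    finally show ?thesis .
  qed
  have R: "card R = (\<Sum>c\<in>\<P>. card (Rl R c))"
    unfolding Rl_def
  proof (rule card_classes[OF cxD(2)[OF cx]])
    show "\<exists>c\<in>\<P>. elab a \<in> c" if "a \<in> R" for a using cxD(7)[OF cx that] coverP by blast
  qed (use disjP in blast)
  have F: "card Ph = card N + (\<Sum>c\<in>\<P>. card {ph\<in>Ph. labs ph \<subseteq> c})"
  proof -
    have "card (Ph - N) = (\<Sum>c\<in>\<P>. card {ph\<in>Ph - N. labs ph \<subseteq> c})"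
    proof (rule card_classes)
      show "finite (Ph - N)" using cxD(3)[OF cx] by simp
      show "\<exists>c\<in>\<P>. labs ph \<subseteq> c" if "ph \<in> Ph - N" for ph using that by (simp add: N_def)
      show "c = c'" if "c \<in> \<P>" "c' \<in> \<P>" "labs ph \<subseteq> c" "labs ph \<subseteq> c'" for ph :: "('u,'v) face" and c c'
        using disjP[OF that(1,2)] that(3,4) by (auto simp: labs_def)
    qed
    moreover have "{ph\<in>Ph - N. labs ph \<subseteq> c} = {ph\<in>Ph. labs ph \<subseteq> c}" if "c \<in> \<P>" for c using that by (simp add: N_def) blast
    moreover have "card (Ph - N) = card Ph - card N" "card N <= card Ph"
      using finN cxD(3)[OF cx] by (auto simp: N_def card_Diff_subset intro!: card_mono)
    ultimately show ?thesis by simp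
  qed
  have I: "(\<Sum>v\<in>U. card (I v)) = (\<Sum>c\<in>\<P>. card (D c))"
  proof -
    have "(\<Sum>v\<in>U. card (I v)) = (\<Sum>v\<in>U. \<Sum>c\<in>\<P>. if c \<in> I v then 1 else 0)"
      using finP by (intro sum.cong refl) (auto simp: sum.If_cases Iv_def Int_def intro!: arg_cong[of _ _ card])
    also have "\<dots> = (\<Sum>c\<in>\<P>. \<Sum>v\<in>U. if c \<in> I v then 1 else 0)" by (rule sum.swap)
    also have "\<dots> = (\<Sum>c\<in>\<P>. card (D c))"
    proof (intro sum.cong refl)
      fix c
      have "{v\<in>U. c \<in> I v} = D c" using DU[of c] by (auto simp: D_def)
      then show "(\<Sum>v\<in>U. if c \<in> I v then 1 else 0) = card (D c)"
        using cxD(1)[OF cx] by (simp add: sum.If_cases Int_def)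
    qed
    finally show ?thesis .
  qed
  have "2 * chi U R Ph = 2 * (\<Sum>c\<in>\<P>. int (card (D c)) - int (card (Rl R c)) + int (card {ph\<in>Ph. labs ph \<subseteq> c})) +
      (\<Sum>v\<in>U. 2 - 2 * int (card (I v)) + int (card (S True v)) + int (card (S False v)))"
  proof -
    have "(\<Sum>v\<in>U. 2 - 2 * int (card (I v)) + int (card (S True v)) + int (card (S False v))) =
       2 * int (card U) - 2 * int (\<Sum>v\<in>U. card (I v)) + int (\<Sum>v\<in>U. card (S True v)) + int (\<Sum>v\<in>U. card (S False v))"
      by (simp add: sum.distrib sum_subtractf sum_distrib_left)
    then show ?thesis unfolding sum_S I chi_def R F by (simp add: sum.distrib sum_subtractf)
  qed
  also have "\<dots> <= 2 * (\<Sum>c\<in>\<P>. int (card {C \<in> comp R c ` D c. 1 <= chip R Ph c C})) + (\<Sum>v\<in>U. - int (card (Tops True v)) - int (card (Tops False v)))"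
    using False by (intro add_mono mult_left_mono sum_mono cls vertex_bound) (auto simp: not_le)
  also have "\<dots> = 2 * int G - int (\<Sum>v\<in>U. card (Tops True v)) - int (\<Sum>v\<in>U. card (Tops False v))"
    by (simp add: G_def sum_subtractf sum_negf)
  also have "\<dots> = 0" unfolding sum_tops G_def D_def by simp
  finally show ?thesis by simp
qed

end

section \<open>Partitions of labelled oriented trees\<close>

definition gadj :: "('v \<times> 'v \<times> 'v) set => ('v \<times> 'v) set" where
  "gadj F = {(u, w). \<exists>e\<in>F. joins e u w}"

lemma gadj_sym: "(u,w) \<in> (gadj F)\<^sup>* ==> (w,u) \<in> (gadj F)\<^sup>*"
proof -
  have "sym (gadj F)" by (auto simp: sym_def gadj_def joins_def)
  then show "(u,w) \<in> (gadj F)\<^sup>* ==> (w,u) \<in> (gadj F)\<^sup>*" by (meson sym_rtrancl symD)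
qed

lemma distinct_walk:
  assumes "(x,y) \<in> (gadj F)\<^sup>*"
  shows "\<exists>vs. vs ~= [] \<and> hd vs = x \<and> last vs = y \<and> distinct vs \<and> (\<forall>i. Suc i < length vs --> (vs ! i, vs ! Suc i) \<in> gadj F)"
  using assms
proof (induction rule: rtrancl_induct)
  case base then show ?case by (intro exI[of _ "[x]"]) auto
next
  case (step y z)
  then obtain vs where vs: "vs ~= []" "hd vs = x" "last vs = y" "distinct vs" "!!i. Suc i < length vs ==> (vs ! i, vs ! Suc i) \<in> gadj F" by blast
  show ?case
  proof (cases "z \<in> set vs")
    case True
    then obtain j where j: "j < length vs" "vs ! j = z" by (metis in_set_conv_nth)
    let ?w = "take (Suc j) vs"
    have "?w ~= []" "hd ?w = x" "distinct ?w" using vs by auto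
    moreover have "last ?w = z" using j by (simp add: take_Suc_conv_app_nth)
    moreover have "(?w ! i, ?w ! Suc i) \<in> gadj F" if "Suc i < length ?w" for i using vs(5)[of i] that by auto
    ultimately show ?thesis by blast
  next
    case False
    let ?w = "vs @ [z]"
    have "(?w ! i, ?w ! Suc i) \<in> gadj F" if i: "Suc i < length ?w" for i
    proof (cases "Suc i < length vs")
      case True then show ?thesis using vs(5)[of i] by (simp add: nth_append)
    next
      case False
      then have "Suc i = length vs" using i by simp
      then have il: "i = length vs - 1" "i < length vs" by auto
      have "vs ! i = y" using vs(1,3) il(1) by (simp add: last_conv_nth)
      then have "?w ! i = y" "?w ! Suc i = z" using il \<open>Suc i = length vs\<close> by (auto simp: nth_append)
      then show ?thesis using step.hyps(2) by simp
    qed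
    then show ?thesis using vs False by (intro exI[of _ ?w]) auto
  qed
qed

lemma cycle_of_walk:
  assumes w: "(tgt e, src e) \<in> (gadj F)\<^sup>*" and e: "e \<notin> F"
  shows "has_cycle (insert e F)"
proof -
  obtain vs where vs: "vs ~= []" "hd vs = tgt e" "last vs = src e" "distinct vs" "!!i. Suc i < length vs ==> (vs ! i, vs ! Suc i) \<in> gadj F"
    using distinct_walk[OF w] by blast
  define n where "n = length vs - 1"
  have len: "length vs = Suc n" using vs(1) by (simp add: n_def)
  have "\<exists>f. f \<in> F \<and> joins f (vs ! i) (vs ! Suc i)" if "i < n" for i
  proof -
    have "(vs ! i, vs ! Suc i) \<in> gadj F" using vs(5)[of i] len that by simp
    then show ?thesis unfolding gadj_def by blast
  qed
  then obtain f where f: "!!i. i < n ==> f i \<in> F \<and> joins (f i) (vs ! i) (vs ! Suc i)" by metis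
  define es where "es = map f [0..<n] @ [e]"
  have les: "length es = Suc n" by (simp add: es_def)
  have es: "es ! i = (if i < n then f i else e)" if "i < Suc n" for i using that by (simp add: es_def nth_append)
  have "distinct es"
  proof -
    have "i = j" if "i < n" "j < n" "f i = f j" for i j
    proof -
      have "joins (f i) (vs ! i) (vs ! Suc i)" "joins (f i) (vs ! j) (vs ! Suc j)" using f[of i] f[of j] that by metis+
      then have "(vs ! i = vs ! j \<and> vs ! Suc i = vs ! Suc j) \<or> (vs ! i = vs ! Suc j \<and> vs ! Suc i = vs ! j)" by (auto simp: joins_def)
      then show ?thesis using nth_eq_iff_index_eq[OF vs(4)] that len by fastforce
    qed
    then have "distinct (map f [0..<n])" by (auto simp: distinct_map inj_on_def)
    then show ?thesis using e f by (auto simp: es_def)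
  qed
  moreover have "set es \<subseteq> insert e F" using f by (auto simp: es_def)
  moreover have "joins (es ! i) (vs ! i) (vs ! ((i + 1) mod length es))" if "i < length es" for i
  proof (cases "i < n")
    case True then show ?thesis using f[of i] es[of i] les by simp
  next
    case False
    then have "i = n" using that les by simp
    then have "vs ! i = src e" "vs ! 0 = tgt e" using vs(1,2,3) len by (auto simp: last_conv_nth hd_conv_nth)
    then show ?thesis using \<open>i = n\<close> les es[of n] by (simp add: joins_def)
  qed
  ultimately show ?thesis unfolding has_cycle_def using les len by (intro exI[of _ es] exI[of _ vs]) (auto simp: es_def)
qed

lemma has_cycle_mono: "has_cycle F ==> F \<subseteq> G ==> has_cycle G"
  unfolding has_cycle_def by (meson order_trans)

text \<open>\<open>f\<close> picks a representative in every component. A further edge either merges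
  two components or closes a cycle.\<close>

lemma component_count:
  assumes "finite F" "finite S" "\<forall>e\<in>F. src e \<in> S \<and> tgt e \<in> S"
  shows "\<exists>f. (\<forall>u\<in>S. f u \<in> S \<and> (u, f u) \<in> (gadj F)\<^sup>*) \<and> (\<forall>e\<in>F. f (src e) = f (tgt e)) \<and>
     card S <= card F + card (f ` S) \<and> (\<not> has_cycle F --> card F + card (f ` S) <= card S)"
  using assms(1,3)
proof (induction F rule: finite_induct)
  case empty show ?case by (intro exI[of _ "\<lambda>x. x"]) auto
next
  case (insert e F)
  then obtain f where f: "!!u. u \<in> S ==> f u \<in> S" "!!u. u \<in> S ==> (u, f u) \<in> (gadj F)\<^sup>*" "!!e. e \<in> F ==> f (src e) = f (tgt e)"
    "card S <= card F + card (f ` S)" "\<not> has_cycle F ==> card F + card (f ` S) <= card S" by (metis insertCI)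
  have e: "src e \<in> S" "tgt e \<in> S" using insert.prems by auto
  have mono: "(gadj F)\<^sup>* \<subseteq> (gadj (insert e F))\<^sup>*" by (intro rtrancl_mono) (auto simp: gadj_def)
  show ?case
  proof (cases "f (src e) = f (tgt e)")
    case True
    have "(tgt e, src e) \<in> (gadj F)\<^sup>*" using f(2)[OF e(2)] gadj_sym[OF f(2)[OF e(1)]] True by (metis rtrancl_trans)
    then have "has_cycle (insert e F)" by (rule cycle_of_walk) fact
    then show ?thesis using f True mono insert.hyps by (intro exI[of _ f]) auto
  next
    case False
    define g where "g u = (if f u = f (tgt e) then f (src e) else f u)" for u
    have st: "(f (tgt e), f (src e)) \<in> (gadj (insert e F))\<^sup>*"
    proof -
      have "(f (tgt e), tgt e) \<in> (gadj (insert e F))\<^sup>*" "(src e, f (src e)) \<in> (gadj (insert e F))\<^sup>*"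
        using gadj_sym[OF f(2)[OF e(2)]] f(2)[OF e(1)] mono by auto
      moreover have "(tgt e, src e) \<in> gadj (insert e F)" by (auto simp: gadj_def joins_def)
      ultimately show ?thesis by (meson converse_rtrancl_into_rtrancl rtrancl_trans)
    qed
    have g1: "g u \<in> S \<and> (u, g u) \<in> (gadj (insert e F))\<^sup>*" if "u \<in> S" for u
    proof -
      have "(u, f u) \<in> (gadj (insert e F))\<^sup>*" using f(2)[OF that] mono by blast
      then show ?thesis using f(1)[OF that] f(1)[OF e(1)] st by (auto simp: g_def intro: rtrancl_trans)
    qed
    have g2: "g (src e') = g (tgt e')" if "e' \<in> insert e F" for e' using that f(3)[of e'] unfolding g_def by (metis insertE)
    have "g ` S \<subseteq> f ` S - {f (tgt e)}" using False e by (auto simp: g_def)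
    then have "card (g ` S) <= card (f ` S - {f (tgt e)})" using assms(2) by (intro card_mono) auto
    then have g3: "card (g ` S) <= card (f ` S) - 1" using e assms(2) by simp
    have "f ` S \<subseteq> insert (f (tgt e)) (g ` S)" by (auto simp: g_def)
    then have "card (f ` S) <= card (insert (f (tgt e)) (g ` S))" using assms(2) by (intro card_mono) auto
    also have "\<dots> <= card (g ` S) + 1" using assms(2) card_insert_le_m1 by (simp add: card_insert_if)
    finally have g4: "card (f ` S) <= card (g ` S) + 1" .
    have pos: "card (f ` S) > 0" using e assms(2) by (auto simp: card_gt_0_iff)
    have nc: "\<not> has_cycle (insert e F) ==> \<not> has_cycle F" using has_cycle_mono[of F "insert e F"] by blast
    show ?thesis
      using g1 g2 g3 g4 f(4,5) insert.hyps nc pos by (intro exI[of _ g]) auto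
  qed
qed

section \<open>Sub-LOTs by counting\<close>

definition Esub :: "('v \<times> 'v \<times> 'v) set => 'v set => ('v \<times> 'v \<times> 'v) set" where
  "Esub E S = {e\<in>E. src e \<in> S \<and> lab e \<in> S \<and> tgt e \<in> S}"

definition block where "block E S \<longleftrightarrow> S ~= {} \<and> card (Esub E S) + 1 = card S"

text \<open>Trees in numerical form: every nonempty vertex set spans fewer edges than it has
  vertices, and \<open>V\<close> just one fewer. Blocks inherit this without any talk of
  paths.\<close>

definition nLOT where
  "nLOT V E \<longleftrightarrow> finite V \<and> V ~= {} \<and> finite E \<and> (\<forall>e\<in>E. src e \<in> V \<and> lab e \<in> V \<and> tgt e \<in> V) \<and> inj_on lab E \<and>
     card E + 1 = card V \<and> (\<forall>S\<subseteq>V. S ~= {} --> card {e\<in>E. src e \<in> S \<and> tgt e \<in> S} < card S)"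

lemma nLOTD:
  assumes "nLOT V E"
  shows "finite V" "V ~= {}" "finite E" "e \<in> E ==> src e \<in> V" "e \<in> E ==> lab e \<in> V" "e \<in> E ==> tgt e \<in> V" "inj_on lab E"
    "card E + 1 = card V" "S \<subseteq> V ==> S ~= {} ==> card {e\<in>E. src e \<in> S \<and> tgt e \<in> S} < card S"
  using assms unfolding nLOT_def by blast+

lemma LOT_nLOT:
  assumes "is_LOT V E" "injective_LOG E" shows "nLOT V E"
proof -
  have E: "finite V" "finite E" "V ~= {}" "graph_connected V E" "\<not> has_cycle E" using assms by (auto simp: is_LOT_def is_LOG_def)
  have ends: "src e \<in> V" "lab e \<in> V" "tgt e \<in> V" if "e \<in> E" for e
    using that assms(1) by (auto simp: is_LOT_def is_LOG_def src_def lab_def tgt_def)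
  have inj: "inj_on lab E" using assms(2) by (auto simp: injective_LOG_def inj_on_def)
  have forest: "card {e\<in>E. src e \<in> S \<and> tgt e \<in> S} < card S" if S: "S \<subseteq> V" "S ~= {}" for S
  proof -
    let ?F = "{e\<in>E. src e \<in> S \<and> tgt e \<in> S}"
    have "finite S" using S(1) E(1) by (rule finite_subset)
    moreover have "\<not> has_cycle ?F" using E(5) has_cycle_mono[of ?F E] by blast
    moreover have "finite ?F" using E(2) by simp
    moreover have "\<forall>e\<in>?F. src e \<in> S \<and> tgt e \<in> S" by blast
    ultimately obtain f :: "'a => 'a" where "card ?F + card (f ` S) <= card S" using component_count[of ?F S] by blast
    moreover have "card (f ` S) > 0" using S(2) \<open>finite S\<close> by (auto simp: card_gt_0_iff)
    ultimately show ?thesis by linarith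
  qed
  have "card V <= card E + 1"
  proof -
    have st: "\<forall>e\<in>E. src e \<in> V \<and> tgt e \<in> V" using ends by blast
    obtain f :: "'a => 'a" where f: "!!e. e \<in> E ==> f (src e) = f (tgt e)" "card V <= card E + card (f ` V)"
      using component_count[OF E(2,1) st] by blast
    have c: "f u = f w" if "(u,w) \<in> (gadj E)\<^sup>*" for u w
      using that by (induction rule: rtrancl_induct) (auto simp: gadj_def joins_def f(1))
    obtain v where v: "v \<in> V" using E(3) by blast
    have "f ` V \<subseteq> {f v}" using E(4) c v unfolding graph_connected_def gadj_def by auto
    then have "card (f ` V) <= 1" by (metis card_mono finite.emptyI finite_insert is_singletonI is_singleton_altdef)
    then show ?thesis using f(2) by linarith
  qed
  moreover have "{e\<in>E. src e \<in> V \<and> tgt e \<in> V} = E" using ends by blast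
  ultimately have "card E + 1 = card V" using forest[of V] E(3) by auto
  then show ?thesis unfolding nLOT_def using E ends inj forest by blast
qed

text \<open>Connectedness forces at least \<open>card VH - 1\<close> edges and the forest bound
  allows no more, so \<open>EH\<close> already contains every edge with ends and label in
  \<open>VH\<close>.\<close>

lemma sub_LOT_block:
  assumes "nLOT V E" "sub_LOT V E VH EH" shows "block E VH" "EH = Esub E VH" "VH \<subseteq> V"
proof -
  show sub: "VH \<subseteq> V" using assms(2) by (simp add: sub_LOT_def)
  have s: "EH \<subseteq> E" "EH ~= {}" "graph_connected VH EH" "!!e. e \<in> EH ==> src e \<in> VH \<and> tgt e \<in> VH \<and> lab e \<in> VH"
    using assms(2) unfolding sub_LOT_def by blast+
  have fin: "finite VH" "finite E" "finite EH" using finite_subset[OF sub nLOTD(1)[OF assms(1)]] nLOTD(3)[OF assms(1)] finite_subset[OF s(1)] by blast+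
  have ne: "VH ~= {}" using s(2,4) by blast
  have "card VH <= card EH + 1"
  proof -
    have st: "\<forall>e\<in>EH. src e \<in> VH \<and> tgt e \<in> VH" using s(4) by blast
    obtain f :: "'a => 'a" where f: "!!e. e \<in> EH ==> f (src e) = f (tgt e)" "card VH <= card EH + card (f ` VH)"
      using component_count[OF fin(3,1) st] by blast
    have c: "f u = f w" if "(u,w) \<in> (gadj EH)\<^sup>*" for u w
      using that by (induction rule: rtrancl_induct) (auto simp: gadj_def joins_def f(1))
    obtain v where v: "v \<in> VH" using ne by blast
    have "f ` VH \<subseteq> {f v}" using s(3) c v unfolding graph_connected_def gadj_def by auto
    then have "card (f ` VH) <= 1" by (metis card_mono finite.emptyI finite_insert is_singletonI is_singleton_altdef)
    then show ?thesis using f(2) by linarith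
  qed
  moreover have "card {e\<in>E. src e \<in> VH \<and> tgt e \<in> VH} < card VH" by (rule nLOTD(9)[OF assms(1) sub ne])
  moreover have sub2: "EH \<subseteq> Esub E VH" "Esub E VH \<subseteq> {e\<in>E. src e \<in> VH \<and> tgt e \<in> VH}" using s(1,4) unfolding Esub_def by blast+
  moreover have "card EH <= card (Esub E VH)" "card (Esub E VH) <= card {e\<in>E. src e \<in> VH \<and> tgt e \<in> VH}"
    using sub2 fin by (intro card_mono; simp add: Esub_def)+
  ultimately have "card EH = card (Esub E VH)" "card (Esub E VH) + 1 = card VH" by linarith+
  moreover have "finite (Esub E VH)" using fin(2) by (simp add: Esub_def)
  ultimately show "block E VH" "EH = Esub E VH" using ne card_subset_eq[OF _ sub2(1)] by (simp_all add: block_def)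
qed

lemma Esub_nLOT:
  assumes "nLOT V E" "block E S" "S \<subseteq> V" shows "nLOT S (Esub E S)"
proof -
  have E: "finite V" "finite E" "inj_on lab E" "!!S. S \<subseteq> V ==> S ~= {} ==> card {e\<in>E. src e \<in> S \<and> tgt e \<in> S} < card S"
    using nLOTD[OF assms(1)] by blast+
  have "card {e \<in> Esub E S. src e \<in> T \<and> tgt e \<in> T} < card T" if "T \<subseteq> S" "T ~= {}" for T
  proof -
    have "card {e \<in> Esub E S. src e \<in> T \<and> tgt e \<in> T} <= card {e\<in>E. src e \<in> T \<and> tgt e \<in> T}"
      using E(2) by (intro card_mono) (auto simp: Esub_def)
    moreover have "T \<subseteq> V" using that(1) assms(3) by blast
    ultimately show ?thesis using E(4)[of T] that(2) by linarith
  qed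
  moreover have "inj_on lab (Esub E S)" using E(3) by (rule inj_on_subset) (auto simp: Esub_def)
  moreover have "finite S" "finite (Esub E S)" using E(1,2) assms(3) by (auto simp: Esub_def intro: finite_subset)
  moreover have "\<forall>e\<in>Esub E S. src e \<in> S \<and> lab e \<in> S \<and> tgt e \<in> S" unfolding Esub_def by blast
  ultimately show ?thesis using assms(2) unfolding nLOT_def block_def by blast
qed

lemma Esub_Esub: "T \<subseteq> S ==> Esub (Esub E S) T = Esub E T" by (auto simp: Esub_def)

lemma block_singleton: assumes "nLOT V E" "v \<in> V" shows "block E {v}"
proof -
  have "card {e\<in>E. src e \<in> {v} \<and> tgt e \<in> {v}} < card {v}" using assms(2) by (intro nLOTD(9)[OF assms(1)]) auto
  then have "{e\<in>E. src e \<in> {v} \<and> tgt e \<in> {v}} = {}" using nLOTD(3)[OF assms(1)] by (simp del: Collect_empty_eq)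
  then have "Esub E {v} = {}" unfolding Esub_def by blast
  then show ?thesis by (simp add: block_def)
qed

text \<open>Take as few classes as possible. Two or more classes whose union is a proper block could
  be replaced by that union.\<close>

lemma partition_exists:
  assumes L: "nLOT V E" and S0: "block E S0" "S0 \<subseteq> V" "S0 ~= V"
  shows "\<exists>\<P>. (finite \<P> \<and> (\<forall>c\<in>\<P>. block E c \<and> c ~= V) \<and> (\<forall>c\<in>\<P>. \<forall>c'\<in>\<P>. c ~= c' --> c \<inter> c' = {}) \<and>
    \<Union>\<P> = V \<and> (\<exists>c\<in>\<P>. S0 \<subseteq> c)) \<and> (\<forall>S\<subseteq>\<P>. 2 <= card S --> block E (\<Union>S) --> \<Union>S = V)"
proof -
  define good where "good \<P> \<longleftrightarrow> finite \<P> \<and> (\<forall>c\<in>\<P>. block E c \<and> c ~= V) \<and> (\<forall>c\<in>\<P>. \<forall>c'\<in>\<P>. c ~= c' --> c \<inter> c' = {}) \<and> \<Union>\<P> = V \<and> (\<exists>c\<in>\<P>. S0 \<subseteq> c)" for \<P>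
  have finV: "finite V" using L by (simp add: nLOT_def)
  have S0ne: "S0 ~= {}" using S0(1) by (simp add: block_def)
  have "good (insert S0 ((\<lambda>v. {v}) ` (V - S0)))"
    unfolding good_def
  proof (intro conjI ballI impI)
    fix c assume "c \<in> insert S0 ((\<lambda>v. {v}) ` (V - S0))"
    then show "block E c" using S0(1) block_singleton[OF L] by auto
    show "c ~= V" using \<open>c \<in> _\<close> S0(2,3) S0ne by auto
  next
    fix c c' assume "c \<in> insert S0 ((\<lambda>v. {v}) ` (V - S0))" "c' \<in> insert S0 ((\<lambda>v. {v}) ` (V - S0))" "c ~= c'"
    then show "c \<inter> c' = {}" by auto
  next
    show "finite (insert S0 ((\<lambda>v. {v}) ` (V - S0)))" using finV by simp
    show "\<Union>(insert S0 ((\<lambda>v. {v}) ` (V - S0))) = V" using S0(2) by auto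
    show "\<exists>c\<in>insert S0 ((\<lambda>v. {v}) ` (V - S0)). S0 \<subseteq> c" by blast
  qed
  then have "\<exists>\<P>. good \<P> \<and> (\<forall>\<Q>. good \<Q> --> card \<P> <= card \<Q>)"
    by (metis (no_types, lifting) ex_has_least_nat)
  then obtain \<P> where P: "good \<P>" "!!\<Q>. good \<Q> ==> card \<P> <= card \<Q>" by blast
  have g: "finite \<P>" "!!c. c \<in> \<P> ==> block E c \<and> c ~= V" "!!c c'. c \<in> \<P> ==> c' \<in> \<P> ==> c ~= c' ==> c \<inter> c' = {}" "\<Union>\<P> = V" "\<exists>c\<in>\<P>. S0 \<subseteq> c"
    using P(1) unfolding good_def by blast+
  have "\<Union>S = V" if S: "S \<subseteq> \<P>" "2 <= card S" "block E (\<Union>S)" for S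
  proof (rule ccontr)
    assume n: "\<Union>S ~= V"
    let ?Q = "insert (\<Union>S) (\<P> - S)"
    have dj: "\<Union>S \<inter> c = {}" if "c \<in> \<P> - S" for c using that S(1) g(3) by blast
    have "good ?Q"
      unfolding good_def
    proof (intro conjI ballI impI)
      show "\<exists>c\<in>?Q. S0 \<subseteq> c" using g(5) by blast
      fix c c' assume cc: "c \<in> ?Q" "c' \<in> ?Q" "c ~= c'"
      show "c \<inter> c' = {}"
      proof (cases "c = \<Union>S")
        case True then show ?thesis using dj[of c'] cc by blast
      next
        case False
        then have c: "c \<in> \<P> - S" using cc(1) by blast
        show ?thesis
        proof (cases "c' = \<Union>S")
          case True then show ?thesis using dj[OF c] by blast
        next
          case False then show ?thesis using g(3)[of c c'] c cc by blast
        qed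
      qed
    next
      show "finite ?Q" using g(1) by simp
      show "\<Union>?Q = V" using g(4) S(1) by blast
      fix c assume "c \<in> ?Q"
      then show "block E c" "c ~= V" using g(2) n S(3) by blast+
    qed
    then have "card \<P> <= card ?Q" by (rule P(2))
    moreover have "card ?Q <= Suc (card (\<P> - S))" using g(1) by (simp add: card_insert_if)
    moreover have "card (\<P> - S) = card \<P> - card S" "card S <= card \<P>"
      using S(1) g(1) by (auto simp: card_Diff_subset finite_subset intro: card_mono)
    ultimately show False using S(2) by linarith
  qed
  then show ?thesis using P(1) unfolding good_def by (intro exI[of _ \<P>] conjI allI impI) blast+
qed

section \<open>Two disjoint arborescences\<close>

definition outs :: "(bool => 'a => 'a) => ('a \<times> bool) set => 'a set => ('a \<times> bool) set" where
  "outs p D S = {a\<in>D. fst a \<in> S \<and> p (snd a) (fst a) \<notin> S}"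

text \<open>The pair \<open>(z, b)\<close> is the arc from \<open>z\<close> to \<open>p b z\<close>.
  An arc leaving the union or the intersection leaves one of the two sets, and an arc leaving both
  of them leaves both sets.\<close>

lemma outs_submodular:
  assumes "finite D"
  shows "card (outs p D (S \<inter> T)) + card (outs p D (S \<union> T)) <= card (outs p D S) + card (outs p D T)"
proof -
  have fin: "finite (outs p D X)" for X using assms by (simp add: outs_def)
  have "outs p D (S \<inter> T) \<union> outs p D (S \<union> T) \<subseteq> outs p D S \<union> outs p D T" "outs p D (S \<inter> T) \<inter> outs p D (S \<union> T) \<subseteq> outs p D S \<inter> outs p D T"
    unfolding outs_def by blast+
  then have "card (outs p D (S \<inter> T) \<union> outs p D (S \<union> T)) <= card (outs p D S \<union> outs p D T)"
    "card (outs p D (S \<inter> T) \<inter> outs p D (S \<union> T)) <= card (outs p D S \<inter> outs p D T)"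
    using fin by (auto intro!: card_mono)
  then show ?thesis using card_Un_Int[OF fin fin, of "S \<inter> T" "S \<union> T"] card_Un_Int[OF fin fin, of S T] by linarith
qed

text \<open>The hypothesis \<open>out\<close> forbids cycles that avoid \<open>r\<close>. A maximal
  set carrying a rank is everything, since otherwise some element outside is mapped into it and can
  be added on top.\<close>

lemma rank_functional:
  fixes f :: "'a => 'a"
  assumes fin: "finite N" and r: "r \<in> N" and f: "!!z. z \<in> N - {r} ==> f z \<in> N"
    and out: "!!S. S ~= {} ==> S \<subseteq> N - {r} ==> \<exists>z\<in>S. f z \<notin> S"
  shows "\<exists>\<rho>::'a => nat. \<forall>z\<in>N - {r}. \<rho> (f z) < \<rho> z"
proof -
  define Inv where "Inv T \<longleftrightarrow> r \<in> T \<and> T \<subseteq> N \<and> (\<exists>\<rho>::'a => nat. \<forall>z\<in>T - {r}. f z \<in> T \<and> \<rho> (f z) < \<rho> z)" for T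
  have "finite (Collect Inv)" by (rule finite_subset[of _ "Pow N"]) (use fin in \<open>auto simp: Inv_def\<close>)
  moreover have "{r} \<in> Collect Inv" using r by (auto simp: Inv_def)
  ultimately obtain T where T: "Inv T" "!!T'. Inv T' ==> T \<subseteq> T' ==> T = T'"
    using finite_has_maximal[of "Collect Inv"] by blast
  obtain \<rho> :: "'a => nat" where \<rho>: "!!z. z \<in> T - {r} ==> f z \<in> T \<and> \<rho> (f z) < \<rho> z" using T(1) unfolding Inv_def by blast
  have TN: "r \<in> T" "T \<subseteq> N" using T(1) by (auto simp: Inv_def)
  have "T = N"
  proof (rule ccontr)
    assume "T ~= N"
    then have "N - T ~= {}" "N - T \<subseteq> N - {r}" using TN by auto
    then obtain z where z: "z \<in> N - T" "f z \<notin> N - T" using out[of "N - T"] by blast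
    then have fz: "f z \<in> T" using f[of z] TN by auto
    define \<rho>' where "\<rho>' = \<rho>(z := Suc (\<rho> (f z)))"
    have zr: "z \<notin> T" "z ~= r" "f z ~= z" using z TN fz by auto
    have "f y \<in> insert z T \<and> \<rho>' (f y) < \<rho>' y" if "y \<in> insert z T - {r}" for y
    proof (cases "y = z")
      case True then show ?thesis using fz zr by (simp add: \<rho>'_def)
    next
      case False
      then have "y \<in> T - {r}" using that by auto
      then show ?thesis using \<rho>[of y] False zr by (auto simp: \<rho>'_def)
    qed
    then have "Inv (insert z T)" unfolding Inv_def using TN z by (intro conjI exI[of _ \<rho>']) auto
    then show False using T(2)[of "insert z T"] zr by auto
  qed
  then show ?thesis using \<rho> by blast
qed

text \<open>Edmonds' theorem for two disjoint arborescences, by Lovasz's argument: grow the first one while every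
  set keeps a remaining outgoing arc; a minimal set with exactly one such arc that is not yet covered
  shows where to grow.\<close>
lemma two_branchings:
  fixes p :: "bool => 'a => 'a"
  assumes fin: "finite N" and r: "r \<in> N" and p: "!!b z. z \<in> N - {r} ==> p b z \<in> N"
    and out: "!!S. S ~= {} ==> S \<subseteq> N - {r} ==> 2 <= card (outs p ((N - {r}) \<times> UNIV) S)"
  shows "\<exists>\<sigma> (\<rho>1::'a => nat) (\<rho>2::'a => nat). \<forall>z\<in>N - {r}. \<rho>1 (p (\<sigma> z) z) < \<rho>1 z \<and> \<rho>2 (p (\<not> \<sigma> z) z) < \<rho>2 z"
proof -
  \<comment> \<open>The arcs left over once the first arborescence has been grown on
    \<open>T\<close>.\<close>
  define D where "D T \<sigma> = (N - {r}) \<times> UNIV - (\<lambda>z. (z, \<sigma> z)) ` (T - {r})" for T and \<sigma> :: "'a => bool"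
  have finD: "finite (D T \<sigma>)" for T \<sigma> using fin by (auto simp: D_def)
  have finO: "finite (outs p (D T \<sigma>) S)" for T \<sigma> S using finD by (simp add: outs_def)
  define ok where "ok T \<sigma> \<longleftrightarrow> (\<forall>S. S ~= {} --> S \<subseteq> N - {r} --> outs p (D T \<sigma>) S ~= {})" for T \<sigma>
  define Inv where "Inv T \<longleftrightarrow> r \<in> T \<and> T \<subseteq> N \<and> (\<exists>\<sigma> (\<rho>::'a => nat). (\<forall>z\<in>T - {r}. p (\<sigma> z) z \<in> T \<and> \<rho> (p (\<sigma> z) z) < \<rho> z) \<and> ok T \<sigma>)" for T
  have "finite (Collect Inv)" by (rule finite_subset[of _ "Pow N"]) (use fin in \<open>auto simp: Inv_def\<close>)
  moreover have "{r} \<in> Collect Inv"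
  proof -
    have "ok {r} (\<lambda>_. True)" unfolding ok_def
    proof (intro allI impI notI)
      fix S assume "S ~= {}" "S \<subseteq> N - {r}" "outs p (D {r} (\<lambda>_. True)) S = {}"
      then show False using out[of S] by (simp add: D_def)
    qed
    then show ?thesis using r unfolding Inv_def mem_Collect_eq by blast
  qed
  ultimately obtain T where T: "Inv T" "!!T'. Inv T' ==> T \<subseteq> T' ==> T = T'"
    using finite_has_maximal[of "Collect Inv"] by blast
  obtain \<sigma> and \<rho> :: "'a => nat" where \<rho>: "!!z. z \<in> T - {r} ==> p (\<sigma> z) z \<in> T \<and> \<rho> (p (\<sigma> z) z) < \<rho> z" and ok: "ok T \<sigma>"
    using T(1) unfolding Inv_def by blast
  have TN: "r \<in> T" "T \<subseteq> N" using T(1) by (auto simp: Inv_def)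
  let ?d = "\<lambda>S. outs p (D T \<sigma>) S"
  have d1: "1 <= card (?d S)" if "S ~= {}" "S \<subseteq> N - {r}" for S
    using ok finO that unfolding ok_def by (metis One_nat_def Suc_leI card_gt_0_iff)
  have d2: "2 <= card (?d S)" if S: "S ~= {}" "S \<subseteq> N - T" for S
  proof -
    have "?d S = outs p ((N - {r}) \<times> UNIV) S" using S(2) by (auto simp: outs_def D_def)
    moreover have "S \<subseteq> N - {r}" using S(2) TN by auto
    ultimately show ?thesis using out[OF S(1)] by simp
  qed
  have "T = N"
  proof (rule ccontr)
    assume neq: "T ~= N"
    \<comment> \<open>A tight set has a single arc left; spending that arc on the first arborescence
      would destroy \<open>ok\<close>.\<close>
    define tight where "tight S \<longleftrightarrow> S \<subseteq> N - {r} \<and> card (?d S) = 1 \<and> \<not> S \<subseteq> T" for S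
    have "\<exists>z b. z \<in> N - T \<and> p b z \<in> T \<and> (\<forall>S. tight S --> z \<in> S --> p b z \<in> S)"
    proof (cases "\<exists>S. tight S")
      case False
      have "2 <= card (?d (N - T))" using neq TN by (intro d2) auto
      then have "?d (N - T) ~= {}" by auto
      then obtain a where a: "a \<in> D T \<sigma>" "fst a \<in> N - T" "p (snd a) (fst a) \<notin> N - T" by (auto simp: outs_def)
      then have "fst a \<in> N - {r}" using TN by auto
      then have "p (snd a) (fst a) \<in> T" using p a(3) by blast
      then show ?thesis using a(2) False by blast
    next
      case True
      have "finite (Collect tight)" by (rule finite_subset[of _ "Pow N"]) (use fin in \<open>auto simp: tight_def\<close>)
      then obtain S where S: "tight S" "!!S'. tight S' ==> S' \<subseteq> S ==> S = S'"
        using True finite_has_minimal[of "Collect tight"] by blast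
      have ST: "S - T ~= {}" "S - T \<subseteq> N - T" "S \<subseteq> N - {r}" "card (?d S) = 1" using S(1) by (auto simp: tight_def)
      have "\<not> ?d (S - T) \<subseteq> ?d S"
      proof
        assume "?d (S - T) \<subseteq> ?d S"
        then have "card (?d (S - T)) <= card (?d S)" using finO by (intro card_mono)
        then show False using d2[OF ST(1,2)] ST(4) by linarith
      qed
      then obtain a where a: "fst a \<in> S - T" "p (snd a) (fst a) \<in> S" "p (snd a) (fst a) \<notin> S - T" by (auto simp: outs_def)
      have "p (snd a) (fst a) \<in> S'" if S': "tight S'" "fst a \<in> S'" for S'
      proof (rule ccontr)
        assume n: "p (snd a) (fst a) \<notin> S'"
        \<comment> \<open>Uncrossing: the intersection of two tight sets is tight again, so by
          minimality it is all of \<open>S\<close>.\<close>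
        have "card (?d (S \<inter> S')) + card (?d (S \<union> S')) <= card (?d S) + card (?d S')" by (rule outs_submodular[OF finD])
        moreover have "1 <= card (?d (S \<union> S'))" by (rule d1) (use S(1) S' in \<open>auto simp: tight_def\<close>)
        moreover have "1 <= card (?d (S \<inter> S'))" by (rule d1) (use ST(3) S' a(1) in auto)
        ultimately have "card (?d (S \<inter> S')) = 1" using ST(4) S'(1) by (simp add: tight_def)
        then have "tight (S \<inter> S')" using ST(3) a(1) S'(2) by (auto simp: tight_def)
        then have "S = S \<inter> S'" by (rule S(2)) auto
        then show False using a(2) n by blast
      qed
      then show ?thesis using a ST(3) by (intro exI[of _ "fst a"] exI[of _ "snd a"]) auto
    qed
    then obtain z b where z: "z \<in> N - T" "p b z \<in> T" "!!S. tight S ==> z \<in> S ==> p b z \<in> S" by blast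
    define \<sigma>' where "\<sigma>' = \<sigma>(z := b)"
    define \<rho>' where "\<rho>' = \<rho>(z := Suc (\<rho> (p b z)))"
    have zr: "z \<notin> T" "z ~= r" "p b z ~= z" using z TN by auto
    have D': "D (insert z T) \<sigma>' = D T \<sigma> - {(z,b)}"
    proof -
      have "(\<lambda>z. (z, \<sigma>' z)) ` (insert z T - {r}) = insert (z,b) ((\<lambda>z. (z, \<sigma> z)) ` (T - {r}))"
      proof -
        have "insert z T - {r} = insert z (T - {r})" using zr by blast
        moreover have "(\<lambda>z. (z, \<sigma>' z)) ` (T - {r}) = (\<lambda>z. (z, \<sigma> z)) ` (T - {r})" by (rule image_cong) (use zr in \<open>auto simp: \<sigma>'_def\<close>)
        ultimately show ?thesis by (simp add: \<sigma>'_def)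
      qed
      then show ?thesis unfolding D_def by (rule ssubst) (rule Diff_insert)
    qed
    have ok': "ok (insert z T) \<sigma>'" unfolding ok_def
    proof (intro allI impI notI)
      fix S assume S: "S ~= {}" "S \<subseteq> N - {r}" "outs p (D (insert z T) \<sigma>') S = {}"
      then have sub: "?d S \<subseteq> {(z,b)}" unfolding D' outs_def by blast
      then have "card (?d S) <= 1" using card_mono[OF _ sub] by simp
      then have c1: "card (?d S) = 1" using d1[OF S(1,2)] by linarith
      then have "(z,b) \<in> ?d S" using sub by (metis card.empty subset_singletonD singletonI zero_neq_one)
      then have "z \<in> S" "p b z \<notin> S" by (auto simp: outs_def)
      moreover have "tight S" using c1 S(2) \<open>z \<in> S\<close> zr by (auto simp: tight_def)
      ultimately show False using z(3) by blast
    qed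
    have "p (\<sigma>' y) y \<in> insert z T \<and> \<rho>' (p (\<sigma>' y) y) < \<rho>' y" if "y \<in> insert z T - {r}" for y
    proof (cases "y = z")
      case True then show ?thesis using z(2) zr by (simp add: \<rho>'_def \<sigma>'_def)
    next
      case False
      then have "y \<in> T - {r}" using that by auto
      then show ?thesis using \<rho>[of y] False zr by (auto simp: \<rho>'_def \<sigma>'_def)
    qed
    then have "Inv (insert z T)" unfolding Inv_def using TN z(1) ok' by blast
    then show False using T(2)[of "insert z T"] zr by auto
  qed
  \<comment> \<open>Once \<open>T = N\<close>, exactly one arc per vertex is left over, and
    \<open>ok\<close> is the hypothesis under which this functional graph has a rank.\<close>
  have "\<exists>\<rho>2::'a => nat. \<forall>z\<in>N - {r}. \<rho>2 (p (\<not> \<sigma> z) z) < \<rho>2 z"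
  proof (rule rank_functional[OF fin r])
    fix S assume S: "S ~= {}" "S \<subseteq> N - {r}"
    obtain a where a: "a \<in> D N \<sigma>" "fst a \<in> S" "p (snd a) (fst a) \<notin> S" using ok S \<open>T = N\<close> unfolding ok_def outs_def by blast
    have "snd a = (\<not> \<sigma> (fst a))" using a(1) by (cases a) (auto simp: D_def)
    then have "p (\<not> \<sigma> (fst a)) (fst a) \<notin> S" using a(3) by simp
    then show "\<exists>z\<in>S. p (\<not> \<sigma> z) z \<notin> S" using a(2) by blast
  qed (use p in auto)
  then show ?thesis using \<rho> \<open>T = N\<close> by blast
qed

section \<open>Admissible partitions\<close>

definition nonclass :: "('v \<times> 'v \<times> 'v) set => 'v set set => ('v \<times> 'v \<times> 'v) set" where
  "nonclass E \<P> = E - (\<Union>c\<in>\<P>. Esub E c)"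

text \<open>The final disjunction separates a degenerate case, a single mixed edge whose label lies
  in the class of one of its ends, from the generic one. There \<open>\<sigma> cz\<close> tells
  which arborescence receives the source of the edge owned by \<open>cz\<close>, the target going to
  the other; \<rho> gives the ranks that decrease along both.\<close>

definition LOT_partition where
  "LOT_partition V E \<P> \<longleftrightarrow> (finite \<P> \<and> (\<forall>c\<in>\<P>. block E c \<and> c ~= V) \<and> (\<forall>c\<in>\<P>. \<forall>c'\<in>\<P>. c ~= c' --> c \<inter> c' = {}) \<and> \<Union>\<P> = V \<and>
     (\<forall>e\<in>nonclass E \<P>. \<forall>c\<in>\<P>. \<not> (src e \<in> c \<and> tgt e \<in> c)) \<and>
     (\<forall>e\<in>nonclass E \<P>. \<forall>e'\<in>nonclass E \<P>. \<forall>c\<in>\<P>. lab e \<in> c --> lab e' \<in> c --> e = e')) \<and>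
     ((\<exists>e. nonclass E \<P> = {e} \<and> (\<exists>c\<in>\<P>. lab e \<in> c \<and> (src e \<in> c \<or> tgt e \<in> c))) \<or>
      (\<exists>\<sigma> \<rho>. \<forall>e\<in>nonclass E \<P>. \<forall>cz\<in>\<P>. \<forall>cx\<in>\<P>. \<forall>cy\<in>\<P>. lab e \<in> cz --> src e \<in> cx --> tgt e \<in> cy -->
          cx ~= cz \<and> cy ~= cz \<and> (\<rho> (\<sigma> cz) cx < (\<rho> (\<sigma> cz) cz :: nat)) \<and> \<rho> (\<not> \<sigma> cz) cy < \<rho> (\<not> \<sigma> cz) cz))"

lemma LOT_partitionD:
  assumes "LOT_partition V E \<P>"
  shows "finite \<P>" "c \<in> \<P> ==> block E c" "c \<in> \<P> ==> c ~= V" "c \<in> \<P> ==> c' \<in> \<P> ==> c ~= c' ==> c \<inter> c' = {}" "\<Union>\<P> = V"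
    "e \<in> nonclass E \<P> ==> c \<in> \<P> ==> \<not> (src e \<in> c \<and> tgt e \<in> c)"
    "e \<in> nonclass E \<P> ==> e' \<in> nonclass E \<P> ==> c \<in> \<P> ==> lab e \<in> c ==> lab e' \<in> c ==> e = e'" "c \<in> \<P> ==> c \<subseteq> V"
proof -
  note P = assms[unfolded LOT_partition_def, THEN conjunct1]
  note P2 = P[THEN conjunct2] note P3 = P2[THEN conjunct2] note P4 = P3[THEN conjunct2] note P5 = P4[THEN conjunct2]
  show "finite \<P>" using P by (rule conjunct1)
  show "block E c" "c ~= V" if "c \<in> \<P>" using P2[THEN conjunct1, THEN bspec, OF that] by auto
  show "c \<inter> c' = {}" if "c \<in> \<P>" "c' \<in> \<P>" "c ~= c'" using P3[THEN conjunct1, THEN bspec, OF that(1), THEN bspec, OF that(2)] that(3) by (rule mp)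
  show U: "\<Union>\<P> = V" using P4 by (rule conjunct1)
  show "\<not> (src e \<in> c \<and> tgt e \<in> c)" if "e \<in> nonclass E \<P>" "c \<in> \<P>" by (rule P5[THEN conjunct1, THEN bspec, OF that(1), THEN bspec, OF that(2)])
  show "e = e'" if "e \<in> nonclass E \<P>" "e' \<in> nonclass E \<P>" "c \<in> \<P>" "lab e \<in> c" "lab e' \<in> c"
    using P5[THEN conjunct2, THEN bspec, OF that(1), THEN bspec, OF that(2), THEN bspec, OF that(3)] that(4,5) by simp
  show "c \<subseteq> V" if "c \<in> \<P>" using that U by blast
qed

lemma card_classes:
  assumes "finite \<S>" "!!c c'. c \<in> \<S> ==> c' \<in> \<S> ==> c ~= c' ==> c \<inter> c' = {}" "!!c. c \<in> \<S> ==> block E c \<and> finite c" "finite E"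
  shows "card (\<Union>c\<in>\<S>. Esub E c) + card \<S> = card (\<Union>\<S>)"
proof -
  have "card (\<Union>c\<in>\<S>. Esub E c) = (\<Sum>c\<in>\<S>. card (Esub E c))"
    using assms by (intro card_UN_disjoint) (auto simp: Esub_def)
  moreover have "card (\<Union>\<S>) = (\<Sum>c\<in>\<S>. card c)" using assms by (intro card_Union_disjoint) (auto simp: pairwise_def disjnt_def)
  moreover have "(\<Sum>c\<in>\<S>. card c) = (\<Sum>c\<in>\<S>. card (Esub E c) + 1)"
    by (rule sum.cong) (use assms(3) in \<open>auto simp: block_def\<close>)
  moreover have "(\<Sum>c\<in>\<S>. card (Esub E c) + 1) = (\<Sum>c\<in>\<S>. card (Esub E c)) + card \<S>" by (subst sum.distrib) simp
  ultimately show ?thesis by linarith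
qed

text \<open>There is one mixed edge fewer than classes, and by injectivity each class contains the
  label of at most one of them; in the generic case every class except a root owns exactly one. The
  ends of the owned edge are the two arcs leaving a class. If at most one arc left a set of several
  classes, the owned edges inside would make its union a proper block, against the choice of the
  partition.\<close>

lemma LOT_partition_exists:
  assumes L: "nLOT V E" and S0: "block E S0" "S0 \<subseteq> V" "S0 ~= V"
  shows "\<exists>\<P>. LOT_partition V E \<P> \<and> (\<exists>c\<in>\<P>. S0 \<subseteq> c)"
proof -
  obtain \<P> where P: "finite \<P>" "!!c. c \<in> \<P> ==> block E c \<and> c ~= V" "!!c c'. c \<in> \<P> ==> c' \<in> \<P> ==> c ~= c' ==> c \<inter> c' = {}"
    "\<Union>\<P> = V" "\<exists>c\<in>\<P>. S0 \<subseteq> c" "!!S. S \<subseteq> \<P> ==> 2 <= card S ==> block E (\<Union>S) ==> \<Union>S = V"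
  proof -
    from partition_exists[OF L S0] obtain \<P> where P: "finite \<P> \<and> (\<forall>c\<in>\<P>. block E c \<and> c ~= V) \<and> (\<forall>c\<in>\<P>. \<forall>c'\<in>\<P>. c ~= c' --> c \<inter> c' = {}) \<and>
      \<Union>\<P> = V \<and> (\<exists>c\<in>\<P>. S0 \<subseteq> c)" "\<forall>S\<subseteq>\<P>. 2 <= card S --> block E (\<Union>S) --> \<Union>S = V" by (elim exE conjE) (rule that; blast)
    show thesis by (rule that[of \<P>]) (use P in blast)+
  qed
  have fin: "finite V" "finite E" "inj_on lab E" and E: "!!e. e \<in> E ==> src e \<in> V \<and> lab e \<in> V \<and> tgt e \<in> V"
    and cE: "card E + 1 = card V" and forest: "!!S. S \<subseteq> V ==> S ~= {} ==> card {e\<in>E. src e \<in> S \<and> tgt e \<in> S} < card S"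
    using nLOTD[OF L] by blast+
  have fc: "finite c" "c \<subseteq> V" "c ~= {}" if "c \<in> \<P>" for c using that P(2,4) fin(1) by (auto simp: block_def intro: finite_subset)
  define M where "M = nonclass E \<P>"
  have ME: "M \<subseteq> E" by (auto simp: M_def nonclass_def)
  have finM: "finite M" using ME fin(2) by (rule finite_subset)
  have finEs: "finite (Esub E c)" for c using fin(2) by (simp add: Esub_def)
  define cl where "cl v = (THE c. c \<in> \<P> \<and> v \<in> c)" for v
  have cl: "cl v = c" if "c \<in> \<P>" "v \<in> c" for c v unfolding cl_def using that P(3) by (intro the_equality) blast+
  have clP: "cl v \<in> \<P>" "v \<in> cl v" if "v \<in> V" for v using that P(4) cl by (metis UnionE)+
  have W: "card (Esub E W) < card W" if "W \<subseteq> V" "W ~= {}" for W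
  proof -
    have "card (Esub E W) <= card {e\<in>E. src e \<in> W \<and> tgt e \<in> W}" using fin(2) by (intro card_mono) (auto simp: Esub_def)
    then show ?thesis using forest[OF that] by linarith
  qed
  \<comment> \<open>A block already attains the forest bound, so it spans no edge besides its
    own.\<close>
  have Q1: "\<not> (src e \<in> c \<and> tgt e \<in> c)" if "e \<in> M" "c \<in> \<P>" for e c
  proof
    assume "src e \<in> c \<and> tgt e \<in> c"
    moreover have "Esub E c = {e\<in>E. src e \<in> c \<and> tgt e \<in> c}"
    proof (rule card_subset_eq)
      show "finite {e\<in>E. src e \<in> c \<and> tgt e \<in> c}" using fin(2) by simp
      show sub: "Esub E c \<subseteq> {e\<in>E. src e \<in> c \<and> tgt e \<in> c}" by (auto simp: Esub_def)
      have "card (Esub E c) <= card {e\<in>E. src e \<in> c \<and> tgt e \<in> c}" using fin(2) sub by (intro card_mono) auto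
      then show "card (Esub E c) = card {e\<in>E. src e \<in> c \<and> tgt e \<in> c}"
        using forest[OF fc(2,3)[OF that(2)]] P(2)[OF that(2)] by (simp add: block_def)
    qed
    ultimately have "e \<in> Esub E c" using that(1) ME by blast
    then show False using that by (auto simp: M_def nonclass_def)
  qed
  \<comment> \<open>The edges of a block have distinct labels, all in the block and one fewer than
    its vertices; only one vertex is left to label a mixed edge.\<close>
  have Q2: "e = e'" if "e \<in> M" "e' \<in> M" "c \<in> \<P>" "lab e \<in> c" "lab e' \<in> c" for e e' c
  proof (rule ccontr)
    assume ne: "e ~= e'"
    have "{e,e'} \<inter> Esub E c = {}" using that by (auto simp: M_def nonclass_def)
    then have "card ({e,e'} \<union> Esub E c) = 2 + card (Esub E c)" using ne finEs by (subst card_Un_disjoint) auto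
    moreover have "card (lab ` ({e,e'} \<union> Esub E c)) = card ({e,e'} \<union> Esub E c)"
      using that(1,2) ME by (intro card_image inj_on_subset[OF fin(3)]) (auto simp: Esub_def)
    moreover have "card (lab ` ({e,e'} \<union> Esub E c)) <= card c"
      using that fc(1)[OF that(3)] by (intro card_mono) (auto simp: Esub_def)
    ultimately show False using P(2)[OF that(3)] by (simp add: block_def)
  qed
  have cM: "card M + 1 = card \<P>"
  proof -
    have "card (\<Union>c\<in>\<P>. Esub E c) + card \<P> = card V" using card_classes[of \<P> E] P fc fin by auto
    moreover have "card M = card E - card (\<Union>c\<in>\<P>. Esub E c)" unfolding M_def nonclass_def
      using P(1) finEs by (intro card_Diff_subset) (auto simp: Esub_def)
    moreover have "card (\<Union>c\<in>\<P>. Esub E c) <= card E" using fin(2) by (intro card_mono) (auto simp: Esub_def)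
    moreover have "card \<P> ~= 0" using P(1,5) by auto
    ultimately show ?thesis using cE by linarith
  qed
  have blockI: "block E (\<Union>S)" if S: "S \<subseteq> \<P>" "S ~= {}" and F: "F \<subseteq> M" "!!e. e \<in> F ==> e \<in> Esub E (\<Union>S)" "card S <= card F + 1" for S F
  proof -
    have finS: "finite S" using S(1) P(1) finite_subset by blast
    have sub: "\<Union>S \<subseteq> V" "\<Union>S ~= {}" using S fc by blast+
    have 1: "card (\<Union>c\<in>S. Esub E c) + card S = card (\<Union>S)"
    proof (rule card_classes[OF finS _ _ fin(2)])
      fix c c' assume "c \<in> S" "c' \<in> S" "c ~= c'" then show "c \<inter> c' = {}" using P(3)[of c c'] S(1) by blast
    next
      fix c assume "c \<in> S" then show "block E c \<and> finite c" using P(2)[of c] fc(1)[of c] S(1) by blast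
    qed
    have "card ((\<Union>c\<in>S. Esub E c) \<union> F) = card (\<Union>c\<in>S. Esub E c) + card F"
      using finS finEs finite_subset[OF F(1) finM] F(1) S(1) by (intro card_Un_disjoint) (auto simp: M_def nonclass_def)
    moreover have "card ((\<Union>c\<in>S. Esub E c) \<union> F) <= card (Esub E (\<Union>S))"
    proof (rule card_mono[OF finEs], intro Un_least UN_least subsetI)
      show "e \<in> Esub E (\<Union>S)" if "c \<in> S" "e \<in> Esub E c" for c e using that unfolding Esub_def by blast
    qed (rule F(2))
    ultimately show ?thesis using 1 F(3) W[OF sub] sub(2) unfolding block_def by linarith
  qed
  have MP: "cl (src e) \<in> \<P>" "src e \<in> cl (src e)" "cl (lab e) \<in> \<P>" "lab e \<in> cl (lab e)" "cl (tgt e) \<in> \<P>" "tgt e \<in> cl (tgt e)" if "e \<in> M" for e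
    using clP E ME that by blast+
  have base: "LOT_partition V E \<P>" if
    "(\<exists>e. M = {e} \<and> (\<exists>c\<in>\<P>. lab e \<in> c \<and> (src e \<in> c \<or> tgt e \<in> c))) \<or>
      (\<exists>\<sigma> \<rho>. \<forall>e\<in>M. \<forall>cz\<in>\<P>. \<forall>cx\<in>\<P>. \<forall>cy\<in>\<P>. lab e \<in> cz --> src e \<in> cx --> tgt e \<in> cy -->
          cx ~= cz \<and> cy ~= cz \<and> (\<rho> (\<sigma> cz) cx < (\<rho> (\<sigma> cz) cz :: nat)) \<and> \<rho> (\<not> \<sigma> cz) cy < \<rho> (\<not> \<sigma> cz) cz)"
    unfolding LOT_partition_def M_def[symmetric]
  proof (intro conjI ballI impI)
    show "\<not> (src e \<in> c \<and> tgt e \<in> c)" if "e \<in> M" "c \<in> \<P>" for e c by (rule Q1[OF that])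
    show "e = e'" if "e \<in> M" "e' \<in> M" "c \<in> \<P>" "lab e \<in> c" "lab e' \<in> c" for e e' c by (rule Q2[OF that])
    show "c \<inter> c' = {}" if "c \<in> \<P>" "c' \<in> \<P>" "c ~= c'" for c c' by (rule P(3)[OF that])
    show "block E c" "c ~= V" if "c \<in> \<P>" for c using P(2)[OF that] by auto
  qed (fact P(1) P(4) that)+
  show ?thesis
  proof (cases "\<exists>e\<in>M. cl (lab e) = cl (src e) \<or> cl (lab e) = cl (tgt e)")
    case True
    then obtain e where e: "e \<in> M" "cl (lab e) = cl (src e) \<or> cl (lab e) = cl (tgt e)" by blast
    \<comment> \<open>The label lies in one of the two end classes, so these two with the edge form
      a block; by minimality they are the whole partition.\<close>
    let ?S = "{cl (src e), cl (tgt e)}"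
    have ne: "cl (src e) ~= cl (tgt e)" using Q1[OF e(1) MP(1)[OF e(1)]] MP[OF e(1)] by auto
    have "block E (\<Union>?S)"
    proof (rule blockI[of _ "{e}"])
      show "?S \<subseteq> \<P>" using MP[OF e(1)] by auto
      show "card ?S <= card {e} + 1" by (simp add: card_insert_if)
      fix e' assume "e' \<in> {e}"
      then show "e' \<in> Esub E (\<Union>?S)" using e MP[OF e(1)] ME unfolding Esub_def by auto
    qed (use e in auto)
    then have V: "\<Union>?S = V" using MP[OF e(1)] ne by (intro P(6)) auto
    have "\<P> \<subseteq> ?S"
    proof
      fix c assume c: "c \<in> \<P>"
      then obtain v where "v \<in> c" "v \<in> V" using fc by blast
      then show "c \<in> ?S" using V c P(3)[OF c] MP[OF e(1)] by blast
    qed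
    then have "\<P> = ?S" using MP[OF e(1)] by auto
    then have "card M = 1" using cM ne by simp
    then have "M = {e}" using e(1) by (metis card_1_singletonE singletonD)
    then have "LOT_partition V E \<P>" using e(2) MP[OF e(1)] by (intro base disjI1) metis
    then show ?thesis using P(5) by blast
  next
    case False
    have inj: "inj_on (\<lambda>e. cl (lab e)) M" by (intro inj_onI) (metis Q2 MP(3,4))
    have imP: "(\<lambda>e. cl (lab e)) ` M \<subseteq> \<P>" using MP by auto
    have "card (\<P> - (\<lambda>e. cl (lab e)) ` M) = 1" using imP P(1) finM cM card_image[OF inj] by (simp add: card_Diff_subset)
    then obtain r where r: "\<P> - (\<lambda>e. cl (lab e)) ` M = {r}" by (metis card_1_singletonE)
    then have rP: "r \<in> \<P>" by blast
    have im: "(\<lambda>e. cl (lab e)) ` M = \<P> - {r}" using r imP by blast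
    define ee where "ee z = inv_into M (\<lambda>e. cl (lab e)) z" for z
    have ee: "ee z \<in> M" "cl (lab (ee z)) = z" if "z \<in> \<P> - {r}" for z
      using that im by (metis ee_def inv_into_into, metis ee_def f_inv_into_f)
    have ee': "ee (cl (lab e)) = e" if "e \<in> M" for e using inv_into_f_f[OF inj that] by (simp add: ee_def)
    define p where "p b z = (if b then cl (src (ee z)) else cl (tgt (ee z)))" for b z
    have pP: "p b z \<in> \<P>" if "z \<in> \<P> - {r}" for b z using ee[OF that] MP by (simp add: p_def)
    have out: "2 <= card (outs p ((\<P> - {r}) \<times> UNIV) S)" if S: "S ~= {}" "S \<subseteq> \<P> - {r}" for S
    proof (rule ccontr)
      assume "\<not> ?thesis"
      then have le: "card (outs p ((\<P> - {r}) \<times> UNIV) S) <= 1" by linarith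
      have finS: "finite S" using S(2) P(1) by (meson finite_Diff finite_subset)
      \<comment> \<open>Each class in \<open>?B\<close> accounts for an arc leaving
        \<open>S\<close>; the edges owned by the other classes of \<open>S\<close> stay inside the
        union.\<close>
      let ?B = "{z\<in>S. p True z \<notin> S \<or> p False z \<notin> S}"
      have "?B \<subseteq> fst ` outs p ((\<P> - {r}) \<times> UNIV) S"
      proof
        fix z assume z: "z \<in> ?B"
        then obtain b where "p b z \<notin> S" by blast
        then have "(z,b) \<in> outs p ((\<P> - {r}) \<times> UNIV) S" using z S(2) unfolding outs_def by auto
        then show "z \<in> fst ` outs p ((\<P> - {r}) \<times> UNIV) S" by (metis fst_conv image_eqI)
      qed
      then have "card ?B <= card (fst ` outs p ((\<P> - {r}) \<times> UNIV) S)"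
        using P(1) by (intro card_mono) (auto simp: outs_def)
      also have "\<dots> <= card (outs p ((\<P> - {r}) \<times> UNIV) S)" using P(1) by (intro card_image_le) (auto simp: outs_def)
      finally have B: "card ?B <= 1" using le by linarith
      have cS: "card (S - ?B) = card S - card ?B" "card ?B <= card S" using finS by (auto intro!: card_Diff_subset card_mono)
      have injS: "inj_on ee (S - ?B)"
      proof (rule inj_onI)
        fix y z assume yz: "y \<in> S - ?B" "z \<in> S - ?B" "ee y = ee z"
        then have "y \<in> \<P> - {r}" "z \<in> \<P> - {r}" using S(2) by blast+
        then have "cl (lab (ee y)) = y" "cl (lab (ee z)) = z" by (simp_all add: ee(2))
        then show "y = z" using yz(3) by metis
      qed
      have "block E (\<Union>S)"
      proof (rule blockI[of _ "ee ` (S - ?B)"])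
        show "S \<subseteq> \<P>" "S ~= {}" using S by auto
        show "ee ` (S - ?B) \<subseteq> M" using ee(1) S(2) by blast
        show "card S <= card (ee ` (S - ?B)) + 1" unfolding card_image[OF injS] using cS B by linarith
        fix e assume "e \<in> ee ` (S - ?B)"
        then obtain z where z: "z \<in> S" "p True z \<in> S" "p False z \<in> S" "e = ee z" by blast
        then have eM: "e \<in> M" "cl (lab e) = z" using ee S(2) by blast+
        then show "e \<in> Esub E (\<Union>S)" using z MP[OF eM(1)] ME unfolding Esub_def p_def by auto
      qed
      moreover have "\<Union>S ~= V"
      proof
        assume "\<Union>S = V"
        then obtain v c where "v \<in> r" "c \<in> S" "v \<in> c" using fc[OF rP] by blast
        then show False using S(2) P(3)[of c r] rP by blast
      qed
      \<comment> \<open>Minimality leaves only the case of a single class, but both of its arcs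
        leave it.\<close>
      ultimately have "\<not> 2 <= card S" using P(6)[of S] S(2) by blast
      moreover have "card S ~= 0" using S(1) finS by simp
      ultimately have "card S = 1" by linarith
      then obtain z where z: "S = {z}" by (metis card_1_singletonE)
      then have zz: "z \<in> \<P> - {r}" using S(2) by blast
      have "p True z ~= z" "p False z ~= z" using False ee[OF zz] unfolding p_def by auto
      then have "{(z,True),(z,False)} \<subseteq> outs p ((\<P> - {r}) \<times> UNIV) S" using z zz by (auto simp: outs_def)
      then have "card {(z,True),(z,False)} <= card (outs p ((\<P> - {r}) \<times> UNIV) S)" using P(1) by (intro card_mono) (auto simp: outs_def)
      then show False using le by simp
    qed
    have "\<exists>\<sigma> (\<rho>1::'a set => nat) (\<rho>2::'a set => nat). \<forall>z\<in>\<P> - {r}. \<rho>1 (p (\<sigma> z) z) < \<rho>1 z \<and> \<rho>2 (p (\<not> \<sigma> z) z) < \<rho>2 z"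
      by (rule two_branchings[OF P(1) rP pP out])
    then obtain \<sigma> and \<rho>1 \<rho>2 :: "'a set => nat" where \<rho>: "\<forall>z\<in>\<P> - {r}. \<rho>1 (p (\<sigma> z) z) < \<rho>1 z \<and> \<rho>2 (p (\<not> \<sigma> z) z) < \<rho>2 z"
      by blast
    define \<rho> where "\<rho> b = (if b then \<rho>1 else \<rho>2)" for b
    have "LOT_partition V E \<P>"
    proof (rule base, rule disjI2, rule exI[of _ \<sigma>], rule exI[of _ \<rho>], intro ballI impI)
      fix e cz cx cy assume a: "e \<in> M" "cz \<in> \<P>" "cx \<in> \<P>" "cy \<in> \<P>" "lab e \<in> cz" "src e \<in> cx" "tgt e \<in> cy"
      have c: "cl (lab e) = cz" "cl (src e) = cx" "cl (tgt e) = cy" using a cl by auto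
      then have "cz \<in> \<P> - {r}" "ee cz = e" using im a(1) ee'[OF a(1)] by auto
      then have "\<rho>1 (p (\<sigma> cz) cz) < \<rho>1 cz" "\<rho>2 (p (\<not> \<sigma> cz) cz) < \<rho>2 cz" "p b cz = (if b then cx else cy)" for b
        using \<rho>[THEN bspec, of cz] c by (auto simp: p_def)
      then show "cx ~= cz \<and> cy ~= cz \<and> \<rho> (\<sigma> cz) cx < \<rho> (\<sigma> cz) cz \<and> \<rho> (\<not> \<sigma> cz) cy < \<rho> (\<not> \<sigma> cz) cz"
        using False a(1) c by (cases "\<sigma> cz") (auto simp: \<rho>_def)
    qed
    then show ?thesis using P(5) by blast
  qed
qed

section \<open>Contractibility of immersed complexes\<close>

definition closed_LOG where "closed_LOG V E \<longleftrightarrow> (\<forall>e\<in>E. src e \<in> V \<and> lab e \<in> V \<and> tgt e \<in> V)"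

section \<open>The complex of a LOG and maps into it\<close>

lemma openin_K_LOG: "openin (K_LOG V E) W \<longleftrightarrow> K_open V E W"
  by (simp add: K_LOG_def istopology_K_open)

lemma char1_in: "x \<in> V ==> char1 x t \<in> K_points V E"
  by (auto simp: char1_def K_points_def)

lemma char2_in: assumes "closed_LOG V E" "e \<in> E" shows "char2 e p \<in> K_points V E"
proof (cases "norm p < 1")
  case True then show ?thesis using assms by (cases e) (auto simp: char2_def K_points_def)
next
  case False
  define s where "s = 2 * Arg2pi p / pi"
  have "0 <= s" "s < 4" using Arg2pi[of p] by (auto simp: s_def field_simps)
  then have k: "nat \<lfloor>s\<rfloor> < 4" by (simp add: nat_less_iff floor_less_iff)
  have V: "src e \<in> V" "lab e \<in> V" "tgt e \<in> V" using assms by (auto simp: closed_LOG_def)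
  have "fst (rel_word e ! nat \<lfloor>s\<rfloor>) \<in> V"
    using V less_4_cases[OF k] by (cases e) (auto simp: rel_word_def src_def lab_def tgt_def)
  from char1_in[OF this, of _ E] show ?thesis using False by (simp add: char2_def attach_def Let_def case_prod_unfold flip: s_def)
qed

lemma topspace_K_LOG: assumes "closed_LOG V E" shows "topspace (K_LOG V E) = K_points V E"
proof -
  have "{t \<in> {0..1}. char1 x t \<in> K_points V E} = {0..1}" if "x \<in> V" for x using char1_in[OF that] by auto
  moreover have "{p \<in> cball 0 1. char2 e p \<in> K_points V E} = cball 0 1" if "e \<in> E" for e using char2_in[OF assms that] by auto
  ultimately have "K_open V E (K_points V E)" unfolding K_open_def by (simp del: mem_cball atLeastAtMost_iff)
  moreover have "W \<subseteq> K_points V E" if "K_open V E W" for W using that by (simp add: K_open_def)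
  ultimately show ?thesis unfolding topspace_def openin_K_LOG by blast
qed

lemma continuous_char1: assumes "closed_LOG V E" "x \<in> V" shows "continuous_map (top_of_set {0..1}) (K_LOG V E) (char1 x)"
  unfolding continuous_map_def using assms char1_in[OF assms(2)]
  by (auto simp: openin_K_LOG K_open_def topspace_K_LOG[OF assms(1)])

lemma K_points_mono: "V' \<subseteq> V ==> E' \<subseteq> E ==> K_points V' E' \<subseteq> K_points V E"
  unfolding K_points_def by blast

lemma continuous_K_incl:
  assumes c: "closed_LOG V E" "closed_LOG V' E'" "V' \<subseteq> V" "E' \<subseteq> E"
  shows "continuous_map (K_LOG V' E') (K_LOG V E) (\<lambda>q. q)"
  unfolding continuous_map_def topspace_K_LOG[OF c(1)] topspace_K_LOG[OF c(2)]
proof (intro conjI allI impI)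
  show "(\<lambda>q. q) \<in> K_points V' E' \<rightarrow> K_points V E" using K_points_mono[OF c(3,4)] by auto
  fix W assume "openin (K_LOG V E) W"
  then have W: "K_open V E W" by (simp add: openin_K_LOG)
  have 1: "{t \<in> {0..1}. char1 x t \<in> {q \<in> K_points V' E'. q \<in> W}} = {t \<in> {0..1}. char1 x t \<in> W}" if "x \<in> V'" for x
    using char1_in[OF that] by blast
  have 2: "{p \<in> cball 0 1. char2 e p \<in> {q \<in> K_points V' E'. q \<in> W}} = {p \<in> cball 0 1. char2 e p \<in> W}" if "e \<in> E'" for e
    using char2_in[OF c(2) that] by blast
  show "openin (K_LOG V' E') {q \<in> K_points V' E'. q \<in> W}"
    unfolding openin_K_LOG K_open_def
  proof (intro conjI ballI)
    fix x assume "x \<in> V'" then show "openin (top_of_set {0..1}) {t \<in> {0..1}. char1 x t \<in> {q \<in> K_points V' E'. q \<in> W}}"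
      unfolding 1[OF \<open>x \<in> V'\<close>] using W c(3) unfolding K_open_def by blast
  next
    fix e assume "e \<in> E'" then show "openin (top_of_set (cball 0 1)) {p \<in> cball 0 1. char2 e p \<in> {q \<in> K_points V' E'. q \<in> W}}"
      unfolding 2[OF \<open>e \<in> E'\<close>] using W c(4) unfolding K_open_def by blast
  qed blast
qed

lemma proj_in: assumes "cx V E U R Ph" "q \<in> lpts U R Ph" shows "proj q \<in> K_points V E"
  using assms cxD(7,8)[OF assms(1)] by (cases q) (auto simp: K_points_def)

lemma continuous_proj:
  assumes c: "closed_LOG V E" and cx: "cx V E U R Ph"
  shows "continuous_map (LT U R Ph) (K_LOG V E) proj"
  unfolding continuous_map_def topspace_K_LOG[OF c(1)] topspace_LT[OF cxD(4)[OF cx]]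
proof (intro conjI allI impI)
  show "proj \<in> lpts U R Ph \<rightarrow> K_points V E" using proj_in[OF cx] by auto
  fix W assume "openin (K_LOG V E) W"
  then have W: "K_open V E W" by (simp add: openin_K_LOG)
  have 1: "{t \<in> {0..1}. charE a t \<in> {q \<in> lpts U R Ph. proj q \<in> W}} = {t \<in> {0..1}. char1 (elab a) t \<in> W}" if "a \<in> R" for a
    using charE_in[OF cxD(4)[OF cx] that] by (simp add: proj_charE)
  have 2: "{p \<in> cball 0 1. charF ph p \<in> {q \<in> lpts U R Ph. proj q \<in> W}} = {p \<in> cball 0 1. char2 (snd ph) p \<in> W}" if "ph \<in> Ph" for ph
    using charF_in[OF cxD(4)[OF cx] that] by (simp add: proj_charF)
  show "openin (LT U R Ph) {q \<in> lpts U R Ph. proj q \<in> W}"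
    unfolding openin_LT lopen_def
  proof (intro conjI ballI)
    fix a assume a: "a \<in> R" show "openin (top_of_set {0..1}) {t \<in> {0..1}. charE a t \<in> {q \<in> lpts U R Ph. proj q \<in> W}}"
      unfolding 1[OF a] using W cxD(7)[OF cx a] unfolding K_open_def by blast
  next
    fix ph assume a: "ph \<in> Ph" show "openin (top_of_set (cball 0 1)) {p \<in> cball 0 1. charF ph p \<in> {q \<in> lpts U R Ph. proj q \<in> W}}"
      unfolding 2[OF a] using W cxD(8)[OF cx a] unfolding K_open_def by blast
  qed blast
qed

lemma nullhtpy_incl:
  assumes "closed_LOG V E" "closed_LOG V' E'" "V' \<subseteq> V" "E' \<subseteq> E" "nullhtpy (K_LOG V' E') r b U R Ph h"
  shows "nullhtpy (K_LOG V E) r b U R Ph h"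
  using assms(5) continuous_map_compose[OF _ continuous_K_incl[OF assms(1-4)], of _ h] unfolding nullhtpy_def by (auto simp: o_def)

text \<open>Add the edges one by one. An edge between two components is accommodated by shifting the
  height on one of them, and the count leaves no room for an edge of another kind.\<close>

lemma tree_Ht:
  fixes U :: "'u set"
  assumes cx: "cx V E U R Ph" and conn: "conn U R" and ne: "U ~= {}" and le: "card R + 1 <= card U"
  shows "Ht R \<and> card U = card R + 1"
proof -
  have finU: "finite U" by (rule cxD(1)[OF cx])
  have "\<exists>f::'u => 'u. (\<forall>a\<in>S. f (esrc a) = f (etgt a)) \<and> card U <= card S + card (f ` U) \<and> (card S + card (f ` U) <= card U --> Ht S)"
    if S: "S \<subseteq> R" for S
    using finite_subset[OF S cxD(2)[OF cx]] S
  proof (induction S rule: finite_induct)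
    case empty show ?case by (intro exI[of _ "\<lambda>x. x"]) (auto simp: Ht_def)
  next
    case (insert a S)
    then obtain f :: "'u => 'u" where f: "!!b. b \<in> S ==> f (esrc b) = f (etgt b)" "card U <= card S + card (f ` U)" "card S + card (f ` U) <= card U --> Ht S"
      by blast
    have aU: "esrc a \<in> U" "etgt a \<in> U" using cxD(5,6)[OF cx] insert.prems by auto
    have cS: "card (insert a S) = Suc (card S)" using insert.hyps by simp
    show ?case
    proof (cases "f (esrc a) = f (etgt a)")
      case True
      have "f (esrc b) = f (etgt b)" if "b \<in> insert a S" for b using that True f(1) by blast
      then have "\<forall>b\<in>insert a S. f (esrc b) = f (etgt b)" by blast
      then show ?thesis using f(2) cS by (intro exI[of _ f] conjI) linarith+
    next
      case False
      define g where "g u = (if f u = f (etgt a) then f (esrc a) else f u)" for u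
      have g1: "g (esrc b) = g (etgt b)" if "b \<in> insert a S" for b using that f(1)[of b] unfolding g_def by (metis insertE)
      have sub1: "g ` U \<subseteq> f ` U - {f (etgt a)}" using False aU by (auto simp: g_def)
      have sub2: "f ` U \<subseteq> insert (f (etgt a)) (g ` U)" by (auto simp: g_def)
      have "card (f ` U) <= card (g ` U) + 1"
        using card_mono[OF _ sub2] finU by (metis (no_types, lifting) Suc_eq_plus1 card_insert_if finite_imageI finite_insert le_Suc_eq)
      moreover have "card (g ` U) <= card (f ` U) - 1" using card_mono[OF _ sub1] finU aU by simp
      moreover have "card (f ` U) > 0" using finU aU by (auto simp: card_gt_0_iff)
      ultimately have cg: "card (g ` U) + 1 = card (f ` U)" by linarith
      have "Ht (insert a S)" if "card (insert a S) + card (g ` U) <= card U"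
      proof -
        have "Ht S" using f(3) that cS cg by linarith
        then obtain h :: "'u => int" where h: "!!b. b \<in> S ==> h (etgt b) = h (esrc b) + 1" unfolding Ht_def by blast
        define k where "k u = (if f u = f (etgt a) then h u + (h (esrc a) + 1 - h (etgt a)) else h u)" for u
        have "k (etgt b) = k (esrc b) + 1" if "b \<in> insert a S" for b
        proof (cases "b = a")
          case True then show ?thesis using False by (simp add: k_def)
        next
          case False
          then have "b \<in> S" using that by simp
          then show ?thesis using h[of b] f(1)[of b] by (simp add: k_def)
        qed
        then show ?thesis unfolding Ht_def by blast
      qed
      moreover have "\<forall>b\<in>insert a S. g (esrc b) = g (etgt b)" using g1 by blast
      moreover have "card U <= card (insert a S) + card (g ` U)" using f(2) cg cS by linarith
      ultimately show ?thesis by blast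
    qed
  qed
  from this[OF subset_refl] obtain f :: "'u => 'u" where f: "!!a. a \<in> R ==> f (esrc a) = f (etgt a)" "card U <= card R + card (f ` U)" "card R + card (f ` U) <= card U --> Ht R"
    by blast
  obtain v where v: "v \<in> U" using ne by blast
  have step: "f u = f w" if "(u,w) \<in> (adj R)\<^sup>*" for u w
    using that
  proof (induction rule: rtrancl_induct)
    case (step y z)
    then obtain a where "a \<in> R" "esrc a = y \<and> etgt a = z \<or> esrc a = z \<and> etgt a = y" unfolding adj_def by blast
    then show ?case using step.IH f(1)[of a] by auto
  qed simp
  have "f ` U = {f v}" using conn v step unfolding conn_def by (auto intro: sym)
  then have "card (f ` U) = 1" by simp
  then show ?thesis using f le by auto
qed

text \<open>The universal covering of the circle formed by \<open>x\<close>. It is pasted over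
  intervals around the integers, where \<open>frac\<close> jumps while both sides tend to the base
  point.\<close>

lemma continuous_wrap:
  assumes "closed_LOG V E" "x \<in> V"
  shows "continuous_map euclidean (K_LOG V E) (\<lambda>t. char1 x (frac t))"
proof (rule pasting_lemma[where I="UNIV::int set" and T="\<lambda>n. {of_int n - 1<..<of_int n + 1}"
      and f="\<lambda>n t. if t <= of_int n then char1 x (t - of_int n + 1) else char1 x (t - of_int n)"])
  have fr: "char1 x (frac t) = (if t <= of_int n then char1 x (t - of_int n + 1) else char1 x (t - of_int n))"
    if "t \<in> {of_int n - 1<..<of_int n + 1}" for n :: int and t :: real
  proof -
    consider "t < of_int n" | "t = of_int n" | "t > of_int n" by linarith
    then show ?thesis
    proof cases
      case 1
      then have "frac t = t - of_int n + 1" using that by (intro frac_unique_iff[THEN iffD2]) (auto intro!: Ints_diff Ints_add simp: algebra_simps)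
      then show ?thesis using 1 by simp
    next
      case 2 then show ?thesis by (simp add: char1_def)
    next
      case 3
      then have "frac t = t - of_int n" using that by (intro frac_unique_iff[THEN iffD2]) auto
      then show ?thesis using 3 by simp
    qed
  qed
  fix n :: int
  let ?S = "{of_int n - 1<..<of_int n + 1 :: real}"
  show "openin euclidean ?S" by simp
  have "continuous_map (top_of_set ?S) (K_LOG V E) (\<lambda>t. if t <= of_int n then char1 x (t - of_int n + 1) else char1 x (t - of_int n))"
  proof (rule continuous_map_top_of_set_cases)
    show "continuous_map (top_of_set {t \<in> ?S. t <= of_int n}) (K_LOG V E) (\<lambda>t. char1 x (t - of_int n + 1))"
      by (rule continuous_map_top_of_set_compose[OF continuous_char1[OF assms]]) (auto intro!: continuous_intros)
    show "continuous_map (top_of_set {t \<in> ?S. of_int n <= t}) (K_LOG V E) (\<lambda>t. char1 x (t - of_int n))"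
      by (rule continuous_map_top_of_set_compose[OF continuous_char1[OF assms]]) (auto intro!: continuous_intros)
  qed (auto intro!: continuous_intros simp: char1_def)
  then show "continuous_map (subtopology euclidean ?S) (K_LOG V E) (\<lambda>t. if t <= of_int n then char1 x (t - of_int n + 1) else char1 x (t - of_int n))" .
  show "(if t <= of_int n then char1 x (t - of_int n + 1) else char1 x (t - of_int n)) = (if t <= of_int m then char1 x (t - of_int m + 1) else char1 x (t - of_int m))"
    if "t \<in> topspace euclidean \<inter> ?S \<inter> {of_int m - 1<..<of_int m + 1}" for m :: int and t :: real
    using fr[of t n] fr[of t m] that by auto
  show "\<exists>j. j \<in> UNIV \<and> t \<in> {of_int j - 1<..<of_int j + 1} \<and> char1 x (frac t) = (if t <= of_int j then char1 x (t - of_int j + 1) else char1 x (t - of_int j))"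
    for t :: real
    using fr[of t "\<lfloor>t\<rfloor>"] by (intro exI[of _ "\<lfloor>t\<rfloor>"]) (auto, linarith+)
qed

text \<open>With all labels equal to \<open>x\<close>, heights extended linearly over edges lift the
  projection to the real line, which contracts linearly to 0.\<close>

lemma nullhtpy_one_generator:
  fixes U :: "'u set" and x :: 'v
  assumes cl: "closed_LOG V E" and x: "x \<in> V" and cx: "cx {x} {} U R Ph" and H: "Ht R"
  shows "\<exists>h. nullhtpy (K_LOG V E) proj Base U R Ph h"
proof -
  have F: "Ph = {}" using cxD(8)[OF cx] by auto
  have lx: "elab a = x" if "a \<in> R" for a using cxD(7)[OF cx that] by simp
  obtain h :: "'u => int" where h: "!!a. a \<in> R ==> h (etgt a) = h (esrc a) + 1" using H unfolding Ht_def by blast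
  define g where "g q = (case q of LV u => real_of_int (h u) | LE a t => real_of_int (h (esrc a)) + t | LF ph p => 0)" for q :: "('u,'v) lpt"
  define k where "k = (\<lambda>(s,q). char1 x (frac ((1 - s) * g q)))"
  note wf = cxD(4)[OF cx]
  have gE: "g (charE a t) = real_of_int (h (esrc a)) + t" if "a \<in> R" "0 <= t" "t <= 1" for a t
    using that h[OF that(1)] by (auto simp: charE_def g_def)
  have "continuous_map (prod_topology I01 (LT U R Ph)) (K_LOG V E) k"
  proof (rule continuous_map_prod_LT[OF wf])
    show "locally_compact_space I01" by (rule compact_imp_locally_compact_space) (simp add: compact_space_subtopology)
    show "Hausdorff_space I01" by (simp add: Hausdorff_space_subtopology)
    show "continuous_map I01 (K_LOG V E) (\<lambda>y. k (y, LV u))" for u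
      unfolding k_def prod.case
      using continuous_map_compose[OF _ continuous_wrap[OF cl x], of I01 "\<lambda>y. (1 - y) * g (LV u)"]
      by (simp add: o_def continuous_intros)
    fix a assume a: "a \<in> R"
    have "continuous_map (prod_topology I01 I01) (K_LOG V E) (\<lambda>z. char1 x (frac ((1 - fst z) * (real_of_int (h (esrc a)) + snd z))))"
    proof -
      have "continuous_map (prod_topology I01 I01) euclidean (\<lambda>z. (1 - fst z) * (real_of_int (h (esrc a)) + snd z))"
        by (simp add: prod_topology_subtopology_eu continuous_intros flip: euclidean_product_topology)
      from continuous_map_compose[OF this continuous_wrap[OF cl x]] show ?thesis by (simp add: o_def)
    qed
    then show "continuous_map (prod_topology I01 I01) (K_LOG V E) (\<lambda>(y,t). k (y, charE a t))"
      by (rule continuous_map_eq) (auto simp: k_def gE[OF a])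
  qed (use F in auto)
  moreover have "k (0,q) = proj q \<and> k (1,q) = Base" if "q \<in> lpts U R Ph" for q
  proof (cases q)
    case (LE a t)
    then have a: "a \<in> R" "0 < t" "t < 1" using that by auto
    have fr: "frac (real_of_int (h (esrc a)) + t) = t" using a by (subst frac_unique_iff) auto
    have "k (0,q) = char1 x (frac (real_of_int (h (esrc a)) + t))" unfolding k_def g_def LE prod.case lpt.case by simp
    also have "\<dots> = proj q" unfolding fr using a lx[OF a(1)] LE by (simp add: char1_def)
    finally show ?thesis by (simp add: k_def char1_def)
  qed (use that F in \<open>auto simp: k_def g_def char1_def\<close>)
  ultimately show ?thesis unfolding nullhtpy_def by blast
qed

text \<open>A piece depends only on the edges and faces that touch it. This is used where pruning or
  splitting changes the complex elsewhere.\<close>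

lemma chip_transfer:
  assumes D: "D = comp R c u"
    and e: "!!b. elab b \<in> c ==> esrc b \<in> D \<or> etgt b \<in> D ==> b \<in> R \<longleftrightarrow> b \<in> R'"
    and f: "!!ph. labs ph \<subseteq> c ==> corner ph 0 \<in> D ==> ph \<in> Ph \<longleftrightarrow> ph \<in> Ph'"
  shows "comp R' c u = D" "chip R' Ph' c D = chip R Ph c D"
proof -
  have "w \<in> comp R' c u" if "w \<in> D" for w
  proof -
    have "(u,w) \<in> (adj (Rl R c))\<^sup>*" using that by (simp add: D comp_def)
    then have "w \<in> D \<and> (u,w) \<in> (adj (Rl R' c))\<^sup>*"
    proof (induction rule: rtrancl_induct)
      case base then show ?case by (simp add: D)
    next
      case (step y z)
      then obtain b where b: "b \<in> R" "elab b \<in> c" "esrc b = y \<and> etgt b = z \<or> esrc b = z \<and> etgt b = y" unfolding adj_def Rl_def by blast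
      have "z \<in> D" using step.IH comp_step[OF b(1,2)] comp_eq[of _ R c u] b(3) unfolding D by (metis comp_refl)
      moreover have "b \<in> R'" using e[OF b(2)] b(1,3) step.IH by blast
      then have "(y,z) \<in> adj (Rl R' c)" using b unfolding adj_def Rl_def by blast
      ultimately show ?case using step.IH by (meson rtrancl.rtrancl_into_rtrancl)
    qed
    then show ?thesis by (simp add: comp_def)
  qed
  moreover have "w \<in> D" if "w \<in> comp R' c u" for w
  proof -
    have "(u,w) \<in> (adj (Rl R' c))\<^sup>*" using that by (simp add: comp_def)
    then show "w \<in> D"
    proof (induction rule: rtrancl_induct)
      case base then show ?case by (simp add: D)
    next
      case (step y z)
      then obtain b where b: "b \<in> R'" "elab b \<in> c" "esrc b = y \<and> etgt b = z \<or> esrc b = z \<and> etgt b = y" unfolding adj_def Rl_def by blast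
      then have "b \<in> R" using e[OF b(2)] step.IH by blast
      then show "z \<in> D" using step.IH comp_step[OF _ b(2)] comp_eq[of _ R c u] b(3) unfolding D by (metis comp_refl)
    qed
  qed
  ultimately show "comp R' c u = D" by blast
  have "Rp R' c D = Rp R c D" unfolding Rp_def using e by blast
  moreover have "Fp Ph' c D = Fp Ph c D" unfolding Fp_def using f by blast
  ultimately show "chip R' Ph' c D = chip R Ph c D" by (simp add: chip_def)
qed

lemma labs_eq: "labs ph = {src (snd ph), lab (snd ph), tgt (snd ph)}"
  by (simp add: labs_def src_def lab_def tgt_def)

lemma clab_simps: "clab ph 0 = src (snd ph)" "clab ph 1 = lab (snd ph)" "clab ph 2 = tgt (snd ph)" "clab ph 3 = lab (snd ph)"
  by (simp_all add: clab_def bd_def elab_def src_def lab_def tgt_def split: prod.splits)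

lemma clab_labs: "k < 4 ==> clab ph k \<in> labs ph"
  using less_4_cases[of k] clab_simps[of ph] unfolding labs_eq by auto

section \<open>Mixed faces and their corners\<close>

definition lt :: "'v \<times> 'v \<times> 'v => nat => 'v" where "lt e j = [src e, lab e, tgt e, lab e] ! j"

lemma bd_edge:
  assumes "k < 4"
  shows "fst (bd ph ! k) = (if k < 2 then (corner ph k, lt (snd ph) k, corner ph (Suc k mod 4)) else (corner ph (Suc k mod 4), lt (snd ph) k, corner ph k))"
    "snd (bd ph ! k) = (k < 2)"
proof -
  obtain u0 u1 u2 u3 x z y where f: "ph = ((u0,u1,u2,u3),(x,z,y))" by (metis prod.exhaust)
  show "fst (bd ph ! k) = (if k < 2 then (corner ph k, lt (snd ph) k, corner ph (Suc k mod 4)) else (corner ph (Suc k mod 4), lt (snd ph) k, corner ph k))"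
    "snd (bd ph ! k) = (k < 2)"
    using less_4_cases[OF assms] unfolding f by (elim disjE; simp add: bd_def corner_def lt_def src_def lab_def tgt_def)+
qed

text \<open>Heights are demanded only on pieces of characteristic at least 1, since only these are
  known to possess them.\<close>

locale pieces =
  fixes V :: "'v set" and E \<P> and U :: "'u set" and R Ph and hh :: "'v set => 'u => int"
  assumes cx: "cx V E U R Ph" and part: "LOT_partition V E \<P>" and EV: "closed_LOG V E"
    and ht: "!!c a. c \<in> \<P> ==> a \<in> R ==> elab a \<in> c ==> 1 <= chip R Ph c (comp R c (esrc a)) ==> hh c (etgt a) = hh c (esrc a) + 1"
begin

abbreviation "I \<equiv> Iv \<P> R"
abbreviation "good c v \<equiv> 1 <= chip R Ph c (comp R c v)"

definition cl where "cl v = (THE c. c \<in> \<P> \<and> v \<in> c)"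

lemmas partD = LOT_partitionD[OF part]

lemma cl_eq: "c \<in> \<P> ==> v \<in> c ==> cl v = c"
  unfolding cl_def using partD(4) by (intro the_equality) blast+
lemma cl_in: "v \<in> V ==> cl v \<in> \<P>" "v \<in> V ==> v \<in> cl v"
  using partD(5) cl_eq by (metis UnionE)+
lemma cl_mem: "v \<in> V ==> c \<in> \<P> ==> v \<in> c \<longleftrightarrow> c = cl v"
  using cl_eq cl_in by blast

definition "N = {ph\<in>Ph. \<not> (\<exists>c\<in>\<P>. labs ph \<subseteq> c)}"

lemma N_nonclass: "ph \<in> N ==> snd ph \<in> nonclass E \<P>"
  using cxD(8)[OF cx, of ph] unfolding N_def nonclass_def labs_eq Esub_def by blast

lemma EinV: "e \<in> E ==> src e \<in> V" "e \<in> E ==> lab e \<in> V" "e \<in> E ==> tgt e \<in> V"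
  using EV by (auto simp: closed_LOG_def)

definition cstep where "cstep c p q \<longleftrightarrow> comp R c p = comp R c q \<and> c \<in> I p \<and> c \<in> I q \<and> (good c p --> hh c q = hh c p + 1)"

lemma edge_cstep: "a \<in> R ==> c \<in> \<P> ==> elab a \<in> c ==> cstep c (esrc a) (etgt a)"
  unfolding cstep_def using comp_step[of a R c] ht[of c a] unfolding Iv_def by blast

lemma face_csteps:
  assumes "ph \<in> Ph" "snd ph = e"
  shows "cstep (cl (src e)) (corner ph 0) (corner ph 1)" "cstep (cl (lab e)) (corner ph 1) (corner ph 2)"
    "cstep (cl (tgt e)) (corner ph 3) (corner ph 2)" "cstep (cl (lab e)) (corner ph 0) (corner ph 3)"
proof -
  have e: "e \<in> E" using cxD(8)[OF cx assms(1)] assms(2) by simp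
  have st: "cstep (cl (clab ph k)) (esrc (fst (bd ph ! k))) (etgt (fst (bd ph ! k)))" if "k < 4" for k
  proof (rule edge_cstep)
    show "fst (bd ph ! k) \<in> R" by (rule cxD(9)[OF cx assms(1) that])
    have "clab ph k \<in> V" using clab_labs[OF that, of ph] EinV[OF e] assms(2) unfolding labs_eq by auto
    then show "cl (clab ph k) \<in> \<P>" "elab (fst (bd ph ! k)) \<in> cl (clab ph k)" using cl_in by (auto simp: clab_def)
  qed
  show "cstep (cl (src e)) (corner ph 0) (corner ph 1)"
    using st[of 0] clab_simps[of ph] assms(2) by (simp add: bd_edge(1) esrc_def etgt_def)
  show "cstep (cl (lab e)) (corner ph 1) (corner ph 2)"
    using st[of 1] clab_simps[of ph] assms(2) by (simp add: bd_edge(1) esrc_def etgt_def numeral_2_eq_2)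
  show "cstep (cl (tgt e)) (corner ph 3) (corner ph 2)"
    using st[of 2] clab_simps[of ph] assms(2) by (simp add: bd_edge(1) esrc_def etgt_def)
  show "cstep (cl (lab e)) (corner ph 0) (corner ph 3)"
    using st[of 3] clab_simps[of ph] assms(2) by (simp add: bd_edge(1) esrc_def etgt_def)
qed

abbreviation "att w \<equiv> 2 <= card (I w)"

lemma attI: "c \<in> I w ==> c' \<in> I w ==> c ~= c' ==> att w"
proof -
  assume a: "c \<in> I w" "c' \<in> I w" "c ~= c'"
  have "finite (I w)" using partD(1) by (simp add: Iv_def)
  then have "card {c,c'} <= card (I w)" using a by (intro card_mono) auto
  then show ?thesis using a(3) by simp
qed

definition astep where "astep c p q \<longleftrightarrow> cstep c p q \<and> att p \<and> att q"

text \<open>For a face with three sides in one class: the fourth side, labelled outside, acts on the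
  heights of that class like an edge of it.\<close>

lemma cstep_square:
  assumes "cstep c u0 u3" "cstep c u0 u1" "cstep c u1 u2" shows "cstep c u3 u2"
  using assms unfolding cstep_def by auto

lemma cstep_square':
  assumes "cstep c u0 u3" "cstep c u3 u2" "cstep c u1 u2" shows "cstep c u0 u1"
  using assms unfolding cstep_def by auto

text \<open>A corner between letters of different classes is attached. If the label shares its class
  with one end, only the two corners on the side of the other end are certain to be attached; along
  that side the class of the label rises by one as well.\<close>

lemma N_face:
  assumes "ph \<in> N" "e = snd ph"
  shows "cl (src e) ~= cl (tgt e)"
    "cl (src e) ~= cl (lab e) ==> cl (tgt e) ~= cl (lab e) ==>
      astep (cl (src e)) (corner ph 0) (corner ph 1) \<and> astep (cl (lab e)) (corner ph 1) (corner ph 2) \<and>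
      astep (cl (tgt e)) (corner ph 3) (corner ph 2) \<and> astep (cl (lab e)) (corner ph 0) (corner ph 3)"
    "cl (src e) = cl (lab e) ==> astep (cl (tgt e)) (corner ph 3) (corner ph 2) \<and> astep (cl (lab e)) (corner ph 3) (corner ph 2)"
    "cl (tgt e) = cl (lab e) ==> astep (cl (src e)) (corner ph 0) (corner ph 1) \<and> astep (cl (lab e)) (corner ph 0) (corner ph 1)"
proof -
  have f: "ph \<in> Ph" using assms(1) by (simp add: N_def)
  have e: "e \<in> E" using cxD(8)[OF cx f] assms(2) by simp
  note c = face_csteps[OF f assms(2)[symmetric]]
  show ne: "cl (src e) ~= cl (tgt e)"
    using partD(6)[OF N_nonclass[OF assms(1)] cl_in(1)[OF EinV(1)[OF e]]] cl_in EinV[OF e] assms(2) by metis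
  have I: "cl (src e) \<in> I (corner ph 0)" "cl (src e) \<in> I (corner ph 1)" "cl (lab e) \<in> I (corner ph 0)" "cl (lab e) \<in> I (corner ph 1)"
     "cl (lab e) \<in> I (corner ph 2)" "cl (lab e) \<in> I (corner ph 3)" "cl (tgt e) \<in> I (corner ph 2)" "cl (tgt e) \<in> I (corner ph 3)"
    using c unfolding cstep_def by auto
  show "astep (cl (src e)) (corner ph 0) (corner ph 1) \<and> astep (cl (lab e)) (corner ph 1) (corner ph 2) \<and>
      astep (cl (tgt e)) (corner ph 3) (corner ph 2) \<and> astep (cl (lab e)) (corner ph 0) (corner ph 3)"
    if n: "cl (src e) ~= cl (lab e)" "cl (tgt e) ~= cl (lab e)"
    using c attI[OF I(1,3) n(1)] attI[OF I(2,4) n(1)] attI[OF I(7,5) n(2)] attI[OF I(8,6) n(2)] unfolding astep_def by blast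
  show "astep (cl (tgt e)) (corner ph 3) (corner ph 2) \<and> astep (cl (lab e)) (corner ph 3) (corner ph 2)"
    if q: "cl (src e) = cl (lab e)"
  proof -
    have n: "cl (tgt e) ~= cl (lab e)" using ne q by metis
    have "cstep (cl (lab e)) (corner ph 3) (corner ph 2)" using cstep_square[OF c(4) _ c(2)] c(1) q by simp
    then show ?thesis using c attI[OF I(7,5) n] attI[OF I(8,6) n] unfolding astep_def by blast
  qed
  show "astep (cl (src e)) (corner ph 0) (corner ph 1) \<and> astep (cl (lab e)) (corner ph 0) (corner ph 1)"
    if q: "cl (tgt e) = cl (lab e)"
  proof -
    have n: "cl (src e) ~= cl (lab e)" using ne q by metis
    have "cstep (cl (lab e)) (corner ph 0) (corner ph 1)" using cstep_square'[OF c(4) _ c(2)] c(3) q by simp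
    then show ?thesis using c attI[OF I(1,3) n] attI[OF I(2,4) n] unfolding astep_def by blast
  qed
qed

text \<open>The ends of an attached step lie in the same piece, and they differ because the height
  does.\<close>

lemma mixed_face_attached:
  assumes "ph \<in> N" "k < 4" "c \<in> \<P>" "clab ph k \<in> c" "good c (corner ph k)"
  shows "\<exists>w w'. w ~= w' \<and> w \<in> comp R c (corner ph k) \<and> w' \<in> comp R c (corner ph k) \<and> att w \<and> att w'"
proof -
  define e where "e = snd ph"
  have f: "ph \<in> Ph" using assms(1) by (simp add: N_def)
  have e: "e \<in> E" using cxD(8)[OF cx f] e_def by simp
  have *: ?thesis if "astep c p q" "comp R c p = comp R c (corner ph k)" for p q
  proof (rule exI[of _ p], rule exI[of _ q], intro conjI)
    show "p ~= q" using that assms(5) unfolding astep_def cstep_def by auto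
    show "p \<in> comp R c (corner ph k)" using that(2) comp_refl[of p R c] by simp
    show "q \<in> comp R c (corner ph k)" using that comp_refl[of q R c] unfolding astep_def cstep_def by simp
  qed (use that in \<open>auto simp: astep_def\<close>)
  have cc: "clab ph k \<in> {src e, lab e, tgt e}" using clab_labs[OF assms(2), of ph] unfolding labs_eq e_def by simp
  have cin: "clab ph k \<in> V" using cc EinV[OF e] by auto
  have ck: "c = cl (clab ph k)" using cl_mem[OF cin assms(3)] assms(4) by blast
  note st = face_csteps[OF f e_def[symmetric]] and nf = N_face[OF assms(1) e_def] and cs = clab_simps[of ph, folded e_def]
  have co: "comp R (cl (src e)) (corner ph 0) = comp R (cl (src e)) (corner ph 1)" "comp R (cl (lab e)) (corner ph 1) = comp R (cl (lab e)) (corner ph 2)"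
     "comp R (cl (tgt e)) (corner ph 3) = comp R (cl (tgt e)) (corner ph 2)" "comp R (cl (lab e)) (corner ph 0) = comp R (cl (lab e)) (corner ph 3)"
    using st unfolding cstep_def by blast+
  consider (A) "cl (src e) ~= cl (lab e)" "cl (tgt e) ~= cl (lab e)" | (B) "cl (src e) = cl (lab e)" | (C) "cl (tgt e) = cl (lab e)" by blast
  then show ?thesis
  proof cases
    case A
    note a = nf(2)[OF A]
    show ?thesis using less_4_cases[OF assms(2)]
    proof (elim disjE)
      assume k: "k = 0" show ?thesis by (rule *[of "corner ph 0" "corner ph 1"]) (use a k ck cs in auto)
    next
      assume k: "k = 1" show ?thesis by (rule *[of "corner ph 1" "corner ph 2"]) (use a k ck cs in auto)
    next
      assume k: "k = 2" show ?thesis by (rule *[of "corner ph 3" "corner ph 2"]) (use a k ck cs co in auto)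
    next
      assume k: "k = 3" show ?thesis by (rule *[of "corner ph 0" "corner ph 3"]) (use a k ck cs co in auto)
    qed
  next
    case B
    note a = nf(3)[OF B]
    have c3: "comp R (cl (lab e)) (corner ph 3) = comp R (cl (lab e)) (corner ph j)" if "j < 4" for j
      using less_4_cases[OF that] co B by (elim disjE) auto
    have l: ?thesis if "c = cl (lab e)" by (rule *[of "corner ph 3" "corner ph 2"]) (use a that c3[OF assms(2)] in simp_all)
    show ?thesis using less_4_cases[OF assms(2)]
    proof (elim disjE)
      assume k: "k = 0" show ?thesis by (rule l) (use ck cs(1) B k in simp)
    next
      assume k: "k = 1" show ?thesis by (rule l) (use ck cs(2) k in simp)
    next
      assume k: "k = 2" show ?thesis by (rule *[of "corner ph 3" "corner ph 2"]) (use a k ck cs(3) co(3) in simp_all)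
    next
      assume k: "k = 3" show ?thesis by (rule l) (use ck cs(4) k in simp)
    qed
  next
    case C
    note a = nf(4)[OF C]
    have c3: "comp R (cl (lab e)) (corner ph 0) = comp R (cl (lab e)) (corner ph j)" if "j < 4" for j
      using less_4_cases[OF that] co C by (elim disjE) auto
    have l: ?thesis if "c = cl (lab e)" by (rule *[of "corner ph 0" "corner ph 1"]) (use a that c3[OF assms(2)] in simp_all)
    show ?thesis using less_4_cases[OF assms(2)]
    proof (elim disjE)
      assume k: "k = 0" show ?thesis by (rule *[of "corner ph 0" "corner ph 1"]) (use a k ck cs(1) in simp_all)
    next
      assume k: "k = 1" show ?thesis by (rule l) (use ck cs(2) k in simp)
    next
      assume k: "k = 2" show ?thesis by (rule l) (use ck cs(3) C k in simp)
    next
      assume k: "k = 3" show ?thesis by (rule l) (use ck cs(4) k in simp)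
    qed
  qed
qed

text \<open>The height of a class is reversed where \<sigma> says so; \<open>pos d\<close> is then
  the corner from which both sides of the face lead in direction \<open>d\<close>. It lies on the
  source side if \<open>\<sigma> (zc ph) = d\<close> and on the target side otherwise, so for each
  \<open>d\<close> the second class is the very one that the arborescence \<open>d\<close> places
  below the owner.\<close>

lemma count_apply:
  assumes noniso: "!!v. v \<in> U ==> I v ~= {}" and chip1: "!!c u. c \<in> \<P> ==> u \<in> U ==> chip R Ph c (comp R c u) <= 1"
    and two: "!!c u. c \<in> I u ==> good c u ==> \<exists>w w'. w ~= w' \<and> w \<in> comp R c u \<and> w' \<in> comp R c u \<and> att w \<and> att w'"
  shows "chi U R Ph <= 0 \<or> (\<exists>v\<in>U. \<exists>c ph0 k0. c \<in> I v \<and> good c v \<and> ph0 \<in> Ph \<and> k0 < 4 \<and> corner ph0 k0 = v \<and> chgc c ph0 k0 \<and>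
     (\<forall>ph\<in>Ph. \<forall>k<4. corner ph k = v --> chgc c ph k --> ph = ph0 \<and> k = k0))"
proof -
  define zc where "zc ph = cl (lab (snd ph))" for ph :: "('u,'v) face"
  define xc where "xc ph = cl (src (snd ph))" for ph :: "('u,'v) face"
  define yc where "yc ph = cl (tgt (snd ph))" for ph :: "('u,'v) face"
  have inE: "snd ph \<in> E" if "ph \<in> N" for ph using cxD(8)[OF cx] that by (simp add: N_def)
  have zc_inj: "snd ph = snd \<psi>" if "ph \<in> N" "\<psi> \<in> N" "zc ph = zc \<psi>" for ph \<psi>
    using partD(7)[OF N_nonclass[OF that(1)] N_nonclass[OF that(2)]] cl_in[OF EinV(2)[OF inE[OF that(1)]]] cl_in[OF EinV(2)[OF inE[OF that(2)]]] that(3)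
    unfolding zc_def by metis
  have mem: "src (snd ph) \<in> c \<longleftrightarrow> c = xc ph" "lab (snd ph) \<in> c \<longleftrightarrow> c = zc ph" "tgt (snd ph) \<in> c \<longleftrightarrow> c = yc ph" if "ph \<in> N" "c \<in> \<P>" for ph c
    using cl_mem EinV[OF inE[OF that(1)]] that(2) unfolding xc_def yc_def zc_def by auto
  have inP: "xc ph \<in> \<P>" "yc ph \<in> \<P>" "zc ph \<in> \<P>" if "ph \<in> N" for ph
    using cl_in EinV[OF inE[OF that]] unfolding xc_def yc_def zc_def by auto
  define UP where "UP s d c u \<longleftrightarrow> c \<in> I u \<and> (good c u --> (\<exists>w\<in>comp R c u. att w \<and> sgd d * (sgd (s c) * hh c u) < sgd d * (sgd (s c) * hh c w)))" for s d c u
  have UPp: "UP s d c p" if a: "astep c p q" "s c = d" for s d c p q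
  proof -
    have q: "q \<in> comp R c p" using a(1) comp_refl[of q R c] unfolding astep_def cstep_def by simp
    have e: "sgd d * (sgd (s c) * y) = y" for y using a(2) by (simp add: sgd_def)
    show ?thesis unfolding UP_def e by (intro conjI impI bexI[OF _ q]) (use a(1) in \<open>simp_all add: astep_def cstep_def\<close>)
  qed
  have UPq: "UP s d c q" if a: "astep c p q" "s c ~= d" for s d c p q
  proof -
    have p: "p \<in> comp R c q" using a(1) comp_refl[of p R c] unfolding astep_def cstep_def by simp
    have e: "sgd d * (sgd (s c) * y) = - y" for y using a(2) by (cases d) (simp_all add: sgd_def)
    show ?thesis unfolding UP_def e by (intro conjI impI bexI[OF _ p]) (use a(1) in \<open>simp_all add: astep_def cstep_def\<close>)
  qed
  have main: ?thesis if pos4: "!!d ph. ph \<in> N ==> pos d ph < (4::nat)" and pos_snd: "!!d ph \<psi>. snd ph = snd \<psi> ==> pos d ph = pos d \<psi>"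
    and up: "!!d ph. ph \<in> N ==> UP s d (zc ph) (corner ph (pos d ph)) \<and> UP s d (oc d ph) (corner ph (pos d ph))"
    and rk: "!!d ph. ph \<in> N ==> rk d (oc d ph) < (rk d (zc ph) :: nat)"
    and lp: "!!d ph. ph \<in> N ==> (oc d ph = xc ph \<and> pos d ph \<in> {0,1} \<or> oc d ph = yc ph \<and> pos d ph \<in> {2,3}) \<and> oc d ph ~= zc ph"
    and transit: "!!d ph c k. ph \<in> N ==> k < 4 ==> c \<in> \<P> ==> chgc c ph k ==> k ~= pos (\<not> d) ph ==> \<exists>c'. UP s d c' (corner ph k)"
    for s pos rk oc
  proof -
    have lab_at: "(k \<in> {0,1} --> {clab ph k, clab ph ((k + 3) mod 4)} = {src (snd ph), lab (snd ph)}) \<and> (k \<in> {2,3} --> {clab ph k, clab ph ((k + 3) mod 4)} = {tgt (snd ph), lab (snd ph)})"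
      for k and ph :: "('u,'v) face"
    proof -
      have "(0 + 3) mod 4 = (3::nat)" "(1 + 3) mod 4 = (0::nat)" "(2 + 3) mod 4 = (1::nat)" "(3 + 3) mod 4 = (2::nat)" by simp_all
      then show ?thesis using clab_simps[of ph] by (intro conjI impI; elim insertE emptyE; simp add: insert_commute)
    qed
    interpret ct: count V E U R Ph \<P> zc pos oc rk "\<lambda>c u. sgd (s c) * hh c u" N
    proof (unfold_locales)
      show "cx V E U R Ph" "finite \<P>" "V \<subseteq> \<Union>\<P>" using cx partD(1,5) by auto
      show "!!c c'. c \<in> \<P> ==> c' \<in> \<P> ==> c ~= c' ==> c \<inter> c' = {}" by (rule partD(4))
      show "N = {ph\<in>Ph. \<not> (\<exists>c\<in>\<P>. labs ph \<subseteq> c)}" by (rule N_def)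
      show "!!v. v \<in> U ==> I v ~= {}" by (rule noniso)
      show "!!ph \<psi>. ph \<in> N ==> \<psi> \<in> N ==> zc ph = zc \<psi> ==> snd ph = snd \<psi>" by (rule zc_inj)
      show "!!d ph. ph \<in> N ==> pos d ph < 4" by (rule pos4)
      show "!!d ph \<psi>. snd ph = snd \<psi> ==> pos d ph = pos d \<psi>" by (rule pos_snd)
      show "!!d ph. ph \<in> N ==> rk d (oc d ph) < rk d (zc ph)" by (rule rk)
      show "!!c u. c \<in> \<P> ==> u \<in> U ==> chip R Ph c (comp R c u) <= 1" by (rule chip1)
      show "!!c u. c \<in> I u ==> 1 <= chip R Ph c (comp R c u) ==>
        \<exists>w w'. w ~= w' \<and> w \<in> comp R c u \<and> w' \<in> comp R c u \<and> 2 <= card (I w) \<and> 2 <= card (I w')" by (rule two)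
      fix d ph assume p: "ph \<in> N"
      show "zc ph \<in> I (corner ph (pos d ph))" "oc d ph \<in> I (corner ph (pos d ph))" using up[OF p, of d] by (auto simp: UP_def)
      show "x \<in> zc ph \<or> x \<in> oc d ph" if "k = pos d ph" "x \<in> {clab ph k, clab ph ((k + 3) mod 4)}" for x k
      proof -
        have "oc d ph = xc ph \<and> x \<in> {src (snd ph), lab (snd ph)} \<or> oc d ph = yc ph \<and> x \<in> {tgt (snd ph), lab (snd ph)}"
          using lp[OF p, of d] lab_at[of k ph] that by metis
        then show ?thesis using mem(1)[OF p inP(1)[OF p]] mem(2)[OF p inP(3)[OF p]] mem(3)[OF p inP(2)[OF p]] by blast
      qed
      show "chgc (zc ph) ph (pos d ph)"
      proof -
        have "(clab ph k \<in> zc ph) ~= (clab ph ((k + 3) mod 4) \<in> zc ph)" if "{clab ph k, clab ph ((k + 3) mod 4)} = {t, lab (snd ph)}" "t \<notin> zc ph" for k t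
          using that mem(2)[OF p inP(3)[OF p]] by (metis doubleton_eq_iff)
        then show ?thesis unfolding chgc_def using lp[OF p, of d] lab_at[of "pos d ph" ph] mem(1,3)[OF p inP(3)[OF p]] by metis
      qed
      show "\<exists>w\<in>comp R c (corner ph (pos d ph)). 2 <= card (I w) \<and> sgd d * (sgd (s c) * hh c (corner ph (pos d ph))) < sgd d * (sgd (s c) * hh c w)"
        if "c = zc ph \<or> c = oc d ph" "1 <= chip R Ph c (comp R c (corner ph (pos d ph)))" for c
        using up[OF p, of d] that unfolding UP_def by blast
      show "\<exists>c'\<in>I (corner ph k). 1 <= chip R Ph c' (comp R c' (corner ph k)) -->
          (\<exists>w\<in>comp R c' (corner ph k). 2 <= card (I w) \<and> sgd d * (sgd (s c') * hh c' (corner ph k)) < sgd d * (sgd (s c') * hh c' w))"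
        if "k < 4" "c \<in> \<P>" "chgc c ph k" "k ~= pos (\<not> d) ph" for c k
        using transit[OF p that] unfolding UP_def by blast
    qed
    show ?thesis by (rule ct.chi_nonpos_or_detach)
  qed
  consider (B) e where "nonclass E \<P> = {e}" "\<exists>c\<in>\<P>. lab e \<in> c \<and> (src e \<in> c \<or> tgt e \<in> c)"
    | (A) \<sigma> and \<rho> :: "bool => 'v set => nat" where "\<forall>e\<in>nonclass E \<P>. \<forall>cz\<in>\<P>. \<forall>cx\<in>\<P>. \<forall>cy\<in>\<P>. lab e \<in> cz --> src e \<in> cx --> tgt e \<in> cy -->
          cx ~= cz \<and> cy ~= cz \<and> \<rho> (\<sigma> cz) cx < \<rho> (\<sigma> cz) cz \<and> \<rho> (\<not> \<sigma> cz) cy < \<rho> (\<not> \<sigma> cz) cz"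
    using part[unfolded LOT_partition_def, THEN conjunct2] by (elim disjE exE conjE) (rule that, assumption+)+
  then show ?thesis
  proof cases
    case A
    have ne: "xc ph ~= zc ph" "yc ph ~= zc ph" "\<rho> (\<sigma> (zc ph)) (xc ph) < \<rho> (\<sigma> (zc ph)) (zc ph)" "\<rho> (\<not> \<sigma> (zc ph)) (yc ph) < \<rho> (\<not> \<sigma> (zc ph)) (zc ph)"
      if p: "ph \<in> N" for ph
      using A[THEN bspec, OF N_nonclass[OF p], THEN bspec, OF inP(3)[OF p], THEN bspec, OF inP(1)[OF p], THEN bspec, OF inP(2)[OF p]]
        mem(1)[OF p inP(1)[OF p]] mem(2)[OF p inP(3)[OF p]] mem(3)[OF p inP(2)[OF p]] by auto
    have a: "astep (xc ph) (corner ph 0) (corner ph 1)" "astep (zc ph) (corner ph 1) (corner ph 2)" "astep (yc ph) (corner ph 3) (corner ph 2)" "astep (zc ph) (corner ph 0) (corner ph 3)"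
      if p: "ph \<in> N" for ph using N_face(2)[OF p refl] ne(1,2)[OF p] unfolding xc_def yc_def zc_def by blast+
    have u: "\<sigma> (zc ph) = d ==> UP \<sigma> d (zc ph) (corner ph 0)" "\<sigma> (zc ph) = d ==> UP \<sigma> d (zc ph) (corner ph 1)"
      "\<sigma> (zc ph) ~= d ==> UP \<sigma> d (zc ph) (corner ph 2)" "\<sigma> (zc ph) ~= d ==> UP \<sigma> d (zc ph) (corner ph 3)"
      "\<sigma> (xc ph) = d ==> UP \<sigma> d (xc ph) (corner ph 0)" "\<sigma> (xc ph) ~= d ==> UP \<sigma> d (xc ph) (corner ph 1)"
      "\<sigma> (yc ph) = d ==> UP \<sigma> d (yc ph) (corner ph 3)" "\<sigma> (yc ph) ~= d ==> UP \<sigma> d (yc ph) (corner ph 2)"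
      if p: "ph \<in> N" for ph d
      using a[OF p] UPp[of _ _ _ \<sigma> d] UPq[of _ _ _ \<sigma> d] by blast+
    \<comment> \<open>Both sides carrying the edge label lead from the source side, corners 0 and 1,
      to the target side, corners 3 and 2. So \<open>\<sigma> (zc ph)\<close> selects the side, and
      the class of that side selects its end.\<close>
    define pos where "pos d ph = (if \<sigma> (zc ph) = d then (if \<sigma> (xc ph) = d then 0 else 1) else (if \<sigma> (yc ph) = d then 3 else 2::nat))" for d ph
    define oc where "oc d ph = (if \<sigma> (zc ph) = d then xc ph else yc ph)" for d ph
    show ?thesis
    proof (rule main[where pos = pos and oc = oc and s = \<sigma> and rk = \<rho>])
      fix d ph assume p: "ph \<in> N"
      show "pos d ph < 4" by (simp add: pos_def)
      show "UP \<sigma> d (zc ph) (corner ph (pos d ph)) \<and> UP \<sigma> d (oc d ph) (corner ph (pos d ph))"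
        using u[OF p, of d] by (simp add: pos_def oc_def)
      show "\<rho> d (oc d ph) < \<rho> d (zc ph)" using ne(3,4)[OF p] unfolding oc_def by (cases d; cases "\<sigma> (zc ph)") simp_all
      show "(oc d ph = xc ph \<and> pos d ph \<in> {0,1} \<or> oc d ph = yc ph \<and> pos d ph \<in> {2,3}) \<and> oc d ph ~= zc ph"
        using ne(1,2)[OF p] by (simp add: pos_def oc_def)
      show "\<exists>c'. UP \<sigma> d c' (corner ph k)" if "k < 4" "c \<in> \<P>" "chgc c ph k" "k ~= pos (\<not> d) ph" for c k
        using u[OF p, of d] that(4) less_4_cases[OF that(1)] unfolding pos_def
        by (elim disjE; cases "\<sigma> (zc ph) = d"; cases "\<sigma> (xc ph) = d"; cases "\<sigma> (yc ph) = d") (simp_all, blast+)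
    qed (simp add: pos_def xc_def yc_def zc_def)
  next
    case B
    \<comment> \<open>All mixed faces have the same relator here. The class \<open>c\<close> of the
      label gets the greater rank, no height is reversed, and the two corners are the ends of the
      side outside \<open>c\<close>.\<close>
    have ee: "snd ph = e" if "ph \<in> N" for ph using N_nonclass[OF that] B(1) by simp
    obtain c where c: "c \<in> \<P>" "lab e \<in> c" "src e \<in> c \<or> tgt e \<in> c" using B(2) by blast
    have cz: "zc ph = c" if "ph \<in> N" for ph using mem(2)[OF that c(1)] c(2) ee[OF that] by simp
    have xy: "xc ph ~= yc ph" if "ph \<in> N" for ph using N_face(1)[OF that refl] by (simp add: xc_def yc_def)
    show ?thesis
    proof (cases "src e \<in> c")
      case True
      have xz: "xc ph = c" if "ph \<in> N" for ph using mem(1)[OF that c(1)] True ee[OF that] by simp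
      have a: "astep (yc ph) (corner ph 3) (corner ph 2)" "astep c (corner ph 3) (corner ph 2)" if "ph \<in> N" for ph
        using N_face(3)[OF that refl] xz[OF that] cz[OF that] unfolding xc_def yc_def zc_def by simp_all
      show ?thesis
      proof (rule main[where pos = "\<lambda>d ph. if d then 3 else 2" and oc = "\<lambda>d ph. yc ph" and s = "\<lambda>_. True" and rk = "\<lambda>d c'. if c' = c then 1 else 0"])
        fix d ph assume p: "ph \<in> N"
        have yz: "yc ph ~= c" using xy[OF p] xz[OF p] by simp
        show "UP (\<lambda>_. True) d (zc ph) (corner ph (if d then 3 else 2)) \<and> UP (\<lambda>_. True) d (yc ph) (corner ph (if d then 3 else 2))"
          using a[OF p] UPp[of _ _ _ "\<lambda>_. True" d] UPq[of _ _ _ "\<lambda>_. True" d] cz[OF p] by (cases d) auto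
        then have up: "UP (\<lambda>_. True) d (zc ph) (corner ph (if d then 3 else 2))" ..
        show "(if yc ph = c then 1 else 0) < (if zc ph = c then 1 else 0::nat)" using yz cz[OF p] by simp
        show "(yc ph = xc ph \<and> (if d then 3 else 2::nat) \<in> {0,1} \<or> yc ph = yc ph \<and> (if d then 3 else 2::nat) \<in> {2,3}) \<and> yc ph ~= zc ph" using yz cz[OF p] by auto
        show "\<exists>c'. UP (\<lambda>_. True) d c' (corner ph k)" if k: "k < 4" "c'' \<in> \<P>" "chgc c'' ph k" "k ~= (if \<not> d then 3 else 2)" for c'' k
        proof -
          have "\<not> chgc c'' ph 0" "\<not> chgc c'' ph 1" using mem(1,2)[OF p k(2)] xz[OF p] cz[OF p] clab_simps[of ph] by (simp_all add: chgc_def)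
          then have "k ~= 0" "k ~= 1" using k(3) by metis+
          then have "k = (if d then 3 else 2)" using k(1,4) less_4_cases[OF k(1)] by (cases d) auto
          then show ?thesis using up by blast
        qed
      qed simp_all
    next
      case False
      then have tc: "tgt e \<in> c" using c(3) by blast
      have yz: "yc ph = c" if "ph \<in> N" for ph using mem(3)[OF that c(1)] tc ee[OF that] by simp
      have a: "astep (xc ph) (corner ph 0) (corner ph 1)" "astep c (corner ph 0) (corner ph 1)" if "ph \<in> N" for ph
        using N_face(4)[OF that refl] yz[OF that] cz[OF that] unfolding xc_def yc_def zc_def by simp_all
      show ?thesis
      proof (rule main[where pos = "\<lambda>d ph. if d then 0 else 1" and oc = "\<lambda>d ph. xc ph" and s = "\<lambda>_. True" and rk = "\<lambda>d c'. if c' = c then 1 else 0"])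
        fix d ph assume p: "ph \<in> N"
        have xz: "xc ph ~= c" using xy[OF p] yz[OF p] by simp
        show "UP (\<lambda>_. True) d (zc ph) (corner ph (if d then 0 else 1)) \<and> UP (\<lambda>_. True) d (xc ph) (corner ph (if d then 0 else 1))"
          using a[OF p] UPp[of _ _ _ "\<lambda>_. True" d] UPq[of _ _ _ "\<lambda>_. True" d] cz[OF p] by (cases d) auto
        then have up: "UP (\<lambda>_. True) d (zc ph) (corner ph (if d then 0 else 1))" ..
        show "(if xc ph = c then 1 else 0) < (if zc ph = c then 1 else 0::nat)" using xz cz[OF p] by simp
        show "(xc ph = xc ph \<and> (if d then 0 else 1::nat) \<in> {0,1} \<or> xc ph = yc ph \<and> (if d then 0 else 1::nat) \<in> {2,3}) \<and> xc ph ~= zc ph" using xz cz[OF p] by auto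
        show "\<exists>c'. UP (\<lambda>_. True) d c' (corner ph k)" if k: "k < 4" "c'' \<in> \<P>" "chgc c'' ph k" "k ~= (if \<not> d then 0 else 1)" for c'' k
        proof -
          have "\<not> chgc c'' ph 2" "\<not> chgc c'' ph 3" using mem(2,3)[OF p k(2)] yz[OF p] cz[OF p] clab_simps[of ph] by (simp_all add: chgc_def)
          then have "k ~= 2" "k ~= 3" using k(3) by metis+
          then have "k = (if d then 0 else 1)" using k(1,4) less_4_cases[OF k(1)] by (cases d) auto
          then show ?thesis using up by blast
        qed
      qed simp_all
    qed
  qed
qed

end

section \<open>Pieces under pruning and splitting\<close>

lemma cx_corner: assumes "cx V E U R Ph" "ph \<in> Ph" "k < 4" shows "corner ph k \<in> U"
  using bd_ends(1)[OF assms(3), of ph] cxD(5,6)[OF assms(1) cxD(9)[OF assms]] by (simp add: bstart_def split: if_splits)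

lemma bd_set: "b \<in> set (bd ph) ==> \<exists>k<4. b = bd ph ! k"
  by (metis in_set_conv_nth length_bd)

lemma face_comp:
  assumes cx: "cx V E U R Ph" and f: "ph \<in> Ph" "labs ph \<subseteq> c" "k < 4"
  shows "comp R c (corner ph k) = comp R c (corner ph 0)"
proof -
  have st: "comp R c (corner ph (Suc j mod 4)) = comp R c (corner ph j)" if "j < 4" for j
  proof -
    have "elab (fst (bd ph ! j)) \<in> c" using clab_labs[OF that, of ph] f(2) by (auto simp: clab_def)
    then show ?thesis using comp_step[OF cxD(9)[OF cx f(1) that]] bd_ends[OF that, of ph] by (auto simp: bstart_def bend_def split: if_splits)
  qed
  have "comp R c (corner ph 1) = comp R c (corner ph 0)" using st[of 0] by simp
  moreover have "comp R c (corner ph 2) = comp R c (corner ph 1)" using st[of 1] by (simp add: numeral_2_eq_2)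
  moreover have "comp R c (corner ph 3) = comp R c (corner ph 2)" using st[of 2] by simp
  ultimately show ?thesis using less_4_cases[OF f(3)] by (elim disjE) (simp_all only:)
qed

lemma Iv_comp:
  assumes "c \<in> Iv \<P> R u" "w \<in> comp R c u" shows "c \<in> Iv \<P> R w"
proof -
  have "(u, w) \<in> (adj (Rl R c))\<^sup>*" using assms(2) by (simp add: comp_def)
  then show ?thesis
  proof (cases rule: rtranclE)
    case (step y)
    then obtain b where "b \<in> R" "elab b \<in> c" "esrc b = w \<or> etgt b = w" unfolding adj_def Rl_def by blast
    then show ?thesis using assms(1) unfolding Iv_def by blast
  qed (use assms in simp)
qed

lemma chip_full:
  assumes cx: "cx V E U R Ph" and conn: "conn U R" and u: "u \<in> U" and R: "!!a. a \<in> R ==> elab a \<in> S" and F: "!!ph. ph \<in> Ph ==> labs ph \<subseteq> S"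
  shows "comp R S u = U" "Rp R S U = R" "Fp Ph S U = Ph" "chip R Ph S U = chi U R Ph"
proof -
  have "Rl R S = R" using R by (auto simp: Rl_def)
  then have "U \<subseteq> comp R S u" using conn u unfolding conn_def comp_def by auto
  then show "comp R S u = U" using comp_sub[OF cx u, of S] by blast
  show Rp: "Rp R S U = R" using R cxD(5)[OF cx] unfolding Rp_def by blast
  have "corner ph 0 \<in> U" if "ph \<in> Ph" for ph by (rule cx_corner[OF cx that]) simp
  then show "Fp Ph S U = Ph" using F unfolding Fp_def by blast
  with Rp show "chip R Ph S U = chi U R Ph" by (simp add: chip_def)
qed

context pieces
begin

lemma class_eq: "c \<in> \<P> ==> c' \<in> \<P> ==> x \<in> c ==> x \<in> c' ==> c = c'" using partD(4) by blast

text \<open>A good piece attached at most at \<open>w\<close> is removed, except for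
  \<open>w\<close>. No mixed face uses its edges, for such a face would provide two attached
  vertices in the piece. The retained vertex accounts for the summand 1 in the
  characteristic.\<close>

lemma prune:
  assumes a0: "a0 \<in> R" "c \<in> \<P>" "elab a0 \<in> c" "good c (esrc a0)" and C: "C = comp R c (esrc a0)"
    and w: "w \<in> C" "\<forall>w'\<in>C. att w' --> w' = w"
    and U2: "U2 = insert w (U - C)" and R2: "R2 = R - Rp R c C" and F2: "Ph2 = Ph - Fp Ph c C" and conn: "conn U R"
  shows "cx V E U2 R2 Ph2" "conn U2 R2" "!!b. b \<in> R2 ==> esrc b \<in> U2 \<and> etgt b \<in> U2" "card U2 < card U"
    "chi U2 R2 Ph2 = chi U R Ph - chip R Ph c C + 1" "card Ph2 <= card Ph"
    "!!c' a. c' \<in> \<P> ==> a \<in> R2 ==> elab a \<in> c' ==> comp R2 c' (esrc a) = comp R c' (esrc a) \<and>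
       chip R2 Ph2 c' (comp R c' (esrc a)) = chip R Ph c' (comp R c' (esrc a))"
proof -
  have a0U: "esrc a0 \<in> U" using cxD(5)[OF cx a0(1)] .
  have CU: "C \<subseteq> U" unfolding C by (rule comp_sub[OF cx a0U])
  have finU: "finite U" "finite R" "finite Ph" using cxD[OF cx] by auto
  have inC: "esrc b \<in> C \<longleftrightarrow> etgt b \<in> C" if "b \<in> R" "elab b \<in> c" for b
    using comp_step[OF that] comp_eq[of _ R c "esrc a0"] unfolding C by (metis comp_refl)
  have cI: "c \<in> I v" if "v \<in> C" for v
    using Iv_comp[of c \<P> R "esrc a0" v] that a0 unfolding C Iv_def by blast
  have compC: "comp R c v = C" if "v \<in> C" for v using comp_eq[of v R c "esrc a0"] that unfolding C by blast
  \<comment> \<open>A remaining edge that reaches the piece belongs to another class, so its end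
    there is attached.\<close>
  have e2: "v = w" if b: "b \<in> R2" "esrc b = v \<or> etgt b = v" "v \<in> C" for b v
  proof -
    have bR: "b \<in> R" using b(1) R2 by blast
    have nc: "elab b \<notin> c"
    proof
      assume "elab b \<in> c"
      then have "b \<in> Rp R c C" using inC[OF bR] b(2,3) bR unfolding Rp_def by blast
      then show False using b(1) R2 by blast
    qed
    have lV: "elab b \<in> V" by (rule cxD(7)[OF cx bR])
    have "cl (elab b) \<in> I v" using cl_in[OF lV] bR b(2) unfolding Iv_def by blast
    moreover have "cl (elab b) ~= c" using cl_in(2)[OF lV] nc by blast
    ultimately have "att v" using attI cI[OF b(3)] by blast
    then show ?thesis using w(2) b(3) by blast
  qed
  show ends: "esrc b \<in> U2 \<and> etgt b \<in> U2" if "b \<in> R2" for b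
    using e2[OF that, of "esrc b"] e2[OF that, of "etgt b"] cxD(5,6)[OF cx, of b] that unfolding U2 R2 by blast
  have wf: "wf_cx U2 R2 Ph2" unfolding wf_cx_def
  proof (intro conjI ballI subsetI)
    fix b assume "b \<in> R2" then show "esrc b \<in> U2" "etgt b \<in> U2" using ends by blast+
  next
    fix ph b assume p: "ph \<in> Ph2" and "b \<in> fst ` set (bd ph)"
    then obtain k where k: "k < 4" "b = fst (bd ph ! k)" using bd_set by blast
    have pF: "ph \<in> Ph" "ph \<notin> Fp Ph c C" using p F2 by auto
    have bR: "b \<in> R" using cxD(9)[OF cx pF(1) k(1)] k(2) by simp
    \<comment> \<open>A mixed face is excluded by \<open>mixed_face_attached\<close>; any other face
      with an edge in the piece lies in it entirely and has been removed.\<close>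
    have "b \<notin> Rp R c C"
    proof
      assume bp: "b \<in> Rp R c C"
      then have lc: "clab ph k \<in> c" "esrc b \<in> C" "etgt b \<in> C" using inC[OF bR] unfolding Rp_def clab_def k(2) by auto
      have kC: "corner ph k \<in> C" using bd_ends(1)[OF k(1), of ph] lc(2,3) unfolding k(2) bstart_def by (auto split: if_splits)
      show False
      proof (cases "ph \<in> N")
        case True
        have "good c (corner ph k)" using a0(4) compC[OF kC] C by simp
        from mixed_face_attached[OF True k(1) a0(2) lc(1) this] compC[OF kC] w(2) show False by metis
      next
        case False
        then obtain c' where c': "c' \<in> \<P>" "labs ph \<subseteq> c'" using pF(1) unfolding N_def by blast
        then have "c' = c" using class_eq[OF _ a0(2)] clab_labs[OF k(1), of ph] lc(1) by blast
        then have l: "labs ph \<subseteq> c" using c' by simp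
        have "comp R c (corner ph 0) = C" using face_comp[OF cx pF(1) l k(1)] compC[OF kC] by simp
        then have "corner ph 0 \<in> C" using comp_refl[of "corner ph 0" R c] by simp
        then show False using pF l unfolding Fp_def by blast
      qed
    qed
    then show "b \<in> R2" using bR R2 by blast
  qed
  show "cx V E U2 R2 Ph2"
    unfolding cx_def
  proof (intro conjI ballI impI wf)
    show "finite U2" "finite R2" "finite Ph2" using finU unfolding U2 R2 F2 by auto
    show "elab ` R2 \<subseteq> V" using cxD(7)[OF cx] unfolding R2 by blast
    show "snd ` Ph2 \<subseteq> E" using cxD(8)[OF cx] unfolding F2 by blast
    fix a a' assume "a \<in> R2" "a' \<in> R2" "elab a = elab a'"
    then show "esrc a = esrc a' \<longleftrightarrow> etgt a = etgt a'" using cxD(10)[OF cx] unfolding R2 by blast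
  qed
  show "conn U2 R2"
  proof -
    \<comment> \<open>Retracting the piece to \<open>w\<close> carries paths to paths of the pruned
      complex.\<close>
    define f where "f u = (if u \<in> C then w else u)" for u
    have f1: "(f u, f v) \<in> (adj R2)\<^sup>*" if "(u,v) \<in> adj R" for u v
    proof -
      obtain b where b: "b \<in> R" "esrc b = u \<and> etgt b = v \<or> esrc b = v \<and> etgt b = u" using \<open>(u,v) \<in> adj R\<close> unfolding adj_def by blast
      show ?thesis
      proof (cases "b \<in> R2")
        case True
        then have "f u = u" "f v = v" using e2[OF True] b(2) unfolding f_def by auto
        moreover have "(u,v) \<in> adj R2" using True b(2) unfolding adj_def by blast
        ultimately show ?thesis by simp
      next
        case False
        then have "u \<in> C" "v \<in> C" using inC[OF b(1)] b unfolding R2 Rp_def by auto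
        then show ?thesis by (simp add: f_def)
      qed
    qed
    have f2: "(f u, f v) \<in> (adj R2)\<^sup>*" if "(u,v) \<in> (adj R)\<^sup>*" for u v
      using that by (induction rule: rtrancl_induct) (auto intro: rtrancl_trans dest: f1)
    have fU2: "f u = u" "u \<in> U" if "u \<in> U2" for u using that w(1) CU unfolding U2 f_def by auto
    show ?thesis unfolding conn_def
    proof (intro ballI)
      fix u v assume uv: "u \<in> U2" "v \<in> U2"
      have "(f u, f v) \<in> (adj R2)\<^sup>*" using f2 conn fU2(2)[OF uv(1)] fU2(2)[OF uv(2)] unfolding conn_def by blast
      then show "(u,v) \<in> (adj R2)\<^sup>*" using fU2(1) uv by simp
    qed
  qed
  have finC: "finite C" using CU finU(1) by (rule finite_subset)
  have cU2: "card U2 = card U - card C + 1" "card C <= card U"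
    using finU finC CU w(1) unfolding U2 by (auto simp: card_Diff_subset card_insert_if card_mono)
  have "esrc a0 ~= etgt a0" using ht[OF a0(2,1,3,4)] by auto
  moreover have eC: "esrc a0 \<in> C" "etgt a0 \<in> C" using inC[OF a0(1,3)] unfolding C by auto
  ultimately have "2 <= card C" using card_mono[OF finC, of "{esrc a0, etgt a0}"] by simp
  then show "card U2 < card U" using cU2 by linarith
  show "card Ph2 <= card Ph" unfolding F2 using finU(3) by (intro card_mono) auto
  have "Rp R c C \<subseteq> R" "Fp Ph c C \<subseteq> Ph" by (auto simp: Rp_def Fp_def)
  then have "card R2 = card R - card (Rp R c C)" "card (Rp R c C) <= card R" "card Ph2 = card Ph - card (Fp Ph c C)" "card (Fp Ph c C) <= card Ph"
    using finU unfolding R2 F2 by (auto intro!: card_Diff_subset card_mono intro: finite_subset)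
  then show "chi U2 R2 Ph2 = chi U R Ph - chip R Ph c C + 1" using cU2 by (simp add: chi_def chip_def)
  fix c' a assume a: "c' \<in> \<P>" "a \<in> R2" "elab a \<in> c'"
  let ?D = "comp R c' (esrc a)"
  have aR: "a \<in> R" "a \<notin> Rp R c C" using a(2) R2 by auto
  have nD: False if "c' = c" "v \<in> ?D" "v \<in> C" for v
  proof -
    have "?D = C" using comp_eq[of v R c "esrc a"] compC[OF that(3)] that by simp
    then have "esrc a \<in> C" using comp_refl[of "esrc a" R c'] by simp
    then show False using aR a(3) that(1) unfolding Rp_def by blast
  qed
  have e: "b \<in> R \<longleftrightarrow> b \<in> R2" if "elab b \<in> c'" "esrc b \<in> ?D \<or> etgt b \<in> ?D" for b
  proof
    assume bR: "b \<in> R"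
    have "b \<notin> Rp R c C"
    proof
      assume bp: "b \<in> Rp R c C"
      then have "elab b \<in> c" "esrc b \<in> C" by (auto simp: Rp_def)
      then have "c' = c" "etgt b \<in> C" using class_eq[OF a(1) a0(2) that(1)] inC[OF bR] by auto
      then show False using nD that(2) \<open>esrc b \<in> C\<close> by blast
    qed
    then show "b \<in> R2" using bR R2 by blast
  qed (simp add: R2)
  have f: "ph \<in> Ph \<longleftrightarrow> ph \<in> Ph2" if "labs ph \<subseteq> c'" "corner ph 0 \<in> ?D" for ph
  proof
    assume pF: "ph \<in> Ph"
    have "ph \<notin> Fp Ph c C"
    proof
      assume "ph \<in> Fp Ph c C"
      then have q: "labs ph \<subseteq> c" "corner ph 0 \<in> C" by (auto simp: Fp_def)
      then have "c' = c" using class_eq[OF a(1) a0(2), of "clab ph 0"] clab_labs[of 0 ph] that(1) by auto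
      then show False using nD that(2) q(2) by blast
    qed
    then show "ph \<in> Ph2" using pF F2 by blast
  qed (simp add: F2)
  show "comp R2 c' (esrc a) = ?D \<and> chip R2 Ph2 c' ?D = chip R Ph c' ?D"
    by (rule conjI[OF chip_transfer(1)[OF refl e f] chip_transfer(2)[OF refl e f]])
qed

text \<open>Splitting changes only \<open>c\<close>-edges at \<open>v\<close> and faces around them,
  so every piece but the \<open>c\<close>-piece of \<open>v\<close> is unaffected. That piece is
  known to be good beforehand.\<close>

lemma detach_transfer:
  assumes d: "detach V E U R Ph c v n ph0 k0" and c: "c \<in> \<P>" and a: "c' \<in> \<P>" "a \<in> R" "elab a \<in> c'" "c' = c ==> esrc a \<notin> comp R c v"
    and R': "R' = detach.R' R c v n" and F': "Ph' = detach.Ph' Ph c v n ph0"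
  shows "a \<in> R'" "comp R' c' (esrc a) = comp R c' (esrc a)" "chip R' Ph' c' (comp R c' (esrc a)) = chip R Ph c' (comp R c' (esrc a))"
proof -
  interpret D: detach V E U R Ph c v n ph0 k0 by (rule d)
  let ?D = "comp R c' (esrc a)"
  have DU: "?D \<subseteq> U" using comp_sub[OF cx cxD(5)[OF cx a(2)]] .
  have vD: "v \<notin> ?D" if "c' = c"
  proof
    assume "v \<in> ?D"
    then have "esrc a \<in> comp R c v" using comp_eq[of v R c "esrc a"] that comp_refl[of "esrc a" R c] by simp
    then show False using a(4) that by blast
  qed
  have cloD: "esrc b \<in> ?D \<longleftrightarrow> etgt b \<in> ?D" if "b \<in> R" "elab b \<in> c'" for b
    using comp_step[OF that] comp_eq[of _ R c' "esrc a"] by (metis comp_refl)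
  have fixE: "spE v c n b = b" if b: "b \<in> R" "elab b \<in> c'" "esrc b \<in> ?D \<or> etgt b \<in> ?D" for b
  proof (cases "c' = c")
    case True
    then have "esrc b ~= v" "etgt b ~= v" using cloD[OF b(1,2)] b(3) vD by auto
    then show ?thesis by (intro edge_eqI) (simp_all add: D.ends_sE)
  next
    case False
    then have "elab b \<notin> c" using class_eq[OF a(1) c b(2)] by blast
    then show ?thesis by (intro edge_eqI) (simp_all add: D.ends_sE)
  qed
  have inR': "b \<in> R' \<longleftrightarrow> (\<exists>b0\<in>R. b = spE v c n b0)" for b unfolding R' D.R'_def by blast
  have inF': "ph \<in> Ph' \<longleftrightarrow> (\<exists>ph1\<in>Ph - {ph0}. ph = spF v c n ph1)" for ph unfolding F' D.Ph'_def by blast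
  show "a \<in> R'" unfolding inR' using fixE[OF a(2,3)] a(2) by (metis comp_refl)
  have e: "b \<in> R \<longleftrightarrow> b \<in> R'" if b: "elab b \<in> c'" "esrc b \<in> ?D \<or> etgt b \<in> ?D" for b
  proof
    assume "b \<in> R" then show "b \<in> R'" unfolding inR' using fixE[OF _ b] by metis
  next
    assume "b \<in> R'"
    then obtain b0 where b0: "b0 \<in> R" "b = spE v c n b0" unfolding inR' by blast
    have l: "elab b0 \<in> c'" using b(1) b0(2) by simp
    have "esrc b0 \<in> ?D \<or> etgt b0 \<in> ?D"
      using b(2) D.ends_sE[of b0] DU D.n unfolding b0(2) by (auto split: if_splits)
    then show "b \<in> R" using fixE[OF b0(1) l] b0 by simp
  qed
  have fixF: "spF v c n ph = ph \<and> ph ~= ph0" if p: "ph \<in> Ph" "labs ph \<subseteq> c'" "corner ph 0 \<in> ?D" for ph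
  proof
    show "ph ~= ph0"
    proof
      assume q: "ph = ph0"
      have k: "k0 < 4" "(k0 + 3) mod 4 < 4" using D.ph0(2) by auto
      have "clab ph0 k0 \<in> c'" "clab ph0 ((k0 + 3) mod 4) \<in> c'" using clab_labs[OF k(1), of ph0] clab_labs[OF k(2), of ph0] p(2) q by auto
      then show False using D.ph0(4) class_eq[OF a(1) c] unfolding chgc_def by metis
    qed
    show "spF v c n ph = ph"
    proof (rule face_eqI)
      fix k :: nat assume k: "k < 4"
      have "\<not> (corner ph k = v \<and> clab ph k \<in> c)"
      proof
        assume q: "corner ph k = v \<and> clab ph k \<in> c"
        then have "c' = c" using class_eq[OF a(1) c, of "clab ph k"] clab_labs[OF k, of ph] p(2) by blast
        moreover have "corner ph k \<in> ?D" using face_comp[OF cx p(1,2) k] comp_eq[OF p(3)] comp_refl[of "corner ph k" R c'] by simp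
        ultimately show False using vD q by blast
      qed
      then show "corner (spF v c n ph) k = corner ph k" unfolding D.corner_sF[OF k] by (rule if_not_P)
    qed simp
  qed
  have f: "ph \<in> Ph \<longleftrightarrow> ph \<in> Ph'" if p: "labs ph \<subseteq> c'" "corner ph 0 \<in> ?D" for ph
  proof
    assume "ph \<in> Ph" then show "ph \<in> Ph'" unfolding inF' using fixF[OF _ p] by (metis DiffI singletonD)
  next
    assume "ph \<in> Ph'"
    then obtain ph1 where p1: "ph1 \<in> Ph" "ph = spF v c n ph1" unfolding inF' by blast
    have "labs ph1 \<subseteq> c'" using p(1) unfolding p1(2) labs_eq by simp
    moreover have "corner ph1 0 \<in> ?D"
      using p(2) D.corner_sF[of 0 ph1] DU D.n unfolding p1(2) by (auto split: if_splits)
    ultimately have "spF v c n ph1 = ph1" using fixF[OF p1(1)] by blast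
    then show "ph \<in> Ph" using p1 by simp
  qed
  show "comp R' c' (esrc a) = ?D" by (rule chip_transfer(1)[OF refl e f])
  show "chip R' Ph' c' ?D = chip R Ph c' ?D" by (rule chip_transfer(2)[OF refl e f])
qed

\<comment> \<open>The induction over sub-LOTs\<close>
end

text \<open>A strong form of nonpositive immersions. Vertices are natural numbers because a
  definition cannot range over types and because splitting needs fresh vertices. The last clause
  lets pieces over blocks inherit characteristic at least 1; it passes down to smaller sub-LOTs and
  in the end yields injectivity on fundamental groups.\<close>

definition NPI :: "'v set => ('v \<times> 'v \<times> 'v) set => bool" where
  "NPI V E \<longleftrightarrow> (\<forall>(U::nat set) R Ph. cx V E U R Ph --> conn U R --> U ~= {} --> 1 <= chi U R Ph -->
     chi U R Ph = 1 \<and> Ht R \<and> (\<exists>h. nullhtpy (K_LOG V E) proj Base U R Ph h) \<and>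
     (\<forall>S\<subseteq>V. block E S --> (\<forall>a\<in>R. elab a \<in> S --> 1 <= chip R Ph S (comp R S (esrc a)))))"

lemma NPI_D:
  fixes U :: "nat set"
  assumes "NPI V E" "cx V E U R Ph" "conn U R" "U ~= {}" "1 <= chi U R Ph"
  shows "chi U R Ph = 1" "Ht R" "\<exists>h. nullhtpy (K_LOG V E) proj Base U R Ph h"
    "S \<subseteq> V ==> block E S ==> a \<in> R ==> elab a \<in> S ==> 1 <= chip R Ph S (comp R S (esrc a))"
  using assms unfolding NPI_def by blast+

lemma closed_nLOT: "nLOT V E ==> closed_LOG V E" using nLOTD unfolding closed_LOG_def by metis

lemma closed_Esub: "closed_LOG S (Esub E S)" unfolding closed_LOG_def Esub_def by blast

lemma labs_closed: "cx V E U R Ph ==> closed_LOG V E ==> ph \<in> Ph ==> labs ph \<subseteq> V"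
  using cxD(8) unfolding closed_LOG_def labs_eq by blast

lemma nullhtpy_const:
  assumes "closed_LOG V E" "cx V E {u} {} Ph" "Ph = {}"
  shows "\<exists>h. nullhtpy (K_LOG V E) proj Base {u} {} Ph h"
proof -
  have B: "Base \<in> topspace (K_LOG V E)" using topspace_K_LOG[OF assms(1)] by (simp add: K_points_def)
  have "proj q = Base" if "q \<in> lpts {u} {} Ph" for q :: "('b,'a) lpt" using that assms(3) by (cases q) auto
  then show ?thesis unfolding nullhtpy_def using B by (intro exI[of _ "\<lambda>_. Base"]) auto
qed

text \<open>A LOT with one vertex has no edges, so the complex has no faces, and characteristic at
  least 1 makes it a tree.\<close>

lemma NPI_base:
  assumes L: "nLOT V E" and c1: "card V = 1" shows "NPI V E"
proof -
  obtain x where V: "V = {x}" using c1 by (metis card_1_singletonE)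
  have E: "E = {}" using nLOTD(3,8)[OF L] c1 by simp
  have cl: "closed_LOG V E" by (rule closed_nLOT[OF L])
  show ?thesis unfolding NPI_def
  proof (intro allI impI)
    fix U :: "nat set" and R Ph assume a: "cx V E U R Ph" "conn U R" "U ~= {}" "1 <= chi U R Ph"
    have F: "Ph = {}" using cxD(8)[OF a(1)] E by auto
    have t: "Ht R \<and> card U = card R + 1" by (rule tree_Ht[OF a(1-3)]) (use a(4) F in \<open>simp add: chi_def\<close>)
    have ch: "chi U R Ph = 1" using t F by (simp add: chi_def)
    have "\<exists>h. nullhtpy (K_LOG V E) proj Base U R Ph h"
      by (rule nullhtpy_one_generator[OF cl, of x]) (use a(1) V E t in auto)
    moreover have "1 <= chip R Ph S (comp R S (esrc b))" if S: "S \<subseteq> V" "block E S" "b \<in> R" "elab b \<in> S" for S b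
    proof -
      have "S = V" using S V by auto
      moreover have "comp R V (esrc b) = U \<and> chip R Ph V U = chi U R Ph"
        using chip_full[OF a(1,2) cxD(5)[OF a(1) S(3)], of V] cxD(7)[OF a(1)] F by blast
      ultimately show ?thesis using ch by simp
    qed
    ultimately show "chi U R Ph = 1 \<and> Ht R \<and> (\<exists>h. nullhtpy (K_LOG V E) proj Base U R Ph h) \<and>
     (\<forall>S\<subseteq>V. block E S --> (\<forall>a\<in>R. elab a \<in> S --> 1 <= chip R Ph S (comp R S (esrc a))))" using ch t by blast
  qed
qed

lemma piece_NPI:
  fixes U :: "nat set"
  assumes L: "nLOT V E" and c: "c \<subseteq> V" "NPI c (Esub E c)" and cx: "cx V E U R Ph" and u: "u \<in> U"
  defines "C \<equiv> comp R c u"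
  shows "cx c (Esub E c) C (Rp R c C) (Fp Ph c C)" "conn C (Rp R c C)" "chip R Ph c C <= 1"
    "1 <= chip R Ph c C ==> Ht (Rp R c C) \<and> (\<exists>h. nullhtpy (K_LOG V E) proj Base C (Rp R c C) (Fp Ph c C) h)"
proof -
  have "V \<inter> c = c" "{e\<in>E. {fst e, fst (snd e), snd (snd e)} \<subseteq> c} = Esub E c" using c(1) by (auto simp: Esub_def src_def lab_def tgt_def)
  then show cx': "cx c (Esub E c) C (Rp R c C) (Fp Ph c C)" and cn: "conn C (Rp R c C)"
    using piece_cx[OF cx u C_def[THEN meta_eq_to_obj_eq]] by auto
  have ne: "C ~= {}" using comp_refl[of u R c] unfolding C_def by blast
  note D = NPI_D[OF c(2) cx' cn ne, folded chip_def]
  show "chip R Ph c C <= 1" using D(1) by linarith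
  assume g: "1 <= chip R Ph c C"
  obtain h where "nullhtpy (K_LOG c (Esub E c)) proj Base C (Rp R c C) (Fp Ph c C) h" using D(3)[OF g] by blast
  then have "nullhtpy (K_LOG V E) proj Base C (Rp R c C) (Fp Ph c C) h"
    by (rule nullhtpy_incl[OF closed_nLOT[OF L] closed_Esub c(1), rotated]) (auto simp: Esub_def)
  then show "Ht (Rp R c C) \<and> (\<exists>h. nullhtpy (K_LOG V E) proj Base C (Rp R c C) (Fp Ph c C) h)" using D(2)[OF g] by blast
qed

text \<open>The measure counts faces twice, since splitting trades one face for one new vertex;
  pruning removes vertices and adds no face. When nothing can be pruned, each good piece has two
  attached vertices and the count provides a splitting.\<close>

lemma NPI_core:
  fixes U :: "nat set"
  assumes L: "nLOT V E" and part: "LOT_partition V E \<P>" and npi: "!!c. c \<in> \<P> ==> NPI c (Esub E c)"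
  shows "cx V E U R Ph ==> conn U R ==> U ~= {} ==> 1 <= chi U R Ph ==>
    chi U R Ph = 1 \<and> Ht R \<and> (\<exists>h. nullhtpy (K_LOG V E) proj Base U R Ph h) \<and>
    (\<forall>c\<in>\<P>. \<forall>a\<in>R. elab a \<in> c --> 1 <= chip R Ph c (comp R c (esrc a)))"
proof (induction "2 * card Ph + card U" arbitrary: U R Ph rule: less_induct)
  case (less U Ph R)
  note cx = less.prems(1) and conn = less.prems(2) and ne = less.prems(3) and chi1 = less.prems(4)
  have cl: "closed_LOG V E" by (rule closed_nLOT[OF L])
  have fin: "finite U" "finite R" "finite Ph" using cxD[OF cx] by auto
  have cV: "c \<subseteq> V" if "c \<in> \<P>" for c using LOT_partitionD(8)[OF part that] .
  note pc = piece_NPI[OF L cV npi cx]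
  \<comment> \<open>The height is chosen for the piece as a set, so that all its vertices refer to
    the same choice.\<close>
  define hh where "hh c v = (SOME h::nat => int. \<forall>a\<in>Rp R c (comp R c v). h (etgt a) = h (esrc a) + 1) v" for c v
  have hh: "hh c (etgt a) = hh c (esrc a) + 1" if a: "c \<in> \<P>" "a \<in> R" "elab a \<in> c" "1 <= chip R Ph c (comp R c (esrc a))" for c a
  proof -
    let ?C = "comp R c (esrc a)"
    have "\<exists>h::nat => int. \<forall>b\<in>Rp R c ?C. h (etgt b) = h (esrc b) + 1"
      using pc(4)[OF a(1) a(1) cxD(5)[OF cx a(2)] a(4)] unfolding Ht_def by blast
    from someI_ex[OF this] have s: "\<forall>b\<in>Rp R c ?C. (SOME h::nat => int. \<forall>a\<in>Rp R c ?C. h (etgt a) = h (esrc a) + 1) (etgt b) = (SOME h::nat => int. \<forall>a\<in>Rp R c ?C. h (etgt a) = h (esrc a) + 1) (esrc b) + 1" .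
    have "a \<in> Rp R c ?C" using a comp_refl[of "esrc a" R c] unfolding Rp_def by blast
    then show ?thesis using s unfolding hh_def comp_step[OF a(2,3), symmetric] by blast
  qed
  interpret pieces V E \<P> U R Ph hh by unfold_locales (use cx part cl hh in blast)+
  show ?case
  proof (cases "R = {}")
    case True
    obtain u where u: "u \<in> U" using ne by blast
    have "U = {u}" using conn u True unfolding conn_def adj_def by auto
    moreover have "Ph = {}" using cxD(9)[OF cx, of _ 0] True by auto
    ultimately show ?thesis using True nullhtpy_const[OF cl, of u Ph] cx by (simp add: chi_def Ht_def)
  next
    case False
    have noniso: "I v ~= {}" if v: "v \<in> U" for v
    proof -
      obtain a where a: "a \<in> R" using False by blast
      have "(v, esrc a) \<in> (adj R)\<^sup>*" using conn v cxD(5)[OF cx a] unfolding conn_def by blast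
      then have "\<exists>b\<in>R. esrc b = v \<or> etgt b = v"
      proof (cases rule: converse_rtranclE)
        case base then show ?thesis using a by blast
      next
        case (step y) then show ?thesis unfolding adj_def by blast
      qed
      then obtain b where b: "b \<in> R" "esrc b = v \<or> etgt b = v" by blast
      then have "cl (elab b) \<in> I v" using cl_in[OF cxD(7)[OF cx b(1)]] unfolding Iv_def by blast
      then show ?thesis by blast
    qed
    have Iedge: "\<exists>a\<in>R. elab a \<in> c \<and> comp R c (esrc a) = comp R c u" if "c \<in> I u" for c u
      using that comp_step unfolding Iv_def by blast
    show ?thesis
    proof (cases "\<exists>c\<in>\<P>. \<exists>a\<in>R. elab a \<in> c \<and> (\<forall>w\<in>comp R c (esrc a). \<not> att w)")
      case True
      then obtain c a where a: "c \<in> \<P>" "a \<in> R" "elab a \<in> c" and na: "!!w. w \<in> comp R c (esrc a) ==> \<not> att w" by blast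
      \<comment> \<open>A piece without attached vertices is the whole complex by connectedness, and
        the hypothesis on its class applies directly.\<close>
      let ?C = "comp R c (esrc a)"
      have cI: "c \<in> I w" if "w \<in> ?C" for w using Iv_comp[of c \<P> R "esrc a" w] that a unfolding Iv_def by blast
      have lab: "elab b \<in> c" if b: "b \<in> R" "esrc b \<in> ?C \<or> etgt b \<in> ?C" for b
      proof (rule ccontr)
        assume n: "elab b \<notin> c"
        obtain w where w: "w \<in> ?C" "esrc b = w \<or> etgt b = w" using b(2) by blast
        have "cl (elab b) \<in> I w" using cl_in[OF cxD(7)[OF cx b(1)]] b(1) w(2) unfolding Iv_def by blast
        moreover have "cl (elab b) ~= c" using cl_in(2)[OF cxD(7)[OF cx b(1)]] n by blast
        ultimately show False using attI[OF cI[OF w(1)]] na[OF w(1)] by metis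
      qed
      have "w \<in> ?C" if "(esrc a, w) \<in> (adj R)\<^sup>*" for w
        using that
      proof (induction rule: rtrancl_induct)
        case (step y z)
        then obtain b where b: "b \<in> R" "esrc b = y \<and> etgt b = z \<or> esrc b = z \<and> etgt b = y" unfolding adj_def by blast
        have "elab b \<in> c" using lab[OF b(1)] b(2) step.IH by blast
        then show ?case using comp_step[OF b(1)] b(2) step.IH comp_eq[of _ R c "esrc a"] by (metis comp_refl)
      qed simp
      then have CU: "?C = U" using comp_sub[OF cx cxD(5)[OF cx a(2)], of c] conn cxD(5)[OF cx a(2)] unfolding conn_def by blast
      have Rc: "elab b \<in> c" if "b \<in> R" for b using lab[OF that] cxD(5)[OF cx that] CU by blast
      have Fc: "labs ph \<subseteq> c" if p: "ph \<in> Ph" for ph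
      proof -
        have "clab ph k \<in> c" if "k < 4" for k using Rc[OF cxD(9)[OF cx p that]] by (simp add: clab_def)
        from this[of 0] this[of 1] this[of 2] show ?thesis unfolding labs_eq using clab_simps[of ph] by simp
      qed
      note fl = chip_full[OF cx conn _ Rc Fc]
      note full = fl[OF cxD(5)[OF cx a(2)]]
      have g: "1 <= chip R Ph c ?C" using chi1 full CU by simp
      have "chi U R Ph = 1" using pc(3)[OF a(1) a(1) cxD(5)[OF cx a(2)]] g full CU by simp
      moreover have "Ht R" "\<exists>h. nullhtpy (K_LOG V E) proj Base U R Ph h"
        using pc(4)[OF a(1) a(1) cxD(5)[OF cx a(2)] g] full CU by simp_all
      moreover have "1 <= chip R Ph c' (comp R c' (esrc b))" if "c' \<in> \<P>" "b \<in> R" "elab b \<in> c'" for c' b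
      proof -
        have "c' = c" using class_eq[OF that(1) a(1) that(3) Rc[OF that(2)]] .
        then show ?thesis using fl[OF cxD(5)[OF cx that(2)]] chi1 by simp
      qed
      ultimately show ?thesis by blast
    next
      case nz: False
      show ?thesis
      proof (cases "\<exists>c\<in>\<P>. \<exists>a\<in>R. elab a \<in> c \<and> good c (esrc a) \<and> (\<exists>w\<in>comp R c (esrc a). \<forall>w'\<in>comp R c (esrc a). att w' --> w' = w)")
        case True
        then obtain c a w where a: "c \<in> \<P>" "a \<in> R" "elab a \<in> c" "good c (esrc a)" and w: "w \<in> comp R c (esrc a)" "\<forall>w'\<in>comp R c (esrc a). att w' --> w' = w"
          by blast
        define C where "C = comp R c (esrc a)"
        define U2 where "U2 = insert w (U - C)"
        define R2 where "R2 = R - Rp R c C"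
        define Ph2 where "Ph2 = Ph - Fp Ph c C"
        note pr = prune[OF a(2,1,3,4) C_def w[folded C_def] U2_def R2_def Ph2_def conn]
        note pcC = pc[OF a(1) a(1) cxD(5)[OF cx a(2)], folded C_def]
        have g: "1 <= chip R Ph c C" using a(4) C_def by simp
        have c1: "chip R Ph c C = 1" using pcC(3) g by linarith
        have chi2: "chi U2 R2 Ph2 = chi U R Ph" using pr(5) c1 by simp
        have m: "2 * card Ph2 + card U2 < 2 * card Ph + card U" using pr(4,6) by linarith
        have m': "U2 ~= {}" "1 <= chi U2 R2 Ph2" using chi2 chi1 unfolding U2_def by auto
        have IH: "chi U2 R2 Ph2 = 1 \<and> Ht R2 \<and> (\<exists>h. nullhtpy (K_LOG V E) proj Base U2 R2 Ph2 h) \<and>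
          (\<forall>c\<in>\<P>. \<forall>a\<in>R2. elab a \<in> c --> 1 <= chip R2 Ph2 c (comp R2 c (esrc a)))" by (rule less.hyps[OF m pr(1,2) m'])
        have CU: "C \<subseteq> U" unfolding C_def by (rule comp_sub[OF cx cxD(5)[OF cx a(2)]])
        have wC: "w \<in> C" using w(1) C_def by simp
        have RpC: "esrc b \<in> C \<and> etgt b \<in> C" if "b \<in> Rp R c C" for b using cxD(5,6)[OF pcC(1) that] by blast
        have H: "Ht R"
        proof -
          have "Ht (Rp R c C)" "Ht R2" using pcC(4)[OF g] IH by (simp_all only:)
          then obtain h1 h2 :: "nat => int" where h1: "\<forall>b\<in>Rp R c C. h1 (etgt b) = h1 (esrc b) + 1"
            and h2: "\<forall>b\<in>R2. h2 (etgt b) = h2 (esrc b) + 1" unfolding Ht_def by (elim exE)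
          \<comment> \<open>The height of the piece is shifted so as to agree with the other one at
            \<open>w\<close>.\<close>
          define k where "k u = (if u \<in> C then h1 u + h2 w - h1 w else h2 u)" for u
          have k2: "k u = h2 u" if "u \<in> U2" for u using that unfolding U2_def k_def by auto
          have "k (etgt b) = k (esrc b) + 1" if b: "b \<in> R" for b
          proof (cases "b \<in> Rp R c C")
            case True then show ?thesis using h1[THEN bspec, OF True] RpC[OF True] by (simp add: k_def)
          next
            case False
            then have "b \<in> R2" using b R2_def by blast
            then show ?thesis using h2[THEN bspec, of b] k2 pr(3)[of b] by simp
          qed
          then show ?thesis unfolding Ht_def by blast
        qed
        have "\<exists>h. nullhtpy (K_LOG V E) proj Base (C \<union> U2) (Rp R c C \<union> R2) (Fp Ph c C \<union> Ph2) h"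
        proof -
          obtain h1 where h1: "nullhtpy (K_LOG V E) proj Base C (Rp R c C) (Fp Ph c C) h1" using pcC(4)[OF g] by (elim conjE exE)
          obtain h2 where h2: "nullhtpy (K_LOG V E) proj Base U2 R2 Ph2 h2" using IH by (elim conjE exE)
          have "C \<inter> U2 = {w}" using wC unfolding U2_def by blast
          moreover have "Rp R c C \<inter> R2 = {}" "Fp Ph c C \<inter> Ph2 = {}" unfolding R2_def Ph2_def by blast+
          ultimately show ?thesis using nullhtpy_wedge[OF cxD(4)[OF pcC(1)] cxD(4)[OF pr(1)] _ _ _ _ h1 h2] by simp
        qed
        moreover have "C \<union> U2 = U" using CU wC unfolding U2_def by blast
        moreover have "Rp R c C \<union> R2 = R" "Fp Ph c C \<union> Ph2 = Ph" unfolding R2_def Ph2_def Rp_def Fp_def by blast+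
        ultimately have nh: "\<exists>h. nullhtpy (K_LOG V E) proj Base U R Ph h" by simp
        have "1 <= chip R Ph c' (comp R c' (esrc b))" if b: "c' \<in> \<P>" "b \<in> R" "elab b \<in> c'" for c' b
        proof (cases "b \<in> Rp R c C")
          case True
          then have "elab b \<in> c" "esrc b \<in> C" by (auto simp: Rp_def)
          then have "c' = c" "comp R c (esrc b) = C" using class_eq[OF b(1) a(1) b(3)] comp_eq[of "esrc b" R c "esrc a"] unfolding C_def by auto
          then show ?thesis using g by simp
        next
          case False
          then have "b \<in> R2" using b R2_def by blast
          note r2 = this
          have "1 <= chip R2 Ph2 c' (comp R2 c' (esrc b))" using IH[THEN conjunct2, THEN conjunct2, THEN conjunct2, THEN bspec, OF b(1), THEN bspec, OF r2] b(3) by (rule mp)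
          then show ?thesis using pr(7)[OF b(1) r2 b(3)] by simp
        qed
        moreover have "chi U R Ph = 1" using IH[THEN conjunct1] chi2 by simp
        ultimately show ?thesis using H nh by blast
      next
        case n1: False
        have two: "\<exists>w w'. w ~= w' \<and> w \<in> comp R c u \<and> w' \<in> comp R c u \<and> att w \<and> att w'" if cu: "c \<in> I u" "good c u" for c u
        proof -
          obtain a where a: "a \<in> R" "elab a \<in> c" "comp R c (esrc a) = comp R c u" using Iedge[OF cu(1)] by blast
          have cP: "c \<in> \<P>" using cu(1) by (simp add: Iv_def)
          obtain w where w: "w \<in> comp R c u" "att w" using nz cP a by metis
          then obtain w' where "w' \<in> comp R c u" "att w'" "w' ~= w" using n1 cP a cu(2) by metis
          then show ?thesis using w by blast
        qed
        have c1: "chip R Ph c (comp R c u) <= 1" if "c \<in> \<P>" "u \<in> U" for c u using pc(3)[OF that(1) that(1) that(2)] .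
        have "chi U R Ph <= 0 \<or> (\<exists>v\<in>U. \<exists>c ph0 k0. c \<in> I v \<and> good c v \<and> ph0 \<in> Ph \<and> k0 < 4 \<and> corner ph0 k0 = v \<and> chgc c ph0 k0 \<and>
          (\<forall>ph\<in>Ph. \<forall>k<4. corner ph k = v --> chgc c ph k --> ph = ph0 \<and> k = k0))" by (rule count_apply[OF noniso c1 two])
        moreover have "\<not> chi U R Ph <= 0" using chi1 by linarith
        ultimately have ex: "\<exists>v\<in>U. \<exists>c ph0 k0. c \<in> I v \<and> good c v \<and> ph0 \<in> Ph \<and> k0 < 4 \<and> corner ph0 k0 = v \<and> chgc c ph0 k0 \<and>
          (\<forall>ph\<in>Ph. \<forall>k<4. corner ph k = v --> chgc c ph k --> ph = ph0 \<and> k = k0)" by (rule disj_imp[THEN iffD1, THEN mp])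
        obtain v c ph0 k0 where d: "v \<in> U" "c \<in> I v" "good c v" "ph0 \<in> Ph" "k0 < 4" "corner ph0 k0 = v" "chgc c ph0 k0"
          and uq: "\<forall>ph\<in>Ph. \<forall>k<4. corner ph k = v --> chgc c ph k --> ph = ph0 \<and> k = k0"
          using ex by (elim bexE exE conjE) (rule that; assumption)
        have cP: "c \<in> \<P>" using d(2) by (simp add: Iv_def)
        obtain n where n: "n \<notin> U" using ex_new_if_finite[OF infinite_UNIV_nat fin(1)] by blast
        have det: "detach V E U R Ph c v n ph0 k0" by unfold_locales (use cx n d uq in blast)+
        interpret D: detach V E U R Ph c v n ph0 k0 by (rule det)
        have m: "2 * card D.Ph' + card D.U' < 2 * card Ph + card U" using D.chi'(3,4) by linarith
        have m': "D.U' ~= {}" "1 <= chi D.U' D.R' D.Ph'" using D.chi'(1) chi1 unfolding D.U'_def by auto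
        have IH: "chi D.U' D.R' D.Ph' = 1 \<and> Ht D.R' \<and> (\<exists>h. nullhtpy (K_LOG V E) proj Base D.U' D.R' D.Ph' h) \<and>
          (\<forall>c\<in>\<P>. \<forall>a\<in>D.R'. elab a \<in> c --> 1 <= chip D.R' D.Ph' c (comp D.R' c (esrc a)))" by (rule less.hyps[OF m D.cx' D.conn'[OF conn] m'])
        have "continuous_map (top_of_set (cball 0 1)) (K_LOG V E) (\<lambda>p. proj (charF ph0 p))"
          using continuous_map_compose[OF continuous_charF[OF cxD(4)[OF cx] d(4)] continuous_proj[OF cl cx]] by (simp add: o_def)
        note ch = this
        obtain h where "nullhtpy (K_LOG V E) proj Base D.U' D.R' D.Ph' h" using IH by (elim conjE exE)
        then have nh: "\<exists>h. nullhtpy (K_LOG V E) proj Base U R Ph h" by (rule D.null'[OF _ ch])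
        have "1 <= chip R Ph c' (comp R c' (esrc b))" if b: "c' \<in> \<P>" "b \<in> R" "elab b \<in> c'" for c' b
        proof (cases "c' = c \<and> esrc b \<in> comp R c v")
          case True then show ?thesis using d(3) comp_eq[of "esrc b" R c v] by simp
        next
          case False
          then have "c' = c ==> esrc b \<notin> comp R c v" by blast
          note tr = detach_transfer[OF det cP b this refl refl]
          have "1 <= chip D.R' D.Ph' c' (comp D.R' c' (esrc b))"
            using IH[THEN conjunct2, THEN conjunct2, THEN conjunct2, THEN bspec, OF b(1), THEN bspec, OF tr(1)] b(3) by (rule mp)
          then show ?thesis using tr(2,3) by simp
        qed
        moreover have "chi U R Ph = 1" using IH[THEN conjunct1] D.chi'(1) by simp
        moreover have "Ht R" using IH D.Ht' by (elim conjE)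
        ultimately show ?thesis using nh by blast
      qed
    qed
  qed
qed

text \<open>The partition may depend on the block \<open>S\<close> under consideration. Take one
  with a class containing \<open>S\<close>: by \<open>NPI_core\<close> the pieces over this class
  have characteristic at least 1, and the hypothesis for the class passes this on to
  \<open>S\<close>.\<close>

lemma NPI_step:
  assumes L: "nLOT V E" and c2: "2 <= card V" and npi: "!!c. c \<subseteq> V ==> c ~= V ==> block E c ==> NPI c (Esub E c)"
  shows "NPI V E"
  unfolding NPI_def
proof (intro allI impI)
  fix U :: "nat set" and R Ph assume a: "cx V E U R Ph" "conn U R" "U ~= {}" "1 <= chi U R Ph"
  have core: "chi U R Ph = 1 \<and> Ht R \<and> (\<exists>h. nullhtpy (K_LOG V E) proj Base U R Ph h) \<and>
    (\<forall>c\<in>\<P>. \<forall>a\<in>R. elab a \<in> c --> 1 <= chip R Ph c (comp R c (esrc a)))" if P: "LOT_partition V E \<P>" for \<P>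
  proof (rule NPI_core[OF L P _ a])
    fix c assume "c \<in> \<P>"
    then have "c \<subseteq> V" "c ~= V" "block E c" using LOT_partitionD(2,3,8)[OF P] by blast+
    then show "NPI c (Esub E c)" by (rule npi)
  qed
  obtain v where v: "v \<in> V" using nLOTD(2)[OF L] by blast
  have "{v} ~= V" using c2 by auto
  then obtain \<P> where "LOT_partition V E \<P>" using LOT_partition_exists[OF L block_singleton[OF L v]] v by blast
  note c0 = core[OF this]
  have "1 <= chip R Ph S (comp R S (esrc b))" if S: "S \<subseteq> V" "block E S" "b \<in> R" "elab b \<in> S" for S b
  proof (cases "S = V")
    case True
    have "comp R V (esrc b) = U \<and> chip R Ph V U = chi U R Ph"
      using chip_full[OF a(1,2) cxD(5)[OF a(1) S(3)], of V] cxD(7)[OF a(1)] labs_closed[OF a(1) closed_nLOT[OF L]] by blast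
    then show ?thesis using True a(4) by simp
  next
    case False
    then obtain \<P> c where P: "LOT_partition V E \<P>" "c \<in> \<P>" "S \<subseteq> c" using LOT_partition_exists[OF L S(2,1)] by blast
    have c: "c \<subseteq> V" "c ~= V" "block E c" using LOT_partitionD(2,3,8)[OF P(1)] P(2) by blast+
    note pc = piece_NPI[OF L c(1) npi[OF c] a(1) cxD(5)[OF a(1) S(3)]]
    define C where "C = comp R c (esrc b)"
    have bc: "elab b \<in> c" using S(4) P(3) by blast
    have g: "1 <= chip R Ph c C" using core[OF P(1)] P(2) S(3) bc unfolding C_def by blast
    have "block (Esub E c) S" using S(2) unfolding block_def Esub_Esub[OF P(3)] .
    moreover have "b \<in> Rp R c C" using S(3) bc comp_refl[of "esrc b" R c] unfolding Rp_def C_def by blast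
    moreover have "C ~= {}" using comp_refl[of "esrc b" R c] unfolding C_def by blast
    ultimately have one: "1 <= chip (Rp R c C) (Fp Ph c C) S (comp (Rp R c C) S (esrc b))"
      using NPI_D(4)[OF npi[OF c] pc(1,2)[folded C_def] _ _ P(3) _ _ S(4)] g unfolding chip_def by blast
    let ?D = "comp R S (esrc b)"
    have DC: "?D \<subseteq> C"
    proof -
      have "adj (Rl R S) \<subseteq> adj (Rl R c)" using P(3) unfolding adj_def Rl_def by blast
      then show ?thesis unfolding comp_def C_def using rtrancl_mono by blast
    qed
    have e: "x \<in> R \<longleftrightarrow> x \<in> Rp R c C" if "elab x \<in> S" "esrc x \<in> ?D \<or> etgt x \<in> ?D" for x
    proof
      assume x: "x \<in> R"
      have xc: "elab x \<in> c" using that(1) P(3) by blast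
      have "esrc x \<in> C" using that(2) DC comp_step[OF x xc] comp_eq[of _ R c "esrc b"] comp_refl unfolding C_def by (metis subsetD)
      then show "x \<in> Rp R c C" using x xc unfolding Rp_def by blast
    qed (simp add: Rp_def)
    have f: "ph \<in> Ph \<longleftrightarrow> ph \<in> Fp Ph c C" if "labs ph \<subseteq> S" "corner ph 0 \<in> ?D" for ph
      using that P(3) DC unfolding Fp_def by blast
    have "comp (Rp R c C) S (esrc b) = ?D" by (rule chip_transfer(1)[OF refl e f])
    moreover have "chip (Rp R c C) (Fp Ph c C) S ?D = chip R Ph S ?D" by (rule chip_transfer(2)[OF refl e f])
    ultimately show ?thesis using one by simp
  qed
  then show "chi U R Ph = 1 \<and> Ht R \<and> (\<exists>h. nullhtpy (K_LOG V E) proj Base U R Ph h) \<and>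
     (\<forall>S\<subseteq>V. block E S --> (\<forall>a\<in>R. elab a \<in> S --> 1 <= chip R Ph S (comp R S (esrc a))))" using c0 by blast
qed

theorem nLOT_NPI: "nLOT V E ==> NPI V E"
proof (induction "card V" arbitrary: V E rule: less_induct)
  case less
  have "card V ~= 0" using nLOTD(1,2)[OF less.prems] by simp
  show ?case
  proof (cases "card V = 1")
    case True then show ?thesis by (rule NPI_base[OF less.prems])
  next
    case False
    show ?thesis
    proof (rule NPI_step[OF less.prems])
      show "2 <= card V" using False \<open>card V ~= 0\<close> by linarith
      fix c assume c: "c \<subseteq> V" "c ~= V" "block E c"
      have "card c < card V" using c nLOTD(1)[OF less.prems] by (intro psubset_card_mono) auto
      then show "NPI c (Esub E c)" using less.hyps Esub_nLOT[OF less.prems c(3,1)] by blast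
    qed
  qed
qed

section \<open>Unfolding of maps\<close>

lemma continuous_map_LT:
  assumes wf: "wf_cx U R Ph" and V: "!!u. u \<in> U ==> h (LV u) \<in> topspace Z"
    and E: "!!a. a \<in> R ==> continuous_map (top_of_set {0..1}) Z (\<lambda>t. h (charE a t))"
    and F: "!!ph. ph \<in> Ph ==> continuous_map (top_of_set (cball 0 1)) Z (\<lambda>p. h (charF ph p))"
  shows "continuous_map (LT U R Ph) Z h"
  unfolding continuous_map_def topspace_LT[OF wf]
proof (intro conjI allI impI)
  have "h q \<in> topspace Z" if "q \<in> lpts U R Ph" for q
  proof (cases q)
    case (LV u) then show ?thesis using V that by simp
  next
    case (LE a t)
    then have a: "a \<in> R" "0 < t" "t < 1" using that by auto
    then have "charE a t = q" "t \<in> topspace (top_of_set {0..1})" using LE by (auto simp: charE_def)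
    then show ?thesis using continuous_map_image_subset_topspace[OF E[OF a(1)]] by (metis image_subset_iff)
  next
    case (LF ph p)
    then have a: "ph \<in> Ph" "norm p < 1" using that by auto
    then have "charF ph p = q" "p \<in> topspace (top_of_set (cball 0 1))" using LF by (auto simp: charF_def)
    then show ?thesis using continuous_map_image_subset_topspace[OF F[OF a(1)]] by (metis image_subset_iff)
  qed
  then show "h \<in> lpts U R Ph \<rightarrow> topspace Z" by blast
  fix W assume W: "openin Z W"
  show "openin (LT U R Ph) {q \<in> lpts U R Ph. h q \<in> W}"
    unfolding openin_LT lopen_def
  proof (intro conjI ballI)
    fix a assume a: "a \<in> R"
    have "{t \<in> {0..1}. charE a t \<in> {q \<in> lpts U R Ph. h q \<in> W}} = {t \<in> topspace (top_of_set {0..1}). h (charE a t) \<in> W}"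
      using charE_in[OF wf a] by auto
    then show "openin (top_of_set {0..1}) {t \<in> {0..1}. charE a t \<in> {q \<in> lpts U R Ph. h q \<in> W}}"
      using openin_continuous_map_preimage[OF E[OF a] W] by simp
  next
    fix ph assume a: "ph \<in> Ph"
    have "{p \<in> cball 0 1. charF ph p \<in> {q \<in> lpts U R Ph. h q \<in> W}} = {p \<in> topspace (top_of_set (cball 0 1)). h (charF ph p) \<in> W}"
      using charF_in[OF wf a] by auto
    then show "openin (top_of_set (cball 0 1)) {p \<in> cball 0 1. charF ph p \<in> {q \<in> lpts U R Ph. h q \<in> W}}"
      using openin_continuous_map_preimage[OF F[OF a] W] by simp
  qed blast
qed

lemma continuous_renP:
  assumes wf: "wf_cx U R Ph" "wf_cx U' R' Ph'" and s: "\<rho> ` U \<subseteq> U'" "renE \<rho> ` R \<subseteq> R'" "renF \<rho> ` Ph \<subseteq> Ph'"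
  shows "continuous_map (LT U R Ph) (LT U' R' Ph') (renP \<rho>)"
proof (rule continuous_map_LT[OF wf(1)])
  show "renP \<rho> (LV u) \<in> topspace (LT U' R' Ph')" if "u \<in> U" for u
    unfolding topspace_LT[OF wf(2)] by (rule renP_in[OF s]) (use that in simp)
  show "continuous_map (top_of_set {0..1}) (LT U' R' Ph') (\<lambda>t. renP \<rho> (charE a t))" if "a \<in> R" for a
    unfolding renP_charE by (rule continuous_charE[OF wf(2)]) (use that s(2) in blast)
  show "continuous_map (top_of_set (cball 0 1)) (LT U' R' Ph') (\<lambda>p. renP \<rho> (charF ph p))" if "ph \<in> Ph" for ph
    unfolding renP_charF by (rule continuous_charF[OF wf(2)]) (use that s(3) in blast)
qed

text \<open>The value on faces is a placeholder: \<open>hx0\<close> is evaluated on the 1-skeleton,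
  where \<open>hx\<close> takes its boundary values from.\<close>

definition hx0 :: "('u => real) => ('u,'v) lpt => real" where
  "hx0 k q = (case q of LV u => k u | LE a t => k (esrc a) + t * (k (etgt a) - k (esrc a)) | LF ph p => 0)"

text \<open>Heights of vertices are extended linearly over edges and radially, from the first corner, over faces.\<close>
definition hx :: "('u => real) => ('u,'v) lpt => real" where
  "hx k q = (case q of LV u => k u | LE a t => hx0 k q
     | LF ph p => k (corner ph 0) + norm p * (hx0 k (bdpt ph (ang p)) - k (corner ph 0)))"

lemma hx0_charE: "0 <= t ==> t <= 1 ==> hx0 k (charE a t) = k (esrc a) + t * (k (etgt a) - k (esrc a))"
  by (auto simp: hx0_def charE_def)

lemma hx_charE: "0 <= t ==> t <= 1 ==> hx k (charE a t) = k (esrc a) + t * (k (etgt a) - k (esrc a))"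
  by (auto simp: hx_def hx0_def charE_def)

lemma bdpt_charE: "\<exists>a t. bdpt ph s = charE a t"
  unfolding bdpt_def Let_def case_prod_unfold by (intro exI) (rule refl)

lemma hx_hx0_bdpt: "hx k (bdpt ph s) = hx0 k (bdpt ph s)"
proof -
  obtain a t where "bdpt ph s = charE a t" using bdpt_charE by blast
  then show ?thesis by (simp add: hx_def hx0_def charE_def)
qed

lemma bdpt_04: "bdpt ph 4 = bdpt ph 0"
  using bdpt_barc[of 3 4 ph] bdpt_barc[of 0 0 ph] barc_ends[of 3 ph] barc_ends[of 0 ph] by simp

lemma continuous_hx0:
  assumes wf: "wf_cx U R Ph" shows "continuous_map (LT U R {}) euclidean (hx0 k)"
proof (rule continuous_map_LT)
  show "wf_cx U R {}" using wf by (simp add: wf_cx_def)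
  fix a assume "a \<in> R"
  have "continuous_on {0..1} (\<lambda>t. k (esrc a) + t * (k (etgt a) - k (esrc a)))" by (intro continuous_intros)
  then have "continuous_map (top_of_set {0..1}) euclidean (\<lambda>t. k (esrc a) + t * (k (etgt a) - k (esrc a)))" by simp
  then show "continuous_map (top_of_set {0..1}) euclidean (\<lambda>t. hx0 k (charE a t))"
    by (rule continuous_map_eq) (simp add: hx0_charE)
qed auto

lemma continuous_hx:
  assumes wf: "wf_cx U R Ph" shows "continuous_map (LT U R Ph) euclidean (hx k)"
proof (rule continuous_map_LT[OF wf])
  fix a assume "a \<in> R"
  have "continuous_on {0..1} (\<lambda>t. k (esrc a) + t * (k (etgt a) - k (esrc a)))" by (intro continuous_intros)
  then have "continuous_map (top_of_set {0..1}) euclidean (\<lambda>t. k (esrc a) + t * (k (etgt a) - k (esrc a)))" by simp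
  then show "continuous_map (top_of_set {0..1}) euclidean (\<lambda>t. hx k (charE a t))"
    by (rule continuous_map_eq) (simp add: hx_charE)
next
  fix ph assume f: "ph \<in> Ph"
  let ?c = "k (corner ph 0)"
  let ?G = "\<lambda>p. ?c + norm p * (hx0 k (bdpt ph (ang p)) - ?c)"
  have wf0: "wf_cx U R {}" using wf by (simp add: wf_cx_def)
  have "continuous_map (top_of_set {0..4}) euclidean (\<lambda>s. hx0 k (bdpt ph s))"
    using continuous_map_compose[OF continuous_bdpt[OF wf f wf0] continuous_hx0[OF wf]] by (simp add: o_def)
  then have cb: "continuous_on {0..4} (\<lambda>s. hx0 k (bdpt ph s))" by simp
  have "continuous_on ({0..1} \<times> {0..4}) (\<lambda>x. ?c + fst x * (hx0 k (bdpt ph (snd x)) - ?c))"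
    by (intro continuous_intros continuous_on_compose2[OF cb]) auto
  then have "continuous_map (top_of_set ({0..1} \<times> {0..4})) euclidean (\<lambda>x. ?c + fst x * (hx0 k (bdpt ph (snd x)) - ?c))" by simp
  then have "continuous_map (top_of_set ({0..1} \<times> {0..4})) euclidean (?G \<circ> (\<lambda>(r,s). of_real r * cis (pi * s / 2)))"
  proof (rule continuous_map_eq)
    fix x :: "real \<times> real" assume "x \<in> topspace (top_of_set ({0..1} \<times> {0..4}))"
    then obtain r s where x: "x = (r,s)" "r \<in> {0..1}" "s \<in> {0..4}" by auto
    have "?c + norm (of_real r * e4 s) * (hx0 k (bdpt ph (ang (of_real r * e4 s))) - ?c) = ?c + r * (hx0 k (bdpt ph s) - ?c)"
      by (rule polar_eq[of "\<lambda>r s. ?c + r * (hx0 k (bdpt ph s) - ?c)"]) (use x in \<open>simp_all add: bdpt_04\<close>)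
    then show "?c + fst x * (hx0 k (bdpt ph (snd x)) - ?c) = (?G \<circ> (\<lambda>(r,s). of_real r * cis (pi * s / 2))) x"
      using x by (simp add: e4_def)
  qed
  then have "continuous_map (top_of_set (cball 0 1)) euclidean ?G" using continuous_compose_quotient_map_eq[OF quotient_disc] by blast
  then show "continuous_map (top_of_set (cball 0 1)) euclidean (\<lambda>p. hx k (charF ph p))"
  proof (rule continuous_map_eq)
    fix p :: complex assume "p \<in> topspace (top_of_set (cball 0 1))"
    then have "norm p <= 1" by simp
    then consider "norm p < 1" | "norm p = 1" by linarith
    then show "?G p = hx k (charF ph p)"
    proof cases
      case 1 then show ?thesis by (simp add: charF_def hx_def)
    next
      case 2 then show ?thesis by (simp add: charF_def hx_hx0_bdpt flip: ang_def)
    qed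
  qed
qed auto

text \<open>Gaussian elimination by cross-multiplication with the pivot, which keeps all
  coefficients integral.\<close>

lemma integer_system:
  fixes c :: "'j => 'x => int"
  assumes "finite J" "finite X" "card J < card X"
  shows "\<exists>\<psi>. (\<exists>x\<in>X. \<psi> x ~= 0) \<and> (\<forall>j\<in>J. (\<Sum>x\<in>X. c j x * \<psi> x) = 0)"
  using assms
proof (induction J arbitrary: X c rule: finite_induct)
  case empty
  then have "X ~= {}" by auto
  then show ?case by (intro exI[of _ "\<lambda>_. 1"]) auto
next
  case (insert j0 J)
  show ?case
  proof (cases "\<forall>x\<in>X. c j0 x = 0")
    case True
    have "card J < card X" using insert by simp
    from insert.IH[OF insert.prems(1) this, of c] obtain \<psi> where "\<exists>x\<in>X. \<psi> x ~= 0" "\<forall>j\<in>J. (\<Sum>x\<in>X. c j x * \<psi> x) = 0" by blast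
    moreover have "(\<Sum>x\<in>X. c j0 x * \<psi> x) = 0" using True by simp
    ultimately show ?thesis by blast
  next
    case False
    then obtain x0 where x0: "x0 \<in> X" "c j0 x0 ~= 0" by blast
    let ?X = "X - {x0}" let ?p = "c j0 x0"
    have "card J < card ?X" using insert x0 by simp
    moreover have "finite ?X" using insert.prems by simp
    ultimately obtain \<psi> where \<psi>: "\<exists>x\<in>?X. \<psi> x ~= 0" "\<forall>j\<in>J. (\<Sum>x\<in>?X. (?p * c j x - c j x0 * c j0 x) * \<psi> x) = 0"
      using insert.IH[of ?X "\<lambda>j x. ?p * c j x - c j x0 * c j0 x"] by blast
    \<comment> \<open>Multiplying the other unknowns by the pivot makes the value at
      \<open>x0\<close> an integer.\<close>
    define \<xi> where "\<xi> x = (if x = x0 then - (\<Sum>x\<in>?X. c j0 x * \<psi> x) else ?p * \<psi> x)" for x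
    have sum: "(\<Sum>x\<in>X. c j x * \<xi> x) = - c j x0 * (\<Sum>x\<in>?X. c j0 x * \<psi> x) + ?p * (\<Sum>x\<in>?X. c j x * \<psi> x)" for j
    proof -
      have "(\<Sum>x\<in>X. c j x * \<xi> x) = c j x0 * \<xi> x0 + (\<Sum>x\<in>?X. c j x * \<xi> x)" using insert.prems(1) x0(1) by (rule sum.remove)
      also have "(\<Sum>x\<in>?X. c j x * \<xi> x) = (\<Sum>x\<in>?X. ?p * (c j x * \<psi> x))" by (rule sum.cong) (auto simp: \<xi>_def)
      also have "\<dots> = ?p * (\<Sum>x\<in>?X. c j x * \<psi> x)" by (rule sum_distrib_left[symmetric])
      finally have "(\<Sum>x\<in>X. c j x * \<xi> x) = c j x0 * \<xi> x0 + ?p * (\<Sum>x\<in>?X. c j x * \<psi> x)" .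
      moreover have "\<xi> x0 = - (\<Sum>x\<in>?X. c j0 x * \<psi> x)" by (simp add: \<xi>_def)
      ultimately show ?thesis by (simp only: mult_minus_right mult_minus_left)
    qed
    have "(\<Sum>x\<in>X. c j x * \<xi> x) = 0" if "j \<in> insert j0 J" for j
    proof (cases "j = j0")
      case True then show ?thesis unfolding sum by simp
    next
      case False
      then have "(\<Sum>x\<in>?X. (?p * c j x - c j x0 * c j0 x) * \<psi> x) = 0" using \<psi>(2) that by blast
      moreover have "(\<Sum>x\<in>?X. (?p * c j x - c j x0 * c j0 x) * \<psi> x) = ?p * (\<Sum>x\<in>?X. c j x * \<psi> x) - c j x0 * (\<Sum>x\<in>?X. c j0 x * \<psi> x)"
        by (simp add: sum_distrib_left left_diff_distrib sum_subtractf mult.assoc)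
      ultimately show ?thesis unfolding sum by simp
    qed
    moreover have "\<exists>x\<in>X. \<xi> x ~= 0" using \<psi>(1) x0(2) by (auto simp: \<xi>_def)
    ultimately show ?thesis by blast
  qed
qed

section \<open>The full star of the base vertex\<close>

datatype 'v sv = B0 | Sv 'v bool | Fr "'v \<times> 'v \<times> 'v" nat

text \<open>The face of type e whose k-th corner is the base vertex B0. The two neighbouring corners are named by the
  letter leading to them, the opposite corner belongs to no other face.\<close>
definition vv :: "'v \<times> 'v \<times> 'v => nat => nat => 'v sv" where
  "vv e k j = (if j = k then B0 else if j = (k + 1) mod 4 then Sv (lt e k) (k < 2)
     else if j = (k + 3) mod 4 then Sv (lt e j) (\<not> j < 2) else Fr e k)"

definition Fc :: "'v \<times> 'v \<times> 'v => nat => ('v sv,'v) face" where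
  "Fc e k = ((vv e k 0, vv e k 1, vv e k 2, vv e k 3), e)"

text \<open>Every relator appears four times around \<open>B0\<close>, once for each of its corners.
  In \<open>RSt\<close> every generator has one outgoing and one incoming edge at \<open>B0\<close>,
  even if no relator involves it.\<close>

definition FSt where "FSt E = (\<lambda>(e,k). Fc e k) ` (E \<times> {..<4})"
definition RSt where "RSt V E = (\<lambda>x. (B0, x, Sv x True)) ` V \<union> (\<lambda>x. (Sv x False, x, B0)) ` V \<union> (\<Union>ph\<in>FSt E. fst ` set (bd ph))"
definition USt where "USt V E = insert B0 (esrc ` RSt V E \<union> etgt ` RSt V E)"

lemma vv_B0: "vv e k j = B0 \<longleftrightarrow> j = k" by (simp add: vv_def)

lemma snd_Fc [simp]: "snd (Fc e k) = e" by (simp add: Fc_def)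

lemma corner_Fc: "j < 4 ==> corner (Fc e k) j = vv e k j"
  using less_4_cases[of j] by (auto simp: corner_def Fc_def)

lemma FSt_E: "ph \<in> FSt E ==> \<exists>e\<in>E. \<exists>k<4. ph = Fc e k" unfolding FSt_def by auto
lemma FStI: "e \<in> E ==> k < 4 ==> Fc e k \<in> FSt E" unfolding FSt_def by force

lemma RSt_face: "ph \<in> FSt E ==> k < 4 ==> fst (bd ph ! k) \<in> RSt V E"
proof -
  assume a: "ph \<in> FSt E" "k < 4"
  then have "fst (bd ph ! k) \<in> fst ` set (bd ph)" by (intro imageI nth_mem) simp
  then show ?thesis using a(1) unfolding RSt_def by blast
qed

lemma RSt_cases:
  assumes "a \<in> RSt V E"
  obtains x where "x \<in> V" "a = (B0, x, Sv x True)" | x where "x \<in> V" "a = (Sv x False, x, B0)"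
    | ph k where "ph \<in> FSt E" "k < 4" "a = fst (bd ph ! k)"
proof -
  consider "a \<in> (\<lambda>x. (B0, x, Sv x True)) ` V" | "a \<in> (\<lambda>x. (Sv x False, x, B0)) ` V" | "a \<in> (\<Union>ph\<in>FSt E. fst ` set (bd ph))"
    using assms unfolding RSt_def by blast
  then show thesis
  proof cases
    case 3
    then obtain ph b where "ph \<in> FSt E" "b \<in> set (bd ph)" "a = fst b" by blast
    then show thesis using that(3) bd_set by blast
  qed (use that in blast)+
qed

lemma wf_St: "wf_cx (USt V E) (RSt V E) (FSt E)"
  unfolding wf_cx_def
proof (intro conjI ballI)
  show "fst ` set (bd ph) \<subseteq> RSt V E" if "ph \<in> FSt E" for ph using that unfolding RSt_def by blast
qed (auto simp: USt_def)

lemma finite_St: assumes "finite V" "finite E" shows "finite (FSt E)" "finite (RSt V E)" "finite (USt V E)"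
  using assms by (auto simp: FSt_def RSt_def USt_def)

lemma lt_in: "closed_LOG V E ==> e \<in> E ==> k < 4 ==> lt e k \<in> V"
  using less_4_cases[of k] unfolding closed_LOG_def by (auto simp: lt_def)

lemma RSt_lab: assumes "closed_LOG V E" "a \<in> RSt V E" shows "elab a \<in> V"
  using assms(2)
proof (cases rule: RSt_cases)
  case (3 ph k)
  then obtain e j where "e \<in> E" "ph = Fc e j" using FSt_E by blast
  then show ?thesis using 3 lt_in[OF assms(1) \<open>e \<in> E\<close> 3(2)] bd_edge(1)[OF 3(2), of ph] by (simp add: elab_def)
qed (simp_all add: elab_def)

lemma FSt_snd: "ph \<in> FSt E ==> snd ph \<in> E" using FSt_E by fastforce

lemma RSt_src:
  assumes "a \<in> RSt V E" "esrc a = B0" shows "a = (B0, elab a, Sv (elab a) True)"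
  using assms(1)
proof (cases rule: RSt_cases)
  case (3 ph j)
  then obtain e k where e: "k < 4" "ph = Fc e k" using FSt_E by blast
  show ?thesis using assms(2) less_4_cases[OF 3(2)] less_4_cases[OF e(1)] unfolding 3(3) e(2) bd_edge(1)[OF 3(2)]
    by (elim disjE) (simp_all add: corner_Fc vv_def esrc_def elab_def)
qed (use assms(2) in \<open>simp_all add: esrc_def elab_def\<close>)

lemma RSt_tgt:
  assumes "a \<in> RSt V E" "etgt a = B0" shows "a = (Sv (elab a) False, elab a, B0)"
  using assms(1)
proof (cases rule: RSt_cases)
  case (3 ph j)
  then obtain e k where e: "k < 4" "ph = Fc e k" using FSt_E by blast
  show ?thesis using assms(2) less_4_cases[OF 3(2)] less_4_cases[OF e(1)] unfolding 3(3) e(2) bd_edge(1)[OF 3(2)]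
    by (elim disjE) (simp_all add: corner_Fc vv_def etgt_def elab_def)
qed (use assms(2) in \<open>simp_all add: etgt_def elab_def\<close>)

lemma FSt_eq:
  assumes "ph \<in> FSt E" "ph' \<in> FSt E" "snd ph = snd ph'" "j < 4" "corner ph j = B0" "corner ph' j = B0" shows "ph = ph'"
proof -
  obtain e k e' k' where "ph = Fc e k" "ph' = Fc e' k'" using FSt_E assms(1,2) by metis
  then show ?thesis using assms(3-) by (simp add: corner_Fc vv_B0)
qed

lemma FSt_edge:
  assumes "a \<in> RSt V E" "esrc a = B0 \<or> etgt a = B0" "e \<in> E" "j < 4" "lt e j = elab a"
  shows "\<exists>ph\<in>FSt E. snd ph = e \<and> fst (bd ph ! j) = a"
proof -
  have j': "(j + 1) mod 4 < 4" by simp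
  have e1: "fst (bd (Fc e j) ! j) = (if j < 2 then (B0, elab a, Sv (elab a) True) else (Sv (elab a) False, elab a, B0))"
    using less_4_cases[OF assms(4)] assms(5) unfolding bd_edge(1)[OF assms(4)] by (elim disjE) (simp_all add: corner_Fc vv_def)
  have e2: "fst (bd (Fc e ((j + 1) mod 4)) ! j) = (if j < 2 then (Sv (elab a) False, elab a, B0) else (B0, elab a, Sv (elab a) True))"
    using less_4_cases[OF assms(4)] assms(5) unfolding bd_edge(1)[OF assms(4)] by (elim disjE) (simp_all add: corner_Fc vv_def)
  have "a = fst (bd (Fc e j) ! j) \<or> a = fst (bd (Fc e ((j + 1) mod 4)) ! j)"
    using assms(2) RSt_src[OF assms(1)] RSt_tgt[OF assms(1)] unfolding e1 e2 by (cases "j < 2") auto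
  then show ?thesis using FStI[OF assms(3,4)] FStI[OF assms(3) j'] snd_Fc by metis
qed

lemma corners_connected:
  assumes "!!k. k < 4 ==> fst (bd ph ! k) \<in> R" "i < 4" "j < 4" shows "(corner ph i, corner ph j) \<in> (adj R)\<^sup>*"
proof -
  have st: "(corner ph k, corner ph (Suc k mod 4)) \<in> (adj R)\<^sup>*" if "k < 4" for k
  proof -
    have "(bstart (bd ph ! k), bend (bd ph ! k)) \<in> adj R" using assms(1)[OF that] unfolding adj_def bstart_def bend_def by auto
    then show ?thesis using bd_ends[OF that, of ph] by auto
  qed
  have s1: "(corner ph 0, corner ph 1) \<in> (adj R)\<^sup>*" using st[of 0] by simp
  have s2: "(corner ph 0, corner ph 2) \<in> (adj R)\<^sup>*" using rtrancl_trans[OF s1, of "corner ph 2"] st[of 1] by (simp add: numeral_2_eq_2)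
  have s3: "(corner ph 0, corner ph 3) \<in> (adj R)\<^sup>*" using rtrancl_trans[OF s2, of "corner ph 3"] st[of 2] by simp
  have "(corner ph 0, corner ph k) \<in> (adj R)\<^sup>*" if "k < 4" for k
    using less_4_cases[OF that] s1 s2 s3 by (elim disjE) (simp_all only: rtrancl.rtrancl_refl)
  then show ?thesis using assms(2,3) by (meson adj_sym rtrancl_trans)
qed

lemma St_connected: assumes "u \<in> USt V E" shows "(B0, u) \<in> (adj (RSt V E))\<^sup>*"
proof -
  have "(B0, esrc a) \<in> (adj (RSt V E))\<^sup>*" if a: "a \<in> RSt V E" for a
    using a
  proof (cases rule: RSt_cases)
    case (1 x) then show ?thesis by (simp add: esrc_def)
  next
    case (2 x)
    have "(etgt a, esrc a) \<in> adj (RSt V E)" using a unfolding adj_def by blast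
    moreover have "etgt a = B0" using 2 by (simp add: etgt_def)
    ultimately show ?thesis by (metis r_into_rtrancl)
  next
    case (3 ph k)
    then obtain e j where e: "j < 4" "ph = Fc e j" using FSt_E by blast
    have k': "Suc k mod 4 < 4" by simp
    have "corner ph j = B0" using e by (simp add: corner_Fc vv_B0)
    moreover have "(corner ph j, corner ph i) \<in> (adj (RSt V E))\<^sup>*" if "i < 4" for i by (rule corners_connected[OF RSt_face[OF 3(1)] e(1) that])
    moreover have "esrc a = corner ph k \<or> esrc a = corner ph (Suc k mod 4)" unfolding 3(3) bd_edge(1)[OF 3(2)] by (simp add: esrc_def)
    ultimately show ?thesis using 3(2) k' by metis
  qed
  note s = this
  have t: "(B0, etgt a) \<in> (adj (RSt V E))\<^sup>*" if "a \<in> RSt V E" for a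
  proof (rule rtrancl_into_rtrancl[OF s[OF that]])
    show "(esrc a, etgt a) \<in> adj (RSt V E)" using that unfolding adj_def by blast
  qed
  consider "u = B0" | a where "a \<in> RSt V E" "u = esrc a" | a where "a \<in> RSt V E" "u = etgt a" using assms unfolding USt_def by blast
  then show ?thesis by cases (simp_all only: s t rtrancl.rtrancl_refl)
qed

section \<open>Sectors and corner cones of a face\<close>

definition rx :: "nat => complex => real" where "rx k p = [Re p, Im p, - Re p, - Im p] ! k"
definition ry :: "nat => complex => real" where "ry k p = [Im p, - Re p, - Im p, Re p] ! k"
text \<open>With coordinates rotated by \<open>k\<close> quarter turns, \<open>Sec k\<close> is the
  open quadrant facing the \<open>k\<close>-th arc, and \<open>Cr k\<close> is the cone of a right
  angle about the direction of the \<open>k\<close>-th corner.\<close>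

definition Sec :: "nat => complex => bool" where "Sec k p \<longleftrightarrow> 0 < rx k p \<and> 0 < ry k p"
definition Cr :: "nat => complex => bool" where "Cr k p \<longleftrightarrow> \<bar>ry k p\<bar> < rx k p"

lemma continuous_rx: assumes "k < 4" shows "continuous_on UNIV (rx k)" "continuous_on UNIV (ry k)"
  using less_4_cases[OF assms] by (elim disjE; simp add: rx_def[abs_def] ry_def[abs_def] continuous_intros)+

lemma open_Sec: "k < 4 ==> open {p. Sec k p}" "k < 4 ==> open {p. Cr k p}"
  unfolding Sec_def Cr_def using continuous_rx[of k] by (auto intro!: open_Collect_conj open_Collect_less continuous_intros)

lemma Sec_unique: assumes "j < 4" "k < 4" "Sec j p" "Sec k p" shows "j = k"
  using less_4_cases[OF assms(1)] less_4_cases[OF assms(2)] assms(3,4) by (elim disjE) (simp_all add: Sec_def rx_def ry_def)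

lemma Cr_unique: assumes "j < 4" "k < 4" "Cr j p" "Cr k p" shows "j = k"
  using less_4_cases[OF assms(1)] less_4_cases[OF assms(2)] assms(3,4) by (elim disjE) (simp_all add: Cr_def rx_def ry_def)

lemma e4_rxy:
  assumes "k < 4" shows "rx k (e4 (real k + u)) = cos (pi * u / 2)" "ry k (e4 (real k + u)) = sin (pi * u / 2)"
proof -
  have e: "e4 1 = \<i>" "e4 2 = -1" "e4 3 = -\<i>"
  proof -
    show 1: "e4 1 = \<i>" by (simp add: e4_def complex_eq_iff)
    have "e4 2 = e4 1 * e4 1" using e4_add[of 1 1] by simp
    then show 2: "e4 2 = -1" unfolding 1 by simp
    have "e4 3 = e4 2 * e4 1" using e4_add[of 2 1] by simp
    then show "e4 3 = -\<i>" unfolding 1 2 by simp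
  qed
  have u: "Re (e4 u) = cos (pi * u / 2)" "Im (e4 u) = sin (pi * u / 2)" by (simp_all add: e4_def)
  show "rx k (e4 (real k + u)) = cos (pi * u / 2)" "ry k (e4 (real k + u)) = sin (pi * u / 2)"
    using less_4_cases[OF assms] unfolding e4_add by (elim disjE; simp add: rx_def ry_def e u)+
qed

lemma rxy_next: "k < 4 ==> rx (Suc k mod 4) p = ry k p" "k < 4 ==> ry (Suc k mod 4) p = - rx k p"
  using less_4_cases[of k] by (auto simp: rx_def ry_def)

lemma cos_sin_half:
  assumes "0 <= u" "u < 1"
  shows "0 < cos (pi * u / 2)" "0 <= sin (pi * u / 2)" "0 < sin (pi * u / 2) \<longleftrightarrow> 0 < u"
    "sin (pi * u / 2) < cos (pi * u / 2) \<longleftrightarrow> u < 1/2" "cos (pi * u / 2) < sin (pi * u / 2) \<longleftrightarrow> 1/2 < u"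
proof -
  let ?x = "pi * u / 2"
  have x: "0 <= ?x" "?x < pi / 2" using assms by (auto simp: field_simps)
  show "0 < cos ?x" using x pi_gt_zero by (intro cos_gt_zero_pi) linarith+
  show "0 <= sin ?x" using x by (intro sin_ge_zero) auto
  show "0 < sin ?x \<longleftrightarrow> 0 < u"
  proof
    assume "0 < u" then show "0 < sin ?x" using x by (intro sin_gt_zero) auto
  next
    assume "0 < sin ?x" then show "0 < u" using assms by (cases "u = 0") auto
  qed
  have c: "cos ?x = sin (pi / 2 - ?x)" by (simp add: sin_diff)
  have m: "sin a < sin b \<longleftrightarrow> a < b" if "0 <= a" "a <= pi / 2" "0 <= b" "b <= pi / 2" for a b :: real
    using that by (intro sin_mono_less_eq) auto
  have "sin ?x < cos ?x \<longleftrightarrow> ?x < pi / 2 - ?x" unfolding c using x by (intro m) auto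
  also have "\<dots> \<longleftrightarrow> pi * u < pi * (1/2)" by linarith
  also have "\<dots> \<longleftrightarrow> u < 1/2" by (simp only: mult_less_cancel_left_pos[OF pi_gt_zero])
  finally show "sin ?x < cos ?x \<longleftrightarrow> u < 1/2" .
  have "cos ?x < sin ?x \<longleftrightarrow> pi / 2 - ?x < ?x" unfolding c using x by (intro m) auto
  also have "\<dots> \<longleftrightarrow> pi * (1/2) < pi * u" by linarith
  also have "\<dots> \<longleftrightarrow> 1/2 < u" by (simp only: mult_less_cancel_left_pos[OF pi_gt_zero])
  finally show "cos ?x < sin ?x \<longleftrightarrow> 1/2 < u" .
qed

lemma Sec_e4:
  assumes "k < 4" "j < 4" "0 <= u" "u < 1" shows "Sec j (e4 (real k + u)) \<longleftrightarrow> j = k \<and> 0 < u"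
proof
  assume S: "Sec j (e4 (real k + u))"
  show "j = k \<and> 0 < u"
  proof (cases "0 < u")
    case True
    then have "Sec k (e4 (real k + u))" using e4_rxy[OF assms(1), of u] cos_sin_half[OF assms(3,4)] by (simp add: Sec_def)
    then show ?thesis using Sec_unique[OF assms(2,1) S] True by blast
  next
    case False
    then have "u = 0" using assms by simp
    then have "rx k (e4 (real k + u)) = 1" "ry k (e4 (real k + u)) = 0" using e4_rxy[OF assms(1), of u] by auto
    then show ?thesis using S less_4_cases[OF assms(1)] less_4_cases[OF assms(2)] by (elim disjE) (auto simp: Sec_def rx_def ry_def)
  qed
next
  assume "j = k \<and> 0 < u" then show "Sec j (e4 (real k + u))" using e4_rxy[OF assms(1), of u] cos_sin_half[OF assms(3,4)] by (simp add: Sec_def)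
qed

lemma Cr_e4:
  assumes "k < 4" "j < 4" "0 <= u" "u < 1" shows "Cr j (e4 (real k + u)) \<longleftrightarrow> (j = k \<and> u < 1/2) \<or> (j = Suc k mod 4 \<and> 1/2 < u)"
proof -
  let ?p = "e4 (real k + u)"
  note r = e4_rxy[OF assms(1), of u] and cs = cos_sin_half[OF assms(3,4)]
  have k: "Cr k ?p \<longleftrightarrow> u < 1/2" unfolding Cr_def r using cs by auto
  have k': "Cr (Suc k mod 4) ?p \<longleftrightarrow> 1/2 < u" unfolding Cr_def rxy_next[OF assms(1)] r using cs by auto
  have "j = k \<or> j = Suc k mod 4 \<or> \<not> Cr j ?p"
    using less_4_cases[OF assms(1)] less_4_cases[OF assms(2)] r cs(1,2) by (elim disjE) (auto simp: Cr_def rx_def ry_def)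
  moreover have "k ~= Suc k mod 4" using less_4_cases[OF assms(1)] by auto
  ultimately show ?thesis using k k' by metis
qed

lemma circle_cases:
  assumes "norm p = 1"
  obtains k u where "k < 4" "0 <= u" "u < 1" "p = e4 (real k + u)"
    "!!ph :: ('u,'v) face. charF ph p = charE (fst (bd ph ! k)) (if k < 2 then u else 1 - u)"
proof -
  define s where "s = ang p"
  have s: "0 <= s" "s < 4" using Arg2pi[of p] by (auto simp: s_def ang_def field_simps)
  have p: "p = e4 s" using assms Arg2pi[of p] by (simp add: s_def ang_def e4_def is_Arg_def cis_conv_exp)
  define k where "k = nat \<lfloor>s\<rfloor>"
  have k: "k < 4" "real k <= s" "s < real k + 1" using s by (auto simp: k_def nat_less_iff floor_less_iff)
  show thesis
  proof (rule that[of k "s - real k"])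
    fix ph :: "('u,'v) face"
    have "charF ph p = bdpt ph s" using charF_cis[of s ph] s p by (simp add: e4_def)
    also have "\<dots> = barc ph k (s - real k)" by (rule bdpt_barc) (use k in auto)
    finally show "charF ph p = charE (fst (bd ph ! k)) (if k < 2 then s - real k else 1 - (s - real k))" by (simp add: barc_def bd_edge(2)[OF k(1)])
  qed (use k p in auto)
qed

section \<open>Local inverses of the projection\<close>

datatype 'v kind = KB | KE 'v | KF "'v \<times> 'v \<times> 'v"

text \<open>At the base vertex each edge contributes the half next to it. Thus the outgoing and the
  incoming edge with the same label never compete for one parameter.\<close>

primrec AA :: "'v kind => ('v sv,'v) edge => real => bool" where
  "AA KB a t \<longleftrightarrow> (esrc a = B0 \<and> t < 1/2) \<or> (etgt a = B0 \<and> 1/2 < t)"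
| "AA (KE x) a t \<longleftrightarrow> a = (B0, x, Sv x True) \<and> 0 < t \<and> t < 1"
| "AA (KF e) a t \<longleftrightarrow> False"

text \<open>Chosen to agree with \<open>AA\<close> on the boundary: a corner cone cuts the adjacent
  arcs in the halves next to the corner, a quadrant cuts out one open arc.\<close>

primrec DD :: "'v kind => ('v sv,'v) face => complex => bool" where
  "DD KB ph p \<longleftrightarrow> (\<exists>k. k < 4 \<and> corner ph k = B0 \<and> Cr k p)"
| "DD (KE x) ph p \<longleftrightarrow> (\<exists>k. k < 4 \<and> fst (bd ph ! k) = (B0, x, Sv x True) \<and> Sec k p)"
| "DD (KF e) ph p \<longleftrightarrow> ph = Fc e 0 \<and> norm p < 1"

text \<open>Lifts to the star of B0 of the open stars of the cells of the complex, cut down so that they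
  project injectively.\<close>
definition Nst where
  "Nst V E \<kappa> = {q \<in> lpts (USt V E) (RSt V E) (FSt E). case q of LV u => \<kappa> = KB \<and> u = B0 | LE a t => AA \<kappa> a t | LF ph p => DD \<kappa> ph p}"

lemma charE_N:
  assumes "a \<in> RSt V E" "0 <= t" "t <= 1" shows "charE a t \<in> Nst V E \<kappa> \<longleftrightarrow> AA \<kappa> a t"
proof -
  consider "t = 0" | "t = 1" | "0 < t" "t < 1" using assms by linarith
  then show ?thesis
    using charE_in[OF wf_St assms(1), of t "FSt E"] by cases (cases \<kappa>; auto simp: Nst_def charE_def)+
qed

lemma charF_N:
  assumes "ph \<in> FSt E" "norm p <= 1" shows "charF ph p \<in> Nst V E \<kappa> \<longleftrightarrow> DD \<kappa> ph p"
proof (cases "norm p < 1")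
  case True then show ?thesis using assms(1) by (simp add: charF_def Nst_def)
next
  case False
  then have n1: "norm p = 1" using assms(2) by simp
  obtain k u where k: "k < 4" "0 <= u" "u < 1" "p = e4 (real k + u)" "charF ph p = charE (fst (bd ph ! k)) (if k < 2 then u else 1 - u)"
    using circle_cases[OF n1] by metis
  have "charF ph p \<in> Nst V E \<kappa> \<longleftrightarrow> AA \<kappa> (fst (bd ph ! k)) (if k < 2 then u else 1 - u)"
    unfolding k(5) by (rule charE_N[OF RSt_face[OF assms(1) k(1)]]) (use k in auto)
  also have "\<dots> \<longleftrightarrow> DD \<kappa> ph p"
  proof (cases \<kappa>)
    case KB
    have "DD \<kappa> ph p \<longleftrightarrow> (corner ph k = B0 \<and> u < 1/2) \<or> (corner ph (Suc k mod 4) = B0 \<and> 1/2 < u)"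
    proof -
      have "k < 4" "Suc k mod 4 < 4" using k(1) by auto
      then show ?thesis unfolding KB DD.simps k(4) using Cr_e4[OF k(1) _ k(2,3)] by metis
    qed
    then show ?thesis unfolding KB bd_edge(1)[OF k(1)] by (cases "k < 2") (auto simp: esrc_def etgt_def)
  next
    case (KE x)
    have "DD \<kappa> ph p \<longleftrightarrow> fst (bd ph ! k) = (B0, x, Sv x True) \<and> 0 < u"
      unfolding KE DD.simps k(4) using Sec_e4[OF k(1) _ k(2,3)] k(1) by metis
    then show ?thesis unfolding KE using k(2,3) by (cases "k < 2") auto
  next
    case (KF e) then show ?thesis using n1 by simp
  qed
  finally show ?thesis .
qed

lemma open_AA: "open {t. AA \<kappa> a t}"
  by (cases \<kappa>) (auto intro!: open_Collect_disj open_Collect_conj open_Collect_less open_Collect_const continuous_intros)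

lemma open_DD: "open {p. DD \<kappa> ph p}"
proof (cases \<kappa>)
  case KB
  have "open {p. k < 4 \<and> corner ph k = B0 \<and> Cr k p}" for k by (cases "k < 4 \<and> corner ph k = B0") (use open_Sec[of k] in auto)
  then show ?thesis unfolding KB DD.simps by (rule open_Collect_ex)
next
  case (KE x)
  have "open {p. k < 4 \<and> fst (bd ph ! k) = (B0, x, Sv x True) \<and> Sec k p}" for k
    by (cases "k < 4 \<and> fst (bd ph ! k) = (B0, x, Sv x True)") (use open_Sec[of k] in auto)
  then show ?thesis unfolding KE DD.simps by (rule open_Collect_ex)
next
  case (KF e)
  then show ?thesis by (cases "ph = Fc e 0") (auto intro!: open_Collect_less continuous_intros)
qed

lemma open_Nst: "openin (LT (USt V E) (RSt V E) (FSt E)) (Nst V E \<kappa>)"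
  unfolding openin_LT lopen_def
proof (intro conjI ballI)
  fix a assume a: "a \<in> RSt V E"
  have "{t \<in> {0..1}. charE a t \<in> Nst V E \<kappa>} = {0..1} \<inter> {t. AA \<kappa> a t}" using charE_N[OF a] by auto
  then show "openin (top_of_set {0..1}) {t \<in> {0..1}. charE a t \<in> Nst V E \<kappa>}" using openin_open_Int[OF open_AA[of \<kappa> a]] by (simp only:)
next
  fix ph assume a: "ph \<in> FSt E"
  have "{p \<in> cball 0 1. charF ph p \<in> Nst V E \<kappa>} = cball 0 1 \<inter> {p. DD \<kappa> ph p}" using charF_N[OF a] by auto
  then show "openin (top_of_set (cball 0 1)) {p \<in> cball 0 1. charF ph p \<in> Nst V E \<kappa>}" using openin_open_Int[OF open_DD[of \<kappa> ph]] by (simp only:)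
qed (auto simp: Nst_def)

lemma AA_inc: "AA \<kappa> a t ==> esrc a = B0 \<or> etgt a = B0" by (cases \<kappa>) (auto simp: esrc_def)

text \<open>A point of a face lies in at most one cone and at most one sector, which fixes the
  index, and a face of the star is determined by its relator and the corner at
  \<open>B0\<close>.\<close>

lemma inj_Nst: "inj_on proj (Nst V E \<kappa>)"
proof (rule inj_onI)
  fix q q' assume qq: "q \<in> Nst V E \<kappa>" "q' \<in> Nst V E \<kappa>" "proj q = proj q'"
  show "q = q'"
  proof (cases q)
    case (LV u) then show ?thesis using qq by (cases q') (simp_all add: Nst_def)
  next
    case (LE a t)
    then obtain a' where q': "q' = LE a' t" "elab a = elab a'" using qq(3) by (cases q') auto
    have a: "a \<in> RSt V E" "a' \<in> RSt V E" "AA \<kappa> a t" "AA \<kappa> a' t" using qq LE q' by (simp_all add: Nst_def)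
    have "a = a'"
    proof (cases \<kappa>)
      case KB
      then consider "esrc a = B0" "esrc a' = B0" | "etgt a = B0" "etgt a' = B0" using a(3,4) by force
      then show ?thesis using RSt_src[OF a(1)] RSt_src[OF a(2)] RSt_tgt[OF a(1)] RSt_tgt[OF a(2)] q'(2) by cases metis+
    qed (use a in auto)
    then show ?thesis using LE q' by simp
  next
    case (LF ph p)
    then obtain ph' where q': "q' = LF ph' p" "snd ph = snd ph'" using qq(3) by (cases q') auto
    have a: "ph \<in> FSt E" "ph' \<in> FSt E" "DD \<kappa> ph p" "DD \<kappa> ph' p" using qq LF q' by (simp_all add: Nst_def)
    have "ph = ph'"
    proof (cases \<kappa>)
      case KB
      then obtain k k' where k: "k < 4" "corner ph k = B0" "Cr k p" "k' < 4" "corner ph' k' = B0" "Cr k' p" using a(3,4) by auto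
      then have "k = k'" using Cr_unique by blast
      then show ?thesis using FSt_eq[OF a(1,2) q'(2)] k by blast
    next
      case (KE x)
      then obtain k k' where k: "k < 4" "fst (bd ph ! k) = (B0, x, Sv x True)" "Sec k p" "k' < 4" "fst (bd ph' ! k') = (B0, x, Sv x True)" "Sec k' p" using a(3,4) by auto
      then have "k = k'" using Sec_unique by blast
      then have "(corner ph k = B0 \<and> corner ph' k = B0) \<or> (corner ph (Suc k mod 4) = B0 \<and> corner ph' (Suc k mod 4) = B0)"
        using k(2,5) bd_edge(1)[OF k(1), of ph] bd_edge(1)[OF k(1), of ph'] by (cases "k < 2") auto
      moreover have "Suc k mod 4 < 4" by simp
      ultimately show ?thesis using FSt_eq[OF a(1,2) q'(2)] k(1) by blast
    qed (use a in auto)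
    then show ?thesis using LF q' by simp
  qed
qed

lemma lift_edge:
  assumes "x \<in> V" "0 <= t" "t <= 1" "q \<in> Nst V E \<kappa>" "proj q = char1 x t"
  shows "\<exists>a\<in>RSt V E. elab a = x \<and> charE a t = q"
proof (cases "0 < t \<and> t < 1")
  case True
  then obtain a where "q = LE a t" "elab a = x" using assms(5) by (cases q) (auto simp: char1_def)
  moreover have "a \<in> RSt V E" using assms(4) calculation by (simp add: Nst_def)
  ultimately show ?thesis using True by (auto simp: charE_def)
next
  case False
  then obtain u where "q = LV u" using assms(5) by (cases q) (auto simp: char1_def)
  then have q: "q = LV B0" using assms(4) by (simp add: Nst_def)
  have "(B0, x, Sv x True) \<in> RSt V E" "(Sv x False, x, B0) \<in> RSt V E" using assms(1) unfolding RSt_def by blast+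
  moreover have "t = 0 \<or> t = 1" using False assms by auto
  ultimately show ?thesis
  proof (elim disjE)
    assume "t = 0" then show ?thesis using q \<open>(B0, x, Sv x True) \<in> RSt V E\<close> by (intro bexI[of _ "(B0, x, Sv x True)"]) (auto simp: charE_def elab_def esrc_def)
  next
    assume "t = 1" then show ?thesis using q \<open>(Sv x False, x, B0) \<in> RSt V E\<close> by (intro bexI[of _ "(Sv x False, x, B0)"]) (auto simp: charE_def elab_def etgt_def)
  qed
qed

text \<open>On the boundary this needs all placements of the relator in the star: a point on an edge
  at \<open>B0\<close> has to lie on a face of type \<open>e\<close> there.\<close>

lemma lift_face:
  assumes "e \<in> E" "norm p <= 1" "q \<in> Nst V E \<kappa>" "proj q = char2 e p"
  shows "\<exists>ph\<in>FSt E. snd ph = e \<and> charF ph p = q"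
proof (cases "norm p < 1")
  case True
  then obtain ph where "q = LF ph p" "snd ph = e" using assms(4) by (cases q) (auto simp: char2_def)
  moreover have "ph \<in> FSt E" using assms(3) calculation by (simp add: Nst_def)
  ultimately show ?thesis using True by (auto simp: charF_def)
next
  case False
  then have n1: "norm p = 1" using assms(2) by simp
  obtain k u where k: "k < 4" "0 <= u" "u < 1" "p = e4 (real k + u)" "!!ph :: ('a sv,'a) face. charF ph p = charE (fst (bd ph ! k)) (if k < 2 then u else 1 - u)"
    using circle_cases[OF n1] by metis
  define u' where "u' = (if k < 2 then u else 1 - u)"
  have "proj q = proj (charF (Fc e k) p)" unfolding proj_charF using assms(4) by simp
  also have "\<dots> = char1 (lt e k) u'" unfolding k(5) proj_charE u'_def[symmetric] bd_edge(1)[OF k(1)] by (simp add: elab_def)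
  finally have pq: "proj q = char1 (lt e k) u'" .
  show ?thesis
  proof (cases "0 < u")
    case True
    then have "0 < u'" "u' < 1" using k(3) by (auto simp: u'_def)
    then obtain a where a: "q = LE a u'" "elab a = lt e k" using pq by (cases q) (auto simp: char1_def)
    then have "a \<in> RSt V E" "AA \<kappa> a u'" using assms(3) by (simp_all add: Nst_def)
    then obtain ph where "ph \<in> FSt E" "snd ph = e" "fst (bd ph ! k) = a" using FSt_edge[OF _ AA_inc assms(1) k(1)] a(2) by metis
    moreover have "charE a u' = q" using a(1) \<open>0 < u'\<close> \<open>u' < 1\<close> by (simp add: charE_def)
    ultimately show ?thesis using k(5) u'_def by metis
  next
    case False
    then have u: "u = 0" using k(2) by simp
    then have "proj q = Base" using pq by (auto simp: char1_def u'_def)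
    then obtain v where "q = LV v" by (cases q) auto
    then have q: "q = LV B0" using assms(3) by (simp add: Nst_def)
    have "charF (Fc e k) p = LV (corner (Fc e k) k)" unfolding k(5) bd_edge(1)[OF k(1)] by (simp add: u charE_def esrc_def etgt_def)
    then have "charF (Fc e k) p = q" using q k(1) by (simp add: corner_Fc vv_B0)
    then show ?thesis using FStI[OF assms(1) k(1)] snd_Fc by blast
  qed
qed

text \<open>By the two lifting lemmas, the preimage of the image of \<open>W\<close> in a cell of
  the complex is the union of the preimages of \<open>W\<close> in the star cells above it.\<close>

lemma proj_open:
  assumes cl: "closed_LOG V E" and W: "openin (LT (USt V E) (RSt V E) (FSt E)) W" "W \<subseteq> Nst V E \<kappa>"
  shows "openin (K_LOG V E) (proj ` W)"
  unfolding openin_K_LOG K_open_def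
proof (intro conjI ballI)
  have Wo: "!!a. a \<in> RSt V E ==> openin (top_of_set {0..1::real}) {t \<in> {0..1}. charE a t \<in> W}"
    "!!ph. ph \<in> FSt E ==> openin (top_of_set (cball (0::complex) 1)) {p \<in> cball 0 1. charF ph p \<in> W}"
    using W(1) unfolding openin_LT lopen_def by blast+
  show "proj ` W \<subseteq> K_points V E"
  proof
    fix k assume "k \<in> proj ` W"
    then obtain q where q: "q \<in> W" "k = proj q" by blast
    then have "q \<in> lpts (USt V E) (RSt V E) (FSt E)" using W(2) by (auto simp: Nst_def)
    then show "k \<in> K_points V E" unfolding q(2) using RSt_lab[OF cl] FSt_snd by (cases q) (auto simp: K_points_def)
  qed
  fix x assume x: "x \<in> V"
  have "{t \<in> {0..1}. char1 x t \<in> proj ` W} = (\<Union>a\<in>{a\<in>RSt V E. elab a = x}. {t \<in> {0..1}. charE a t \<in> W})"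
  proof (intro set_eqI iffI)
    fix t assume "t \<in> {t \<in> {0..1}. char1 x t \<in> proj ` W}"
    then obtain q where q: "0 <= t" "t <= 1" "q \<in> W" "proj q = char1 x t" by auto
    then obtain a where "a \<in> RSt V E" "elab a = x" "charE a t = q" using lift_edge[OF x q(1,2) _ q(4)] W(2) by blast
    then show "t \<in> (\<Union>a\<in>{a\<in>RSt V E. elab a = x}. {t \<in> {0..1}. charE a t \<in> W})" using q by (intro UN_I[of a]) auto
  next
    fix t assume "t \<in> (\<Union>a\<in>{a\<in>RSt V E. elab a = x}. {t \<in> {0..1}. charE a t \<in> W})"
    then obtain a where "elab a = x" "t \<in> {0..1}" "charE a t \<in> W" by blast
    then show "t \<in> {t \<in> {0..1}. char1 x t \<in> proj ` W}" using proj_charE[of a t] by (metis (mono_tags, lifting) imageI mem_Collect_eq)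
  qed
  then show "openin (top_of_set {0..1}) {t \<in> {0..1}. char1 x t \<in> proj ` W}" using Wo(1) by (simp only:) (rule openin_Union, blast)
next
  have Wo: "!!ph. ph \<in> FSt E ==> openin (top_of_set (cball (0::complex) 1)) {p \<in> cball 0 1. charF ph p \<in> W}"
    using W(1) unfolding openin_LT lopen_def by blast+
  fix e assume e: "e \<in> E"
  have "{p \<in> cball 0 1. char2 e p \<in> proj ` W} = (\<Union>ph\<in>{ph\<in>FSt E. snd ph = e}. {p \<in> cball 0 1. charF ph p \<in> W})"
  proof (intro set_eqI iffI)
    fix p assume "p \<in> {p \<in> cball 0 1. char2 e p \<in> proj ` W}"
    then obtain q where q: "norm p <= 1" "q \<in> W" "proj q = char2 e p" by auto
    then obtain ph where "ph \<in> FSt E" "snd ph = e" "charF ph p = q" using lift_face[OF e q(1) _ q(3)] W(2) by blast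
    then show "p \<in> (\<Union>ph\<in>{ph\<in>FSt E. snd ph = e}. {p \<in> cball 0 1. charF ph p \<in> W})" using q by (intro UN_I[of ph]) auto
  next
    fix p assume "p \<in> (\<Union>ph\<in>{ph\<in>FSt E. snd ph = e}. {p \<in> cball 0 1. charF ph p \<in> W})"
    then obtain ph where "snd ph = e" "p \<in> cball 0 1" "charF ph p \<in> W" by blast
    then show "p \<in> {p \<in> cball 0 1. char2 e p \<in> proj ` W}" using proj_charF[of ph p] by (metis (mono_tags, lifting) imageI mem_Collect_eq)
  qed
  then show "openin (top_of_set (cball 0 1)) {p \<in> cball 0 1. char2 e p \<in> proj ` W}" using Wo by (simp only:) (rule openin_Union, blast)
qed

lemma star_section:
  assumes cl: "closed_LOG V E"
  shows "openin (K_LOG V E) (proj ` Nst V E \<kappa>)"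
    "continuous_map (subtopology (K_LOG V E) (proj ` Nst V E \<kappa>)) (LT (USt V E) (RSt V E) (FSt E)) (inv_into (Nst V E \<kappa>) proj)"
proof -
  let ?N = "Nst V E \<kappa>" let ?L = "LT (USt V E) (RSt V E) (FSt E)"
  show o: "openin (K_LOG V E) (proj ` ?N)" by (rule proj_open[OF cl open_Nst subset_refl])
  have ts: "topspace (subtopology (K_LOG V E) (proj ` ?N)) = proj ` ?N" using openin_subset[OF o] by auto
  show "continuous_map (subtopology (K_LOG V E) (proj ` ?N)) ?L (inv_into ?N proj)"
    unfolding continuous_map_def ts
  proof (intro conjI allI impI)
    have "?N \<subseteq> topspace ?L" by (rule openin_subset[OF open_Nst])
    then show "inv_into ?N proj \<in> proj ` ?N \<rightarrow> topspace ?L" using inv_into_into[of _ proj ?N] by blast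
    fix W assume "openin ?L W"
    then have "openin (K_LOG V E) (proj ` (?N \<inter> W))" by (intro proj_open[OF cl, of _ \<kappa>] openin_Int open_Nst) auto
    moreover have "{q \<in> proj ` ?N. inv_into ?N proj q \<in> W} = proj ` (?N \<inter> W)"
      using inv_into_f_f[OF inj_Nst, of _ V E \<kappa>] by force
    ultimately show "openin (subtopology (K_LOG V E) (proj ` ?N)) {q \<in> proj ` ?N. inv_into ?N proj q \<in> W}"
      by (auto intro!: openin_subset_topspace_eq[THEN iffD2] simp: openin_open_subtopology[OF o])
  qed
qed

lemma star_cover:
  assumes "q \<in> K_points V E" shows "\<exists>\<kappa>. q \<in> proj ` Nst V E \<kappa>"
proof (cases q)
  case Base
  have "LV B0 \<in> Nst V E KB" by (simp add: Nst_def USt_def)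
  then show ?thesis using Base by (metis imageI proj.simps(1))
next
  case (Edge x t)
  then have "x \<in> V" "0 < t" "t < 1" using assms by (auto simp: K_points_def)
  then have "LE (B0, x, Sv x True) t \<in> Nst V E (KE x)" unfolding Nst_def by (simp add: RSt_def)
  then show ?thesis using Edge by (metis elab_def fst_conv imageI proj.simps(2) snd_conv)
next
  case (Face e p)
  then have "e \<in> E" "norm p < 1" using assms by (auto simp: K_points_def)
  then have "LF (Fc e 0) p \<in> Nst V E (KF e)" unfolding Nst_def by (simp add: FStI)
  then show ?thesis using Face by (metis snd_Fc imageI proj.simps(3))
qed

text \<open>Closures of small connected open sets are taken. Compactness allows pasting along closed
  sets, and connectedness makes integer-valued corrections constant on each of them.\<close>

lemma connected_cover:
  fixes T :: "'a::euclidean_space set"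
  assumes T: "compact T" "locally path_connected T" and Op: "!!t. t \<in> T ==> \<exists>\<kappa>. t \<in> Op \<kappa>" "!!\<kappa>. openin (top_of_set T) (Op \<kappa>)"
  shows "\<exists>(m::nat) Q \<kappa>. T = (\<Union>i<m. Q i) \<and> (\<forall>i<m. compact (Q i) \<and> connected (Q i) \<and> Q i ~= {} \<and> Q i \<subseteq> Op (\<kappa> i))"
proof -
  have ex: "\<exists>C \<kappa>. openin (top_of_set T) C \<and> t \<in> C \<and> connected C \<and> closure C \<subseteq> Op \<kappa>" if t: "t \<in> T" for t
  proof -
    obtain \<kappa> where k: "t \<in> Op \<kappa>" using Op(1)[OF t] by blast
    obtain e where e: "e > 0" "cball t e \<inter> T \<subseteq> Op \<kappa>" using Op(2)[of \<kappa>] k unfolding openin_contains_cball by blast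
    have "openin (top_of_set T) (T \<inter> ball t e)" by (intro openin_open_Int) simp
    moreover have "t \<in> T \<inter> ball t e" using t e by simp
    ultimately obtain C where C: "openin (top_of_set T) C" "path_connected C" "t \<in> C" "C \<subseteq> T \<inter> ball t e"
      using T(2) unfolding locally_path_connected by metis
    have "closure C \<subseteq> T" using C(4) compact_imp_closed[OF T(1)] by (intro closure_minimal) auto
    moreover have "closure C \<subseteq> cball t e" using C(4) by (intro closure_minimal) auto
    ultimately have "closure C \<subseteq> Op \<kappa>" using e(2) by blast
    then show ?thesis using C path_connected_imp_connected by blast
  qed
  define \<C> where "\<C> = {C. openin (top_of_set T) C \<and> C ~= {} \<and> connected C \<and> (\<exists>\<kappa>. closure C \<subseteq> Op \<kappa>)}"
  have "T \<subseteq> \<Union>\<C>" using ex unfolding \<C>_def by blast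
  moreover have "\<forall>C\<in>\<C>. openin (top_of_set T) C" unfolding \<C>_def by blast
  ultimately obtain \<D> where D: "\<D> \<subseteq> \<C>" "finite \<D>" "T \<subseteq> \<Union>\<D>" using T(1) unfolding compact_eq_openin_cover by metis
  obtain g where g: "\<D> = g ` {i::nat. i < card \<D>}" using finite_imp_nat_seg_image_inj_on[OF D(2)] by (metis card_image card_Collect_less_nat)
  have gi: "g i \<in> \<C>" if "i < card \<D>" for i using that g D(1) by blast
  have cs: "closure C \<subseteq> T" if "C \<in> \<C>" for C
    using that openin_subset[of "top_of_set T" C] compact_imp_closed[OF T(1)] unfolding \<C>_def by (intro closure_minimal) auto
  have "\<forall>i. \<exists>\<kappa>. i < card \<D> --> closure (g i) \<subseteq> Op \<kappa>" using gi unfolding \<C>_def by blast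
  then obtain \<kappa> where \<kappa>: "!!i. i < card \<D> ==> closure (g i) \<subseteq> Op (\<kappa> i)" by metis
  have "T = (\<Union>i<card \<D>. closure (g i))"
  proof
    have "T \<subseteq> (\<Union>i<card \<D>. g i)"
    proof
      fix x assume "x \<in> T"
      then obtain C where C: "C \<in> \<D>" "x \<in> C" using D(3) by blast
      obtain i where "i < card \<D>" "C = g i" using equalityD1[OF g, THEN subsetD, OF C(1)] by blast
      then show "x \<in> (\<Union>i<card \<D>. g i)" using C(2) by blast
    qed
    then show "T \<subseteq> (\<Union>i<card \<D>. closure (g i))" using closure_subset by blast
  qed (use gi cs in blast)
  moreover have "compact (closure (g i)) \<and> connected (closure (g i)) \<and> closure (g i) ~= {} \<and> closure (g i) \<subseteq> Op (\<kappa> i)" if i: "i < card \<D>" for i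
  proof (intro conjI \<kappa>[OF i])
    have "bounded (g i)" using gi[OF i] closure_subset[of "g i"] cs[OF gi[OF i]] compact_imp_bounded[OF T(1)] by (metis bounded_subset)
    then show "compact (closure (g i))" by simp
    show "connected (closure (g i))" using gi[OF i] unfolding \<C>_def by (intro connected_imp_connected_closure) blast
    show "closure (g i) ~= {}" using gi[OF i] unfolding \<C>_def by simp
  qed
  ultimately show ?thesis by (intro exI[of _ "card \<D>"] exI[of _ "\<lambda>i. closure (g i)"] exI[of _ \<kappa>]) blast
qed

section \<open>From vanishing cohomology to the Euler characteristic\<close>

lemma esrc_renE [simp]: "esrc (renE \<rho> a) = \<rho> (esrc a)" "etgt (renE \<rho> a) = \<rho> (etgt a)" "elab (renE \<rho> a) = elab a"
  by (simp_all add: renE_def esrc_def etgt_def elab_def)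

lemma bd_renF_nth: "k < 4 ==> fst (bd (renF \<rho> ph) ! k) = renE \<rho> (fst (bd ph ! k))"
  unfolding bd_renF by (simp add: case_prod_unfold)

lemma hx0_bdpt:
  assumes "k < 4" "real k <= s" "s <= real k + 1"
  shows "hx0 h (bdpt ph s) = h (corner ph k) + (s - real k) * (h (corner ph (Suc k mod 4)) - h (corner ph k))"
proof -
  have "bdpt ph s = charE (fst (bd ph ! k)) (if k < 2 then s - real k else 1 - (s - real k))"
    using bdpt_barc[OF assms, of ph] bd_edge(2)[OF assms(1), of ph] by (simp add: barc_def)
  then show ?thesis using assms unfolding bd_edge(1)[OF assms(1)] by (simp add: hx0_charE esrc_def etgt_def algebra_simps)
qed

text \<open>Otherwise the cocycle conditions on the faces and zero divergence at all vertices except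
  \<open>u0\<close> are fewer equations than there are edges, so there is a nonzero solution \<psi>.
  Divergences add up to 0, so \<psi> is divergence-free at \<open>u0\<close> too. Being also a
  coboundary, it is orthogonal to itself.\<close>

lemma chi_ge_1:
  fixes U :: "'u set"
  assumes cx: "cx V E U R Ph" and u0: "u0 \<in> U"
    and H1: "!!\<psi>::('u,'v) edge => int. (!!ph. ph \<in> Ph ==> \<psi> (fst (bd ph ! 0)) + \<psi> (fst (bd ph ! 1)) = \<psi> (fst (bd ph ! 2)) + \<psi> (fst (bd ph ! 3)))
      ==> \<exists>n::'u => int. \<forall>a\<in>R. \<psi> a = n (etgt a) - n (esrc a)"
  shows "1 <= chi U R Ph"
proof (rule ccontr)
  assume "\<not> 1 <= chi U R Ph"
  then have le: "card U + card Ph <= card R" by (simp add: chi_def)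
  have fin: "finite U" "finite R" "finite Ph" using cxD[OF cx] by auto
  define sg :: "nat => int" where "sg k = (if k < 2 then 1 else -1)" for k
  \<comment> \<open>The rows are the divergence at a vertex and the signed boundary sum of a
    face.\<close>
  define c :: "'u + ('u,'v) face => ('u,'v) edge => int" where
    "c j a = (case j of Inl u => (if etgt a = u then 1 else 0) - (if esrc a = u then 1 else 0)
      | Inr ph => (\<Sum>k<4. if fst (bd ph ! k) = a then sg k else 0))" for j a
  have "card ((U - {u0}) <+> Ph) < card R"
  proof -
    have "card ((U - {u0}) <+> Ph) = card (U - {u0}) + card Ph" using fin by (simp add: card_Plus)
    moreover have "card (U - {u0}) + 1 = card U" using fin(1) u0 by (metis Suc_eq_plus1 card_Suc_Diff1)
    ultimately show ?thesis using le by linarith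
  qed
  moreover have "finite ((U - {u0}) <+> Ph)" using fin by simp
  ultimately obtain \<psi> where nz: "\<exists>a\<in>R. \<psi> a ~= 0" and eq: "\<forall>j\<in>(U - {u0}) <+> Ph. (\<Sum>a\<in>R. c j a * \<psi> a) = 0"
    using integer_system[of "(U - {u0}) <+> Ph" R c] fin(2) by blast
  have "\<psi> (fst (bd ph ! 0)) + \<psi> (fst (bd ph ! 1)) = \<psi> (fst (bd ph ! 2)) + \<psi> (fst (bd ph ! 3))" if f: "ph \<in> Ph" for ph
  proof -
    have "0 = (\<Sum>a\<in>R. c (Inr ph) a * \<psi> a)" using eq f by (metis InrI)
    also have "\<dots> = (\<Sum>a\<in>R. \<Sum>k<4. if fst (bd ph ! k) = a then sg k * \<psi> a else 0)"
      unfolding c_def sum.case sum_distrib_right by (intro sum.cong refl) auto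
    also have "\<dots> = (\<Sum>k<4. \<Sum>a\<in>R. if fst (bd ph ! k) = a then sg k * \<psi> a else 0)" by (rule sum.swap)
    also have "\<dots> = (\<Sum>k<4. sg k * \<psi> (fst (bd ph ! k)))"
    proof (rule sum.cong[OF refl])
      fix k :: nat assume "k \<in> {..<4}"
      then have "fst (bd ph ! k) \<in> R" using cxD(9)[OF cx f] by simp
      then show "(\<Sum>a\<in>R. if fst (bd ph ! k) = a then sg k * \<psi> a else 0) = sg k * \<psi> (fst (bd ph ! k))" using fin(2) by (simp add: sum.delta')
    qed
    also have "\<dots> = \<psi> (fst (bd ph ! 0)) + \<psi> (fst (bd ph ! 1)) - \<psi> (fst (bd ph ! 2)) - \<psi> (fst (bd ph ! 3))"
    proof -
      have "{..<4::nat} = {0,1,2,3}" by auto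
      then show ?thesis by (simp add: sg_def)
    qed
    finally show ?thesis by linarith
  qed
  then obtain n where n: "!!a. a \<in> R ==> \<psi> a = n (etgt a) - n (esrc a)" using H1[of \<psi>] by blast
  define d where "d u = (\<Sum>a\<in>R. c (Inl u) a * \<psi> a)" for u
  have du: "d u = 0" if "u \<in> U - {u0}" for u using eq that unfolding d_def by (metis InlI)
  have s1: "(\<Sum>u\<in>U. (h u::int) * c (Inl u) a) = h (etgt a) - h (esrc a)" if "a \<in> R" for a h
  proof -
    have "(\<Sum>u\<in>U. h u * c (Inl u) a) = (\<Sum>u\<in>U. (if etgt a = u then h u else 0) - (if esrc a = u then h u else 0))"
      unfolding c_def sum.case by (intro sum.cong refl) (simp add: algebra_simps)
    then show ?thesis using fin(1) cxD(5,6)[OF cx that] by (simp add: sum_subtractf sum.delta')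
  qed
  have s2: "(\<Sum>u\<in>U. h u * d u) = (\<Sum>a\<in>R. (h (etgt a) - h (esrc a)) * \<psi> a)" for h :: "'u => int"
  proof -
    have "(\<Sum>u\<in>U. h u * d u) = (\<Sum>u\<in>U. \<Sum>a\<in>R. h u * c (Inl u) a * \<psi> a)" unfolding d_def sum_distrib_left by (simp add: mult.assoc)
    also have "\<dots> = (\<Sum>a\<in>R. \<Sum>u\<in>U. h u * c (Inl u) a * \<psi> a)" by (rule sum.swap)
    also have "\<dots> = (\<Sum>a\<in>R. (h (etgt a) - h (esrc a)) * \<psi> a)"
      by (rule sum.cong[OF refl]) (simp add: s1 flip: sum_distrib_right)
    finally show ?thesis .
  qed
  have dsum: "(\<Sum>u\<in>U. h u * d u) = h u0 * d u0" for h :: "'u => int"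
    using sum.remove[OF fin(1) u0, of "\<lambda>u. h u * d u"] du by simp
  have "d u0 = 0" using dsum[of "\<lambda>_. 1"] s2[of "\<lambda>_. 1"] by simp
  then have "(\<Sum>a\<in>R. (n (etgt a) - n (esrc a)) * \<psi> a) = 0" using s2[of n] dsum[of n] by simp
  then have "(\<Sum>a\<in>R. \<psi> a * \<psi> a) = 0" using n by simp
  then have "\<forall>a\<in>R. \<psi> a * \<psi> a = 0" using fin(2) by (subst (asm) sum_nonneg_eq_0_iff) auto
  then show False using nz by auto
qed

text \<open>The space \<open>T\<close> is cut into the parts \<open>Q i\<close>, and on each part
  \<open>f\<close> has a lift \<open>g i\<close> to a separate copy of the star.\<close>

locale unfold =
  fixes V :: "'v set" and E and T :: "'a::euclidean_space set" and f and m :: nat and Q and g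
  assumes fin: "finite V" "finite E" and cl: "closed_LOG V E"
    and T: "connected T" "simply_connected T" "locally path_connected T" "T = (\<Union>i<m. Q i)" "T ~= {}"
    and Q: "!!i. i < m ==> compact (Q i)" "!!i. i < m ==> connected (Q i)" "!!i. i < m ==> Q i ~= {}"
    and g: "!!i. i < m ==> continuous_map (top_of_set (Q i)) (LT (USt V E) (RSt V E) (FSt E)) (g i)"
      "!!i t. i < m ==> t \<in> Q i ==> proj (g i t) = f t"
begin

abbreviation "US \<equiv> USt V E"
abbreviation "RS \<equiv> RSt V E"
abbreviation "FS \<equiv> FSt E"

text \<open>One vertex per open cell is enough for gluing: the label being known, folding recovers
  the whole cell from it.\<close>

definition org :: "('v sv,'v) lpt => 'v sv" where "org q = (case q of LV u => u | LE a t => esrc a | LF ph p => corner ph 0)"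
definition P :: "(nat \<times> 'v sv) set" where "P = {..<m} \<times> US"
definition good where
  "good r \<longleftrightarrow> equiv P r \<and> (\<forall>i<m. \<forall>j<m. \<forall>t\<in>Q i \<inter> Q j. ((i, org (g i t)), (j, org (g j t))) \<in> r) \<and>
     (\<forall>i<m. \<forall>j<m. \<forall>a\<in>RS. \<forall>a'\<in>RS. elab a = elab a' --> ((i, esrc a), (j, esrc a')) \<in> r \<longleftrightarrow> ((i, etgt a), (j, etgt a')) \<in> r)"
text \<open>The smallest equivalence gluing the local lifts and closed under folding edges with a common label and end.\<close>
definition r0 where "r0 = {x \<in> P \<times> P. \<forall>r. good r --> x \<in> r}"
text \<open>Classes are numbered because \<open>NPI\<close> speaks of natural numbers as
  vertices.\<close>

definition cls where "cls p = to_nat_on (P // r0) (r0 `` {p})"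
definition rho where "rho i u = cls (i,u)"
definition U where "U = cls ` P"
definition R where "R = (\<Union>i<m. renE (rho i) ` RS)"
definition Ph where "Ph = (\<Union>i<m. renF (rho i) ` FS)"

lemma RS_ends: "a \<in> RS ==> esrc a \<in> US" "a \<in> RS ==> etgt a \<in> US" by (auto simp: USt_def)

lemma FS_corner: "ph \<in> FS ==> k < 4 ==> corner ph k \<in> US"
  using bd_ends(1)[of k ph] RS_ends[OF RSt_face[of ph E k V]] by (auto simp: bstart_def split: if_splits)

lemma g_in: assumes "i < m" "t \<in> Q i" shows "g i t \<in> lpts US RS FS"
  using continuous_map_image_subset_topspace[OF g(1)[OF assms(1)]] assms(2) unfolding topspace_LT[OF wf_St] by auto

lemma org_in: assumes "i < m" "t \<in> Q i" shows "org (g i t) \<in> US"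
  using g_in[OF assms] RS_ends(1) FS_corner[of _ 0] by (cases "g i t") (simp_all add: org_def)

lemma r0_sub: "good r ==> r0 \<subseteq> r" unfolding r0_def by blast

text \<open>The conditions are implications between memberships, hence stable under intersection;
  this includes the empty one, so no good relation has to be exhibited first.\<close>

lemma good_r0: "good r0"
proof -
  have e: "(p,p) \<in> r" "(p,q) \<in> r ==> (q,p) \<in> r" "(p,q) \<in> r ==> (q,s) \<in> r ==> (p,s) \<in> r" if "good r" "p \<in> P" for r p q s
    using that unfolding good_def equiv_def refl_on_def sym_def trans_def by blast+
  have r0: "x \<in> r0 \<longleftrightarrow> x \<in> P \<times> P \<and> (\<forall>r. good r --> x \<in> r)" for x unfolding r0_def by blast
  have refl: "(p,p) \<in> r0" if "p \<in> P" for p unfolding r0 using e(1) that by blast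
  have sym: "(q,p) \<in> r0" if "(p,q) \<in> r0" for p q using that e(2) unfolding r0 by blast
  have trans: "(p,s) \<in> r0" if "(p,q) \<in> r0" "(q,s) \<in> r0" for p q s using that e(3) unfolding r0 by blast
  have "r0 \<subseteq> P \<times> P" unfolding r0_def by blast
  then have "equiv P r0" using refl sym trans unfolding equiv_def refl_on_def sym_def trans_def by blast
  moreover have "((i, org (g i t)), (j, org (g j t))) \<in> r0" if "i < m" "j < m" "t \<in> Q i \<inter> Q j" for i j t
    unfolding r0 using that org_in by (auto simp: P_def good_def)
  moreover have "((i, esrc a), (j, esrc a')) \<in> r0 \<longleftrightarrow> ((i, etgt a), (j, etgt a')) \<in> r0" if "i < m" "j < m" "a \<in> RS" "a' \<in> RS" "elab a = elab a'" for i j a a'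
  proof -
    have "((i, esrc a), (j, esrc a')) \<in> r \<longleftrightarrow> ((i, etgt a), (j, etgt a')) \<in> r" if "good r" for r
      using \<open>good r\<close> \<open>i < m\<close> \<open>j < m\<close> \<open>a \<in> RS\<close> \<open>a' \<in> RS\<close> \<open>elab a = elab a'\<close> unfolding good_def by blast
    moreover have "(i, esrc a) \<in> P" "(i, etgt a) \<in> P" "(j, esrc a') \<in> P" "(j, etgt a') \<in> P" using that RS_ends by (simp_all add: P_def)
    ultimately show ?thesis unfolding r0 by blast
  qed
  ultimately show ?thesis unfolding good_def by blast
qed

lemma eq_r0: "equiv P r0" using good_r0 by (simp add: good_def)

lemma finP: "finite P" using finite_St[OF fin] by (simp add: P_def)

lemma cls_eq: assumes "p \<in> P" "q \<in> P" shows "cls p = cls q \<longleftrightarrow> (p,q) \<in> r0"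
proof -
  have "finite (P // r0)" using finP by (simp add: quotient_def)
  then have "inj_on (to_nat_on (P // r0)) (P // r0)" by (intro inj_on_to_nat_on countable_finite)
  moreover have "r0 `` {p} \<in> P // r0" "r0 `` {q} \<in> P // r0" using assms by (auto intro: quotientI)
  ultimately have "cls p = cls q \<longleftrightarrow> r0 `` {p} = r0 `` {q}" unfolding cls_def by (rule inj_on_eq_iff)
  then show ?thesis using eq_equiv_class_iff[OF eq_r0 assms] by simp
qed

lemma rho_eq: "i < m ==> j < m ==> u \<in> US ==> w \<in> US ==> rho i u = rho j w \<longleftrightarrow> ((i,u),(j,w)) \<in> r0"
  unfolding rho_def by (rule cls_eq) (simp_all add: P_def)

lemma rho_fold:
  assumes "i < m" "j < m" "a \<in> RS" "a' \<in> RS" "elab a = elab a'"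
  shows "rho i (esrc a) = rho j (esrc a') \<longleftrightarrow> rho i (etgt a) = rho j (etgt a')"
  using good_r0 assms rho_eq[OF assms(1,2) RS_ends(1)[OF assms(3)] RS_ends(1)[OF assms(4)]] rho_eq[OF assms(1,2) RS_ends(2)[OF assms(3)] RS_ends(2)[OF assms(4)]]
  unfolding good_def by blast

lemma rho_glue: assumes "i < m" "j < m" "t \<in> Q i" "t \<in> Q j" shows "rho i (org (g i t)) = rho j (org (g j t))"
  using good_r0 assms rho_eq[OF assms(1,2) org_in[OF assms(1,3)] org_in[OF assms(2,4)]] unfolding good_def by blast

lemma R_iff: "a \<in> R \<longleftrightarrow> (\<exists>i<m. \<exists>b\<in>RS. a = renE (rho i) b)" unfolding R_def by blast
lemma F_iff: "ph \<in> Ph \<longleftrightarrow> (\<exists>i<m. \<exists>b\<in>FS. ph = renF (rho i) b)" unfolding Ph_def by blast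
lemma rho_U: "i < m ==> u \<in> US ==> rho i u \<in> U" unfolding rho_def U_def P_def by blast

lemma cxL: "cx V E U R Ph"
  unfolding cx_def
proof (intro conjI ballI impI)
  show "finite U" using finP by (simp add: U_def)
  show "finite R" "finite Ph" using finite_St[OF fin] by (simp_all add: R_def Ph_def)
  show "elab ` R \<subseteq> V"
  proof
    fix x assume "x \<in> elab ` R"
    then obtain i b where "b \<in> RS" "x = elab (renE (rho i) b)" unfolding R_def by blast
    then show "x \<in> V" using RSt_lab[OF cl] by simp
  qed
  show "snd ` Ph \<subseteq> E"
  proof
    fix x assume "x \<in> snd ` Ph"
    then obtain i b where "b \<in> FS" "x = snd (renF (rho i) b)" unfolding Ph_def by blast
    then show "x \<in> E" using FSt_snd by simp
  qed
  show "wf_cx U R Ph" unfolding wf_cx_def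
  proof (intro conjI ballI subsetI)
    fix a assume "a \<in> R"
    then obtain i b where "i < m" "b \<in> RS" "a = renE (rho i) b" unfolding R_iff by blast
    then show "esrc a \<in> U" "etgt a \<in> U" using RS_ends rho_U by simp_all
  next
    fix ph a assume "ph \<in> Ph" "a \<in> fst ` set (bd ph)"
    then obtain i b k where b: "i < m" "b \<in> FS" "ph = renF (rho i) b" "k < 4" "a = fst (bd ph ! k)" unfolding F_iff using bd_set by blast
    then have "a = renE (rho i) (fst (bd b ! k))" by (simp add: bd_renF_nth)
    then show "a \<in> R" unfolding R_iff using b RSt_face by blast
  qed
next
  fix a a' assume "a \<in> R" "a' \<in> R" and l: "elab a = elab a'"
  then obtain i b j b' where "i < m" "b \<in> RS" "a = renE (rho i) b" "j < m" "b' \<in> RS" "a' = renE (rho j) b'" unfolding R_iff by blast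
  then show "esrc a = esrc a' \<longleftrightarrow> etgt a = etgt a'" using rho_fold[of i j b b'] l by simp
qed

lemma ren_edge_eq:
  assumes "i < m" "j < m" "a \<in> RS" "a' \<in> RS" "elab a = elab a'" "rho i (esrc a) = rho j (esrc a')"
  shows "renE (rho i) a = renE (rho j) a'"
  by (rule cx_edge_eq[OF cxL]) (use assms R_iff in \<open>auto simp del: split_paired_Ex\<close>)

lemma ren_face_eq:
  assumes "i < m" "j < m" "ph \<in> FS" "ph' \<in> FS" "snd ph = snd ph'" "rho i (corner ph 0) = rho j (corner ph' 0)"
  shows "renF (rho i) ph = renF (rho j) ph'"
proof (rule cx_face_eq[OF cxL, of _ _ 0])
  show "renF (rho i) ph \<in> Ph" "renF (rho j) ph' \<in> Ph" unfolding F_iff using assms by blast+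
qed (use assms in \<open>simp_all add: corner_renF\<close>)

text \<open>Two lifts of a point lie in cells with the same label. Their \<open>org\<close> vertices
  are glued, so folding makes the images of the cells equal.\<close>

lemma same_cell:
  assumes "i < m" "j < m" "t \<in> Q i" "t \<in> Q j"
  obtains u u' where "g i t = LV u" "g j t = LV u'" "rho i u = rho j u'"
    | a a' s where "g i t = LE a s" "g j t = LE a' s" "a \<in> RS" "a' \<in> RS" "renE (rho i) a = renE (rho j) a'"
    | ph ph' p where "g i t = LF ph p" "g j t = LF ph' p" "ph \<in> FS" "ph' \<in> FS" "renF (rho i) ph = renF (rho j) ph'"
proof -
  have pr: "proj (g i t) = proj (g j t)" using g(2) assms by simp
  note gl = rho_glue[OF assms] and inI = g_in[OF assms(1,3)] and inJ = g_in[OF assms(2,4)]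
  show thesis
  proof (cases "g i t")
    case (LV u)
    then obtain u' where u': "g j t = LV u'" using pr by (cases "g j t") auto
    show thesis using that(1)[OF LV u'] gl LV u' by (simp add: org_def)
  next
    case (LE a s)
    then obtain a' where a': "g j t = LE a' s" "elab a = elab a'" using pr by (cases "g j t") auto
    have "a \<in> RS" "a' \<in> RS" using inI inJ LE a' by simp_all
    moreover have "rho i (esrc a) = rho j (esrc a')" using gl LE a' by (simp add: org_def)
    ultimately show thesis using that(2)[OF LE a'(1)] ren_edge_eq[OF assms(1,2)] a'(2) by blast
  next
    case (LF ph p)
    then obtain ph' where a': "g j t = LF ph' p" "snd ph = snd ph'" using pr by (cases "g j t") auto
    have "ph \<in> FS" "ph' \<in> FS" using inI inJ LF a' by simp_all
    moreover have "rho i (corner ph 0) = rho j (corner ph' 0)" using gl LF a' by (simp add: org_def)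
    ultimately show thesis using that(3)[OF LF a'(1)] ren_face_eq[OF assms(1,2)] a'(2) by blast
  qed
qed

definition ix where "ix t = (SOME i. i < m \<and> t \<in> Q i)"
lemma ix: assumes "t \<in> T" shows "ix t < m \<and> t \<in> Q (ix t)"
proof -
  obtain i where "i < m" "t \<in> Q i" using equalityD1[OF T(4), THEN subsetD, OF assms] by blast
  then show ?thesis unfolding ix_def by (intro someI[of "\<lambda>i. i < m \<and> t \<in> Q i" i]) simp
qed

definition fL where "fL t = renP (rho (ix t)) (g (ix t) t)"

lemma fL_eq: assumes "i < m" "t \<in> Q i" shows "fL t = renP (rho i) (g i t)"
proof -
  have "t \<in> T" using assms T(4) by blast
  then have ix': "ix t < m" "t \<in> Q (ix t)" using ix by blast+
  show ?thesis using ix'(1) assms(1) ix'(2) assms(2) by (cases rule: same_cell) (simp_all add: fL_def)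
qed

lemma continuous_fL: "continuous_map (top_of_set T) (LT U R Ph) fL"
proof (rule pasting_lemma_closed[where I="{..<m}" and T=Q and f="\<lambda>i t. renP (rho i) (g i t)"])
  show "finite {..<m}" by simp
  fix i assume i: "i \<in> {..<m}"
  then have QT: "Q i \<subseteq> T" using T(4) by blast
  show "closedin (top_of_set T) (Q i)" using QT Q(1) i by (intro closed_subset compact_imp_closed) auto
  have "continuous_map (LT US RS FS) (LT U R Ph) (renP (rho i))"
    by (rule continuous_renP[OF wf_St cxD(4)[OF cxL]]) (use i rho_U in \<open>auto simp: R_def Ph_def\<close>)
  then have "continuous_map (top_of_set (Q i)) (LT U R Ph) (\<lambda>t. renP (rho i) (g i t))"
    using continuous_map_compose[OF g(1)] i by (auto simp: o_def)
  moreover have "subtopology (top_of_set T) (Q i) = top_of_set (Q i)" using QT by (simp add: subtopology_subtopology inf.absorb2)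
  ultimately show "continuous_map (subtopology (top_of_set T) (Q i)) (LT U R Ph) (\<lambda>t. renP (rho i) (g i t))" by simp
next
  fix i j t assume "i \<in> {..<m}" "j \<in> {..<m}" "t \<in> topspace (top_of_set T) \<inter> Q i \<inter> Q j"
  then show "renP (rho i) (g i t) = renP (rho j) (g j t)" using fL_eq[of i t] fL_eq[of j t] by simp
next
  fix t assume "t \<in> topspace (top_of_set T)"
  then show "\<exists>j. j \<in> {..<m} \<and> t \<in> Q j \<and> fL t = renP (rho j) (g j t)" using ix[of t] by (intro exI[of _ "ix t"]) (simp add: fL_def)
qed

lemma proj_fL: "t \<in> T ==> proj (fL t) = f t"
  using ix[of t] g(2) by (simp add: fL_def proj_renP)

lemma m_pos: "0 < m" using T(4,5) by (cases m) auto

lemma base_U: "rho 0 B0 \<in> U" "U ~= {}" using rho_U[OF m_pos, of B0] by (auto simp: USt_def)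

lemma rho_path: assumes "i < m" "u \<in> US" shows "(rho i B0, rho i u) \<in> (adj R)\<^sup>*"
proof -
  have st: "(rho i u, rho i w) \<in> adj R" if "(u,w) \<in> adj RS" for u w
  proof -
    obtain a where a: "a \<in> RS" "esrc a = u \<and> etgt a = w \<or> esrc a = w \<and> etgt a = u" using \<open>(u,w) \<in> adj RS\<close> unfolding adj_def by blast
    have "renE (rho i) a \<in> R" unfolding R_iff using a(1) assms(1) by blast
    moreover have "esrc (renE (rho i) a) = rho i u \<and> etgt (renE (rho i) a) = rho i w \<or> esrc (renE (rho i) a) = rho i w \<and> etgt (renE (rho i) a) = rho i u" using a(2) by auto
    ultimately show ?thesis unfolding adj_def by blast
  qed
  have "(rho i u, rho i w) \<in> (adj R)\<^sup>*" if "(u,w) \<in> (adj RS)\<^sup>*" for u w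
    using that
  proof (induction rule: rtrancl_induct)
    case (step y z) show ?case by (rule rtrancl_into_rtrancl[OF step.IH st[OF step.hyps(2)]])
  qed simp
  then show ?thesis using St_connected[OF assms(2)] by blast
qed

text \<open>The indices whose star can be reached from star 0 cover a closed subset of
  \<open>T\<close>, the others a disjoint closed subset; connectedness of \<open>T\<close> leaves no
  others.\<close>

lemma connL: "conn U R"
proof -
  define J where "J = {i. i < m \<and> (rho 0 B0, rho i B0) \<in> (adj R)\<^sup>*}"
  let ?A = "\<Union>i\<in>J. Q i" let ?B = "\<Union>i\<in>{..<m} - J. Q i"
  have finJ: "finite J" "finite ({..<m} - J)" by (auto simp: J_def)
  have clAB: "closed ?A" "closed ?B" using finJ Q(1) by (auto intro!: closed_UN compact_imp_closed simp: J_def)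
  have cov: "T \<subseteq> ?A \<union> ?B" using T(4) by (auto simp: J_def)
  have dis: "?A \<inter> ?B \<inter> T = {}"
  proof (rule ccontr)
    assume "?A \<inter> ?B \<inter> T ~= {}"
    then obtain t i j where t: "t \<in> Q i" "t \<in> Q j" "i \<in> J" "j < m" "j \<notin> J" by blast
    have i: "i < m" "(rho 0 B0, rho i B0) \<in> (adj R)\<^sup>*" using t(3) by (auto simp: J_def)
    have "(rho i B0, rho i (org (g i t))) \<in> (adj R)\<^sup>*" "(rho j B0, rho j (org (g j t))) \<in> (adj R)\<^sup>*"
      using rho_path org_in t i by blast+
    then have "(rho i B0, rho j B0) \<in> (adj R)\<^sup>*" using rho_glue[OF i(1) t(4,1,2)] adj_sym by (metis rtrancl_trans)
    then have "j \<in> J" using i(2) t(4) unfolding J_def by (auto intro: rtrancl_trans)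
    then show False using t(5) by blast
  qed
  have Ane: "?A \<inter> T ~= {}"
  proof -
    have "0 \<in> J" using m_pos by (simp add: J_def)
    moreover obtain t where "t \<in> Q 0" using Q(3)[OF m_pos] by blast
    ultimately show ?thesis using T(4) m_pos by blast
  qed
  have BT: "?B \<inter> T = {}" using connected_closedD[OF T(1) dis cov clAB] Ane by (simp only: simp_thms)
  have J: "i \<in> J" if i: "i < m" for i
  proof (rule ccontr)
    assume "i \<notin> J"
    then have "Q i \<subseteq> ?B" using i by blast
    moreover have "Q i \<subseteq> T" using i equalityD2[OF T(4)] by blast
    ultimately show False using BT Q(3)[OF i] by blast
  qed
  have "(rho 0 B0, u) \<in> (adj R)\<^sup>*" if u: "u \<in> U" for u
  proof -
    obtain i w where i: "i < m" "w \<in> US" "u = rho i w" using u unfolding U_def P_def rho_def by blast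
    then show ?thesis using J[OF i(1)] rho_path[OF i(1,2)] unfolding J_def by (auto intro: rtrancl_trans)
  qed
  then show ?thesis unfolding conn_def by (meson adj_sym rtrancl_trans)
qed

text \<open>On each star the pulled back cocycle has a potential \<open>ka i\<close>. Made
  real-valued and composed with the lifts, these potentials differ by integers on overlaps, so their
  exponentials form a circle-valued function on \<open>T\<close>. Its logarithm supplies integers
  \<open>M i\<close> after whose addition the potentials agree at glued points. Having equal
  corrected potentials is compatible with folding, so by minimality it holds throughout
  \<open>r0\<close>.\<close>

lemma coboundary:
  fixes \<psi> :: "(nat,'v) edge => int"
  assumes \<psi>: "!!ph. ph \<in> Ph ==> \<psi> (fst (bd ph ! 0)) + \<psi> (fst (bd ph ! 1)) = \<psi> (fst (bd ph ! 2)) + \<psi> (fst (bd ph ! 3))"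
  shows "\<exists>n::nat => int. \<forall>a\<in>R. \<psi> a = n (etgt a) - n (esrc a)"
proof -
  define px where "px i a = \<psi> (renE (rho i) a)" for i a
  define k1 where "k1 i x b = (if b then px i (B0, x, Sv x True) else - px i (Sv x False, x, B0))" for i x b
  \<comment> \<open>The potential is 0 at \<open>B0\<close>; a neighbour receives the value of the
    edge leading to it, and the far corner \<open>Fr e k\<close> is reached by one more step along
    the letter \<open>k + 1\<close>.\<close>
  define ka where "ka i u = (case u of B0 => 0 | Sv x b => k1 i x b
    | Fr e k => k1 i (lt e k) (k < 2) + (if (k + 1) mod 4 < 2 then 1 else -1) * px i (fst (bd (Fc e k) ! ((k + 1) mod 4))))" for i u
  have ka_edge: "ka i (etgt a) - ka i (esrc a) = px i a" if i: "i < m" and a: "a \<in> RS" for i a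
    using a
  proof (cases rule: RSt_cases)
    case (1 x) then show ?thesis by (simp add: ka_def k1_def esrc_def etgt_def)
  next
    case (2 x) then show ?thesis by (simp add: ka_def k1_def esrc_def etgt_def)
  next
    case (3 ph j)
    then obtain e k where e: "k < 4" "ph = Fc e k" using FSt_E by blast
    define d where "d j = ka i (corner ph (Suc j mod 4)) - ka i (corner ph j)" for j
    define s where "s j = (if j < 2 then 1 else -1) * px i (fst (bd ph ! j))" for j
    have "renF (rho i) ph \<in> Ph" unfolding F_iff using 3(1) i by blast
    from \<psi>[OF this] have s0: "s 0 + s 1 + s 2 + s 3 = 0" by (simp add: bd_renF_nth s_def px_def)
    have "d 0 = ka i (corner ph 1) - ka i (corner ph 0)" "d 2 = ka i (corner ph 3) - ka i (corner ph 2)" "d 3 = ka i (corner ph 0) - ka i (corner ph 3)" by (simp_all add: d_def)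
    moreover have "d 1 = ka i (corner ph 2) - ka i (corner ph 1)" by (simp add: d_def numeral_2_eq_2)
    ultimately have d0: "d 0 + d 1 + d 2 + d 3 = 0" by linarith
    \<comment> \<open>Three sides of a star face obey the formula by construction. The fourth
      follows because differences and cocycle values both sum to 0 around the face.\<close>
    have D: "d k = s k \<and> d ((k + 1) mod 4) = s ((k + 1) mod 4) \<and> d ((k + 3) mod 4) = s ((k + 3) mod 4)"
      using less_4_cases[OF e(1)] unfolding d_def s_def e(2)
      by (elim disjE) (simp_all add: bd_edge(1) corner_Fc vv_def ka_def k1_def)
    have m: "(0 + 1) mod 4 = (1::nat)" "(0 + 3) mod 4 = (3::nat)" "(1 + 1) mod 4 = (2::nat)" "(1 + 3) mod 4 = (0::nat)"
      "(2 + 1) mod 4 = (3::nat)" "(2 + 3) mod 4 = (1::nat)" "(3 + 1) mod 4 = (0::nat)" "(3 + 3) mod 4 = (2::nat)" by simp_all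
    have "d 0 = s 0 \<and> d 1 = s 1 \<and> d 2 = s 2 \<and> d 3 = s 3" using less_4_cases[OF e(1)]
    proof (elim disjE)
      assume k: "k = 0" from D[unfolded k m] show ?thesis using s0 d0 by (elim conjE) (intro conjI; linarith)
    next
      assume k: "k = 1" from D[unfolded k m] show ?thesis using s0 d0 by (elim conjE) (intro conjI; linarith)
    next
      assume k: "k = 2" from D[unfolded k m] show ?thesis using s0 d0 by (elim conjE) (intro conjI; linarith)
    next
      assume k: "k = 3" from D[unfolded k m] show ?thesis using s0 d0 by (elim conjE) (intro conjI; linarith)
    qed
    then have "d j = s j" using less_4_cases[OF 3(2)] by (elim conjE disjE) (simp_all only:)
    then show ?thesis unfolding d_def s_def 3(3) bd_edge(1)[OF 3(2)] by (cases "j < 2") (simp_all add: esrc_def etgt_def)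
  qed
  define \<eta> where "\<eta> i t = hx (\<lambda>u. real_of_int (ka i u)) (g i t)" for i t
  have \<eta>c: "continuous_on (Q i) (\<eta> i)" if "i < m" for i
    using continuous_map_compose[OF g(1)[OF that] continuous_hx[OF wf_St]] unfolding \<eta>_def by (simp add: o_def)
  have \<eta>d: "\<eta> i t - \<eta> j t = real_of_int (ka i (org (g i t)) - ka j (org (g j t)))" if ij: "i < m" "j < m" "t \<in> Q i" "t \<in> Q j" for i j t
    using ij
  proof (cases rule: same_cell)
    case (1 u u') then show ?thesis by (simp add: \<eta>_def org_def hx_def)
  next
    case (2 a a' s)
    have p: "px i a = px j a'" using 2 by (simp add: px_def)
    have "\<eta> i t = ka i (esrc a) + s * px i a" "\<eta> j t = ka j (esrc a') + s * px j a'"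
      using 2 ka_edge[OF ij(1) 2(3)] ka_edge[OF ij(2) 2(4)] by (simp_all add: \<eta>_def hx_def hx0_def flip: of_int_diff)
    then show ?thesis using 2 p by (simp add: org_def)
  next
    case (3 ph ph' p)
    have px: "px i (fst (bd ph ! k)) = px j (fst (bd ph' ! k))" if "k < 4" for k
      using 3(5) bd_renF_nth[OF that, of "rho i" ph] bd_renF_nth[OF that, of "rho j" ph'] by (simp add: px_def)
    have e: "ka i (etgt (fst (bd ph ! k))) - ka i (esrc (fst (bd ph ! k))) = ka j (etgt (fst (bd ph' ! k))) - ka j (esrc (fst (bd ph' ! k)))" if "k < 4" for k
      using ka_edge[OF ij(1) RSt_face[OF 3(3) that]] ka_edge[OF ij(2) RSt_face[OF 3(4) that]] px[OF that] by simp
    have dif: "ka i (corner ph k) - ka i (corner ph 0) = ka j (corner ph' k) - ka j (corner ph' 0)" if "k < 4" for k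
    proof -
      have "ka i (corner ph 1) - ka i (corner ph 0) = ka j (corner ph' 1) - ka j (corner ph' 0)" using e[of 0] by (simp add: bd_edge(1) esrc_def etgt_def)
      moreover have "ka i (corner ph 2) - ka i (corner ph 1) = ka j (corner ph' 2) - ka j (corner ph' 1)" using e[of 1] by (simp add: bd_edge(1) esrc_def etgt_def numeral_2_eq_2)
      moreover have "ka i (corner ph 3) - ka i (corner ph 0) = ka j (corner ph' 3) - ka j (corner ph' 0)" using e[of 3] by (simp add: bd_edge(1) esrc_def etgt_def)
      ultimately show ?thesis using less_4_cases[OF that] by (elim disjE; hypsubst; linarith)
    qed
    define s where "s = ang p"
    have s: "0 <= s" "s < 4" using Arg2pi[of p] by (auto simp: s_def ang_def field_simps)
    define k where "k = nat \<lfloor>s\<rfloor>"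
    have k: "k < 4" "real k <= s" "s <= real k + 1" using s by (auto simp: k_def nat_less_iff floor_less_iff)
    have k': "Suc k mod 4 < 4" by simp
    have D: "real_of_int (ka i (corner ph l)) = real_of_int (ka j (corner ph' l)) + (real_of_int (ka i (corner ph 0)) - real_of_int (ka j (corner ph' 0)))" if "l < 4" for l
      using dif[OF that] by linarith
    show ?thesis using 3 unfolding \<eta>_def
      by (simp add: hx_def org_def hx0_bdpt[OF k] D[OF k(1)] D[OF k'] flip: s_def)
  qed
  define G where "G t = exp (2 * of_real pi * \<i> * of_real (\<eta> (ix t) t))" for t
  have G: "G t = exp (2 * of_real pi * \<i> * of_real (\<eta> i t))" if it: "i < m" "t \<in> Q i" for i t
  proof -
    have "t \<in> T" using it T(4) by blast
    then have ix': "ix t < m" "t \<in> Q (ix t)" using ix by blast+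
    obtain n :: int where "\<eta> (ix t) t = \<eta> i t + real_of_int n" using \<eta>d[OF ix'(1) it(1) ix'(2) it(2)] by (metis add.commute diff_add_cancel)
    then have "2 * of_real pi * \<i> * of_real (\<eta> (ix t) t) = 2 * of_real pi * \<i> * of_real (\<eta> i t) + of_real (real_of_int (2 * n) * pi) * \<i>" by (simp add: algebra_simps)
    then show ?thesis unfolding G_def exp_eq by blast
  qed
  have "continuous_on (\<Union>i\<in>{..<m}. Q i) G"
  proof (rule continuous_on_closed_Union)
    fix i assume i: "i \<in> {..<m}"
    then show "closed (Q i)" using Q(1) by (simp add: compact_imp_closed)
    have "continuous_on (Q i) (\<lambda>t. exp (2 * of_real pi * \<i> * of_real (\<eta> i t)) :: complex)" using \<eta>c i by (intro continuous_intros) auto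
    then show "continuous_on (Q i) G" using G i by (simp cong: continuous_on_cong)
  qed simp
  then have "continuous_on T G" using T(4) by simp
  moreover have "G t ~= 0" for t by (simp add: G_def)
  ultimately obtain c where c: "continuous_on T c" "!!t. t \<in> T ==> G t = exp (c t)"
    using continuous_logarithm_on_simply_connected[OF _ T(2,3), of G] by blast
  \<comment> \<open>Two logarithms differ by an integer multiple of the period; the difference is
    continuous, hence constant on the connected set \<open>Q i\<close>.\<close>
  have "\<exists>M::int. \<forall>t\<in>Q i. Im (c t) / (2 * pi) - \<eta> i t = real_of_int M" if i: "i < m" for i
  proof -
    define \<mu> where "\<mu> t = Im (c t) / (2 * pi) - \<eta> i t" for t
    have QT: "Q i \<subseteq> T" using i T(4) by blast
    have int: "\<exists>n::int. \<mu> t = real_of_int n" if "t \<in> Q i" for t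
    proof -
      have "exp (c t) = exp (2 * of_real pi * \<i> * of_real (\<eta> i t))" using c(2) G[OF i that] that QT by auto
      then obtain n :: int where "c t = 2 * of_real pi * \<i> * of_real (\<eta> i t) + of_real (real_of_int (2 * n) * pi) * \<i>" unfolding exp_eq by blast
      then have "Im (c t) = 2 * pi * \<eta> i t + 2 * real_of_int n * pi" by simp
      then show ?thesis by (intro exI[of _ n]) (simp add: \<mu>_def field_simps)
    qed
    have "\<mu> constant_on Q i"
    proof (rule continuous_discrete_range_constant[OF Q(2)[OF i]])
      show "continuous_on (Q i) \<mu>" unfolding \<mu>_def using \<eta>c[OF i] continuous_on_subset[OF c(1) QT] by (intro continuous_intros) auto
      fix x assume x: "x \<in> Q i"
      have "1 <= norm (\<mu> y - \<mu> x)" if y: "y \<in> Q i" "\<mu> y ~= \<mu> x" for y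
      proof -
        obtain a b :: int where "\<mu> y = real_of_int a" "\<mu> x = real_of_int b" using int x y(1) by metis
        then show ?thesis using y(2) by (simp flip: of_int_diff)
      qed
      then show "\<exists>e>0. \<forall>y. y \<in> Q i \<and> \<mu> y ~= \<mu> x --> e <= norm (\<mu> y - \<mu> x)" by (intro exI[of _ 1]) auto
    qed
    then obtain v where v: "!!t. t \<in> Q i ==> \<mu> t = v" unfolding constant_on_def by blast
    obtain t where "t \<in> Q i" using Q(3)[OF i] by blast
    then obtain n :: int where "v = real_of_int n" using int v by metis
    then show ?thesis using v unfolding \<mu>_def by blast
  qed
  then have "\<forall>i. \<exists>M::int. i < m --> (\<forall>t\<in>Q i. Im (c t) / (2 * pi) - \<eta> i t = real_of_int M)" by blast
  then obtain M :: "nat => int" where M: "!!i t. i < m ==> t \<in> Q i ==> Im (c t) / (2 * pi) - \<eta> i t = real_of_int (M i)" by metis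
  define \<nu> where "\<nu> p = M (fst p) + ka (fst p) (snd p)" for p
  \<comment> \<open>Intersecting with \<open>r0\<close> keeps the folding condition checkable: equal
    classes of the ends make the cocycle values of the two edges equal.\<close>
  define r1 where "r1 = {x \<in> r0. \<nu> (fst x) = \<nu> (snd x)}"
  have r1: "(p,q) \<in> r1 \<longleftrightarrow> (p,q) \<in> r0 \<and> \<nu> p = \<nu> q" for p q by (simp add: r1_def)
  have r0P: "r0 \<subseteq> P \<times> P" unfolding r0_def by blast
  have r0e: "(p,p) \<in> r0" if "p \<in> P" for p using that eq_r0 unfolding equiv_def refl_on_def by blast
  have r0s: "(p,q) \<in> r0 ==> (q,p) \<in> r0" for p q using eq_r0 unfolding equiv_def sym_def by blast
  have r0t: "(p,q) \<in> r0 ==> (q,s) \<in> r0 ==> (p,s) \<in> r0" for p q s using eq_r0 unfolding equiv_def trans_def by blast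
  have "good r1"
    unfolding good_def
  proof (intro conjI allI impI ballI)
    have "r1 \<subseteq> P \<times> P" using r0P unfolding r1_def by blast
    moreover have "(p,p) \<in> r1" if "p \<in> P" for p using r0e[OF that] by (simp add: r1)
    moreover have "(q,p) \<in> r1" if "(p,q) \<in> r1" for p q using that r0s by (simp add: r1)
    moreover have "(p,s) \<in> r1" if "(p,q) \<in> r1" "(q,s) \<in> r1" for p q s using that r0t[of p q s] by (simp add: r1)
    ultimately show "equiv P r1" unfolding equiv_def refl_on_def sym_def trans_def by blast
  next
    fix i j t assume ij: "i < m" "j < m" "t \<in> Q i \<inter> Q j"
    then have t: "t \<in> Q i" "t \<in> Q j" by auto
    have "((i, org (g i t)), (j, org (g j t))) \<in> r0" using good_r0 ij unfolding good_def by blast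
    moreover have "real_of_int (M i + ka i (org (g i t))) = real_of_int (M j + ka j (org (g j t)))"
      using M[OF ij(1) t(1)] M[OF ij(2) t(2)] \<eta>d[OF ij(1,2) t] by simp
    then have "\<nu> (i, org (g i t)) = \<nu> (j, org (g j t))" unfolding \<nu>_def of_int_eq_iff by simp
    ultimately show "((i, org (g i t)), (j, org (g j t))) \<in> r1" by (simp add: r1)
  next
    fix i j a a' assume ij: "i < m" "j < m" and a: "a \<in> RS" "a' \<in> RS" "elab a = elab a'"
    have f0: "((i, esrc a), (j, esrc a')) \<in> r0 \<longleftrightarrow> ((i, etgt a), (j, etgt a')) \<in> r0" using good_r0 ij a unfolding good_def by blast
    have "\<nu> (i, esrc a) = \<nu> (j, esrc a') \<longleftrightarrow> \<nu> (i, etgt a) = \<nu> (j, etgt a')" if "((i, esrc a), (j, esrc a')) \<in> r0"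
    proof -
      have "rho i (esrc a) = rho j (esrc a')" using rho_eq[OF ij RS_ends(1)[OF a(1)] RS_ends(1)[OF a(2)]] that by blast
      then have "px i a = px j a'" using ren_edge_eq[OF ij a] by (simp add: px_def)
      then show ?thesis using ka_edge[OF ij(1) a(1)] ka_edge[OF ij(2) a(2)] by (auto simp: \<nu>_def)
    qed
    then show "((i, esrc a), (j, esrc a')) \<in> r1 \<longleftrightarrow> ((i, etgt a), (j, etgt a')) \<in> r1" using f0 unfolding r1 by blast
  qed
  then have sub: "r0 \<subseteq> r1" by (rule r0_sub)
  define n where "n u = \<nu> (inv_into P cls u)" for u
  have n: "n (cls p) = \<nu> p" if p: "p \<in> P" for p
  proof -
    have q: "inv_into P cls (cls p) \<in> P" "cls (inv_into P cls (cls p)) = cls p" using p by (auto intro: inv_into_into f_inv_into_f)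
    then have "(inv_into P cls (cls p), p) \<in> r1" using cls_eq[OF q(1) p] sub by blast
    then show ?thesis unfolding n_def r1 by blast
  qed
  have "\<psi> a = n (etgt a) - n (esrc a)" if aR: "a \<in> R" for a
  proof -
    obtain i b where b: "i < m" "b \<in> RS" "a = renE (rho i) b" using aR unfolding R_iff by blast
    have "(i, esrc b) \<in> P" "(i, etgt b) \<in> P" using b RS_ends by (simp_all add: P_def)
    then have "n (esrc a) = \<nu> (i, esrc b)" "n (etgt a) = \<nu> (i, etgt b)" unfolding b(3) using n by (simp_all add: rho_def)
    then show ?thesis using ka_edge[OF b(1,2)] unfolding b(3) px_def by (simp add: \<nu>_def)
  qed
  then show ?thesis by blast
qed

lemma chiL: "1 <= chi U R Ph" by (rule chi_ge_1[OF cxL base_U(1) coboundary])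

end

theorem unfolding_exists:
  fixes T :: "'a::euclidean_space set"
  assumes fin: "finite V" "finite E" and cl: "closed_LOG V E"
    and T: "compact T" "connected T" "simply_connected T" "locally path_connected T" "T ~= {}"
    and f: "continuous_map (top_of_set T) (K_LOG V E) f"
  shows "\<exists>(U::nat set) R Ph fL. cx V E U R Ph \<and> conn U R \<and> U ~= {} \<and> 1 <= chi U R Ph \<and>
    continuous_map (top_of_set T) (LT U R Ph) fL \<and> (\<forall>t\<in>T. proj (fL t) = f t)"
proof -
  define Op where "Op \<kappa> = {t \<in> topspace (top_of_set T). f t \<in> proj ` Nst V E \<kappa>}" for \<kappa>
  have fK: "f t \<in> K_points V E" if "t \<in> T" for t
    using continuous_map_image_subset_topspace[OF f] that unfolding topspace_K_LOG[OF cl] by auto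
  have O1: "\<exists>\<kappa>. t \<in> Op \<kappa>" if "t \<in> T" for t using star_cover[OF fK[OF that]] that unfolding Op_def by auto
  have O2: "openin (top_of_set T) (Op \<kappa>)" for \<kappa> unfolding Op_def by (rule openin_continuous_map_preimage[OF f star_section(1)[OF cl]])
  obtain m :: nat and Q \<kappa> where Q: "T = (\<Union>i<m. Q i)" "\<forall>i<m. compact (Q i) \<and> connected (Q i) \<and> Q i ~= {} \<and> Q i \<subseteq> Op (\<kappa> i)"
    using connected_cover[OF T(1,4) O1 O2] by metis
  define g where "g i t = inv_into (Nst V E (\<kappa> i)) proj (f t)" for i t
  interpret unfold V E T f m Q g
  proof unfold_locales
    fix i assume i: "i < m"
    then have QO: "Q i \<subseteq> Op (\<kappa> i)" using Q(2) by blast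
    have QT: "Q i \<subseteq> T" using Q(1) i by blast
    have "continuous_map (top_of_set (Q i)) (K_LOG V E) f" using continuous_map_from_subtopology_mono[OF f QT] .
    then have "continuous_map (top_of_set (Q i)) (subtopology (K_LOG V E) (proj ` Nst V E (\<kappa> i))) f"
      using QO unfolding Op_def by (auto simp: continuous_map_in_subtopology)
    from continuous_map_compose[OF this star_section(2)[OF cl]]
    show "continuous_map (top_of_set (Q i)) (LT (USt V E) (RSt V E) (FSt E)) (g i)" by (simp add: o_def g_def[abs_def])
    show "proj (g i t) = f t" if "t \<in> Q i" for t
    proof -
      have "f t \<in> proj ` Nst V E (\<kappa> i)" using that QO unfolding Op_def by blast
      then show ?thesis unfolding g_def by (rule f_inv_into_f)
    qed
  qed (use fin cl T Q in blast)+
  show ?thesis using cxL connL base_U(2) chiL continuous_fL proj_fL by blast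
qed

section \<open>Homotopy groups\<close>

text \<open>A subcomplex carries the subspace topology: the rest \<open>D\<close> of the subcomplex
  is closed in the large complex, since a foreign edge meets it in end points only and a foreign
  face in a closed part of its boundary circle.\<close>

lemma subcomplex_continuous:
  assumes wf: "wf_cx U R Ph" "wf_cx U' R' Ph'" and sub: "U' \<subseteq> U" "R' \<subseteq> R" "Ph' \<subseteq> Ph"
    and \<gamma>: "continuous_map X (LT U R Ph) \<gamma>" "!!x. x \<in> topspace X ==> \<gamma> x \<in> lpts U' R' Ph'"
  shows "continuous_map X (LT U' R' Ph') \<gamma>"
  unfolding continuous_map_def topspace_LT[OF wf(2)]
proof (intro conjI allI impI)
  show "\<gamma> \<in> topspace X \<rightarrow> lpts U' R' Ph'" using \<gamma>(2) by blast
  fix W assume "openin (LT U' R' Ph') W"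
  then have W: "W \<subseteq> lpts U' R' Ph'" "!!a. a \<in> R' ==> openin (top_of_set {0..1::real}) {t \<in> {0..1}. charE a t \<in> W}"
    "!!ph. ph \<in> Ph' ==> openin (top_of_set (cball (0::complex) 1)) {p \<in> cball 0 1. charF ph p \<in> W}"
    unfolding openin_LT lopen_def by blast+
  define D where "D = lpts U' R' Ph' - W"
  have wf0: "wf_cx U R {}" using wf(1) by (simp add: wf_cx_def)
  have edges: "openin (top_of_set {0..1::real}) {t \<in> {0..1}. charE a t \<notin> D}" if a: "a \<in> R" for a
  proof (cases "a \<in> R'")
    case True
    have "{t \<in> {0..1}. charE a t \<notin> D} = {t \<in> {0..1}. charE a t \<in> W}" using charE_in[OF wf(2) True] unfolding D_def by blast
    then show ?thesis using W(2)[OF True] by simp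
  next
    case False
    let ?Z = "{t \<in> {0,1::real}. charE a t \<in> D}"
    have z: "t = 0 \<or> t = 1" if "t \<in> {0..1}" "charE a t \<in> D" for t
      using that False by (cases "t <= 0"; cases "1 <= t") (auto simp: charE_def D_def)
    have "{t \<in> {0..1}. charE a t \<notin> D} = {0..1} \<inter> - ?Z"
    proof (rule set_eqI)
      show "t \<in> {t \<in> {0..1}. charE a t \<notin> D} \<longleftrightarrow> t \<in> {0..1} \<inter> - ?Z" for t using z[of t] by auto
    qed
    moreover have "open (- ?Z)" by (intro open_Compl finite_imp_closed) simp
    ultimately show ?thesis by (simp only: openin_open_Int)
  qed
  have "openin (LT U R Ph) (lpts U R Ph - D)"
    unfolding openin_LT lopen_def
  proof (intro conjI ballI)
    fix a assume a: "a \<in> R"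
    have "{t \<in> {0..1}. charE a t \<in> lpts U R Ph - D} = {t \<in> {0..1}. charE a t \<notin> D}" using charE_in[OF wf(1) a] by blast
    then show "openin (top_of_set {0..1}) {t \<in> {0..1}. charE a t \<in> lpts U R Ph - D}" using edges[OF a] by simp
  next
    fix ph assume f: "ph \<in> Ph"
    have eq: "{p \<in> cball 0 1. charF ph p \<in> lpts U R Ph - D} = {p \<in> cball 0 1. charF ph p \<notin> D}" using charF_in[OF wf(1) f] by blast
    show "openin (top_of_set (cball 0 1)) {p \<in> cball 0 1. charF ph p \<in> lpts U R Ph - D}"
    proof (cases "ph \<in> Ph'")
      case True
      have "{p \<in> cball 0 1. charF ph p \<notin> D} = {p \<in> cball 0 1. charF ph p \<in> W}" using charF_in[OF wf(2) True] unfolding D_def by blast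
      then show ?thesis using W(3)[OF True] eq by simp
    next
      case False
      have "openin (LT U R {}) (lpts U R {} - D)"
        unfolding openin_LT lopen_def
      proof (intro conjI ballI)
        fix a assume a: "a \<in> R"
        have "{t \<in> {0..1}. charE a t \<in> lpts U R {} - D} = {t \<in> {0..1}. charE a t \<notin> D}" using charE_in[OF wf(1) a] by blast
        then show "openin (top_of_set {0..1}) {t \<in> {0..1}. charE a t \<in> lpts U R {} - D}" using edges[OF a] by simp
      qed auto
      define Z where "Z = {p \<in> topspace (top_of_set (sphere 0 1)). charF ph p \<in> lpts U R {} - D}"
      have "openin (top_of_set (sphere 0 1)) Z" unfolding Z_def by (rule openin_continuous_map_preimage[OF continuous_charF_sphere[OF wf(1) f wf0] \<open>openin (LT U R {}) (lpts U R {} - D)\<close>])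
      then have "closedin (top_of_set (sphere 0 1)) (topspace (top_of_set (sphere 0 1)) - Z)" by (intro closedin_diff closedin_topspace)
      then have "closedin (top_of_set (sphere 0 1)) (sphere 0 1 - Z)" unfolding topspace_euclidean_subtopology .
      then have cl: "closed (sphere 0 1 - Z)" by (rule closedin_closed_trans) simp
      have b: "charF ph p \<in> lpts U R {}" if "norm p = 1" for p
        using bdpt_in[OF wf(1) f, of _ "{}"] that by (simp add: charF_def)
      have n: "charF ph p \<notin> D" if "norm p < 1" for p using that False by (simp add: charF_def D_def)
      have "{p \<in> cball 0 1. charF ph p \<notin> D} = cball 0 1 \<inter> - (sphere 0 1 - Z)"
      proof (rule set_eqI)
        fix p :: complex
        consider "norm p < 1" | "norm p = 1" | "1 < norm p" by linarith
        then show "p \<in> {p \<in> cball 0 1. charF ph p \<notin> D} \<longleftrightarrow> p \<in> cball 0 1 \<inter> - (sphere 0 1 - Z)"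
          using b[of p] n[of p] by cases (auto simp: Z_def)
      qed
      then show ?thesis using openin_open_Int[OF open_Compl[OF cl], of "cball 0 1"] unfolding eq by (simp only:)
    qed
  qed blast
  from openin_continuous_map_preimage[OF \<gamma>(1) this]
  have "openin X {x \<in> topspace X. \<gamma> x \<in> lpts U R Ph - D}" .
  moreover have "{x \<in> topspace X. \<gamma> x \<in> lpts U R Ph - D} = {x \<in> topspace X. \<gamma> x \<in> W}"
  proof -
    have "lpts U' R' Ph' \<subseteq> lpts U R Ph" unfolding lpts_def using sub by blast
    then show ?thesis using \<gamma>(2) W(1) unfolding D_def by blast
  qed
  ultimately show "openin X {x \<in> topspace X. \<gamma> x \<in> W}" by simp
qed

section \<open>Paths in an unfolded complex\<close>

lemma zero_one_constant:
  assumes wf: "wf_cx U R Ph" and \<gamma>: "continuous_map I01 (LT U R Ph) \<gamma>"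
    and v: "!!x. x \<in> {0..1} ==> hx k (\<gamma> x) = 0 \<or> hx k (\<gamma> x) = 1" and x: "x \<in> {0..1}"
  shows "hx k (\<gamma> x) = hx k (\<gamma> 0)"
proof -
  have c: "continuous_on {0..1} (\<lambda>x. hx k (\<gamma> x))" using continuous_map_compose[OF \<gamma> continuous_hx[OF wf, of k]] by (simp add: o_def)
  have "(\<lambda>x. hx k (\<gamma> x)) constant_on {0..1}"
  proof (rule continuous_discrete_range_constant[OF _ c])
    fix y :: real assume y: "y \<in> {0..1}"
    have "1 <= norm (hx k (\<gamma> z) - hx k (\<gamma> y))" if "z \<in> {0..1} \<and> hx k (\<gamma> z) ~= hx k (\<gamma> y)" for z
      using v[OF y] v[of z] that by auto
    then show "\<exists>e>0. \<forall>z. z \<in> {0..1} \<and> hx k (\<gamma> z) ~= hx k (\<gamma> y) --> e <= norm (hx k (\<gamma> z) - hx k (\<gamma> y))" by (intro exI[of _ 1]) auto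
  qed simp
  then show ?thesis using x unfolding constant_on_def by auto
qed

text \<open>The indicator of a vertex extends to a continuous function, which takes only the values
  0 and 1 along such a path.\<close>

lemma vertex_path_constant:
  assumes wf: "wf_cx U R Ph" and \<gamma>: "continuous_map I01 (LT U R Ph) \<gamma>" and b: "!!x. x \<in> {0..1} ==> proj (\<gamma> x) = Base"
  shows "\<gamma> 0 = \<gamma> 1"
proof -
  have V: "\<exists>u. \<gamma> x = LV u" if "x \<in> {0..1}" for x using b[OF that] by (cases "\<gamma> x") auto
  obtain v w where v: "\<gamma> 0 = LV v" "\<gamma> 1 = LV w" using V[of 0] V[of 1] by auto
  define k where "k u = (if u = v then 1 else 0 :: real)" for u
  have "hx k (\<gamma> 1) = hx k (\<gamma> 0)"
  proof (rule zero_one_constant[OF wf \<gamma>])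
    fix x :: real assume "x \<in> {0..1}"
    then obtain u where "\<gamma> x = LV u" using V by blast
    then show "hx k (\<gamma> x) = 0 \<or> hx k (\<gamma> x) = 1" by (simp add: hx_def k_def)
  qed simp
  then show ?thesis unfolding v by (simp add: hx_def k_def split: if_splits)
qed

text \<open>The indicator of the piece, extended by \<open>hx\<close>, is 0 or 1 along the path,
  because edges and faces labelled in \<open>S\<close> lie entirely inside or outside the
  piece.\<close>

lemma path_in_piece:
  fixes S :: "'v set"
  assumes cx: "cx V E U R Ph" and \<gamma>: "continuous_map I01 (LT U R Ph) \<gamma>" "\<gamma> 0 = LV v" "v \<in> U"
    and S: "!!x. x \<in> {0..1} ==> proj (\<gamma> x) \<in> K_points S (Esub E S)" and x: "x \<in> {0..1}"
  defines "C \<equiv> comp R S v"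
  shows "\<gamma> x \<in> lpts C (Rp R S C) (Fp Ph S C)"
proof -
  note wf = cxD(4)[OF cx]
  have inL: "\<gamma> y \<in> lpts U R Ph" if "y \<in> {0..1}" for y
    using continuous_map_image_subset_topspace[OF \<gamma>(1)] that unfolding topspace_LT[OF wf] by auto
  define k where "k u = (if u \<in> C then 1 else 0 :: real)" for u
  have inC: "w \<in> C \<longleftrightarrow> w' \<in> C" if "comp R S w = comp R S w'" for w w'
    using that comp_eq[of w R S v] comp_eq[of w' R S v] comp_refl[of w R S] comp_refl[of w' R S] unfolding C_def by metis
  have val: "hx k (\<gamma> y) = (if \<gamma> y \<in> lpts C (Rp R S C) (Fp Ph S C) then 1 else 0)" if y: "y \<in> {0..1}" for y
  proof (cases "\<gamma> y")
    case (LV u) then show ?thesis by (simp add: hx_def k_def)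
  next
    case (LE a t)
    then have a: "a \<in> R" "elab a \<in> S" "0 < t" "t < 1" using inL[OF y] S[OF y] by (auto simp: K_points_def)
    have "esrc a \<in> C \<longleftrightarrow> etgt a \<in> C" by (rule inC[OF comp_step[OF a(1,2)]])
    then show ?thesis using LE a by (simp add: hx_def hx0_def k_def Rp_def)
  next
    case (LF ph p)
    then have a: "ph \<in> Ph" "norm p < 1" "snd ph \<in> Esub E S" using inL[OF y] S[OF y] by (auto simp: K_points_def)
    have l: "labs ph \<subseteq> S" using a(3) unfolding labs_eq Esub_def by blast
    have kc: "k (corner ph j) = k (corner ph 0)" if "j < 4" for j
      using inC[OF face_comp[OF cx a(1) l that]] by (simp add: k_def)
    define s where "s = ang p"
    have s: "0 <= s" "s < 4" using Arg2pi[of p] by (auto simp: s_def ang_def field_simps)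
    define j where "j = nat \<lfloor>s\<rfloor>"
    have j: "j < 4" "real j <= s" "s <= real j + 1" using s by (auto simp: j_def nat_less_iff floor_less_iff)
    have "hx k (\<gamma> y) = k (corner ph 0)" unfolding LF hx_def lpt.case s_def[symmetric] hx0_bdpt[OF j] using kc[OF j(1)] kc[of "Suc j mod 4"] by simp
    then show ?thesis using LF a l by (simp add: k_def Fp_def)
  qed
  have "hx k (\<gamma> x) = hx k (\<gamma> 0)" by (rule zero_one_constant[OF wf \<gamma>(1) _ x]) (simp add: val)
  also have "\<dots> = 1" unfolding \<gamma>(2) using comp_refl[of v R S] by (simp add: hx_def k_def C_def)
  finally show ?thesis using val[OF x] by (simp split: if_splits)
qed

lemma homotopy_along_lift:
  assumes h: "nullhtpy Z r b U R Ph h" and \<gamma>: "continuous_map X (LT U R Ph) \<gamma>"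
  shows "continuous_map (prod_topology I01 X) Z (\<lambda>(s,x). h (s, \<gamma> x))"
proof -
  have "continuous_map (prod_topology I01 X) (LT U R Ph) (\<lambda>p. \<gamma> (snd p))" using continuous_map_compose[OF continuous_map_snd \<gamma>] by (simp add: o_def)
  then have "continuous_map (prod_topology I01 X) (prod_topology I01 (LT U R Ph)) (\<lambda>p. (fst p, \<gamma> (snd p)))"
    by (intro continuous_map_pairedI continuous_map_fst)
  from continuous_map_compose[OF this h[unfolded nullhtpy_def, THEN conjunct1]] show ?thesis by (simp add: o_def case_prod_unfold)
qed

lemma homotopic_with_lift:
  fixes X :: "'x topology" and f :: "'x => 'v cellpt"
  assumes wf: "wf_cx U R Ph" and h: "nullhtpy Z proj Base U R Ph h" and \<gamma>: "continuous_map X (LT U R Ph) \<gamma>"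
    and f: "!!x. x \<in> topspace X ==> proj (\<gamma> x) = f x"
    and B: "!!s x. s \<in> {0..1} ==> x \<in> A ==> h (s, \<gamma> x) = Base" and A: "A \<subseteq> topspace X"
  shows "homotopic_with (\<lambda>k. \<forall>x\<in>A. k x = Base) X Z f (\<lambda>_. Base)"
proof -
  have inL: "\<gamma> x \<in> lpts U R Ph" if "x \<in> topspace X" for x
    using continuous_map_image_subset_topspace[OF \<gamma>] that unfolding topspace_LT[OF wf] by auto
  have h01: "h (0,q) = proj q" "h (1,q) = Base" if "q \<in> lpts U R Ph" for q
    using h[unfolded nullhtpy_def, THEN conjunct2, THEN bspec, OF that] by auto
  \<comment> \<open>The formulation of \<open>homotopic_with\<close> fixes the values at times 0 and
    1 even at points outside the space, hence the case distinction.\<close>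
  define H where "H z = (if snd z \<in> topspace X then h (fst z, \<gamma> (snd z)) else if fst z = 0 then f (snd z) else Base)" for z :: "real \<times> 'x"
  have "continuous_map (prod_topology I01 X) Z H"
    by (rule continuous_map_eq[OF homotopy_along_lift[OF h \<gamma>]]) (auto simp: H_def)
  moreover have "H (0,x) = f x" "H (1,x) = Base" for x
    using h01[OF inL[of x]] f[of x] by (simp_all add: H_def)
  moreover have "\<forall>x\<in>A. H (t,x) = Base" if "t \<in> {0..1}" for t using B[OF that] A by (auto simp: H_def)
  ultimately show ?thesis unfolding homotopic_with_def by (intro exI[of _ H] conjI allI ballI) blast+
qed

text \<open>The sphere is simply connected, so the map factors through a complex that contracts in
  \<open>K\<close>; the contraction is made stationary at the image of the base point.\<close>

lemma pi2_trivial_LOT: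
  assumes L: "nLOT V E" shows "pi2_trivial (K_LOG V E) Base"
  unfolding pi2_trivial_def S2_def
proof (intro allI impI, elim conjE)
  fix f :: "real \<times> real \<times> real => 'a cellpt"
  assume f: "continuous_map (top_of_set (sphere 0 1)) (K_LOG V E) f" "f s2_base = Base"
  let ?S = "sphere (0::real \<times> real \<times> real) 1"
  have b: "s2_base \<in> ?S" by (simp add: s2_base_def norm_Pair)
  have D: "DIM(real \<times> real \<times> real) = 3" by simp
  have S: "compact ?S" "connected ?S" "simply_connected ?S" "locally path_connected ?S" "?S ~= {}"
  proof -
    show "connected ?S" by (rule connected_sphere) (simp add: D)
    show "simply_connected ?S" by (rule simply_connected_sphere) (simp add: D)
    show "locally path_connected ?S" by (rule locally_path_connected_sphere)
  qed (use b in auto)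
  obtain U :: "nat set" and R Ph fL where L1: "cx V E U R Ph" "conn U R" "U ~= {}" "1 <= chi U R Ph"
      "continuous_map (top_of_set ?S) (LT U R Ph) fL" "\<forall>t\<in>?S. proj (fL t) = f t"
    using unfolding_exists[OF nLOTD(1,3)[OF L] closed_nLOT[OF L] S f(1)] by blast
  note wf = cxD(4)[OF L1(1)]
  obtain h where h: "nullhtpy (K_LOG V E) proj Base U R Ph h" using NPI_D(3)[OF nLOT_NPI[OF L] L1(1-4)] by blast
  have "proj (fL s2_base) = Base" using L1(6) b f(2) by simp
  then obtain v where v: "fL s2_base = LV v" by (cases "fL s2_base") auto
  have "fL s2_base \<in> lpts U R Ph" using continuous_map_image_subset_topspace[OF L1(5)] b unfolding topspace_LT[OF wf] by auto
  then have vU: "v \<in> U" using v by simp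
  obtain h' where h': "nullhtpy (K_LOG V E) proj Base U R Ph h'" "!!s. s \<in> {0..1} ==> h' (s, LV v) = Base"
    using nullhtpy_based[OF wf _ vU h] by auto
  have "homotopic_with (\<lambda>k. \<forall>x\<in>{s2_base}. k x = Base) (top_of_set ?S) (K_LOG V E) f (\<lambda>_. Base)"
    by (rule homotopic_with_lift[OF wf h'(1) L1(5)]) (use L1(6) h'(2) v b in auto)
  then show "homotopic_with (\<lambda>h. h s2_base = Base) (top_of_set ?S) (K_LOG V E) f (\<lambda>_. Base)" by simp
qed

text \<open>Unfold the null homotopy, a map of a square. Three sides go to the base point and hence
  sit at one vertex, so the fourth side lifts the loop to a closed path, which stays in the
  \<open>S\<close>-piece of that vertex. This piece has characteristic at least 1 and therefore
  contracts already over the sub-LOT.\<close>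

lemma pi1_injective_LOT:
  assumes L: "nLOT V E" and S: "block E S" "S \<subseteq> V"
  shows "pi1_incl_injective (K_LOG S (Esub E S)) (K_LOG V E) Base"
  unfolding pi1_incl_injective_def
proof (intro allI impI, elim conjE)
  fix g :: "real => 'a cellpt"
  assume g: "continuous_map I01 (K_LOG S (Esub E S)) g" "g 0 = Base" "g 1 = Base"
    and hom: "homotopic_with (\<lambda>h. h 0 = Base \<and> h 1 = Base) I01 (K_LOG V E) (id \<circ> g) (\<lambda>_. Base)"
  obtain k where k: "continuous_map (prod_topology I01 I01) (K_LOG V E) k" "!!x. k (0,x) = g x" "!!x. k (1,x) = Base"
    "!!s. s \<in> {0..1} ==> k (s,0) = Base \<and> k (s,1) = Base"
    using hom unfolding homotopic_with_def by auto
  let ?T = "{0..1::real} \<times> {0..1::real}"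
  have cT: "convex ?T" by (intro convex_Times) auto
  have T: "compact ?T" "connected ?T" "simply_connected ?T" "locally path_connected ?T" "?T ~= {}"
    using cT by (auto simp: compact_Times intro: convex_connected convex_imp_simply_connected convex_imp_locally_path_connected)
  have "continuous_map (top_of_set ?T) (K_LOG V E) k" using k(1) by (simp add: prod_topology_subtopology_eu)
  then obtain U :: "nat set" and R Ph fL where L1: "cx V E U R Ph" "conn U R" "U ~= {}" "1 <= chi U R Ph"
      "continuous_map (top_of_set ?T) (LT U R Ph) fL" "\<forall>t\<in>?T. proj (fL t) = k t"
    using unfolding_exists[OF nLOTD(1,3)[OF L] closed_nLOT[OF L] T] by blast
  note wf = cxD(4)[OF L1(1)]
  have pth: "continuous_map I01 (LT U R Ph) (\<lambda>x. fL (p x))" if "continuous_on {0..1} p" "p ` {0..1} \<subseteq> ?T" for p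
    by (rule continuous_map_top_of_set_compose[OF L1(5) that])
  have c1: "continuous_map I01 (LT U R Ph) (\<lambda>s. fL (s,0))" by (rule pth) (auto intro!: continuous_intros)
  have c2: "continuous_map I01 (LT U R Ph) (\<lambda>s. fL (1,s))" by (rule pth) (auto intro!: continuous_intros)
  have c3: "continuous_map I01 (LT U R Ph) (\<lambda>s. fL (s,1))" by (rule pth) (auto intro!: continuous_intros)
  have "fL (0,0) = fL (1,0)" by (rule vertex_path_constant[OF wf c1]) (use L1(6) k(4) in auto)
  moreover have "fL (1,0) = fL (1,1)" by (rule vertex_path_constant[OF wf c2]) (use L1(6) k(3) in auto)
  moreover have "fL (0,1) = fL (1,1)" by (rule vertex_path_constant[OF wf c3]) (use L1(6) k(4) in auto)
  ultimately have ends: "fL (0,1) = fL (0,0)" by simp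
  define \<gamma> where "\<gamma> x = fL (0,x)" for x
  have \<gamma>: "continuous_map I01 (LT U R Ph) \<gamma>" unfolding \<gamma>_def by (rule pth) (auto intro!: continuous_intros)
  have pg: "proj (\<gamma> x) = g x" if "x \<in> {0..1}" for x using L1(6) k(2) that by (simp add: \<gamma>_def)
  obtain v where v: "\<gamma> 0 = LV v" using pg[of 0] g(2) by (cases "\<gamma> 0") auto
  have "\<gamma> 0 \<in> lpts U R Ph" using continuous_map_image_subset_topspace[OF \<gamma>] unfolding topspace_LT[OF wf] by auto
  then have vU: "v \<in> U" using v by simp
  define C where "C = comp R S v"
  have vC: "v \<in> C" unfolding C_def by simp
  have npi: "NPI S (Esub E S)" by (rule nLOT_NPI[OF Esub_nLOT[OF L S]])
  note pc = piece_NPI[OF L S(2) npi L1(1) vU, folded C_def]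
  have gK: "g x \<in> K_points S (Esub E S)" if "x \<in> {0..1}" for x
    using continuous_map_image_subset_topspace[OF g(1)] that unfolding topspace_K_LOG[OF closed_Esub] by auto
  have inC: "\<gamma> x \<in> lpts C (Rp R S C) (Fp Ph S C)" if "x \<in> {0..1}" for x
    unfolding C_def by (rule path_in_piece[OF L1(1) \<gamma> v vU _ that]) (use pg gK in simp)
  have CU: "C \<subseteq> U" unfolding C_def by (rule comp_sub[OF L1(1) vU])
  have \<gamma>C: "continuous_map I01 (LT C (Rp R S C) (Fp Ph S C)) \<gamma>"
    by (rule subcomplex_continuous[OF wf cxD(4)[OF pc(1)] CU _ _ \<gamma>]) (use inC in \<open>auto simp: Rp_def Fp_def\<close>)
  have "1 <= chip R Ph S C"
  proof (cases "Rp R S C = {}")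
    case True
    \<comment> \<open>The clause of \<open>NPI\<close> speaks of pieces containing an edge; a piece
      without edges is a single vertex.\<close>
    have "w = v" if "(v,w) \<in> (adj (Rl R S))\<^sup>*" for w
      using that
    proof (cases rule: converse_rtranclE)
      case (step y)
      then obtain a where a: "a \<in> R" "elab a \<in> S" "esrc a = v \<or> etgt a = v" unfolding adj_def Rl_def by blast
      then have "esrc a \<in> C" using comp_step[OF a(1,2)] comp_refl[of "esrc a" R S] unfolding C_def by auto
      then have "a \<in> Rp R S C" using a unfolding Rp_def by blast
      then show ?thesis using True by blast
    qed simp
    then have "C = {v}" using vC unfolding C_def comp_def by blast
    then show ?thesis using True by (simp add: chip_def chi_def)
  next
    case False
    then obtain a where a: "a \<in> R" "elab a \<in> S" "esrc a \<in> C" unfolding Rp_def by blast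
    have "1 <= chip R Ph S (comp R S (esrc a))" by (rule NPI_D(4)[OF nLOT_NPI[OF L] L1(1-4) S(2,1) a(1,2)])
    then show ?thesis using comp_eq[of "esrc a" R S v] a(3) unfolding C_def by simp
  qed
  then obtain h where h: "nullhtpy (K_LOG S (Esub E S)) proj Base C (Rp R S C) (Fp Ph S C) h"
    using NPI_D(3)[OF npi pc(1,2)] vC unfolding chip_def by blast
  obtain h' where h': "nullhtpy (K_LOG S (Esub E S)) proj Base C (Rp R S C) (Fp Ph S C) h'" "!!s. s \<in> {0..1} ==> h' (s, LV v) = Base"
    using nullhtpy_based[OF cxD(4)[OF pc(1)] _ vC h] by auto
  have v1: "\<gamma> 1 = LV v" using ends v unfolding \<gamma>_def by simp
  have "homotopic_with (\<lambda>k. \<forall>x\<in>{0,1}. k x = Base) I01 (K_LOG S (Esub E S)) g (\<lambda>_. Base)"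
    by (rule homotopic_with_lift[OF cxD(4)[OF pc(1)] h'(1) \<gamma>C]) (use pg h'(2) v v1 in auto)
  then show "homotopic_with (\<lambda>h. h 0 = Base \<and> h 1 = Base) I01 (K_LOG S (Esub E S)) g (\<lambda>_. Base)" by simp
qed

theorem mainTheorem1:
  fixes V :: "'v set" and E :: "('v \<times> 'v \<times> 'v) set"
  assumes "is_LOT V E" and "finite V" and "injective_LOG E"
  shows "pi2_trivial (K_LOG V E) Base \<and>
         (\<forall>VH EH. sub_LOT V E VH EH \<longrightarrow> pi1_incl_injective (K_LOG VH EH) (K_LOG V E) Base)"
proof (intro conjI allI impI)
  have L: "nLOT V E" by (rule LOT_nLOT[OF assms(1,3)])
  show "pi2_trivial (K_LOG V E) Base" by (rule pi2_trivial_LOT[OF L])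
  fix VH EH assume H: "sub_LOT V E VH EH"
  show "pi1_incl_injective (K_LOG VH EH) (K_LOG V E) Base"
    unfolding sub_LOT_block(2)[OF L H] by (rule pi1_injective_LOT[OF L sub_LOT_block(1,3)[OF L H]])
qed

end
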